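(* Let $(M,\eta,\phi_1,\phi_2,\phi_3)$ be a normal almost bi-paracontact manifold. Then the $1$-dimensional foliation $\mathcal F_\xi$ defined by the Reeb vector field $\xi$ is transversely anti-hypercomplex, i.e. the tensor fields $(\phi_1,\phi_2,\phi_3)$ project locally to an anti-hypercomplex structure $(J_1,J_2,J_3)$ on the leaf space. Furthermore, the canonical connection $\nabla^c$ is (locally) projectable to the Obata connection defined on the leaf space.
   Context: Everything is smooth. A contact manifold $(M,\eta)$ is a $(2n+1)$-dimensional manifold with a $1$-form $\eta$ such that $\eta\wedge(d\eta)^n\neq 0$ everywhere; its Reeb vector field $\xi$ is determined by $\eta(\xi)=1$, $d\eta(\xi,\cdot)=0$. Normalization: $2d\eta(X,Y)=X(\eta(Y))-Y(\eta(X))-\eta([X,Y])$. An almost bi-paracontact structure on $(M,\eta)$ is a triplet $(\phi_1,\phi_2,\phi_3)$ of $(1,1)$-tensor fields with $\phi_1\phi_2=-\phi_2\phi_1$, $\phi_1^2=\phi_2^2=I-\eta\otimes\xi$, $\phi_3=\phi_1\phi_2$, and $\phi_3^2=-I+\eta\otimes\xi$. With $[\phi,\phi](X,Y)=\phi^2[X,Y]+[\phi X,\phi Y]-\phi[\phi X,Y]-\phi[X,\phi Y]$, put $N^{(1)}_{\phi_\alpha}=[\phi_\alpha,\phi_\alpha]-2d\eta\otimes\xi$ for $\alpha=1,2$ and $N^{(1)}_{\phi_3}=[\phi_3,\phi_3]+2d\eta\otimes\xi$. The structure is normal if $N^{(1)}_{\phi_\alpha}=0$ for $\alpha=1,2,3$.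 On a normal almost bi-paracontact manifold the canonical connection $\nabla^c$ is the unique linear connection with $\nabla^c\xi=0$, $\nabla^c\phi_\alpha=0$ for $\alpha=1,2,3$, and torsion $T^c=2d\eta\otimes\xi$. An anti-hypercomplex (complex-product) structure on an even-dimensional manifold is given by two anti-commuting (integrable) product structures $I,J$ and an (integrable) complex structure $K$ such that $IJ=K$. Its Obata connection is the unique torsion-free linear connection preserving $I,J,K$. Local leaf space: the target of a local submersion $\pi$ whose fibres are (pieces of) the leaves of $\mathcal F_\xi$. That $\phi_\alpha$ projects means there is a tensor field $J_\alpha$ on the local leaf space with $\pi_*\circ\phi_\alpha=J_\alpha\circ\pi_*$. A basic vector field is a section $X$ of $\mathcal D=\ker\eta$ with $[X,V]$ tangent to $\mathcal F_\xi$ for all $V$ tangent to $\mathcal F_\xi$, i.e. a section of $\mathcal D$ locally projectable to the leaf space. The connection $\nabla^c$ is projectable if $\nabla^c_VX=0$ and $\nabla^c_XY$ is basic for all basic $X,Y$ and all $V$ tangent to $\mathcal F_\xi$; the projected connection is $\nabla'_{\pi_*X}\pi_*Y=\pi_*(\nabla^c_XY)$. *)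

theory Defs
  imports "HOL-Analysis.Analysis" "HOL-Library.Function_Algebras"
begin

text \<open>
  Vector space operations on tangent vectors and on vector fields are the pointwise operations of
  \<open>HOL-Library.Function_Algebras\<close>.
\<close>

section \<open>Smooth manifolds\<close>

text \<open>\<open>C_k k S f\<close> is only meant for open \<open>S\<close>: \<open>f\<close> is \<open>k\<close> times continuously differentiable on \<open>S\<close>.\<close>

primrec C_k :: "nat \<Rightarrow> 'e::euclidean_space set \<Rightarrow> ('e \<Rightarrow> 'f::euclidean_space) \<Rightarrow> bool" where
  "C_k 0 S f \<longleftrightarrow> continuous_on S f"
| "C_k (Suc k) S f \<longleftrightarrow>
     (\<forall>x\<in>S. f differentiable (at x)) \<and> (\<forall>v. C_k k S (\<lambda>x. frechet_derivative f (at x) v))"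

definition smooth_on :: "'e::euclidean_space set \<Rightarrow> ('e \<Rightarrow> 'f::euclidean_space) \<Rightarrow> bool" where
  "smooth_on S f \<longleftrightarrow> (\<forall>k. C_k k S f)"

text \<open>
  A manifold is given by an atlas on an open subset (its carrier) of the ambient space \<open>'a\<close>, whose
  type class makes the carrier Hausdorff and second countable. A chart is a pair of a domain and
  a coordinate map; only the values of the coordinate map on the domain matter.
\<close>

type_synonym ('a, 'e) atlas = "('a set \<times> ('a \<Rightarrow> 'e)) set"

definition carrier :: "('a, 'e) atlas \<Rightarrow> 'a set" where
  "carrier A = \<Union> (fst ` A)"

definition smooth_manifold ::
  "('a::{t2_space, second_countable_topology}, 'e::euclidean_space) atlas \<Rightarrow> bool" where
  "smooth_manifold A \<longleftrightarrow>
     (\<forall>(D, c)\<in>A. open D \<and> open (c ` D) \<and> homeomorphism D (c ` D) c (inv_into D c)) \<and>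
     (\<forall>(D, c)\<in>A. \<forall>(D', c')\<in>A. smooth_on (c ` (D \<inter> D')) (c' \<circ> inv_into D c))"

definition smooth_fun ::
  "('a::topological_space, 'e::euclidean_space) atlas \<Rightarrow> 'a set \<Rightarrow> ('a \<Rightarrow> real) \<Rightarrow> bool" where
  "smooth_fun A U f \<longleftrightarrow>
     open U \<and> U \<subseteq> carrier A \<and> (\<forall>(D, c)\<in>A. smooth_on (c ` (D \<inter> U)) (f \<circ> inv_into D c))"

definition smooth_near ::
  "('a::topological_space, 'e::euclidean_space) atlas \<Rightarrow> 'a \<Rightarrow> ('a \<Rightarrow> real) \<Rightarrow> bool" where
  "smooth_near A p f \<longleftrightarrow> (\<exists>U. p \<in> U \<and> smooth_fun A U f)"

definition smooth_map ::
  "('a::topological_space, 'e::euclidean_space) atlas \<Rightarrow>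
   ('b::topological_space, 'f::euclidean_space) atlas \<Rightarrow> 'a set \<Rightarrow> ('a \<Rightarrow> 'b) \<Rightarrow> bool" where
  "smooth_map A B U h \<longleftrightarrow>
     open U \<and> U \<subseteq> carrier A \<and> h ` U \<subseteq> carrier B \<and> continuous_on U h \<and>
     (\<forall>(D, c)\<in>A. \<forall>(E, d)\<in>B. smooth_on (c ` (D \<inter> U \<inter> h -` E)) (d \<circ> h \<circ> inv_into D c))"

section \<open>Tangent vectors, vector fields, tensor fields\<close>

text \<open>
  A tangent vector at \<open>p\<close> is a derivation at \<open>p\<close> of the functions that are smooth near \<open>p\<close>; the last
  clause fixes its value on the remaining functions, so that equality of tangent vectors
  is equality of functions. That derivations depend on germs only is a consequence of the Leibniz rule,
  since the indicator function of the complement of a neighbourhood of \<open>p\<close> is smooth near \<open>p\<close>.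
\<close>

type_synonym 'a tvec = "('a \<Rightarrow> real) \<Rightarrow> real"
type_synonym 'a vfield = "'a \<Rightarrow> 'a tvec"
type_synonym 'a tensor11 = "'a \<Rightarrow> 'a tvec \<Rightarrow> 'a tvec"
type_synonym 'a oneform = "'a \<Rightarrow> 'a tvec \<Rightarrow> real"

definition scale :: "real \<Rightarrow> 'a tvec \<Rightarrow> 'a tvec" (infixr "*\<^sub>T" 75) where
  "r *\<^sub>T v = (\<lambda>f. r * v f)"

definition tangent_space ::
  "('a::topological_space, 'e::euclidean_space) atlas \<Rightarrow> 'a \<Rightarrow> 'a tvec set" where
  "tangent_space A p = {v.
     (\<forall>f g. smooth_near A p f \<longrightarrow> smooth_near A p g \<longrightarrow>
        v (\<lambda>q. f q + g q) = v f + v g \<and> v (\<lambda>q. f q * g q) = v f * g p + f p * v g) \<and>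
     (\<forall>f r. smooth_near A p f \<longrightarrow> v (\<lambda>q. r * f q) = r * v f) \<and>
     (\<forall>f. \<not> smooth_near A p f \<longrightarrow> v f = 0)}"

text \<open>Smooth vector fields on an open subset \<open>U\<close>; the values of \<open>X\<close> outside \<open>U\<close> are arbitrary.\<close>

definition vector_field ::
  "('a::topological_space, 'e::euclidean_space) atlas \<Rightarrow> 'a set \<Rightarrow> 'a vfield \<Rightarrow> bool" where
  "vector_field A U X \<longleftrightarrow>
     open U \<and> U \<subseteq> carrier A \<and> (\<forall>p\<in>U. X p \<in> tangent_space A p) \<and>
     (\<forall>V f. V \<subseteq> U \<longrightarrow> smooth_fun A V f \<longrightarrow> smooth_fun A V (\<lambda>p. X p f))"

definition lie_bracket ::
  "('a::topological_space, 'e::euclidean_space) atlas \<Rightarrow> 'a vfield \<Rightarrow> 'a vfield \<Rightarrow> 'a vfield" where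
  "lie_bracket A X Y = (\<lambda>p f.
     if smooth_near A p f then X p (\<lambda>q. Y q f) - Y p (\<lambda>q. X q f) else 0)"

definition one_form ::
  "('a::topological_space, 'e::euclidean_space) atlas \<Rightarrow> 'a oneform \<Rightarrow> bool" where
  "one_form A \<eta> \<longleftrightarrow>
     (\<forall>p\<in>carrier A. \<forall>v\<in>tangent_space A p. \<forall>w\<in>tangent_space A p. \<forall>r.
        \<eta> p (v + w) = \<eta> p v + \<eta> p w \<and> \<eta> p (r *\<^sub>T v) = r * \<eta> p v) \<and>
     (\<forall>U X. vector_field A U X \<longrightarrow> smooth_fun A U (\<lambda>p. \<eta> p (X p)))"

definition act :: "'a tensor11 \<Rightarrow> 'a vfield \<Rightarrow> 'a vfield" where
  "act \<phi> X = (\<lambda>p. \<phi> p (X p))"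

definition tensor_field ::
  "('a::topological_space, 'e::euclidean_space) atlas \<Rightarrow> 'a tensor11 \<Rightarrow> bool" where
  "tensor_field A \<phi> \<longleftrightarrow>
     (\<forall>p\<in>carrier A. \<forall>v\<in>tangent_space A p. \<forall>w\<in>tangent_space A p. \<forall>r.
        \<phi> p v \<in> tangent_space A p \<and>
        \<phi> p (v + w) = \<phi> p v + \<phi> p w \<and> \<phi> p (r *\<^sub>T v) = r *\<^sub>T \<phi> p v) \<and>
     (\<forall>U X. vector_field A U X \<longrightarrow> vector_field A U (act \<phi> X))"

definition nijenhuis ::
  "('a::topological_space, 'e::euclidean_space) atlas \<Rightarrow> 'a tensor11 \<Rightarrow>
   'a vfield \<Rightarrow> 'a vfield \<Rightarrow> 'a vfield" where
  "nijenhuis A \<phi> X Y =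
     act \<phi> (act \<phi> (lie_bracket A X Y)) + lie_bracket A (act \<phi> X) (act \<phi> Y)
     - act \<phi> (lie_bracket A (act \<phi> X) Y) - act \<phi> (lie_bracket A X (act \<phi> Y))"

section \<open>Contact forms\<close>

text \<open>The factor \<open>1/2\<close> is the normalization of the exterior derivative used throughout.\<close>

definition ext_deriv ::
  "('a::topological_space, 'e::euclidean_space) atlas \<Rightarrow> 'a oneform \<Rightarrow>
   'a vfield \<Rightarrow> 'a vfield \<Rightarrow> 'a \<Rightarrow> real" where
  "ext_deriv A \<eta> X Y p =
     (X p (\<lambda>q. \<eta> q (Y q)) - Y p (\<lambda>q. \<eta> q (X q)) - \<eta> p (lie_bracket A X Y p)) / 2"

text \<open>
  A \<open>k\<close>-form takes a sequence of local vector fields, of which it uses the members with index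
  less than \<open>k\<close>, to a function. The constant in front of the alternating sum
  depends on the convention for wedge products; it is irrelevant for non-vanishing.
\<close>

type_synonym 'a form = "(nat \<Rightarrow> 'a vfield) \<Rightarrow> 'a \<Rightarrow> real"

definition wedge :: "nat \<Rightarrow> nat \<Rightarrow> 'a form \<Rightarrow> 'a form \<Rightarrow> 'a form" where
  "wedge k l \<alpha> \<beta> = (\<lambda>X p.
     (\<Sum>\<sigma> | \<sigma> permutes {..<k + l}.
        of_int (sign \<sigma>) * \<alpha> (\<lambda>i. X (\<sigma> i)) p * \<beta> (\<lambda>i. X (\<sigma> (k + i))) p) / (fact k * fact l))"

primrec wedge_power :: "'a form \<Rightarrow> nat \<Rightarrow> 'a form" where
  "wedge_power \<omega> 0 = (\<lambda>X p. 1)"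
| "wedge_power \<omega> (Suc m) = wedge 2 (2 * m) \<omega> (wedge_power \<omega> m)"

text \<open>The form is evaluated at \<open>p\<close> on vector fields \<open>X 0, \<dots>, X (2 n)\<close> defined near \<open>p\<close>.\<close>

definition contact_form ::
  "nat \<Rightarrow> ('a::topological_space, 'e::euclidean_space) atlas \<Rightarrow> 'a oneform \<Rightarrow> bool" where
  "contact_form n A \<eta> \<longleftrightarrow> one_form A \<eta> \<and>
     (\<forall>p\<in>carrier A. \<exists>U X. p \<in> U \<and> (\<forall>i. vector_field A U (X i)) \<and>
        wedge 1 (2 * n) (\<lambda>X p. \<eta> p (X 0 p))
          (wedge_power (\<lambda>X. ext_deriv A \<eta> (X 0) (X 1)) n) X p \<noteq> 0)"

definition contact_manifold ::
  "nat \<Rightarrow> ('a::{t2_space, second_countable_topology}, 'e::euclidean_space) atlas \<Rightarrow>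
   'a oneform \<Rightarrow> bool" where
  "contact_manifold n A \<eta> \<longleftrightarrow>
     smooth_manifold A \<and> DIM('e) = 2 * n + 1 \<and> contact_form n A \<eta>"

definition reeb_field ::
  "('a::topological_space, 'e::euclidean_space) atlas \<Rightarrow> 'a oneform \<Rightarrow> 'a vfield \<Rightarrow> bool" where
  "reeb_field A \<eta> \<xi> \<longleftrightarrow> vector_field A (carrier A) \<xi> \<and>
     (\<forall>p\<in>carrier A. \<eta> p (\<xi> p) = 1) \<and>
     (\<forall>U X. vector_field A U X \<longrightarrow> (\<forall>p\<in>U. ext_deriv A \<eta> \<xi> X p = 0))"

section \<open>Almost bi-paracontact structures\<close>

definition almost_bi_paracontact ::
  "('a::topological_space, 'e::euclidean_space) atlas \<Rightarrow> 'a oneform \<Rightarrow> 'a vfield \<Rightarrow>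
   'a tensor11 \<Rightarrow> 'a tensor11 \<Rightarrow> 'a tensor11 \<Rightarrow> bool" where
  "almost_bi_paracontact A \<eta> \<xi> \<phi>1 \<phi>2 \<phi>3 \<longleftrightarrow>
     tensor_field A \<phi>1 \<and> tensor_field A \<phi>2 \<and> tensor_field A \<phi>3 \<and>
     (\<forall>p\<in>carrier A. \<forall>v\<in>tangent_space A p.
        \<phi>1 p (\<phi>2 p v) = - \<phi>2 p (\<phi>1 p v) \<and>
        \<phi>1 p (\<phi>1 p v) = v - \<eta> p v *\<^sub>T \<xi> p \<and>
        \<phi>2 p (\<phi>2 p v) = v - \<eta> p v *\<^sub>T \<xi> p \<and>
        \<phi>3 p v = \<phi>1 p (\<phi>2 p v) \<and>
        \<phi>3 p (\<phi>3 p v) = - v + \<eta> p v *\<^sub>T \<xi> p)"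

definition normal_structure ::
  "('a::topological_space, 'e::euclidean_space) atlas \<Rightarrow> 'a oneform \<Rightarrow> 'a vfield \<Rightarrow>
   'a tensor11 \<Rightarrow> 'a tensor11 \<Rightarrow> 'a tensor11 \<Rightarrow> bool" where
  "normal_structure A \<eta> \<xi> \<phi>1 \<phi>2 \<phi>3 \<longleftrightarrow>
     (\<forall>U X Y. vector_field A U X \<longrightarrow> vector_field A U Y \<longrightarrow> (\<forall>p\<in>U.
        nijenhuis A \<phi>1 X Y p - (2 * ext_deriv A \<eta> X Y p) *\<^sub>T \<xi> p = 0 \<and>
        nijenhuis A \<phi>2 X Y p - (2 * ext_deriv A \<eta> X Y p) *\<^sub>T \<xi> p = 0 \<and>
        nijenhuis A \<phi>3 X Y p + (2 * ext_deriv A \<eta> X Y p) *\<^sub>T \<xi> p = 0))"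

section \<open>Linear connections\<close>

text \<open>
  \<open>\<D> p v Y\<close> is the covariant derivative at \<open>p\<close>, in direction \<open>v\<close>, of a vector field \<open>Y\<close> defined on
  a neighbourhood of \<open>p\<close>. As for tangent vectors, the Leibniz rule with indicator
  functions shows that it depends only on the germ of \<open>Y\<close> at \<open>p\<close>.
\<close>

type_synonym 'a conn = "'a \<Rightarrow> 'a tvec \<Rightarrow> 'a vfield \<Rightarrow> 'a tvec"

definition field_near ::
  "('a::topological_space, 'e::euclidean_space) atlas \<Rightarrow> 'a \<Rightarrow> 'a vfield \<Rightarrow> bool" where
  "field_near A p X \<longleftrightarrow> (\<exists>U. p \<in> U \<and> vector_field A U X)"

definition linear_connection ::
  "('a::topological_space, 'e::euclidean_space) atlas \<Rightarrow> 'a conn \<Rightarrow> bool" where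
  "linear_connection A \<D> \<longleftrightarrow>
     (\<forall>p\<in>carrier A. \<forall>v\<in>tangent_space A p. \<forall>Y. field_near A p Y \<longrightarrow>
        \<D> p v Y \<in> tangent_space A p \<and>
        (\<forall>w\<in>tangent_space A p. \<D> p (v + w) Y = \<D> p v Y + \<D> p w Y) \<and>
        (\<forall>r. \<D> p (r *\<^sub>T v) Y = r *\<^sub>T \<D> p v Y) \<and>
        (\<forall>Z. field_near A p Z \<longrightarrow> \<D> p v (Y + Z) = \<D> p v Y + \<D> p v Z) \<and>
        (\<forall>f. smooth_near A p f \<longrightarrow>
           \<D> p v (\<lambda>q. f q *\<^sub>T Y q) = v f *\<^sub>T Y p + f p *\<^sub>T \<D> p v Y)) \<and>
     (\<forall>U X Y. vector_field A U X \<longrightarrow> vector_field A U Y \<longrightarrow>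
        vector_field A U (\<lambda>p. \<D> p (X p) Y))"

definition torsion ::
  "('a::topological_space, 'e::euclidean_space) atlas \<Rightarrow> 'a conn \<Rightarrow>
   'a vfield \<Rightarrow> 'a vfield \<Rightarrow> 'a vfield" where
  "torsion A \<D> X Y = (\<lambda>p. \<D> p (X p) Y - \<D> p (Y p) X - lie_bracket A X Y p)"

definition parallel_tensor ::
  "('a::topological_space, 'e::euclidean_space) atlas \<Rightarrow> 'a conn \<Rightarrow> 'a tensor11 \<Rightarrow> bool" where
  "parallel_tensor A \<D> \<phi> \<longleftrightarrow>
     (\<forall>p\<in>carrier A. \<forall>v\<in>tangent_space A p. \<forall>Y. field_near A p Y \<longrightarrow>
        \<D> p v (act \<phi> Y) - \<phi> p (\<D> p v Y) = 0)"

text \<open>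
  At most one connection has these properties (up to values at meaningless arguments), so
  uniqueness is not made part of the definition.
\<close>

definition canonical_connection ::
  "('a::topological_space, 'e::euclidean_space) atlas \<Rightarrow> 'a oneform \<Rightarrow> 'a vfield \<Rightarrow>
   'a tensor11 \<Rightarrow> 'a tensor11 \<Rightarrow> 'a tensor11 \<Rightarrow> 'a conn \<Rightarrow> bool" where
  "canonical_connection A \<eta> \<xi> \<phi>1 \<phi>2 \<phi>3 \<D> \<longleftrightarrow>
     linear_connection A \<D> \<and>
     (\<forall>p\<in>carrier A. \<forall>v\<in>tangent_space A p. \<D> p v \<xi> = 0) \<and>
     parallel_tensor A \<D> \<phi>1 \<and> parallel_tensor A \<D> \<phi>2 \<and> parallel_tensor A \<D> \<phi>3 \<and>
     (\<forall>U X Y. vector_field A U X \<longrightarrow> vector_field A U Y \<longrightarrow>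
        (\<forall>p\<in>U. torsion A \<D> X Y p = (2 * ext_deriv A \<eta> X Y p) *\<^sub>T \<xi> p))"

section \<open>Anti-hypercomplex structures\<close>

text \<open>
  Integrability of an almost product or almost complex structure is the vanishing of its Nijenhuis tensor.
\<close>

definition integrable_tensor ::
  "('a::topological_space, 'e::euclidean_space) atlas \<Rightarrow> 'a tensor11 \<Rightarrow> bool" where
  "integrable_tensor A J \<longleftrightarrow>
     (\<forall>U X Y. vector_field A U X \<longrightarrow> vector_field A U Y \<longrightarrow> (\<forall>p\<in>U. nijenhuis A J X Y p = 0))"

definition product_structure ::
  "('a::topological_space, 'e::euclidean_space) atlas \<Rightarrow> 'a tensor11 \<Rightarrow> bool" where
  "product_structure A J \<longleftrightarrow> tensor_field A J \<and>
     (\<forall>p\<in>carrier A. \<forall>v\<in>tangent_space A p. J p (J p v) = v) \<and> integrable_tensor A J"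

definition complex_structure ::
  "('a::topological_space, 'e::euclidean_space) atlas \<Rightarrow> 'a tensor11 \<Rightarrow> bool" where
  "complex_structure A J \<longleftrightarrow> tensor_field A J \<and>
     (\<forall>p\<in>carrier A. \<forall>v\<in>tangent_space A p. J p (J p v) = - v) \<and> integrable_tensor A J"

text \<open>
  The customary requirement that a product structure differ from plus and minus the identity
  is automatic for two anti-commuting ones on a manifold of positive dimension.
\<close>

definition anti_hypercomplex ::
  "('a::topological_space, 'e::euclidean_space) atlas \<Rightarrow>
   'a tensor11 \<Rightarrow> 'a tensor11 \<Rightarrow> 'a tensor11 \<Rightarrow> bool" where
  "anti_hypercomplex A J1 J2 J3 \<longleftrightarrow>
     product_structure A J1 \<and> product_structure A J2 \<and> complex_structure A J3 \<and>
     (\<forall>p\<in>carrier A. \<forall>v\<in>tangent_space A p.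
        J1 p (J2 p v) = - J2 p (J1 p v) \<and> J1 p (J2 p v) = J3 p v)"

definition torsion_free_preserving ::
  "('a::topological_space, 'e::euclidean_space) atlas \<Rightarrow>
   'a tensor11 \<Rightarrow> 'a tensor11 \<Rightarrow> 'a tensor11 \<Rightarrow> 'a conn \<Rightarrow> bool" where
  "torsion_free_preserving A J1 J2 J3 \<D> \<longleftrightarrow>
     linear_connection A \<D> \<and>
     (\<forall>U X Y. vector_field A U X \<longrightarrow> vector_field A U Y \<longrightarrow> (\<forall>p\<in>U. torsion A \<D> X Y p = 0)) \<and>
     parallel_tensor A \<D> J1 \<and> parallel_tensor A \<D> J2 \<and> parallel_tensor A \<D> J3"

text \<open>
  The unique such connection; two connections are identified if they agree on all arguments
  that have a meaning.
\<close>

definition obata_connection ::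
  "('a::topological_space, 'e::euclidean_space) atlas \<Rightarrow>
   'a tensor11 \<Rightarrow> 'a tensor11 \<Rightarrow> 'a tensor11 \<Rightarrow> 'a conn \<Rightarrow> bool" where
  "obata_connection A J1 J2 J3 \<D> \<longleftrightarrow>
     torsion_free_preserving A J1 J2 J3 \<D> \<and>
     (\<forall>\<D>'. torsion_free_preserving A J1 J2 J3 \<D>' \<longrightarrow>
        (\<forall>p\<in>carrier A. \<forall>v\<in>tangent_space A p. \<forall>Y. field_near A p Y \<longrightarrow> \<D>' p v Y = \<D> p v Y))"

section \<open>The Reeb foliation and its local leaf spaces\<close>

definition pushforward ::
  "('b::topological_space, 'f::euclidean_space) atlas \<Rightarrow> ('a \<Rightarrow> 'b) \<Rightarrow> 'a \<Rightarrow> 'a tvec \<Rightarrow> 'b tvec" where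
  "pushforward B h p v = (\<lambda>g. if smooth_near B (h p) g then v (g \<circ> h) else 0)"

definition submersion_on ::
  "('a::topological_space, 'e::euclidean_space) atlas \<Rightarrow>
   ('b::topological_space, 'f::euclidean_space) atlas \<Rightarrow> 'a set \<Rightarrow> ('a \<Rightarrow> 'b) \<Rightarrow> bool" where
  "submersion_on A B U h \<longleftrightarrow> smooth_map A B U h \<and>
     (\<forall>p\<in>U. pushforward B h p ` tangent_space A p = tangent_space B (h p))"

definition integral_curve ::
  "('a::topological_space, 'e::euclidean_space) atlas \<Rightarrow> 'a vfield \<Rightarrow> real set \<Rightarrow> (real \<Rightarrow> 'a) \<Rightarrow> bool"
  where
  "integral_curve A \<xi> I \<gamma> \<longleftrightarrow> continuous_on I \<gamma> \<and> \<gamma> ` I \<subseteq> carrier A \<and>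
     (\<forall>t\<in>I. \<forall>f. smooth_near A (\<gamma> t) f \<longrightarrow>
        ((f \<circ> \<gamma>) has_real_derivative \<xi> (\<gamma> t) f) (at t))"

text \<open>
  The leaves of the foliation by a nowhere vanishing vector field are the images of its
  maximal integral curves; pieces of leaves are the images of integral curves on open intervals.
  In particular they are connected.
\<close>

definition leaf_piece ::
  "('a::topological_space, 'e::euclidean_space) atlas \<Rightarrow> 'a vfield \<Rightarrow> 'a set \<Rightarrow> bool" where
  "leaf_piece A \<xi> L \<longleftrightarrow>
     (\<exists>I \<gamma>. open I \<and> is_interval I \<and> I \<noteq> {} \<and> integral_curve A \<xi> I \<gamma> \<and> L = \<gamma> ` I)"

definition local_leaf_space ::
  "('a::topological_space, 'e::euclidean_space) atlas \<Rightarrow> 'a vfield \<Rightarrow>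
   ('b::{t2_space, second_countable_topology}, 'f::euclidean_space) atlas \<Rightarrow>
   'a set \<Rightarrow> ('a \<Rightarrow> 'b) \<Rightarrow> bool" where
  "local_leaf_space A \<xi> B U h \<longleftrightarrow>
     smooth_manifold B \<and> submersion_on A B U h \<and> h ` U = carrier B \<and>
     (\<forall>y\<in>carrier B. leaf_piece A \<xi> {p\<in>U. h p = y})"

definition tensor_projects ::
  "('a::topological_space, 'e::euclidean_space) atlas \<Rightarrow>
   ('b::topological_space, 'f::euclidean_space) atlas \<Rightarrow>
   'a set \<Rightarrow> ('a \<Rightarrow> 'b) \<Rightarrow> 'a tensor11 \<Rightarrow> 'b tensor11 \<Rightarrow> bool" where
  "tensor_projects A B U h \<phi> J \<longleftrightarrow>
     (\<forall>p\<in>U. \<forall>v\<in>tangent_space A p. pushforward B h p (\<phi> p v) = J (h p) (pushforward B h p v))"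

definition tangent_to_leaves ::
  "('a::topological_space, 'e::euclidean_space) atlas \<Rightarrow> 'a vfield \<Rightarrow> 'a set \<Rightarrow> 'a vfield \<Rightarrow> bool" where
  "tangent_to_leaves A \<xi> W V \<longleftrightarrow> vector_field A W V \<and> (\<forall>p\<in>W. \<exists>r. V p = r *\<^sub>T \<xi> p)"

definition basic_field ::
  "('a::topological_space, 'e::euclidean_space) atlas \<Rightarrow> 'a oneform \<Rightarrow> 'a vfield \<Rightarrow>
   'a set \<Rightarrow> 'a vfield \<Rightarrow> bool" where
  "basic_field A \<eta> \<xi> W X \<longleftrightarrow> vector_field A W X \<and> (\<forall>p\<in>W. \<eta> p (X p) = 0) \<and>
     (\<forall>V. tangent_to_leaves A \<xi> W V \<longrightarrow> tangent_to_leaves A \<xi> W (lie_bracket A X V))"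

definition projectable_connection ::
  "('a::topological_space, 'e::euclidean_space) atlas \<Rightarrow> 'a oneform \<Rightarrow> 'a vfield \<Rightarrow>
   'a conn \<Rightarrow> bool" where
  "projectable_connection A \<eta> \<xi> \<D> \<longleftrightarrow>
     (\<forall>W X Y V. basic_field A \<eta> \<xi> W X \<longrightarrow> basic_field A \<eta> \<xi> W Y \<longrightarrow> tangent_to_leaves A \<xi> W V \<longrightarrow>
        (\<forall>p\<in>W. \<D> p (V p) X = 0) \<and> basic_field A \<eta> \<xi> W (\<lambda>p. \<D> p (X p) Y))"

definition fields_related ::
  "('b::topological_space, 'f::euclidean_space) atlas \<Rightarrow> ('a \<Rightarrow> 'b) \<Rightarrow> 'a set \<Rightarrow>
   'a vfield \<Rightarrow> 'b vfield \<Rightarrow> bool" where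
  "fields_related B h W X X' \<longleftrightarrow> (\<forall>p\<in>W. pushforward B h p (X p) = X' (h p))"

text \<open>
  \<open>\<D>'\<close> is the projection of \<open>\<D>\<close>: it sends the projections \<open>X'\<close>, \<open>Y'\<close> of basic fields \<open>X\<close>, \<open>Y\<close>
  to the projection of the covariant derivative of \<open>Y\<close> along \<open>X\<close>.
\<close>

definition connection_projects ::
  "('a::topological_space, 'e::euclidean_space) atlas \<Rightarrow> 'a oneform \<Rightarrow> 'a vfield \<Rightarrow>
   ('b::topological_space, 'f::euclidean_space) atlas \<Rightarrow> 'a set \<Rightarrow> ('a \<Rightarrow> 'b) \<Rightarrow>
   'a conn \<Rightarrow> 'b conn \<Rightarrow> bool" where
  "connection_projects A \<eta> \<xi> B U h \<D> \<D>' \<longleftrightarrow>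
     (\<forall>W W' X Y X' Y'.
        W \<subseteq> U \<longrightarrow> h ` W \<subseteq> W' \<longrightarrow>
        basic_field A \<eta> \<xi> W X \<longrightarrow> basic_field A \<eta> \<xi> W Y \<longrightarrow>
        vector_field B W' X' \<longrightarrow> vector_field B W' Y' \<longrightarrow>
        fields_related B h W X X' \<longrightarrow> fields_related B h W Y Y' \<longrightarrow>
        fields_related B h W (\<lambda>p. \<D> p (X p) Y) (\<lambda>y. \<D>' y (X' y) Y'))"

end

theory Submission
  imports Defs
begin

text \<open>
  \<^emph>\<open>The tensors.\<close> Since \<open>d\<eta> (\<xi>, \<cdot>) = 0\<close>, normality makes \<open>[\<phi>\<^sub>\<alpha>, \<phi>\<^sub>\<alpha>]\<close> vanish when one argument is \<open>\<xi>\<close>. Together with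
  \<open>\<phi>\<^sub>\<alpha> \<xi> = 0\<close> and \<open>\<eta> \<phi>\<^sub>\<alpha> = 0\<close> this says that the Lie derivative of \<open>\<phi>\<^sub>\<alpha>\<close> along \<open>\<xi>\<close> is zero (\<open>phi_invariant\<close>).
  Now let \<open>X\<close> be a field that projects to a leaf space. Then \<open>[\<xi>, \<phi>\<^sub>\<alpha> X] = \<phi>\<^sub>\<alpha> [\<xi>, X] = 0\<close>, because \<open>[\<xi>, X]\<close> is a multiple
  of \<open>\<xi>\<close>. Therefore the projection of \<open>\<phi>\<^sub>\<alpha> X\<close> is constant along each fibre, fibres being connected pieces
  of leaves, and \<open>\<phi>\<^sub>\<alpha>\<close> descends to a tensor \<open>J\<^sub>\<alpha>\<close> (\<open>push_along_fibre\<close>, \<open>induced_tensor\<close>). The algebraic relations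
  descend as well. So does integrability: normality says that the Nijenhuis tensors of the \<open>\<phi>\<^sub>\<alpha>\<close> are multiples of \<open>\<xi>\<close>, and
  these project to zero (\<open>anti_hypercomplex_induced\<close>).

  \<^emph>\<open>The connections.\<close> Let \<open>P\<close> and \<open>M\<close> be the projections to the eigenbundles of \<open>\<phi>\<^sub>1\<close> for \<open>1\<close> and \<open>-1\<close>, and \<open>F = \<phi>\<^sub>2\<close>, which
  exchanges them. Put \<open>K (X, Y) = M [P X, M Y] + P [M X, P Y]\<close> and \<open>E (X, Y) = K (X, Y) + F K (X, F Y)\<close>. A connection
  for which \<open>P\<close>, \<open>M\<close>, \<open>F\<close> are parallel and whose torsion is killed by \<open>P\<close> and \<open>M\<close> has no choice but \<open>\<nabla>\<^sub>X Y = E (X, Y)\<close>,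
  up to the projection \<open>P + M\<close> applied to \<open>X\<close> and to the result (\<open>parallel_connection_eq_E\<close>). This covers the canonical
  connection on horizontal fields, its torsion being a multiple of \<open>\<xi>\<close>, and every torsion-free connection
  preserving an anti-hypercomplex structure. On an anti-hypercomplex manifold \<open>E\<close> does define such a connection, which
  therefore is the Obata connection (\<open>obata_connection_obata_conn\<close>). As \<open>E\<close> consists of brackets and tensors only, it is
  compatible with projections, so the canonical connection projects to the Obata connection
  (\<open>canonical_projects\<close>). For the same reason and by the Jacobi identity, \<open>E (X, Y)\<close> commutes with \<open>\<xi>\<close> when \<open>X\<close> and \<open>Y\<close> are
  basic, and the canonical connection is projectable (\<open>canonical_projectable\<close>).

  \<^emph>\<open>The leaf spaces.\<close> They exist around every point by the flow box theorem for \<open>\<xi>\<close>, which follows from the smooth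
  dependence of solutions of ordinary differential equations on initial values and from the inverse function theorem
  (\<open>smooth_local_flow\<close>, \<open>local_leaf_space_exists\<close>). Tangent vectors are derivations here; Hadamard's lemma gives them
  coordinates (\<open>tangent_coords\<close>).
\<close>

section \<open>Calculus of finitely differentiable maps\<close>

lemma C_k_subset: "C_k k S f \<Longrightarrow> T \<subseteq> S \<Longrightarrow> C_k k T f"
  by (induction k arbitrary: f) (auto intro: continuous_on_subset)

lemma C_k_derivative: "C_k (Suc k) S f \<Longrightarrow> C_k k S (\<lambda>x. frechet_derivative f (at x) v)"
  by simp

text \<open>Congruence under equality on \<open>S\<close> is a hypothesis because its proof, by induction on \<open>k\<close>, needs this lemma.\<close>

lemma C_k_SucI:
  fixes f :: "'a::euclidean_space \<Rightarrow> 'b::euclidean_space"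
  assumes "open S" and "\<And>x. x \<in> S \<Longrightarrow> (f has_derivative f' x) (at x)"
    and "\<And>v. C_k k S (\<lambda>x. f' x v)"
    and cong: "\<And>g h :: 'a::euclidean_space \<Rightarrow> 'b::euclidean_space. (\<And>x. x \<in> S \<Longrightarrow> g x = h x) \<Longrightarrow> C_k k S g \<Longrightarrow> C_k k S h"
  shows "C_k (Suc k) S f"
proof -
  have "frechet_derivative f (at x) = f' x" if "x \<in> S" for x
    using frechet_derivative_at[OF assms(2)[OF that]] by simp
  then have "C_k k S (\<lambda>x. frechet_derivative f (at x) v)" for v
    using cong[of "\<lambda>x. f' x v" "\<lambda>x. frechet_derivative f (at x) v"] assms(3) by simp
  then show ?thesis
    using assms(2) unfolding C_k.simps differentiable_def by blast
qed

lemma C_k_cong: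
  assumes "open S" "\<And>x. x \<in> S \<Longrightarrow> f x = g x" "C_k k S f"
  shows "C_k k S g"
  using assms(2,3)
proof (induction k arbitrary: f g)
  case 0
  then show ?case using continuous_on_cong by (metis C_k.simps(1))
next
  case (Suc k)
  have "(g has_derivative frechet_derivative f (at x)) (at x)" if "x \<in> S" for x
  proof -
    have "(f has_derivative frechet_derivative f (at x)) (at x)"
      using Suc.prems(2) that by (simp add: frechet_derivative_works[symmetric])
    then show ?thesis
      using has_derivative_transform_within_open[OF _ \<open>open S\<close> that] Suc.prems(1) by metis
  qed
  then show ?case
    using C_k_SucI[OF \<open>open S\<close>, of g "\<lambda>x. frechet_derivative f (at x)" k] Suc.IH
      C_k_derivative[OF Suc.prems(2)] by blast
qed

lemma C_k_SucI':
  assumes "open S" and "\<And>x. x \<in> S \<Longrightarrow> (f has_derivative f' x) (at x)"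
    and "\<And>v. C_k k S (\<lambda>x. f' x v)"
  shows "C_k (Suc k) S f"
  using C_k_SucI[OF assms] C_k_cong[OF \<open>open S\<close>] by blast

lemma C_k_has_derivative:
  "C_k (Suc k) S f \<Longrightarrow> x \<in> S \<Longrightarrow> (f has_derivative frechet_derivative f (at x)) (at x)"
  by (simp add: frechet_derivative_works[symmetric])

lemma C_k_Suc_imp: "C_k (Suc k) S f \<Longrightarrow> C_k k S f"
proof (induction k arbitrary: f)
  case 0
  then show ?case
    by (simp add: continuous_at_imp_continuous_on differentiable_imp_continuous_within)
next
  case (Suc k)
  then show ?case by (metis C_k.simps(2))
qed

lemma C_k_continuous_on: "C_k k S f \<Longrightarrow> continuous_on S f"
  by (induction k) (use C_k_Suc_imp in \<open>auto simp del: C_k.simps(2)\<close>)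

lemma C_k_local:
  assumes "\<And>x. x \<in> S \<Longrightarrow> \<exists>T. open T \<and> x \<in> T \<and> C_k k T f"
  shows "C_k k S f"
  using assms
proof (induction k arbitrary: f)
  case 0
  then have "\<forall>x\<in>S. isCont f x"
    by (metis C_k.simps(1) continuous_on_eq_continuous_at)
  then show ?case
    by (simp add: continuous_at_imp_continuous_on)
next
  case (Suc k)
  then show ?case by (metis C_k.simps(2))
qed

lemma linear_on_Basis:
  fixes F :: "'a::euclidean_space \<Rightarrow> 'b::real_vector"
  assumes "linear F"
  shows "F v = (\<Sum>b\<in>Basis. (v \<bullet> b) *\<^sub>R F b)"
proof -
  have "F (\<Sum>b\<in>Basis. (v \<bullet> b) *\<^sub>R b) = (\<Sum>b\<in>Basis. F ((v \<bullet> b) *\<^sub>R b))"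
    by (rule linear_sum[OF assms])
  then show ?thesis
    by (simp add: linear_cmul[OF assms] euclidean_representation)
qed

lemma C_k_const: "open S \<Longrightarrow> C_k k S (\<lambda>x. c)"
proof (induction k arbitrary: c)
  case (Suc k)
  then show ?case using C_k_SucI'[OF \<open>open S\<close>, of "\<lambda>x. c" "\<lambda>x v. 0"] by auto
qed auto

lemma C_k_bounded_linear:
  fixes L :: "'a::euclidean_space \<Rightarrow> 'b::euclidean_space"
  assumes "open S" "bounded_linear L"
  shows "C_k k S L"
proof (cases k)
  case 0
  then show ?thesis using assms by (simp add: linear_continuous_on)
next
  case (Suc j)
  then show ?thesis
    using C_k_SucI'[OF \<open>open S\<close>, of L "\<lambda>x. L"] assms
    by (simp add: bounded_linear_imp_has_derivative C_k_const)
qed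

lemma C_k_linear_comp:
  fixes L :: "'b::euclidean_space \<Rightarrow> 'c::euclidean_space"
  assumes "open S" "bounded_linear L" "C_k k S f"
  shows "C_k k S (\<lambda>x. L (f x))"
  using assms(3)
proof (induction k arbitrary: f)
  case 0
  then show ?case
    using bounded_linear.continuous_on[OF assms(2)] by simp
next
  case (Suc k)
  show ?case
    using C_k_SucI'[OF \<open>open S\<close>, of "\<lambda>x. L (f x)" "\<lambda>x v. L (frechet_derivative f (at x) v)"]
      Suc.IH[OF C_k_derivative[OF Suc.prems]]
      bounded_linear.has_derivative[OF assms(2) C_k_has_derivative[OF Suc.prems]] by blast
qed

lemma C_k_add:
  assumes "open S" "C_k k S f" "C_k k S g"
  shows "C_k k S (\<lambda>x. f x + g x)"
  using assms(2,3)
proof (induction k arbitrary: f g)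
  case 0
  then show ?case by (simp add: continuous_on_add)
next
  case (Suc k)
  show ?case
    using C_k_SucI'[OF \<open>open S\<close>, of "\<lambda>x. f x + g x"
        "\<lambda>x v. frechet_derivative f (at x) v + frechet_derivative g (at x) v"]
      Suc.IH[OF C_k_derivative[OF Suc.prems(1)] C_k_derivative[OF Suc.prems(2)]]
      has_derivative_add[OF C_k_has_derivative[OF Suc.prems(1)] C_k_has_derivative[OF Suc.prems(2)]]
    by blast
qed

lemma C_k_sum:
  assumes "open S" "\<And>i. i \<in> I \<Longrightarrow> C_k k S (f i)"
  shows "C_k k S (\<lambda>x. \<Sum>i\<in>I. f i x)"
  using assms(2)
  by (induction I rule: infinite_finite_induct) (auto simp: C_k_const C_k_add assms(1))

lemma C_k_scaleR:
  assumes "open S" "C_k k S r" "C_k k S f"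
  shows "C_k k S (\<lambda>x. r x *\<^sub>R f x)"
  using assms(2,3)
proof (induction k arbitrary: f r)
  case 0
  then show ?case by (simp add: continuous_on_scaleR)
next
  case (Suc k)
  have "C_k k S (\<lambda>x. r x *\<^sub>R frechet_derivative f (at x) v + frechet_derivative r (at x) v *\<^sub>R f x)" for v
    using Suc.IH[OF C_k_derivative[OF Suc.prems(1)] C_k_Suc_imp[OF Suc.prems(2)]]
      Suc.IH[OF C_k_Suc_imp[OF Suc.prems(1)] C_k_derivative[OF Suc.prems(2)]]
    by (simp add: C_k_add assms(1))
  then show ?case
    using C_k_SucI'[OF \<open>open S\<close>, of "\<lambda>x. r x *\<^sub>R f x"
        "\<lambda>x v. r x *\<^sub>R frechet_derivative f (at x) v + frechet_derivative r (at x) v *\<^sub>R f x"]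
      has_derivative_scaleR[OF C_k_has_derivative[OF Suc.prems(1)] C_k_has_derivative[OF Suc.prems(2)]]
    by blast
qed

lemma C_k_componentwise:
  fixes f :: "'a::euclidean_space \<Rightarrow> 'b::euclidean_space"
  assumes "open S" "\<And>b. b \<in> Basis \<Longrightarrow> C_k k S (\<lambda>x. f x \<bullet> b)"
  shows "C_k k S f"
proof -
  have "C_k k S (\<lambda>x. \<Sum>b\<in>Basis. (f x \<bullet> b) *\<^sub>R b)"
    by (intro C_k_sum C_k_scaleR C_k_const assms)
  then show ?thesis by (simp add: euclidean_representation)
qed

lemma C_k_compose:
  fixes f :: "'a::euclidean_space \<Rightarrow> 'b::euclidean_space" and g :: "'b \<Rightarrow> 'c::euclidean_space"
  assumes "open S" "open T" "C_k k T g" "C_k k S f" "\<And>x. x \<in> S \<Longrightarrow> f x \<in> T"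
  shows "C_k k S (\<lambda>x. g (f x))"
  using assms(3,4)
proof (induction k arbitrary: g)
  case 0
  then show ?case using assms(5) by (auto intro: continuous_on_compose2)
next
  case (Suc k)
  let ?Df = "\<lambda>x. frechet_derivative f (at x)" and ?Dg = "\<lambda>x. frechet_derivative g (at x)"
  have gf: "((\<lambda>x. g (f x)) has_derivative (\<lambda>v. ?Dg (f x) (?Df x v))) (at x)" if "x \<in> S" for x
    using has_derivative_compose[OF C_k_has_derivative[OF Suc.prems(2) that],
        of g "?Dg (f x)"] C_k_has_derivative[OF Suc.prems(1) assms(5)[OF that]] by simp
  have eq: "?Dg (f x) (?Df x v) = (\<Sum>b\<in>Basis. (?Df x v \<bullet> b) *\<^sub>R ?Dg (f x) b)" if "x \<in> S" for x v
    using linear_on_Basis has_derivative_linear C_k_has_derivative[OF Suc.prems(1) assms(5)[OF that]]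
    by blast
  have "C_k k S (\<lambda>x. \<Sum>b\<in>Basis. (?Df x v \<bullet> b) *\<^sub>R ?Dg (f x) b)" for v
    by (intro C_k_sum C_k_scaleR assms C_k_linear_comp[where L = "\<lambda>y. y \<bullet> _"] bounded_linear_inner_left
        C_k_derivative[OF Suc.prems(2)] Suc.IH C_k_derivative[OF Suc.prems(1)]
        C_k_Suc_imp[OF Suc.prems(2)])
  then have "C_k k S (\<lambda>x. ?Dg (f x) (?Df x v))" for v
    using C_k_cong[OF \<open>open S\<close>, of "\<lambda>x. \<Sum>b\<in>Basis. (?Df x v \<bullet> b) *\<^sub>R ?Dg (f x) b"] eq by simp
  then show ?case using C_k_SucI'[OF \<open>open S\<close> gf] by blast
qed

lemma C_k_Pair:
  fixes f :: "'a::euclidean_space \<Rightarrow> 'b::euclidean_space" and g :: "'a \<Rightarrow> 'c::euclidean_space"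
  assumes "open S" "C_k k S f" "C_k k S g"
  shows "C_k k S (\<lambda>x. (f x, g x))"
proof -
  have "C_k k S (\<lambda>x. (f x, 0) + (0, g x))"
    by (intro C_k_add assms C_k_linear_comp[where L = "\<lambda>y. (y, 0)"] C_k_linear_comp[where L = "\<lambda>y. (0, y)"]
        bounded_linear_intros)
  then show ?thesis by simp
qed

lemma C_k_linear_apply:
  fixes a :: "'z::euclidean_space \<Rightarrow> 'a::euclidean_space \<Rightarrow> 'b::euclidean_space"
  assumes "open S" "\<And>z. z \<in> S \<Longrightarrow> linear (a z)" "\<And>b. b \<in> Basis \<Longrightarrow> C_k k S (\<lambda>z. a z b)" "C_k k S v"
  shows "C_k k S (\<lambda>z. a z (v z))"
proof -
  have "C_k k S (\<lambda>z. \<Sum>b\<in>Basis. (v z \<bullet> b) *\<^sub>R a z b)"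
    by (intro C_k_sum C_k_scaleR assms C_k_linear_comp[where L = "\<lambda>y. y \<bullet> _"] bounded_linear_inner_left)
  then show ?thesis
    by (rule C_k_cong[OF \<open>open S\<close>, rotated]) (metis assms(2) linear_on_Basis)
qed

text \<open>At a zero of \<open>r\<close> the increment of the product is \<open>r' h *\<^sub>R c z\<close> up to \<open>o(h)\<close> as soon as \<open>c\<close> is continuous;
  the derivative of \<open>c\<close> would be multiplied by \<open>r z = 0\<close>.\<close>

lemma differentiable_scaleR_zero:
  fixes r :: "'a::real_normed_vector \<Rightarrow> real" and c :: "'a \<Rightarrow> 'b::real_normed_vector"
  assumes "r differentiable (at z)" "r z = 0" "isCont c z"
  shows "(\<lambda>x. r x *\<^sub>R c x) differentiable (at z)"
proof -
  obtain r' where r': "(r has_derivative r') (at z)"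
    using assms(1) by (auto simp: differentiable_def)
  interpret r': bounded_linear r' using r' by (rule has_derivative_bounded_linear)
  obtain K where K: "\<And>h. norm (r' h) \<le> norm h * K" using r'.bounded by blast
  have "((\<lambda>h. norm (r (z + h) - r z - r' h) / norm h) \<longlongrightarrow> 0) (at 0)"
    using r' by (simp add: has_derivative_at)
  then have "((\<lambda>h. (norm (r (z + h) - r z - r' h) / norm h) * norm (c (z + h)) + K * norm (c (z + h) - c z)) \<longlongrightarrow> 0 * norm (c z) + K * 0) (at 0)"
    using assms(3) by (intro tendsto_intros) (auto simp: isCont_def LIM_offset_zero_iff intro!: tendsto_norm_zero LIM_zero)
  then have lim: "((\<lambda>h. (norm (r (z + h) - r z - r' h) / norm h) * norm (c (z + h)) + K * norm (c (z + h) - c z)) \<longlongrightarrow> 0) (at 0)"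
    by simp
  have "((\<lambda>h. norm (r (z + h) *\<^sub>R c (z + h) - r z *\<^sub>R c z - r' h *\<^sub>R c z) / norm h) \<longlongrightarrow> 0) (at 0)"
  proof (rule Lim_null_comparison[OF _ lim])
    have "norm (norm (r (z + h) *\<^sub>R c (z + h) - r z *\<^sub>R c z - r' h *\<^sub>R c z) / norm h)
        \<le> (norm (r (z + h) - r z - r' h) / norm h) * norm (c (z + h)) + K * norm (c (z + h) - c z)"
      if "h \<noteq> 0" for h
    proof -
      have "r (z + h) *\<^sub>R c (z + h) - r z *\<^sub>R c z - r' h *\<^sub>R c z
          = (r (z + h) - r z - r' h) *\<^sub>R c (z + h) + r' h *\<^sub>R (c (z + h) - c z)"
        using assms(2) by (simp add: algebra_simps)
      then have "norm (r (z + h) *\<^sub>R c (z + h) - r z *\<^sub>R c z - r' h *\<^sub>R c z)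
          \<le> norm (r (z + h) - r z - r' h) * norm (c (z + h)) + norm (r' h) * norm (c (z + h) - c z)"
        by (metis norm_scaleR norm_triangle_ineq real_norm_def)
      also have "\<dots> \<le> norm (r (z + h) - r z - r' h) * norm (c (z + h)) + (norm h * K) * norm (c (z + h) - c z)"
        using K mult_right_mono[OF K norm_ge_zero] by simp
      finally show ?thesis using that by (simp add: field_simps)
    qed
    then show "\<forall>\<^sub>F h in at 0. norm (norm (r (z + h) *\<^sub>R c (z + h) - r z *\<^sub>R c z - r' h *\<^sub>R c z) / norm h)
        \<le> (norm (r (z + h) - r z - r' h) / norm h) * norm (c (z + h)) + K * norm (c (z + h) - c z)"
      by (simp add: eventually_at_filter)
  qed
  then have "((\<lambda>x. r x *\<^sub>R c x) has_derivative (\<lambda>h. r' h *\<^sub>R c z)) (at z)"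
    by (simp add: has_derivative_at bounded_linear_scaleR_left bounded_linear_compose[OF bounded_linear_scaleR_left r'.bounded_linear_axioms])
  then show ?thesis by (auto simp: differentiable_def)
qed

text \<open>An injective linear map is bounded below, and this bound survives a small perturbation.\<close>

lemma inverse_linear_locally_bounded:
  fixes a :: "'z::euclidean_space \<Rightarrow> 'a::euclidean_space \<Rightarrow> 'b::euclidean_space"
  assumes "open S" "z \<in> S" and lin: "\<And>z. z \<in> S \<Longrightarrow> linear (a z)"
    and inv: "\<And>z w. z \<in> S \<Longrightarrow> i z (a z w) = w" "\<And>z w. z \<in> S \<Longrightarrow> a z (i z w) = w"
    and cont: "\<And>v. continuous_on S (\<lambda>z. a z v)"
  obtains C where "\<forall>\<^sub>F z' in at z. \<forall>w. norm (i z' w) \<le> C * norm w"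
proof -
  have "inj (a z)" by (metis inv(1)[OF \<open>z \<in> S\<close>] injI)
  then obtain B where B: "B > 0" "\<And>x. B * norm x \<le> norm (a z x)"
    using linear_inj_bounded_below_pos lin[OF \<open>z \<in> S\<close>] by blast
  define d where "d = B / (2 * DIM('a))"
  have d: "d > 0" using B by (simp add: d_def)
  have "\<forall>\<^sub>F z' in at z. dist (a z' b) (a z b) < d" for b
    using cont[of b] \<open>open S\<close> \<open>z \<in> S\<close> d
    by (metis continuous_on_eq_continuous_at isCont_def tendstoD)
  then have "\<forall>\<^sub>F z' in at z. \<forall>b\<in>Basis. dist (a z' b) (a z b) < d"
    by (simp add: eventually_ball_finite)
  moreover have "\<forall>\<^sub>F z' in at z. z' \<in> S"
    using \<open>open S\<close> \<open>z \<in> S\<close> eventually_at_topological by blast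
  ultimately have "\<forall>\<^sub>F z' in at z. \<forall>w. norm (i z' w) \<le> (2 / B) * norm w"
  proof eventually_elim
    case (elim z')
    show ?case
    proof
      fix w
      let ?x = "i z' w"
      have "norm (a z' ?x - a z ?x) = norm (\<Sum>b\<in>Basis. (?x \<bullet> b) *\<^sub>R (a z' b - a z b))"
        using linear_on_Basis[OF lin, of z' ?x] linear_on_Basis[OF lin, of z ?x] elim(2) \<open>z \<in> S\<close>
        by (simp add: scaleR_diff_right sum_subtractf)
      also have "\<dots> \<le> (\<Sum>b\<in>(Basis::'a set). norm ?x * d)"
      proof (rule sum_norm_le)
        fix b :: 'a assume "b \<in> Basis"
        then have "\<bar>?x \<bullet> b\<bar> \<le> norm ?x" "norm (a z' b - a z b) \<le> d"
          using elim(1) Basis_le_norm by (auto simp: dist_norm less_imp_le)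
        then show "norm ((?x \<bullet> b) *\<^sub>R (a z' b - a z b)) \<le> norm ?x * d"
          by (simp add: mult_mono)
      qed
      also have "\<dots> = B / 2 * norm ?x"
        by (simp add: d_def)
      finally have "norm (a z ?x) \<le> norm w + B / 2 * norm ?x"
        using inv(2)[OF elim(2), of w] norm_triangle_ineq4[of w "w - a z ?x"] by simp
      with B(2)[of ?x] have "B / 2 * norm ?x \<le> norm w" by linarith
      then show "norm ?x \<le> (2 / B) * norm w" using B(1) by (simp add: field_simps)
    qed
  qed
  then show ?thesis using that by blast
qed

text \<open>Everything comes from \<open>i z' - i z = - i z' (a z' - a z) i z\<close>. The middle factor vanishes at \<open>z' = z\<close>, so
  that the mere continuity of \<open>i\<close> already yields its differentiability.\<close>

lemma differentiable_inverse_linear: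
  fixes a :: "'z::euclidean_space \<Rightarrow> 'a::euclidean_space \<Rightarrow> 'b::euclidean_space"
  assumes "open S" "z \<in> S" and lin: "\<And>z. z \<in> S \<Longrightarrow> linear (a z)" "\<And>z. z \<in> S \<Longrightarrow> linear (i z)"
    and inv: "\<And>z w. z \<in> S \<Longrightarrow> i z (a z w) = w" "\<And>z w. z \<in> S \<Longrightarrow> a z (i z w) = w"
    and a: "\<And>v. continuous_on S (\<lambda>z. a z v)"
  shows "isCont (\<lambda>z. i z w) z"
    and "(\<And>v. (\<lambda>z. a z v) differentiable (at z)) \<Longrightarrow> (\<lambda>z. i z w) differentiable (at z)"
proof -
  obtain C where C: "\<forall>\<^sub>F z' in at z. \<forall>w. norm (i z' w) \<le> C * norm w"
    using inverse_linear_locally_bounded[OF assms(1,2) lin(1) inv a] by blast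
  have evS: "\<forall>\<^sub>F z' in at z. z' \<in> S"
    using \<open>open S\<close> \<open>z \<in> S\<close> eventually_at_topological by blast
  have eq: "i z' w - i z w = - i z' (a z' (i z w) - a z (i z w))" if "z' \<in> S" for z' w
    using that inv(1)[OF that] inv(2)[OF \<open>z \<in> S\<close>] linear_diff[OF lin(2)[OF that]] by simp
  show cont: "isCont (\<lambda>z. i z w) z" for w
  proof -
    have "((\<lambda>z'. a z' (i z w)) \<longlongrightarrow> a z (i z w)) (at z)"
      using a \<open>open S\<close> \<open>z \<in> S\<close> by (metis continuous_on_eq_continuous_at isCont_def)
    then have lim: "((\<lambda>z'. C * norm (a z' (i z w) - a z (i z w))) \<longlongrightarrow> 0) (at z)"
      by (auto intro!: tendsto_mult_right_zero tendsto_norm_zero LIM_zero)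
    have "\<forall>\<^sub>F z' in at z. norm (i z' w - i z w) \<le> C * norm (a z' (i z w) - a z (i z w))"
      using C evS by eventually_elim (simp add: eq)
    then show ?thesis
      unfolding isCont_def by (intro LIM_zero_cancel[OF Lim_null_comparison[OF _ lim]])
  qed
  assume diff: "\<And>v. (\<lambda>z. a z v) differentiable (at z)"
  let ?u = "\<lambda>z' b. (a z' (i z w) - a z (i z w)) \<bullet> b"
  have "(\<lambda>z'. i z w - (\<Sum>b\<in>Basis. ?u z' b *\<^sub>R i z' b)) differentiable (at z)"
    by (intro differentiable_diff differentiable_const differentiable_sum finite_Basis ballI
        differentiable_scaleR_zero cont differentiable_inner diff) auto
  then obtain D where "((\<lambda>z'. i z w - (\<Sum>b\<in>Basis. ?u z' b *\<^sub>R i z' b)) has_derivative D) (at z)"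
    by (auto simp: differentiable_def)
  moreover have "i z w - (\<Sum>b\<in>Basis. ?u z' b *\<^sub>R i z' b) = i z' w" if "z' \<in> S" for z'
    using eq[OF that, of w] linear_on_Basis[OF lin(2)[OF that], of "a z' (i z w) - a z (i z w)"]
    by (simp add: algebra_simps)
  ultimately have "((\<lambda>z. i z w) has_derivative D) (at z)"
    by (rule has_derivative_transform_within_open[OF _ \<open>open S\<close> \<open>z \<in> S\<close>])
  then show "(\<lambda>z. i z w) differentiable (at z)" by (auto simp: differentiable_def)
qed

text \<open>Differentiating an inverse matrix only brings in the inverse matrix itself, so its
  regularity bootstraps from continuity.\<close>

lemma C_k_inverse_linear:
  fixes a :: "'z::euclidean_space \<Rightarrow> 'a::euclidean_space \<Rightarrow> 'b::euclidean_space"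
  assumes "open S" and lin: "\<And>z. z \<in> S \<Longrightarrow> linear (a z)" "\<And>z. z \<in> S \<Longrightarrow> linear (i z)"
    and inv: "\<And>z w. z \<in> S \<Longrightarrow> i z (a z w) = w" "\<And>z w. z \<in> S \<Longrightarrow> a z (i z w) = w"
    and a: "\<And>v. C_k k S (\<lambda>z. a z v)"
  shows "C_k k S (\<lambda>z. i z w)"
  using a
proof (induction k arbitrary: w)
  case 0
  then show ?case
    using differentiable_inverse_linear(1)[OF \<open>open S\<close> _ lin inv]
    by (simp add: continuous_at_imp_continuous_on)
next
  case (Suc k)
  let ?I = "\<lambda>z. frechet_derivative (\<lambda>z. i z w) (at z)"
  let ?A = "\<lambda>z v. \<Sum>b\<in>Basis. (i z w \<bullet> b) *\<^sub>R frechet_derivative (\<lambda>z. a z b) (at z) v"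
  have "(\<lambda>z. i z w) differentiable (at z)" if "z \<in> S" for z w
    using differentiable_inverse_linear(2)[OF \<open>open S\<close> that lin inv]
      C_k_continuous_on[OF Suc.prems] Suc.prems that by simp
  then have I: "((\<lambda>z. i z w) has_derivative frechet_derivative (\<lambda>z. i z w) (at z)) (at z)" if "z \<in> S" for z w
    using that by (simp add: frechet_derivative_works[symmetric])
  have eq: "- i z (?A z v) = ?I z v" if z: "z \<in> S" for z v
  proof -
    have "((\<lambda>z. \<Sum>b\<in>Basis. (i z w \<bullet> b) *\<^sub>R a z b) has_derivative
        (\<lambda>v. \<Sum>b\<in>Basis. (i z w \<bullet> b) *\<^sub>R frechet_derivative (\<lambda>z. a z b) (at z) v + (?I z v \<bullet> b) *\<^sub>R a z b)) (at z)"
      using I[OF z, of w] C_k_has_derivative[OF Suc.prems z]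
      by (auto intro!: derivative_eq_intros)
    moreover have "((\<lambda>z. \<Sum>b\<in>Basis. (i z w \<bullet> b) *\<^sub>R a z b) has_derivative (\<lambda>v. 0)) (at z)"
    proof (rule has_derivative_transform_within_open[OF has_derivative_const \<open>open S\<close> z])
      show "w = (\<Sum>b\<in>Basis. (i z w \<bullet> b) *\<^sub>R a z b)" if "z \<in> S" for z
        using linear_on_Basis[OF lin(1)[OF that], of "i z w"] inv(2)[OF that] by simp
    qed
    ultimately have "(\<lambda>v. \<Sum>b\<in>Basis. (i z w \<bullet> b) *\<^sub>R frechet_derivative (\<lambda>z. a z b) (at z) v + (?I z v \<bullet> b) *\<^sub>R a z b) = (\<lambda>v. 0)"
      using has_derivative_unique by blast
    then have "?A z v + (\<Sum>b\<in>Basis. (?I z v \<bullet> b) *\<^sub>R a z b) = 0"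
      by (drule_tac x = v in fun_cong) (simp add: sum.distrib)
    then have "?A z v + a z (?I z v) = 0"
      by (simp add: linear_on_Basis[OF lin(1)[OF z], of "?I z v"])
    then have "i z (?A z v) + ?I z v = 0"
      using linear_add[OF lin(2)[OF z], of "?A z v" "a z (?I z v)"] by (simp add: inv(1)[OF z] linear_0[OF lin(2)[OF z]])
    then show ?thesis by (simp add: neg_eq_iff_add_eq_0)
  qed
  have IH: "C_k k S (\<lambda>z. i z w)" for w by (rule Suc.IH[OF C_k_Suc_imp[OF Suc.prems]])
  have A: "C_k k S (\<lambda>z. ?A z v)" for v
    by (rule C_k_sum[OF \<open>open S\<close>], rule C_k_scaleR[OF \<open>open S\<close>],
        rule C_k_linear_comp[OF \<open>open S\<close> bounded_linear_inner_left IH], rule C_k_derivative[OF Suc.prems])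
  have "C_k k S (\<lambda>z. - i z (?A z v))" for v
    using C_k_linear_comp[OF \<open>open S\<close> bounded_linear_minus[OF bounded_linear_ident]
        C_k_linear_apply[OF \<open>open S\<close> lin(2) IH A]] .
  then have "C_k k S (\<lambda>z. ?I z v)" for v
    using C_k_cong[OF \<open>open S\<close>, of "\<lambda>z. - i z (?A z v)"] eq by simp
  then show ?case
    using C_k_SucI'[OF \<open>open S\<close> I] by blast
qed

section \<open>Smooth maps between Euclidean spaces\<close>

lemma smooth_on_subset: "smooth_on S f \<Longrightarrow> T \<subseteq> S \<Longrightarrow> smooth_on T f"
  by (auto simp: smooth_on_def intro: C_k_subset)

lemma smooth_on_cong: "open S \<Longrightarrow> (\<And>x. x \<in> S \<Longrightarrow> f x = g x) \<Longrightarrow> smooth_on S f \<Longrightarrow> smooth_on S g"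
  using C_k_cong by (metis smooth_on_def)

lemma smooth_on_local:
  "(\<And>x. x \<in> S \<Longrightarrow> \<exists>T. open T \<and> x \<in> T \<and> smooth_on T f) \<Longrightarrow> smooth_on S f"
  unfolding smooth_on_def by (meson C_k_local)

lemma smooth_on_const: "open S \<Longrightarrow> smooth_on S (\<lambda>x. c)"
  by (simp add: smooth_on_def C_k_const)

lemma smooth_on_add:
  "open S \<Longrightarrow> smooth_on S f \<Longrightarrow> smooth_on S g \<Longrightarrow> smooth_on S (\<lambda>x. f x + g x)"
  by (simp add: smooth_on_def C_k_add)

lemma smooth_on_scaleR:
  "open S \<Longrightarrow> smooth_on S r \<Longrightarrow> smooth_on S f \<Longrightarrow> smooth_on S (\<lambda>x. r x *\<^sub>R f x)"
  by (simp add: smooth_on_def C_k_scaleR)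

lemma smooth_on_mult:
  fixes f g :: "'a::euclidean_space \<Rightarrow> real"
  shows "open S \<Longrightarrow> smooth_on S f \<Longrightarrow> smooth_on S g \<Longrightarrow> smooth_on S (\<lambda>x. f x * g x)"
  using smooth_on_scaleR[of S f g] by simp

lemma smooth_on_linear_comp:
  "open S \<Longrightarrow> bounded_linear L \<Longrightarrow> smooth_on S f \<Longrightarrow> smooth_on S (\<lambda>x. L (f x))"
  for L :: "'b::euclidean_space \<Rightarrow> 'c::euclidean_space"
  by (simp add: smooth_on_def C_k_linear_comp)

lemma smooth_on_bounded_linear: "open S \<Longrightarrow> bounded_linear L \<Longrightarrow> smooth_on S L"
  by (simp add: smooth_on_def C_k_bounded_linear)

lemma smooth_on_ident: "open S \<Longrightarrow> smooth_on S (\<lambda>x. x)"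
  by (rule smooth_on_bounded_linear) (auto intro: bounded_linear_ident)

lemma smooth_on_inner_left: "open S \<Longrightarrow> smooth_on S f \<Longrightarrow> smooth_on S (\<lambda>x. f x \<bullet> b)"
  by (rule smooth_on_linear_comp) (auto intro: bounded_linear_inner_left)

lemma smooth_on_componentwise:
  fixes f :: "'a::euclidean_space \<Rightarrow> 'b::euclidean_space"
  shows "open S \<Longrightarrow> (\<And>b. b \<in> Basis \<Longrightarrow> smooth_on S (\<lambda>x. f x \<bullet> b)) \<Longrightarrow> smooth_on S f"
  by (simp add: smooth_on_def C_k_componentwise)

lemma smooth_on_compose:
  "open S \<Longrightarrow> open T \<Longrightarrow> smooth_on T g \<Longrightarrow> smooth_on S f \<Longrightarrow> (\<And>x. x \<in> S \<Longrightarrow> f x \<in> T)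
    \<Longrightarrow> smooth_on S (\<lambda>x. g (f x))"
  unfolding smooth_on_def using C_k_compose by blast

lemma smooth_on_Pair:
  "open S \<Longrightarrow> smooth_on S f \<Longrightarrow> smooth_on S g \<Longrightarrow> smooth_on S (\<lambda>x. (f x, g x))"
  by (simp add: smooth_on_def C_k_Pair)

lemma smooth_on_linear_apply:
  assumes "open S" "\<And>z. z \<in> S \<Longrightarrow> linear (a z)" "\<And>b. b \<in> Basis \<Longrightarrow> smooth_on S (\<lambda>z. a z b)" "smooth_on S v"
  shows "smooth_on S (\<lambda>z. a z (v z))"
  using assms unfolding smooth_on_def by (blast intro: C_k_linear_apply)

lemma smooth_on_continuous_on: "smooth_on S f \<Longrightarrow> continuous_on S f"
  using C_k_continuous_on by (auto simp: smooth_on_def)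

lemma smooth_on_has_derivative:
  "smooth_on S f \<Longrightarrow> x \<in> S \<Longrightarrow> (f has_derivative frechet_derivative f (at x)) (at x)"
  unfolding smooth_on_def using C_k_has_derivative by blast

lemma smooth_on_derivative: "smooth_on S f \<Longrightarrow> smooth_on S (\<lambda>x. frechet_derivative f (at x) v)"
  unfolding smooth_on_def using C_k_derivative by blast

lemma smooth_on_linear_derivative: "smooth_on S f \<Longrightarrow> x \<in> S \<Longrightarrow> linear (frechet_derivative f (at x))"
  using smooth_on_has_derivative has_derivative_linear by blast

lemma C_k_blinfun_derivative:
  fixes f :: "'a::euclidean_space \<Rightarrow> 'b::euclidean_space"
  assumes "C_k (Suc k) S f"
  obtains f' :: "'a \<Rightarrow> 'a \<Rightarrow>\<^sub>L 'b" where
    "\<And>x. x \<in> S \<Longrightarrow> blinfun_apply (f' x) = frechet_derivative f (at x)"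
    "\<And>x. x \<in> S \<Longrightarrow> (f has_derivative blinfun_apply (f' x)) (at x)" "continuous_on S f'"
proof -
  define f' where "f' x = Blinfun (frechet_derivative f (at x))" for x
  have f': "blinfun_apply (f' x) = frechet_derivative f (at x)" if "x \<in> S" for x
    using C_k_has_derivative[OF assms that] has_derivative_bounded_linear bounded_linear_Blinfun_apply
    unfolding f'_def by blast
  moreover have "continuous_on S f'"
  proof (rule continuous_on_blinfun_componentwise)
    show "continuous_on S (\<lambda>x. f' x b)" for b
      using C_k_continuous_on[OF C_k_derivative[OF assms]]
        continuous_on_cong[of S S "\<lambda>x. f' x b" "\<lambda>x. frechet_derivative f (at x) b"] f' by simp
  qed
  ultimately show ?thesis using C_k_has_derivative[OF assms] that by metis
qed

text \<open>The inverse function theorem gives a differentiable inverse \<open>g\<close> whose derivative is the inverse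
  of that of \<open>f\<close> at \<open>g y\<close>; each order of regularity of \<open>g\<close> therefore yields the next.\<close>

lemma smooth_inverse_endo:
  fixes f :: "'a::euclidean_space \<Rightarrow> 'a"
  assumes "open S" "x0 \<in> S" "smooth_on S f" "inj (frechet_derivative f (at x0))"
  obtains S' T g where "open S'" "S' \<subseteq> S" "x0 \<in> S'" "open T" "homeomorphism S' T f g" "smooth_on T g"
proof -
  obtain f' :: "'a \<Rightarrow> 'a \<Rightarrow>\<^sub>L 'a" where f': "\<And>x. x \<in> S \<Longrightarrow> blinfun_apply (f' x) = frechet_derivative f (at x)"
      "\<And>x. x \<in> S \<Longrightarrow> (f has_derivative blinfun_apply (f' x)) (at x)" "continuous_on S f'"
    using C_k_blinfun_derivative assms(3) unfolding smooth_on_def by blast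
  have lin: "linear (blinfun_apply (f' x))" for x
    by (simp add: blinfun.bounded_linear_right bounded_linear.linear)
  obtain h where h: "linear h" "h \<circ> blinfun_apply (f' x0) = id"
    using linear_injective_left_inverse[OF lin[of x0]] assms(2,4) f'(1) by metis
  then have "Blinfun h o\<^sub>L f' x0 = id_blinfun"
    by (intro blinfun_eqI) (simp add: bounded_linear_Blinfun_apply linear_linear comp_def fun_eq_iff)
  then obtain S' T g g' where g: "open S'" "S' \<subseteq> S" "x0 \<in> S'" "open T" "homeomorphism S' T f g"
    "\<And>y. y \<in> T \<Longrightarrow> (g has_derivative (g' y)) (at y)"
    "\<And>y. y \<in> T \<Longrightarrow> g' y = inv (blinfun_apply (f'(g y)))"
    "\<And>y. y \<in> T \<Longrightarrow> bij (blinfun_apply (f'(g y)))"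
    using inverse_function_theorem[OF assms(1) f'(2,3) assms(2)] by metis
  have gT: "g y \<in> S'" if "y \<in> T" for y using g(5) that by (auto simp: homeomorphism_def)
  have "C_k k T g" for k
  proof (induction k)
    case 0
    then show ?case using g(5) by (simp add: homeomorphism_def)
  next
    case (Suc k)
    have fC: "C_k k S (\<lambda>x. frechet_derivative f (at x) v)" for v
      using assms(3) smooth_on_derivative unfolding smooth_on_def by blast
    have "C_k k T (\<lambda>y. frechet_derivative f (at (g y)) v)" for v
      using C_k_compose[OF g(4) assms(1) fC Suc] gT g(2) by blast
    then have *: "C_k k T (\<lambda>y. blinfun_apply (f' (g y)) v)" for v
      using C_k_cong[OF g(4), of "\<lambda>y. frechet_derivative f (at (g y)) v" "\<lambda>y. blinfun_apply (f' (g y)) v"]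
        f'(1) gT g(2) by (simp add: subset_iff)
    have "C_k k T (\<lambda>y. g' y v)" for v
    proof (rule C_k_inverse_linear[OF g(4) _ _ _ _ *])
      fix y assume y: "y \<in> T"
      show "linear (g' y)" using g(6)[OF y] has_derivative_linear by blast
      show "g' y (f' (g y) w) = w" "f' (g y) (g' y w) = w" for w
        using g(7,8)[OF y] by (simp_all add: bij_is_inj bij_is_surj surj_f_inv_f)
    qed (rule lin)
    then show ?case using C_k_SucI'[OF g(4) g(6)] by blast
  qed
  then show ?thesis using that g by (simp add: smooth_on_def)
qed

lemma smooth_inverse_function:
  fixes f :: "'a::euclidean_space \<Rightarrow> 'b::euclidean_space"
  assumes dim: "DIM('a) = DIM('b)"
    and "open S" "x0 \<in> S" "smooth_on S f" "inj (frechet_derivative f (at x0))"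
  obtains S' T g where "open S'" "S' \<subseteq> S" "x0 \<in> S'" "open T" "homeomorphism S' T f g" "smooth_on T g"
proof -
  obtain j :: "'b \<Rightarrow> 'a" and i where j: "linear j" "linear i" "\<And>x. i (j x) = x" "\<And>y. j (i y) = y"
    using isomorphisms_UNIV_UNIV dim by metis
  have bl: "bounded_linear j" "bounded_linear i" using j by (auto simp: linear_linear)
  have sm: "smooth_on S (\<lambda>x. j (f x))" by (rule smooth_on_linear_comp[OF assms(2) bl(1) assms(4)])
  have "((\<lambda>x. j (f x)) has_derivative (\<lambda>v. j (frechet_derivative f (at x0) v))) (at x0)"
    by (rule bounded_linear.has_derivative[OF bl(1) smooth_on_has_derivative[OF assms(4,3)]])
  then have "frechet_derivative (\<lambda>x. j (f x)) (at x0) = (\<lambda>v. j (frechet_derivative f (at x0) v))"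
    using frechet_derivative_at by metis
  then have "inj (frechet_derivative (\<lambda>x. j (f x)) (at x0))"
    using assms(5) j(3) by (metis (mono_tags, lifting) injD injI)
  then obtain S' T g where g: "open S'" "S' \<subseteq> S" "x0 \<in> S'" "open T"
      "homeomorphism S' T (\<lambda>x. j (f x)) g" "smooth_on T g"
    using smooth_inverse_endo[OF assms(2,3) sm] by blast
  have op: "open (j -` T)"
    using g(4) bl(1) by (simp add: continuous_open_vimage linear_continuous_on linear_continuous_at)
  have "smooth_on (j -` T) (\<lambda>y. g (j y))"
    by (rule smooth_on_compose[OF op g(4,6) smooth_on_bounded_linear[OF op bl(1)]]) auto
  moreover have "homeomorphism S' (j -` T) f (\<lambda>y. g (j y))"
  proof (rule homeomorphismI)
    have "continuous_on S' (\<lambda>x. i (j (f x)))"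
      using g(5) bl(2) by (auto simp: homeomorphism_def intro: bounded_linear.continuous_on)
    then show "continuous_on S' f" using j(3) by simp
    show "continuous_on (j -` T) (\<lambda>y. g (j y))" using calculation smooth_on_continuous_on by blast
    show "f ` S' \<subseteq> j -` T" "(\<lambda>y. g (j y)) ` (j -` T) \<subseteq> S'"
      using g(5) by (auto simp: homeomorphism_def)
    show "g (j (f x)) = x" if "x \<in> S'" for x using g(5) that by (auto simp: homeomorphism_def)
    show "f (g (j y)) = y" if "y \<in> j -` T" for y
      using g(5) that j(3) by (metis homeomorphism_def vimage_eq)
  qed
  ultimately show ?thesis using that g(1-3) op by blast
qed

section \<open>Radial means and the Hadamard lemma\<close>

lemma continuous_on_radial:
  fixes F :: "'a::euclidean_space \<Rightarrow> 'b::real_normed_vector"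
  assumes "convex S" "x0 \<in> S" "continuous_on S F"
  shows "continuous_on (S \<times> {0..1}) (\<lambda>(x, u). u ^ m *\<^sub>R F (x0 + u *\<^sub>R (x - x0)))"
proof -
  have mem: "x0 + u *\<^sub>R (x - x0) \<in> S" if "x \<in> S" "u \<in> {0..1}" for x u
  proof -
    have "(1 - u) *\<^sub>R x0 + u *\<^sub>R x \<in> S" using assms(1,2) that by (simp add: convex_alt)
    then show ?thesis by (simp add: algebra_simps)
  qed
  have "continuous_on (S \<times> {0..1}) (\<lambda>z. F (x0 + snd z *\<^sub>R (fst z - x0)))"
    by (rule continuous_on_compose2[OF assms(3)]) (auto intro!: continuous_intros mem)
  then show ?thesis by (auto simp: split_beta intro!: continuous_intros)
qed

text \<open>Differentiating under the integral sign produces a mean of the same form, with \<open>u ^ Suc m\<close> in place of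
  \<open>u ^ m\<close> and a partial derivative in place of \<open>F\<close>; hence the weight in the statement.\<close>

lemma C_k_radial_mean:
  fixes F :: "'a::euclidean_space \<Rightarrow> 'b::euclidean_space"
  assumes "open S" "convex S" "x0 \<in> S" "C_k k S F"
  shows "C_k k S (\<lambda>x. integral {0..1} (\<lambda>u. u ^ m *\<^sub>R F (x0 + u *\<^sub>R (x - x0))))"
  using assms(4)
proof (induction k arbitrary: F m)
  case 0
  then show ?case
    using integral_continuous_on_param[where U = S and a = 0 and b = "1::real",
        of "\<lambda>x u. u ^ m *\<^sub>R F (x0 + u *\<^sub>R (x - x0))"]
      continuous_on_radial[OF assms(2,3), of F m] by simp
next
  case (Suc k)
  obtain F' :: "'a \<Rightarrow> 'a \<Rightarrow>\<^sub>L 'b" where F': "\<And>x. x \<in> S \<Longrightarrow> blinfun_apply (F' x) = frechet_derivative F (at x)"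
    "\<And>x. x \<in> S \<Longrightarrow> (F has_derivative blinfun_apply (F' x)) (at x)" "continuous_on S F'"
    using C_k_blinfun_derivative[OF Suc.prems] by blast
  have mem: "x0 + u *\<^sub>R (x - x0) \<in> S" if "x \<in> S" "u \<in> {0..1}" for x u
  proof -
    have "(1 - u) *\<^sub>R x0 + u *\<^sub>R x \<in> S" using assms(2,3) that by (simp add: convex_alt)
    then show ?thesis by (simp add: algebra_simps)
  qed
  let ?f = "\<lambda>x u. u ^ m *\<^sub>R F (x0 + u *\<^sub>R (x - x0))"
  let ?f' = "\<lambda>x u. u ^ Suc m *\<^sub>R F' (x0 + u *\<^sub>R (x - x0))"
  have cont: "continuous_on {0..1} (?f x)" "continuous_on {0..1} (?f' x)" if "x \<in> S" for x
  proof -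
    have "continuous_on {0..1} (Pair x)" "Pair x ` {0..1} \<subseteq> S \<times> {0..1::real}"
      using that by (auto intro!: continuous_intros)
    then show "continuous_on {0..1} (?f x)" "continuous_on {0..1} (?f' x)"
      using continuous_on_compose2[OF continuous_on_radial[OF assms(2,3) C_k_continuous_on[OF Suc.prems]],
          of "{0..1}" "Pair x" m]
        continuous_on_compose2[OF continuous_on_radial[OF assms(2,3) F'(3)], of "{0..1}" "Pair x" "Suc m"]
      by simp_all
  qed
  have deriv: "((\<lambda>x. integral (cbox 0 1) (?f x)) has_derivative integral (cbox 0 1) (?f' x)) (at x)"
    if "x \<in> S" for x
  proof -
    have "((\<lambda>x. integral (cbox 0 1) (?f x)) has_derivative integral (cbox 0 1) (?f' x)) (at x within S)"
    proof (rule leibniz_rule[OF _ _ _ that assms(2)])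
      fix x u assume xu: "x \<in> S" "u \<in> cbox (0::real) 1"
      have "((\<lambda>x. x0 + u *\<^sub>R (x - x0)) has_derivative (\<lambda>v. u *\<^sub>R v)) (at x)"
        by (auto intro!: derivative_eq_intros)
      then have "((\<lambda>x. F (x0 + u *\<^sub>R (x - x0))) has_derivative (\<lambda>v. F' (x0 + u *\<^sub>R (x - x0)) (u *\<^sub>R v))) (at x)"
        using has_derivative_compose[of "\<lambda>x. x0 + u *\<^sub>R (x - x0)", OF _ F'(2)[OF mem]] xu by simp
      then show "(((\<lambda>x. ?f x u)) has_derivative blinfun_apply (?f' x u)) (at x within S)"
        using has_derivative_at_withinI[OF has_derivative_scaleR_right, of "\<lambda>x. F (x0 + u *\<^sub>R (x - x0))"
            "\<lambda>v. F' (x0 + u *\<^sub>R (x - x0)) (u *\<^sub>R v)" x "u ^ m" S]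
        by (simp add: scaleR_blinfun.rep_eq blinfun.scaleR_right mult.commute)
    next
      show "?f x integrable_on cbox 0 1" if "x \<in> S" for x
        using cont(1)[OF that] by (simp add: integrable_continuous_real)
      show "continuous_on (S \<times> cbox 0 1) (\<lambda>(x, u). ?f' x u)"
        using continuous_on_radial[OF assms(2,3) F'(3), of "Suc m"] by simp
    qed
    then show ?thesis using at_within_open[OF that assms(1)] by simp
  qed
  have "C_k k S (\<lambda>x. integral (cbox 0 1) (?f' x) v)" for v
  proof (rule C_k_cong[OF assms(1)])
    show "C_k k S (\<lambda>x. integral {0..1} (\<lambda>u. u ^ Suc m *\<^sub>R frechet_derivative F (at (x0 + u *\<^sub>R (x - x0))) v))"
      by (rule Suc.IH[OF C_k_derivative[OF Suc.prems]])
    show "integral {0..1} (\<lambda>u. u ^ Suc m *\<^sub>R frechet_derivative F (at (x0 + u *\<^sub>R (x - x0))) v)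
        = integral (cbox 0 1) (?f' x) v" if "x \<in> S" for x
      using blinfun_apply_integral[OF integrable_continuous_real[OF cont(2)[OF that]], of v]
      by (auto simp: F'(1)[OF mem[OF that]] scaleR_blinfun.rep_eq cbox_interval intro!: integral_cong)
  qed
  then show ?case using C_k_SucI'[OF assms(1) deriv] by (simp add: cbox_interval del: C_k.simps)
qed

text \<open>The fundamental theorem of calculus along the segment from \<open>x0\<close> to \<open>x\<close>; \<open>g b\<close> is the mean of the
  partial derivative in direction \<open>b\<close> over that segment.\<close>

lemma hadamard:
  fixes F :: "'a::euclidean_space \<Rightarrow> real"
  assumes "open S" "convex S" "x0 \<in> S" "smooth_on S F"
  obtains g where "\<And>b. smooth_on S (g b)" "\<And>b. g b x0 = frechet_derivative F (at x0) b"
    "\<And>x. x \<in> S \<Longrightarrow> F x = F x0 + (\<Sum>b\<in>Basis. ((x - x0) \<bullet> b) * g b x)"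
proof
  define g where "g b x = integral {0..1} (\<lambda>u. u ^ 0 *\<^sub>R frechet_derivative F (at (x0 + u *\<^sub>R (x - x0))) b)" for b x
  have dF: "smooth_on S (\<lambda>x. frechet_derivative F (at x) b)" for b
    by (rule smooth_on_derivative[OF assms(4)])
  show "smooth_on S (g b)" for b
    unfolding g_def smooth_on_def using C_k_radial_mean[OF assms(1-3)] dF unfolding smooth_on_def by blast
  show "g b x0 = frechet_derivative F (at x0) b" for b
    by (simp add: g_def)
  fix x assume x: "x \<in> S"
  have mem: "x0 + u *\<^sub>R (x - x0) \<in> S" if "u \<in> {0..1}" for u
  proof -
    have "(1 - u) *\<^sub>R x0 + u *\<^sub>R x \<in> S" using assms(2,3) x that by (simp add: convex_alt)
    then show ?thesis by (simp add: algebra_simps)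
  qed
  let ?D = "\<lambda>u. frechet_derivative F (at (x0 + u *\<^sub>R (x - x0)))"
  have "((\<lambda>u. ?D u (x - x0)) has_integral F (x0 + 1 *\<^sub>R (x - x0)) - F (x0 + 0 *\<^sub>R (x - x0))) {0..1}"
  proof (rule fundamental_theorem_of_calculus)
    fix u :: real assume u: "u \<in> {0..1}"
    have "((\<lambda>u. x0 + u *\<^sub>R (x - x0)) has_derivative (\<lambda>s. s *\<^sub>R (x - x0))) (at u)"
      by (auto intro!: derivative_eq_intros)
    then have "((\<lambda>u. F (x0 + u *\<^sub>R (x - x0))) has_derivative (\<lambda>s. ?D u (s *\<^sub>R (x - x0)))) (at u)"
      by (rule has_derivative_compose[of "\<lambda>u. x0 + u *\<^sub>R (x - x0)", OF _ smooth_on_has_derivative[OF assms(4) mem[OF u]]])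
    then show "((\<lambda>u. F (x0 + u *\<^sub>R (x - x0))) has_vector_derivative ?D u (x - x0)) (at u within {0..1})"
      by (simp add: has_vector_derivative_def linear_cmul[OF smooth_on_linear_derivative[OF assms(4) mem[OF u]]]
          has_derivative_at_withinI)
  qed simp
  then have 1: "integral {0..1} (\<lambda>u. ?D u (x - x0)) = F x - F x0"
    by (simp add: integral_unique)
  have "continuous_on {0..1} (\<lambda>u. ?D u b)" for b
    by (rule continuous_on_compose2[OF smooth_on_continuous_on[OF dF[of b]]])
      (auto intro!: continuous_intros mem)
  then have int: "(\<lambda>u. ?D u b) integrable_on {0..1}" for b
    by (rule integrable_continuous_real)
  have "integral {0..1} (\<lambda>u. ?D u (x - x0)) = integral {0..1} (\<lambda>u. \<Sum>b\<in>Basis. ((x - x0) \<bullet> b) * ?D u b)"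
    using linear_on_Basis[OF smooth_on_linear_derivative[OF assms(4) mem]]
    by (intro integral_cong) simp
  also have "\<dots> = (\<Sum>b\<in>Basis. ((x - x0) \<bullet> b) * g b x)"
    using int integrable_cmul[OF int, unfolded real_scaleR_def] by (subst integral_sum) (auto simp: g_def)
  finally show "F x = F x0 + (\<Sum>b\<in>Basis. ((x - x0) \<bullet> b) * g b x)" using 1 by simp
qed

section \<open>Smooth flows\<close>

text \<open>The integral \<open>\<integral>\<^sub>0\<^sup>t G ((x, s), V (x, s)) ds\<close> after the substitution \<open>s = u t\<close>: the fixed interval of
  integration treats both signs of \<open>t\<close> alike. A fixed point \<open>V\<close> solves \<open>\<partial>V/\<partial>t = G (z, V z)\<close> with \<open>V (x, 0) = 0\<close>.
  The base point \<open>x\<close> is kept as an argument, so that continuity and smoothness in \<open>(x, t)\<close> jointly can be stated.\<close>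

definition volterra ::
  "(('e::euclidean_space \<times> real) \<times> 'v::banach \<Rightarrow> 'v) \<Rightarrow> ('e \<times> real \<Rightarrow> 'v) \<Rightarrow> 'e \<times> real \<Rightarrow> 'v" where
  "volterra G V z = snd z *\<^sub>R integral {0..1} (\<lambda>u. G ((fst z, u * snd z), V (fst z, u * snd z)))"

lemma continuous_on_volterra_integrand:
  fixes G :: "('e::euclidean_space \<times> real) \<times> 'v::banach \<Rightarrow> 'v"
  assumes G: "continuous_on (Z \<times> S) G" and V: "continuous_on Z V" "V ` Z \<subseteq> S"
    and star: "\<And>x t u. (x, t) \<in> Z \<Longrightarrow> 0 \<le> u \<Longrightarrow> u \<le> 1 \<Longrightarrow> (x, u * t) \<in> Z"
  shows "continuous_on (Z \<times> {0..1}) (\<lambda>(z, u). G ((fst z, u * snd z), V (fst z, u * snd z)))"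
proof -
  have "continuous_on (Z \<times> {0..1}) (\<lambda>w. V (fst (fst w), snd w * snd (fst w)))"
    by (rule continuous_on_compose2[OF V(1)]) (auto intro!: continuous_intros star)
  then have "continuous_on (Z \<times> {0..1}) (\<lambda>w. ((fst (fst w), snd w * snd (fst w)), V (fst (fst w), snd w * snd (fst w))))"
    by (intro continuous_intros)
  then have "continuous_on (Z \<times> {0..1}) (\<lambda>w. G ((fst (fst w), snd w * snd (fst w)), V (fst (fst w), snd w * snd (fst w))))"
    by (rule continuous_on_compose2[OF G]) (use V(2) star in \<open>auto simp: image_subset_iff\<close>)
  then show ?thesis by (simp add: split_beta)
qed

lemma continuous_on_volterra_slice:
  fixes G :: "('e::euclidean_space \<times> real) \<times> 'v::banach \<Rightarrow> 'v"
  assumes "continuous_on (Z \<times> S) G" "continuous_on Z V" "V ` Z \<subseteq> S"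
    and "\<And>x t u. (x, t) \<in> Z \<Longrightarrow> 0 \<le> u \<Longrightarrow> u \<le> 1 \<Longrightarrow> (x, u * t) \<in> Z" and "z \<in> Z"
  shows "continuous_on {0..1} (\<lambda>u. G ((fst z, u * snd z), V (fst z, u * snd z)))"
proof -
  have "continuous_on {0..1} (Pair z)" "Pair z ` {0..1} \<subseteq> Z \<times> {0..1::real}"
    using \<open>z \<in> Z\<close> by (auto intro!: continuous_intros)
  then show ?thesis
    using continuous_on_compose2[OF continuous_on_volterra_integrand[OF assms(1-4)], of "{0..1}" "Pair z"]
    by simp
qed

lemma continuous_on_volterra:
  fixes G :: "('e::euclidean_space \<times> real) \<times> 'v::banach \<Rightarrow> 'v"
  assumes "continuous_on (Z \<times> S) G" "continuous_on Z V" "V ` Z \<subseteq> S"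
    and "\<And>x t u. (x, t) \<in> Z \<Longrightarrow> 0 \<le> u \<Longrightarrow> u \<le> 1 \<Longrightarrow> (x, u * t) \<in> Z"
  shows "continuous_on Z (volterra G V)"
  unfolding volterra_def
  using integral_continuous_on_param[where U = Z and a = 0 and b = "1::real",
      of "\<lambda>z u. G ((fst z, u * snd z), V (fst z, u * snd z))"] continuous_on_volterra_integrand[OF assms]
  by (auto intro!: continuous_intros simp: cbox_interval)

lemma norm_volterra_le:
  fixes G :: "('e::euclidean_space \<times> real) \<times> 'v::banach \<Rightarrow> 'v"
  assumes "continuous_on {0..1} (\<lambda>u. G ((x, u * t), V (x, u * t)))" "\<bar>t\<bar> \<le> d"
    and "\<And>u. 0 \<le> u \<Longrightarrow> u \<le> 1 \<Longrightarrow> norm (G ((x, u * t), V (x, u * t))) \<le> B"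
  shows "norm (volterra G V (x, t)) \<le> d * B"
proof -
  have "norm (integral {0..1} (\<lambda>u. G ((x, u * t), V (x, u * t)))) \<le> B * (1 - 0)"
    by (rule integral_bound) (use assms in auto)
  moreover have "0 \<le> B" using order_trans[OF norm_ge_zero assms(3)[of 0]] by simp
  ultimately show ?thesis
    using assms(2) by (auto simp: volterra_def intro!: mult_mono)
qed

lemma norm_volterra_diff_le:
  fixes G :: "('e::euclidean_space \<times> real) \<times> 'v::banach \<Rightarrow> 'v"
  assumes "continuous_on (Z \<times> S) G" "continuous_on Z V" "V ` Z \<subseteq> S" "continuous_on Z W" "W ` Z \<subseteq> S"
    and star: "\<And>x t u. (x, t) \<in> Z \<Longrightarrow> 0 \<le> u \<Longrightarrow> u \<le> 1 \<Longrightarrow> (x, u * t) \<in> Z"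
    and "(x, t) \<in> Z" "\<bar>t\<bar> \<le> d"
    and "\<And>z v w. z \<in> Z \<Longrightarrow> v \<in> S \<Longrightarrow> w \<in> S \<Longrightarrow> norm (G (z, v) - G (z, w)) \<le> K * norm (v - w)"
    and "\<And>z. z \<in> Z \<Longrightarrow> norm (V z - W z) \<le> e" "0 \<le> K"
  shows "norm (volterra G V (x, t) - volterra G W (x, t)) \<le> d * (K * e)"
proof -
  note cV = continuous_on_volterra_slice[OF assms(1-3) star \<open>(x, t) \<in> Z\<close>, simplified]
  note cW = continuous_on_volterra_slice[OF assms(1,4,5) star \<open>(x, t) \<in> Z\<close>, simplified]
  let ?H = "\<lambda>(z, v :: 'v). G (z, V z) - G (z, W z)"
  have "volterra G V (x, t) - volterra G W (x, t) = volterra ?H (\<lambda>_. 0) (x, t)"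
    unfolding volterra_def using integral_diff[OF integrable_continuous_real[OF cV] integrable_continuous_real[OF cW]]
    by (simp add: scaleR_diff_right)
  also have "norm \<dots> \<le> d * (K * e)"
  proof (rule norm_volterra_le[OF _ \<open>\<bar>t\<bar> \<le> d\<close>])
    show "continuous_on {0..1} (\<lambda>u. ?H ((x, u * t), 0))"
      using continuous_on_diff[OF cV cW] by simp
    fix u :: real assume "0 \<le> u" "u \<le> 1"
    then have z: "(x, u * t) \<in> Z" using star \<open>(x, t) \<in> Z\<close> by blast
    then have "norm (G ((x, u * t), V (x, u * t)) - G ((x, u * t), W (x, u * t))) \<le> K * norm (V (x, u * t) - W (x, u * t))"
      using assms(3,5) by (intro assms(9)) auto
    also have "\<dots> \<le> K * e" using assms(10)[OF z] \<open>0 \<le> K\<close> by (simp add: mult_left_mono)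
    finally show "norm (?H ((x, u * t), 0)) \<le> K * e" by simp
  qed
  finally show ?thesis .
qed

text \<open>Picard iteration: on times of size at most \<open>d\<close> with \<open>d * K \<le> 1/2\<close> the operator contracts by a factor \<open>1/2\<close>
  in the uniform norm.\<close>

lemma volterra_fixed_point:
  fixes G :: "('e::euclidean_space \<times> real) \<times> 'v::banach \<Rightarrow> 'v"
  assumes G: "continuous_on (Z \<times> S) G" and S: "closed S" "0 \<in> S"
    and star: "\<And>x t u. (x, t) \<in> Z \<Longrightarrow> 0 \<le> u \<Longrightarrow> u \<le> 1 \<Longrightarrow> (x, u * t) \<in> Z"
    and d: "\<And>x t. (x, t) \<in> Z \<Longrightarrow> \<bar>t\<bar> \<le> d" "d * K \<le> 1 / 2" "0 \<le> K" "0 \<le> d"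
    and lip: "\<And>z v w. z \<in> Z \<Longrightarrow> v \<in> S \<Longrightarrow> w \<in> S \<Longrightarrow> norm (G (z, v) - G (z, w)) \<le> K * norm (v - w)"
    and M: "\<And>z. z \<in> Z \<Longrightarrow> norm (G (z, 0)) \<le> M"
    and inv: "\<And>V. continuous_on Z V \<Longrightarrow> V ` Z \<subseteq> S \<Longrightarrow> volterra G V ` Z \<subseteq> S"
  obtains V where "continuous_on Z V" "V ` Z \<subseteq> S" "\<And>z. z \<in> Z \<Longrightarrow> V z = volterra G V z"
proof -
  define P where "P n = (volterra G ^^ n) (\<lambda>z. 0)" for n
  have P_simps: "P 0 = (\<lambda>z. 0)" "P (Suc n) = volterra G (P n)" for n
    by (auto simp: P_def)
  have PS: "continuous_on Z (P n) \<and> P n ` Z \<subseteq> S" for n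
  proof (induction n)
    case 0
    then show ?case using S(2) by (auto simp: P_simps)
  next
    case (Suc n)
    then show ?case using inv[of "P n"] continuous_on_volterra[OF G _ _ star, of "P n"] by (simp add: P_simps)
  qed
  have step: "norm (P (Suc n) z - P n z) \<le> (1 / 2) ^ n * (d * M)" if "z \<in> Z" for n z
    using that
  proof (induction n arbitrary: z)
    case 0
    obtain x t where z: "z = (x, t)" by (cases z)
    have "norm (volterra G (\<lambda>z. 0) (x, t)) \<le> d * M"
    proof (rule norm_volterra_le)
      show "continuous_on {0..1} (\<lambda>u. G ((x, u * t), 0))"
        using continuous_on_volterra_slice[OF G _ _ star, of "\<lambda>z. 0" z] 0 z S by auto
      show "\<bar>t\<bar> \<le> d" using d(1) 0 z by blast
    qed (use M star 0 z in auto)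
    then show ?case by (simp add: P_simps z)
  next
    case (Suc n)
    obtain x t where z: "z = (x, t)" by (cases z)
    have "norm (volterra G (P (Suc n)) (x, t) - volterra G (P n) (x, t)) \<le> d * (K * ((1 / 2) ^ n * (d * M)))"
      by (rule norm_volterra_diff_le[where Z = Z and S = S]) (use PS[of n] PS[of "Suc n"] star d lip Suc z G in \<open>auto simp del: power_Suc\<close>)
    also have "\<dots> = (d * K) * ((1 / 2) ^ n * (d * M))" by simp
    also have "\<dots> \<le> (1 / 2) * ((1 / 2) ^ n * (d * M))"
    proof (rule mult_right_mono[OF d(2)])
      have "0 \<le> M" using M Suc.prems norm_ge_zero order_trans by blast
      then show "0 \<le> (1 / 2) ^ n * (d * M)" using d(4) by simp
    qed
    finally show ?case by (simp add: P_simps z)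
  qed
  define V where "V z = (\<Sum>n. P (Suc n) z - P n z)" for z
  have "uniform_limit Z (\<lambda>n z. \<Sum>i<n. P (Suc i) z - P i z) V sequentially"
    unfolding V_def by (rule Weierstrass_m_test[OF step]) (auto intro!: summable_mult2 summable_geometric)
  moreover have "(\<Sum>i<n. P (Suc i) z - P i z) = P n z" for n z
    using sum_lessThan_telescope[of "\<lambda>i. P i z" n] by (simp add: P_simps)
  ultimately have lim: "uniform_limit Z P V sequentially" by simp
  show ?thesis
  proof
    show cV: "continuous_on Z V"
      by (rule uniform_limit_theorem[OF _ lim]) (auto simp: PS)
    show VS: "V ` Z \<subseteq> S"
    proof clarify
      fix z assume "z \<in> Z"
      then show "V z \<in> S"
        using PS by (intro closed_sequentially[OF S(1) _ tendsto_uniform_limitI[OF lim]]) auto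
    qed
    fix z assume z: "z \<in> Z"
    obtain x t where xt: "z = (x, t)" by (cases z)
    have "(\<lambda>n. volterra G (P n) z) \<longlonglongrightarrow> volterra G V z"
    proof (rule LIMSEQ_I)
      fix e :: real assume "e > 0"
      then have "\<forall>\<^sub>F n in sequentially. \<forall>z\<in>Z. dist (P n z) (V z) < e"
        using lim by (simp add: uniform_limit_iff)
      then obtain N where N: "\<And>n z. n \<ge> N \<Longrightarrow> z \<in> Z \<Longrightarrow> norm (P n z - V z) \<le> e"
        unfolding eventually_sequentially dist_norm by (meson less_imp_le)
      have "norm (volterra G (P n) z - volterra G V z) < e" if "n \<ge> N" for n
      proof -
        have "norm (volterra G (P n) (x, t) - volterra G V (x, t)) \<le> d * (K * e)"
          by (rule norm_volterra_diff_le[where Z = Z and S = S]) (use PS[of n] cV VS star d lip z xt N that G in auto)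
        also have "\<dots> \<le> (1 / 2) * e" using mult_right_mono[OF d(2), of e] \<open>e > 0\<close> by simp
        finally show ?thesis using \<open>e > 0\<close> xt by simp
      qed
      then show "\<exists>N. \<forall>n\<ge>N. norm (volterra G (P n) z - volterra G V z) < e" by blast
    qed
    moreover have "(\<lambda>n. P (Suc n) z) \<longlonglongrightarrow> V z"
      by (rule LIMSEQ_Suc[OF tendsto_uniform_limitI[OF lim z]])
    ultimately show "V z = volterra G V z"
      unfolding P_simps using LIMSEQ_unique[of "\<lambda>n. volterra G (P n) z"] by simp
  qed
qed

text \<open>A Lebesgue number of a cover on whose members the derivative varies by at most \<open>e\<close>.\<close>

lemma C1_remainder_near_compact:
  fixes F :: "'a::euclidean_space \<Rightarrow> 'b::euclidean_space" and F' :: "'a \<Rightarrow> 'a \<Rightarrow>\<^sub>L 'b"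
  assumes "open S" "compact \<Gamma>" "\<Gamma> \<subseteq> S" "e > 0"
    and F': "\<And>x. x \<in> S \<Longrightarrow> (F has_derivative blinfun_apply (F' x)) (at x)" "continuous_on S F'"
  obtains d where "d > 0"
    "\<And>p q. p \<in> \<Gamma> \<Longrightarrow> norm (q - p) < d \<Longrightarrow> norm (F q - F p - F' p (q - p)) \<le> e * norm (q - p)"
proof -
  have *: "\<exists>B. open B \<and> p \<in> B \<and> B \<subseteq> S \<and> (\<forall>x\<in>B. \<forall>y\<in>B. norm (F' x - F' y) \<le> e)" if "p \<in> \<Gamma>" for p
  proof -
    have "p \<in> S" using that assms(3) by blast
    define B where "B = S \<inter> F' -` ball (F' p) (e / 2)"
    have B: "open B" "p \<in> B" "\<And>x. x \<in> B \<Longrightarrow> dist (F' x) (F' p) < e / 2 \<and> x \<in> S"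
      using continuous_open_preimage[OF F'(2) assms(1), of "ball (F' p) (e / 2)"] \<open>p \<in> S\<close> \<open>e > 0\<close>
      by (auto simp: B_def dist_commute)
    have "norm (F' x - F' y) \<le> e" if "x \<in> B" "y \<in> B" for x y
    proof -
      have "dist (F' x) (F' y) \<le> dist (F' x) (F' p) + dist (F' y) (F' p)"
        by (rule dist_triangle2)
      then show ?thesis using B(3)[OF that(1)] B(3)[OF that(2)] by (simp add: dist_norm)
    qed
    then show ?thesis using B by blast
  qed
  have "\<Gamma> \<subseteq> \<Union> {B. open B \<and> B \<subseteq> S \<and> (\<forall>x\<in>B. \<forall>y\<in>B. norm (F' x - F' y) \<le> e)}"
  proof (intro subsetI)
    fix p assume "p \<in> \<Gamma>"
    from *[OF this] show "p \<in> \<Union> {B. open B \<and> B \<subseteq> S \<and> (\<forall>x\<in>B. \<forall>y\<in>B. norm (F' x - F' y) \<le> e)}"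
      unfolding Union_iff by auto
  qed
  then obtain d where d: "d > 0"
    "\<And>p. p \<in> \<Gamma> \<Longrightarrow> \<exists>B\<in>{B. open B \<and> B \<subseteq> S \<and> (\<forall>x\<in>B. \<forall>y\<in>B. norm (F' x - F' y) \<le> e)}. ball p d \<subseteq> B"
    by (rule Heine_Borel_lemma[OF assms(2)]) auto
  have "norm (F q - F p - F' p (q - p)) \<le> e * norm (q - p)" if p: "p \<in> \<Gamma>" and q: "norm (q - p) < d" for p q
  proof -
    obtain B where B: "B \<subseteq> S" "\<And>x y. x \<in> B \<Longrightarrow> y \<in> B \<Longrightarrow> norm (F' x - F' y) \<le> e" "ball p d \<subseteq> B"
      using d(2)[OF p] by blast
    have "norm (F q - F p - F' p (q - p)) \<le> norm (q - p) * e"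
    proof (rule differentiable_bound_linearization[where S = "ball p d"])
      show "p + t *\<^sub>R (q - p) \<in> ball p d" if "t \<in> {0..1}" for t
      proof -
        have "t * norm (q - p) \<le> 1 * norm (q - p)" using that by (intro mult_right_mono) auto
        then show ?thesis using q that by (simp add: dist_norm)
      qed
      show "(F has_derivative blinfun_apply (F' x)) (at x within ball p d)" if "x \<in> ball p d" for x
        using F'(1) that B(1,3) has_derivative_at_withinI by blast
      show "onorm (blinfun_apply (F' x) - blinfun_apply (F' p)) \<le> e" if "x \<in> ball p d" for x
      proof -
        have "x \<in> B" "p \<in> B" using B(3) that d(1) by auto
        then show ?thesis using B(2)[of x p] by (simp add: norm_blinfun.rep_eq minus_blinfun.rep_eq fun_diff_def)
      qed
      show "p \<in> ball p d" using d(1) by simp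
    qed
    then show ?thesis by (simp add: mult.commute)
  qed
  then show ?thesis using that d(1) by blast
qed

text \<open>A Lipschitz bound along the line through \<open>p\<close> in direction \<open>w\<close> bounds the derivative in that direction.
  Applied to the second argument of \<open>G\<close>, it passes the constant \<open>K\<close> on to the linearised equation.\<close>

lemma derivative_le_lipschitz:
  fixes F :: "'a::real_normed_vector \<Rightarrow> 'b::real_normed_vector"
  assumes F: "(F has_derivative F') (at p)" and "open S" "p \<in> S" "0 \<le> K"
    and lip: "\<And>s. p + s *\<^sub>R w \<in> S \<Longrightarrow> norm (F (p + s *\<^sub>R w) - F p) \<le> K * norm (s *\<^sub>R w)"
  shows "norm (F' w) \<le> K * norm w"
proof -
  interpret F': bounded_linear F' using F by (rule has_derivative_bounded_linear)
  show ?thesis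
  proof (cases "w = 0")
    case False
    obtain r where r: "r > 0" "ball p r \<subseteq> S" using assms(2,3) openE by blast
    show ?thesis
    proof (rule field_le_epsilon)
      fix e :: real assume "e > 0"
      then have "e / norm w > 0" using False by simp
      then obtain d where d: "d > 0"
        "\<And>y. norm (y - p) < d \<Longrightarrow> norm (F y - F p - F' (y - p)) \<le> e / norm w * norm (y - p)"
        using F unfolding has_derivative_at_alt by blast
      define s where "s = min r d / (2 * norm w)"
      have s: "s > 0" using r d False by (simp add: s_def)
      have "norm (s *\<^sub>R w) = min r d / 2" using r(1) d(1) False by (simp add: s_def)
      then have "norm (s *\<^sub>R w) < min r d" using r(1) d(1) by linarith
      then have sm: "p + s *\<^sub>R w \<in> S" "norm ((p + s *\<^sub>R w) - p) < d"
        using r(2) by (auto simp: dist_norm subset_iff)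
      have "norm (F' (s *\<^sub>R w)) \<le> norm (F (p + s *\<^sub>R w) - F p) + norm (F (p + s *\<^sub>R w) - F p - F' (s *\<^sub>R w))"
        using norm_triangle_ineq4[of "F (p + s *\<^sub>R w) - F p" "F (p + s *\<^sub>R w) - F p - F' (s *\<^sub>R w)"] by simp
      also have "\<dots> \<le> K * norm (s *\<^sub>R w) + e / norm w * norm (s *\<^sub>R w)"
        using lip[OF sm(1)] d(2)[OF sm(2)] by simp
      finally have "s * norm (F' w) \<le> s * (K * norm w + e)"
        using s False by (simp add: F'.scaleR algebra_simps)
      then show "norm (F' w) \<le> K * norm w + e" using s by simp
    qed
  qed (simp add: F'.zero)
qed

lemma volterra_time_derivative:
  fixes G :: "('e::euclidean_space \<times> real) \<times> 'v::banach \<Rightarrow> 'v"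
  assumes "continuous_on {-d<..<d} (\<lambda>t. G ((x, t), V (x, t)))" "\<bar>t\<bar> < d"
    and "\<And>t. \<bar>t\<bar> < d \<Longrightarrow> V (x, t) = volterra G V (x, t)"
  shows "((\<lambda>t. V (x, t)) has_vector_derivative G ((x, t), V (x, t))) (at t)"
proof -
  let ?g = "\<lambda>t. G ((x, t), V (x, t))"
  obtain c where c: "\<bar>t\<bar> < c" "c < d" using dense[OF assms(2)] by blast
  have "continuous_on {-c..c} ?g" by (rule continuous_on_subset[OF assms(1)]) (use c in auto)
  then obtain H where H: "\<And>s. s \<in> {-c..c} \<Longrightarrow> (H has_vector_derivative ?g s) (at s within {-c..c})"
    using antiderivative_continuous by blast
  have eq: "V (x, s) = H s - H 0" if s: "s \<in> {-c<..<c}" for s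
  proof -
    have "((\<lambda>u. s *\<^sub>R ?g (u * s)) has_integral H (1 * s) - H (0 * s)) {0..1}"
    proof (rule fundamental_theorem_of_calculus)
      fix u :: real assume u: "u \<in> {0..1}"
      then have "\<bar>u * s\<bar> \<le> 1 * \<bar>s\<bar>" unfolding abs_mult by (intro mult_right_mono) auto
      then have us: "u * s \<in> {-c<..<c}" using s by auto
      then have "(H has_vector_derivative ?g (u * s)) (at (u * s))"
        using H[of "u * s"] at_within_interior[of "u * s" "{-c..c}"] by (auto simp: interior_atLeastAtMost_real)
      moreover have "((\<lambda>u. u * s) has_vector_derivative s) (at u)"
        by (auto simp: has_vector_derivative_def intro!: derivative_eq_intros)
      ultimately have "(H \<circ> (\<lambda>u. u * s) has_vector_derivative s *\<^sub>R ?g (u * s)) (at u)"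
        using vector_diff_chain_at by blast
      then show "((\<lambda>u. H (u * s)) has_vector_derivative s *\<^sub>R ?g (u * s)) (at u within {0..1})"
        by (simp add: comp_def has_vector_derivative_at_within)
    qed simp
    then have "integral {0..1} (\<lambda>u. s *\<^sub>R ?g (u * s)) = H s - H 0" by (auto dest: integral_unique)
    moreover have "\<bar>s\<bar> < d" using s c by auto
    ultimately show ?thesis using assms(3)[of s] by (simp add: volterra_def)
  qed
  have t: "t \<in> {-c<..<c}" using c by auto
  have "(H has_vector_derivative ?g t) (at t)"
    using H[of t] at_within_interior[of t "{-c..c}"] t by (auto simp: interior_atLeastAtMost_real)
  then have "((\<lambda>s. H s - H 0) has_vector_derivative ?g t) (at t)"
    by (auto intro!: derivative_eq_intros)
  then show ?thesis
    by (rule has_vector_derivative_transform_within_open[OF _ _ t]) (use eq in auto)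
qed

text \<open>The candidate \<open>W\<close> is the fixed point of the linearised equation. For \<open>y = x + k\<close> let \<open>E = V (y, \<cdot>) - V (x, \<cdot>)\<close>
  and \<open>D = E - W (x, \<cdot>) k\<close>. In the integral equations for \<open>E\<close> and \<open>D\<close> the factor \<open>c * K \<le> 1/2\<close> allows the
  terms in \<open>E\<close> and \<open>D\<close> at their maximum to be absorbed on the left; this gives \<open>|E| \<le> L |k|\<close> and
  then \<open>|D| = o(k)\<close>, the remainder of \<open>G\<close> being uniform along the compact graph of \<open>V (x, \<cdot>)\<close>.\<close>

lemma volterra_space_derivative:
  fixes G :: "('e::euclidean_space \<times> real) \<times> 'v::euclidean_space \<Rightarrow> 'v"
  assumes X: "open X" "cball x0 r \<subseteq> X" and S: "open S" and G: "C_k (Suc 0) ((X \<times> {-d<..<d}) \<times> S) G"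
    and V: "continuous_on (X \<times> {-d<..<d}) V" "V ` (X \<times> {-d<..<d}) \<subseteq> S"
      "\<And>z. z \<in> X \<times> {-d<..<d} \<Longrightarrow> V z = volterra G V z"
    and lip: "\<And>z v w. z \<in> X \<times> {-d<..<d} \<Longrightarrow> v \<in> S \<Longrightarrow> w \<in> S \<Longrightarrow> norm (G (z, v) - G (z, w)) \<le> K * norm (v - w)"
    and K: "0 \<le> K" "d * K \<le> 1 / 2" and c: "0 < c" "c < d"
  obtains W :: "'e \<times> real \<Rightarrow> 'e \<Rightarrow>\<^sub>L 'v" where "continuous_on (cball x0 r \<times> {-c..c}) W"
    "\<And>z h. z \<in> cball x0 r \<times> {-c..c} \<Longrightarrow>
      W z h = volterra (\<lambda>(z, w). frechet_derivative G (at (z, V z)) ((h, 0), w)) (\<lambda>z. W z h) z"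
    "\<And>z w. z \<in> cball x0 r \<times> {-c..c} \<Longrightarrow> norm (frechet_derivative G (at (z, V z)) (0, w)) \<le> K * norm w"
    "\<And>x t. x \<in> ball x0 r \<Longrightarrow> t \<in> {-c..c} \<Longrightarrow> ((\<lambda>x. V (x, t)) has_derivative W (x, t)) (at x)"
proof -
  define Z where "Z = X \<times> {-d<..<d}"
  define C where "C = cball x0 r \<times> {-c..c}"
  have CZ: "C \<subseteq> Z" using X c by (auto simp: C_def Z_def)
  have cC: "compact C" by (simp add: C_def compact_Times)
  have ZS: "open (Z \<times> S)" using X S by (simp add: Z_def open_Times)
  have cK: "c * K \<le> 1 / 2" using mult_right_mono[of c d K] K c by linarith
  obtain G' :: "('e \<times> real) \<times> 'v \<Rightarrow> (('e \<times> real) \<times> 'v) \<Rightarrow>\<^sub>L 'v" where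
    G': "\<And>q. q \<in> Z \<times> S \<Longrightarrow> blinfun_apply (G' q) = frechet_derivative G (at q)"
    "\<And>q. q \<in> Z \<times> S \<Longrightarrow> (G has_derivative blinfun_apply (G' q)) (at q)" "continuous_on (Z \<times> S) G'"
    using C_k_blinfun_derivative[OF G] unfolding Z_def by blast
  define i1 :: "'e \<Rightarrow>\<^sub>L (('e \<times> real) \<times> 'v)" where "i1 = Blinfun (\<lambda>h. ((h, 0), 0))"
  define i2 :: "'v \<Rightarrow>\<^sub>L (('e \<times> real) \<times> 'v)" where "i2 = Blinfun (\<lambda>w. (0, w))"
  have "bounded_linear (\<lambda>h::'e. ((h, 0::real), 0::'v))" "bounded_linear (\<lambda>w::'v. (0 :: 'e \<times> real, w))"
    by (intro bounded_linear_Pair bounded_linear_ident bounded_linear_zero)+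
  then have i: "i1 h = ((h, 0), 0)" "i2 w = (0, w)" for h w
    by (simp_all add: i1_def i2_def bounded_linear_Blinfun_apply)
  define A where "A z = G' (z, V z) o\<^sub>L i1" for z
  define B where "B z = G' (z, V z) o\<^sub>L i2" for z
  have zV: "(z, V z) \<in> Z \<times> S" if "z \<in> C" for z using that CZ V(2) by (auto simp: Z_def)
  have AB: "A z h + B z w = frechet_derivative G (at (z, V z)) ((h, 0), w)"
    "G' (z, V z) ((h, 0), w) = A z h + B z w" if "z \<in> C" for z h w
  proof -
    have "((h, 0 :: real), w) = ((h, 0), 0) + (0, w)" by (simp add: zero_prod_def)
    then show "G' (z, V z) ((h, 0), w) = A z h + B z w"
      unfolding A_def B_def blinfun_apply_blinfun_compose i by (metis blinfun.add_right)
    then show "A z h + B z w = frechet_derivative G (at (z, V z)) ((h, 0), w)"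
      using G'(1)[OF zV[OF that]] by simp
  qed
  have bound: "norm (frechet_derivative G (at (z, V z)) (0, w)) \<le> K * norm w" if "z \<in> C" for z w
  proof -
    have z: "z \<in> Z" "V z \<in> S" using zV[OF that] by auto
    have "norm (frechet_derivative G (at (z, V z)) (0, w)) \<le> K * norm (0 :: 'e \<times> real, w)"
    proof (rule derivative_le_lipschitz[OF _ ZS zV[OF that] K(1)])
      show "(G has_derivative frechet_derivative G (at (z, V z))) (at (z, V z))"
        using G'(1,2)[OF zV[OF that]] by simp
      fix s assume "(z, V z) + s *\<^sub>R (0, w) \<in> Z \<times> S"
      then show "norm (G ((z, V z) + s *\<^sub>R (0, w)) - G (z, V z)) \<le> K * norm (s *\<^sub>R (0 :: 'e \<times> real, w))"
        using lip[of z "V z + s *\<^sub>R w" "V z"] z by (simp add: Z_def norm_Pair)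
    qed
    then show ?thesis by (simp add: norm_Pair)
  qed
  have BK: "norm (B z) \<le> K" if "z \<in> C" for z
    by (rule norm_blinfun_bound[OF K(1)]) (use bound[OF that] AB(1)[OF that, of 0] in \<open>simp add: zero_prod_def\<close>)
  have "continuous_on C (\<lambda>z. G' (z, V z))"
    by (rule continuous_on_compose2[OF G'(3)])
      (use zV V(1) CZ in \<open>auto intro!: continuous_intros intro: continuous_on_subset simp: Z_def\<close>)
  then have contAB: "continuous_on C A" "continuous_on C B"
    unfolding A_def B_def by (intro continuous_intros; assumption)+
  obtain a where a: "a > 0" "\<And>z. z \<in> C \<Longrightarrow> norm (A z) \<le> a"
    using compact_imp_bounded[OF compact_continuous_image[OF contAB(1) cC]] unfolding bounded_pos by auto
  define H where "H = (\<lambda>(z, w). A z + (B z o\<^sub>L w))"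
  have star: "(x, u * t) \<in> C" if "(x, t) \<in> C" "0 \<le> u" "u \<le> 1" for x t u
  proof -
    have "\<bar>u * t\<bar> \<le> 1 * \<bar>t\<bar>" unfolding abs_mult by (intro mult_right_mono) (use that in auto)
    then show ?thesis using that by (auto simp: C_def)
  qed
  have contH: "continuous_on (C \<times> UNIV) H"
    unfolding H_def split_beta
    by (intro continuous_intros continuous_on_compose2[OF contAB(1)] continuous_on_compose2[OF contAB(2)]) auto
  obtain W where W: "continuous_on C W" "\<And>z. z \<in> C \<Longrightarrow> W z = volterra H W z"
  proof (rule volterra_fixed_point[OF contH closed_UNIV UNIV_I star, of c K a])
    show "norm (H (z, v) - H (z, w)) \<le> K * norm (v - w)" if "z \<in> C" for z v w
    proof -
      have "H (z, v) - H (z, w) = B z o\<^sub>L (v - w)"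
        by (auto simp: H_def intro!: blinfun_eqI simp: blinfun.diff_left blinfun.diff_right)
      then show ?thesis
        using norm_blinfun_compose[of "B z" "v - w"] mult_right_mono[OF BK[OF that], of "norm (v - w)"] by simp
    qed
    show "norm (H (z, 0)) \<le> a" if "z \<in> C" for z
      using a(2)[OF that] by (simp add: H_def)
  qed (use c K(1) cK in \<open>auto simp: C_def\<close>)
  have contW: "continuous_on {0..1} (\<lambda>u. H ((x, u * t), W (x, u * t)))" if "(x, t) \<in> C" for x t
    using continuous_on_volterra_slice[OF contH W(1) _ star that] by simp
  have Wh: "W (x, t) h = t *\<^sub>R integral {0..1} (\<lambda>u. A (x, u * t) h + B (x, u * t) (W (x, u * t) h))"
    if "(x, t) \<in> C" for x t h
    using blinfun_apply_integral[OF integrable_continuous_real[OF contW[OF that]], of h] W(2)[OF that]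
    by (simp add: volterra_def H_def scaleR_blinfun.rep_eq plus_blinfun.rep_eq)
  have GC: "continuous_on (C \<times> S) G"
    by (rule continuous_on_subset[OF C_k_continuous_on[OF G]]) (use CZ in \<open>auto simp: Z_def\<close>)
  have VC: "continuous_on C V" "V ` C \<subseteq> S"
    using continuous_on_subset[OF V(1)] V(2) CZ by (auto simp: Z_def)
  have main: "((\<lambda>x. V (x, t)) has_derivative W (x1, t)) (at x1)" if x1: "x1 \<in> ball x0 r" and t: "t \<in> {-c..c}" for x1 t
  proof -
    have x1C: "(x1, s) \<in> C" if "s \<in> {-c..c}" for s using that x1 by (auto simp: C_def)
    have contV: "continuous_on {-c..c} (\<lambda>s. V (y, s))" if "y \<in> cball x0 r" for y
      by (rule continuous_on_compose2[OF V(1)]) (use that X(2) c in \<open>auto intro!: continuous_intros\<close>)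
    define \<Gamma> where "\<Gamma> = (\<lambda>s. ((x1, s), V (x1, s))) ` {-c..c}"
    have \<Gamma>: "compact \<Gamma>" "\<Gamma> \<subseteq> Z \<times> S"
      unfolding \<Gamma>_def using x1 x1C zV
      by (auto intro!: compact_continuous_image continuous_intros contV simp: less_imp_le)
    \<comment> \<open>the Lipschitz constant of \<open>V\<close> in space that the absorption argument yields\<close>
    define L where "L = 4 * c * (1 + a)"
    have L: "L > 0" using a c by (simp add: L_def)
    have "\<exists>\<delta>>0. \<forall>y. norm (y - x1) < \<delta> \<longrightarrow> norm (V (y, t) - V (x1, t) - W (x1, t) (y - x1)) \<le> e * norm (y - x1)"
      if "e > 0" for e
    proof -
      \<comment> \<open>chosen so that \<open>c * e1 + c * K \<le> 3/4\<close> leaves something to absorb into, and the final error is at most \<open>e\<close>\<close>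
      define e1 where "e1 = min 1 (min (1 / (4 * c)) (e / (2 * c * (1 + L))))"
      have e1: "e1 > 0" "e1 \<le> 1" "c * e1 \<le> 1 / 4" "2 * c * e1 * (1 + L) \<le> e"
      proof -
        show "e1 > 0" "e1 \<le> 1" using c L \<open>e > 0\<close> by (simp_all add: e1_def)
        have "e1 \<le> 1 / (4 * c)" "e1 \<le> e / (2 * c * (1 + L))" by (simp_all add: e1_def)
        then have "e1 * (4 * c) \<le> 1" "e1 * (2 * c * (1 + L)) \<le> e"
          using c L by (simp_all add: pos_le_divide_eq)
        then show "c * e1 \<le> 1 / 4" "2 * c * e1 * (1 + L) \<le> e"
          by (simp_all add: algebra_simps)
      qed
      obtain d1 where d1: "d1 > 0"
        "\<And>p q. p \<in> \<Gamma> \<Longrightarrow> norm (q - p) < d1 \<Longrightarrow> norm (G q - G p - G' p (q - p)) \<le> e1 * norm (q - p)"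
        using C1_remainder_near_compact[OF ZS \<Gamma> e1(1) G'(2,3)] by blast
      have "uniformly_continuous_on C V"
        by (rule compact_uniformly_continuous[OF continuous_on_subset[OF V(1)] cC]) (use CZ in \<open>simp add: Z_def\<close>)
      then obtain d2 where d2: "d2 > 0"
        "\<And>z z'. z \<in> C \<Longrightarrow> z' \<in> C \<Longrightarrow> dist z' z < d2 \<Longrightarrow> dist (V z') (V z) < d1 / 2"
        using d1(1) unfolding uniformly_continuous_on_def by (meson half_gt_zero)
      define \<delta> where "\<delta> = min (d1 / 2) (min d2 (r - dist x0 x1))"
      have \<delta>: "\<delta> > 0" using d1 d2 x1 by (simp add: \<delta>_def)
      have "norm (V (y, t) - V (x1, t) - W (x1, t) (y - x1)) \<le> e * norm (y - x1)" if y: "norm (y - x1) < \<delta>" for y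
      proof -
        define k where "k = y - x1"
        have "dist x0 y \<le> dist x0 x1 + norm k" using dist_triangle[of x0 y x1] by (simp add: k_def dist_norm norm_minus_commute)
        then have yb: "y \<in> cball x0 r" using y by (simp add: \<delta>_def k_def)
        then have yC: "(y, s) \<in> C" if "s \<in> {-c..c}" for s using that by (auto simp: C_def)
        define E where "E s = V (y, s) - V (x1, s)" for s
        define D where "D s = E s - W (x1, s) k" for s
        define R where "R s = G ((y, s), V (y, s)) - G ((x1, s), V (x1, s)) - A (x1, s) k - B (x1, s) (E s)" for s
        have R: "norm (R s) \<le> e1 * (norm k + norm (E s))" if s: "s \<in> {-c..c}" for s
        proof -
          let ?q = "((y, s), V (y, s))" and ?p = "((x1, s), V (x1, s))"
          have qp: "?q - ?p = ((k, 0), E s)" by (simp add: k_def E_def)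
          have "norm ((k, 0::real), E s) \<le> norm (k, 0::real) + norm (E s)" by (rule norm_Pair_le)
          then have n: "norm (?q - ?p) \<le> norm k + norm (E s)" unfolding qp by (simp add: norm_Pair)
          have "dist (y, s) (x1, s) < d2" using y by (simp add: \<delta>_def dist_Pair_Pair dist_norm)
          then have "norm (E s) < d1 / 2" using d2(2)[OF x1C[OF s] yC[OF s]] by (simp add: E_def dist_norm)
          then have "norm (?q - ?p) < d1" using n y by (simp add: \<delta>_def k_def)
          then have "norm (G ?q - G ?p - G' ?p (?q - ?p)) \<le> e1 * norm (?q - ?p)"
            by (intro d1(2)) (use s in \<open>auto simp: \<Gamma>_def\<close>)
          also have "\<dots> \<le> e1 * (norm k + norm (E s))" using n e1(1) by simp
          finally show ?thesis
            unfolding qp AB(2)[OF x1C[OF s]] by (simp add: R_def algebra_simps)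
        qed
        have contE: "continuous_on {-c..c} E"
          unfolding E_def using x1 yb by (intro continuous_intros contV) auto
        have contD: "continuous_on {-c..c} D"
          unfolding D_def
          by (intro continuous_intros contE continuous_on_compose2[OF W(1)]) (use x1C in auto)
        have ne: "{-c..c} \<noteq> {}" using c by simp
        have cGq: "continuous_on {0..1} (\<lambda>u. G ((y', u * s), V (y', u * s)))" if "(y', s) \<in> C" for y' s
          using continuous_on_volterra_slice[OF GC VC star that] by simp
        have cGd: "continuous_on {0..1} (\<lambda>u. G ((y, u * s), V (y, u * s)) - G ((x1, u * s), V (x1, u * s)))"
          if "s \<in> {-c..c}" for s
          using cGq[OF yC[OF that]] cGq[OF x1C[OF that]] by (rule continuous_on_diff)
        have Vs: "V (y', s) = s *\<^sub>R integral {0..1} (\<lambda>u. G ((y', u * s), V (y', u * s)))" if "(y', s) \<in> C" for y' s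
          using V(3)[of "(y', s)"] that CZ by (auto simp: volterra_def Z_def)
        have us: "u * s \<in> {-c..c}" if "s \<in> {-c..c}" "0 \<le> u" "u \<le> 1" for u s
          using star[OF x1C[OF that(1)] that(2,3)] by (simp add: C_def)
        have mean: "norm (s *\<^sub>R integral {0..1} f) \<le> c * b"
          if "continuous_on {0..1} f" "\<And>u. 0 \<le> u \<Longrightarrow> u \<le> 1 \<Longrightarrow> norm (f u) \<le> b" "s \<in> {-c..c}" for s b and f :: "real \<Rightarrow> 'v"
        proof -
          have "norm (integral {0..1} f) \<le> b * (1 - 0)" by (rule integral_bound) (use that in auto)
          moreover have "0 \<le> b" using order_trans[OF norm_ge_zero that(2)[of 0]] by simp
          ultimately show ?thesis using that(3) by (auto intro!: mult_mono)
        qed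
        obtain s0 where s0: "s0 \<in> {-c..c}" "\<And>s. s \<in> {-c..c} \<Longrightarrow> norm (E s) \<le> norm (E s0)"
          using continuous_attains_sup[OF compact_Icc ne continuous_on_norm[OF contE]] by blast
        have "norm (E s0) \<le> c * (e1 * (norm k + norm (E s0)) + a * norm k + K * norm (E s0))"
        proof -
          have "E s0 = s0 *\<^sub>R integral {0..1} (\<lambda>u. G ((y, u * s0), V (y, u * s0)) - G ((x1, u * s0), V (x1, u * s0)))"
            unfolding E_def Vs[OF yC[OF s0(1)]] Vs[OF x1C[OF s0(1)]]
            using cGq[OF yC[OF s0(1)]] cGq[OF x1C[OF s0(1)]]
            by (simp add: integral_diff integrable_continuous_real scaleR_diff_right)
          also have "norm \<dots> \<le> c * (e1 * (norm k + norm (E s0)) + a * norm k + K * norm (E s0))"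
          proof (rule mean[OF cGd[OF s0(1)] _ s0(1)])
            fix u :: real assume "0 \<le> u" "u \<le> 1"
            then have u: "u * s0 \<in> {-c..c}" using us s0(1) by blast
            let ?s = "u * s0"
            have "norm (A (x1, ?s) k) \<le> a * norm k"
              using norm_blinfun[of "A (x1, ?s)" k] mult_right_mono[OF a(2)[OF x1C[OF u]], of "norm k"] by simp
            moreover have "norm (B (x1, ?s) (E ?s)) \<le> K * norm (E s0)"
              using norm_blinfun[of "B (x1, ?s)" "E ?s"] mult_mono[OF BK[OF x1C[OF u]] s0(2)[OF u] K(1)] by simp
            moreover have "norm (R ?s) \<le> e1 * (norm k + norm (E s0))"
              by (rule order_trans[OF R[OF u] mult_left_mono]) (use s0(2)[OF u] e1(1) in auto)
            moreover have eq: "G ((y, ?s), V (y, ?s)) - G ((x1, ?s), V (x1, ?s)) = R ?s + A (x1, ?s) k + B (x1, ?s) (E ?s)"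
              by (simp add: R_def)
            ultimately show "norm (G ((y, ?s), V (y, ?s)) - G ((x1, ?s), V (x1, ?s))) \<le> e1 * (norm k + norm (E s0)) + a * norm k + K * norm (E s0)"
              unfolding eq using norm_triangle_ineq[of "R ?s + A (x1, ?s) k" "B (x1, ?s) (E ?s)"] norm_triangle_ineq[of "R ?s" "A (x1, ?s) k"]
              by linarith
          qed
          finally show ?thesis .
        qed
        also have "\<dots> = (c * e1) * norm k + (c * e1) * norm (E s0) + c * a * norm k + (c * K) * norm (E s0)"
          by (simp add: algebra_simps)
        also have "\<dots> \<le> c * 1 * norm k + 1 / 4 * norm (E s0) + c * a * norm k + 1 / 2 * norm (E s0)"
          using e1 cK c by (intro add_mono mult_right_mono mult_left_mono) auto
        finally have EL: "norm (E s0) \<le> L * norm k" by (simp add: L_def algebra_simps)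
        obtain s1 where s1: "s1 \<in> {-c..c}" "\<And>s. s \<in> {-c..c} \<Longrightarrow> norm (D s) \<le> norm (D s1)"
          using continuous_attains_sup[OF compact_Icc ne continuous_on_norm[OF contD]] by blast
        have "norm (D s1) \<le> c * (e1 * (norm k + L * norm k) + K * norm (D s1))"
        proof -
          let ?h = "\<lambda>u. A (x1, u * s1) k + B (x1, u * s1) (W (x1, u * s1) k)"
          have ch: "continuous_on {0..1} ?h"
            using continuous_on_compose2[OF bounded_linear.continuous_on[OF blinfun.bounded_linear_left[of k] contW[OF x1C[OF s1(1)]]], of "{0..1}" "\<lambda>u. u"]
            by (simp add: H_def plus_blinfun.rep_eq)
          have "D s1 = s1 *\<^sub>R integral {0..1} (\<lambda>u. (G ((y, u * s1), V (y, u * s1)) - G ((x1, u * s1), V (x1, u * s1))) - ?h u)"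
            unfolding D_def E_def Vs[OF yC[OF s1(1)]] Vs[OF x1C[OF s1(1)]] Wh[OF x1C[OF s1(1)]]
            using cGq[OF yC[OF s1(1)]] cGq[OF x1C[OF s1(1)]] ch cGd[OF s1(1)]
            by (simp add: integral_diff integrable_continuous_real scaleR_diff_right)
          also have "norm \<dots> \<le> c * (e1 * (norm k + L * norm k) + K * norm (D s1))"
          proof (rule mean[OF continuous_on_diff[OF cGd[OF s1(1)] ch] _ s1(1)])
            fix u :: real assume "0 \<le> u" "u \<le> 1"
            then have u: "u * s1 \<in> {-c..c}" using us s1(1) by blast
            let ?s = "u * s1"
            have "norm (B (x1, ?s) (D ?s)) \<le> K * norm (D s1)"
              using norm_blinfun[of "B (x1, ?s)" "D ?s"] mult_mono[OF BK[OF x1C[OF u]] s1(2)[OF u] K(1)] by simp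
            moreover have "norm (R ?s) \<le> e1 * (norm k + L * norm k)"
              by (rule order_trans[OF R[OF u] mult_left_mono]) (use s0(2)[OF u] EL e1(1) in auto)
            moreover have eq: "(G ((y, ?s), V (y, ?s)) - G ((x1, ?s), V (x1, ?s))) - ?h u = R ?s + B (x1, ?s) (D ?s)"
              by (simp add: R_def D_def blinfun.diff_right)
            ultimately show "norm ((G ((y, ?s), V (y, ?s)) - G ((x1, ?s), V (x1, ?s))) - ?h u) \<le> e1 * (norm k + L * norm k) + K * norm (D s1)"
              unfolding eq using norm_triangle_ineq[of "R ?s" "B (x1, ?s) (D ?s)"] by linarith
          qed
          finally show ?thesis .
        qed
        also have "\<dots> = c * e1 * (1 + L) * norm k + (c * K) * norm (D s1)"
          by (simp add: algebra_simps)
        also have "\<dots> \<le> c * e1 * (1 + L) * norm k + 1 / 2 * norm (D s1)"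
          using mult_right_mono[OF cK, of "norm (D s1)"] by simp
        finally have "norm (D s1) \<le> (2 * c * e1 * (1 + L)) * norm k" by (simp add: algebra_simps)
        also have "\<dots> \<le> e * norm k" using e1(4) by (rule mult_right_mono) simp
        finally show ?thesis using s1(2)[OF t] by (simp add: D_def E_def k_def)
      qed
      then show ?thesis using \<delta> by blast
    qed
    then show ?thesis unfolding has_derivative_at_alt
      by (simp add: blinfun.bounded_linear_right)
  qed
  have "W z h = volterra (\<lambda>(z, w). frechet_derivative G (at (z, V z)) ((h, 0), w)) (\<lambda>z. W z h) z"
    if zC: "z \<in> C" for z h
  proof -
    obtain x t where z: "z = (x, t)" "(x, t) \<in> C" using zC by (cases z) auto
    show ?thesis
      unfolding z(1) volterra_def Wh[OF z(2)] using AB(1) star[OF z(2)] by (auto intro!: integral_cong)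
  qed
  then show ?thesis
    using that[OF W(1)[unfolded C_def]] main bound unfolding C_def by blast
qed

text \<open>The derivative \<open>W\<close> of a solution \<open>V\<close> solves an equation of the same form, with the same Lipschitz
  constant and with coefficients as regular as \<open>V\<close>. This is why no order of regularity is lost, and why
  one step length serves all orders.\<close>

lemma C_k_volterra:
  fixes G :: "('e::euclidean_space \<times> real) \<times> 'v::euclidean_space \<Rightarrow> 'v"
  assumes K: "0 \<le> K"
    and "open X" "open S" "d * K \<le> 1 / 2" "C_k k ((X \<times> {-d<..<d}) \<times> S) G"
    and "continuous_on (X \<times> {-d<..<d}) V" "V ` (X \<times> {-d<..<d}) \<subseteq> S"
    and "\<And>z. z \<in> X \<times> {-d<..<d} \<Longrightarrow> V z = volterra G V z"
    and "\<And>z v w. z \<in> X \<times> {-d<..<d} \<Longrightarrow> v \<in> S \<Longrightarrow> w \<in> S \<Longrightarrow> norm (G (z, v) - G (z, w)) \<le> K * norm (v - w)"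
  shows "C_k k (X \<times> {-d<..<d}) V"
  using assms(2-)
proof (induction k arbitrary: X S d G V)
  case 0
  then show ?case by simp
next
  case (Suc k)
  let ?Z = "X \<times> {-d<..<d}"
  have Z: "open ?Z" "open (?Z \<times> S)" using Suc.prems(1,2) by (simp_all add: open_Times)
  have VC: "C_k k ?Z V"
    by (rule Suc.IH[OF Suc.prems(1-3) C_k_Suc_imp[OF Suc.prems(4)] Suc.prems(5-8)])
  have G1: "C_k (Suc 0) (?Z \<times> S) G"
    using Suc.prems(4) by (induction k) (auto dest: C_k_Suc_imp simp del: C_k.simps)
  have VS: "(z, V z) \<in> ?Z \<times> S" if "z \<in> ?Z" for z using Suc.prems(6) that by auto
  show ?case
  proof (rule C_k_local)
    fix z0 assume "z0 \<in> ?Z"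
    then obtain x0 t0 where z0: "z0 = (x0, t0)" "x0 \<in> X" "\<bar>t0\<bar> < d" by auto
    obtain r where r: "r > 0" "cball x0 r \<subseteq> X" using Suc.prems(1) z0(2) open_contains_cball by blast
    obtain c where c: "\<bar>t0\<bar> < c" "c < d" using dense[OF z0(3)] by blast
    then have c0: "0 < c" by linarith
    obtain W :: "'e \<times> real \<Rightarrow> 'e \<Rightarrow>\<^sub>L 'v" where W: "continuous_on (cball x0 r \<times> {-c..c}) W"
      "\<And>z h. z \<in> cball x0 r \<times> {-c..c} \<Longrightarrow>
        W z h = volterra (\<lambda>(z, w). frechet_derivative G (at (z, V z)) ((h, 0), w)) (\<lambda>z. W z h) z"
      "\<And>z w. z \<in> cball x0 r \<times> {-c..c} \<Longrightarrow> norm (frechet_derivative G (at (z, V z)) (0, w)) \<le> K * norm w"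
      "\<And>x t. x \<in> ball x0 r \<Longrightarrow> t \<in> {-c..c} \<Longrightarrow> ((\<lambda>x. V (x, t)) has_derivative W (x, t)) (at x)"
      using volterra_space_derivative[OF Suc.prems(1) r(2) Suc.prems(2) G1 Suc.prems(5-8) K Suc.prems(3) c0 c(2)]
      by blast
    define T where "T = ball x0 r \<times> {-c<..<c}"
    have T: "open T" "z0 \<in> T" "T \<subseteq> cball x0 r \<times> {-c..c}" "T \<subseteq> ?Z"
      using z0 c r by (auto simp: T_def open_Times)
    have cK: "c * K \<le> 1 / 2" using mult_right_mono[of c d K] K c Suc.prems(3) by linarith
    have WC: "C_k k T (\<lambda>z. W z h)" for h
      unfolding T_def
    proof (rule Suc.IH[where S = UNIV and G = "\<lambda>(z, w). frechet_derivative G (at (z, V z)) ((h, 0), w)"])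
      show "c * K \<le> 1 / 2" by (rule cK)
      show "continuous_on (ball x0 r \<times> {-c<..<c}) (\<lambda>z. W z h)"
        using continuous_on_subset[OF W(1) T(3)] unfolding T_def by (intro continuous_intros)
      show "W z h = volterra (\<lambda>(z, w). frechet_derivative G (at (z, V z)) ((h, 0), w)) (\<lambda>z. W z h) z"
        if "z \<in> ball x0 r \<times> {-c<..<c}" for z
        using W(2) that T(3) unfolding T_def by blast
      have lin: "linear (frechet_derivative G (at (z, V z)))" if "z \<in> T" for z
        using C_k_has_derivative[OF G1 VS] T(4) that has_derivative_linear by blast
      show "norm ((\<lambda>(z, w). frechet_derivative G (at (z, V z)) ((h, 0), w)) (z, v) -
          (\<lambda>(z, w). frechet_derivative G (at (z, V z)) ((h, 0), w)) (z, w)) \<le> K * norm (v - w)"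
        if "z \<in> ball x0 r \<times> {-c<..<c}" for z v w
      proof -
        have "z \<in> T" using that by (simp add: T_def)
        then show ?thesis
          using linear_diff[OF lin, of z "((h, 0), v)" "((h, 0), w)"] W(3)[of z "v - w"] T(3)
          by (auto simp: zero_prod_def)
      qed
      have TU: "open (T \<times> (UNIV :: 'v set))" using T(1) by (simp add: open_Times)
      have "C_k k (T \<times> UNIV) (\<lambda>p. frechet_derivative G (at (fst p, V (fst p))) ((h, 0), snd p))"
      proof (rule C_k_linear_apply[OF TU, where v = "\<lambda>p. ((h, 0), snd p)"
            and a = "\<lambda>p. frechet_derivative G (at (fst p, V (fst p)))"])
        show "linear (frechet_derivative G (at (fst p, V (fst p))))" if "p \<in> T \<times> UNIV" for p :: "('e \<times> real) \<times> 'v"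
          using lin that by auto
        have "C_k k (T \<times> (UNIV :: 'v set)) (\<lambda>p. V (fst p))"
          by (rule C_k_compose[OF TU Z(1) VC C_k_bounded_linear[OF TU bounded_linear_fst]]) (use T(4) in auto)
        then have 1: "C_k k (T \<times> (UNIV :: 'v set)) (\<lambda>p. (fst p, V (fst p)))"
          by (rule C_k_Pair[OF TU C_k_bounded_linear[OF TU bounded_linear_fst]])
        show "C_k k (T \<times> (UNIV :: 'v set)) (\<lambda>p. frechet_derivative G (at (fst p, V (fst p))) b)" for b
          by (rule C_k_compose[where g = "\<lambda>q. frechet_derivative G (at q) b" and f = "\<lambda>p. (fst p, V (fst p))",
                OF TU Z(2) C_k_derivative[OF Suc.prems(4)] 1]) (use VS T(4) in auto)
        show "C_k k (T \<times> (UNIV :: 'v set)) (\<lambda>p. ((h, 0), snd p))"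
          by (intro C_k_Pair[OF TU] C_k_const[OF TU] C_k_bounded_linear[OF TU] bounded_linear_snd)
      qed
      then show "C_k k ((ball x0 r \<times> {-c<..<c}) \<times> UNIV) (\<lambda>(z, w). frechet_derivative G (at (z, V z)) ((h, 0), w))"
        by (simp add: case_prod_beta' T_def)
    qed auto
    have GV: "C_k k T (\<lambda>z. G (z, V z))"
      by (rule C_k_compose[OF T(1) Z(2) C_k_Suc_imp[OF Suc.prems(4)]
            C_k_Pair[OF T(1) C_k_bounded_linear[OF T(1) bounded_linear_ident] C_k_subset[OF VC T(4)]]])
        (use VS T(4) in auto)
    have deriv: "(V has_derivative (\<lambda>v. W z (fst v) + snd v *\<^sub>R G (z, V z))) (at z)" if zT: "z \<in> T" for z
    proof -
      obtain x t where z: "z = (x, t)" "x \<in> ball x0 r" "t \<in> {-c<..<c}" using zT by (auto simp: T_def)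
      have "((\<lambda>(x, t). V (x, t)) has_derivative (\<lambda>(h, s). W (x, t) h + blinfun_scaleR_left (G ((x, t), V (x, t))) s))
          (at (x, t) within ball x0 r \<times> {-c<..<c})"
      proof (rule has_derivative_partialsI[where fy = "\<lambda>x t. blinfun_scaleR_left (G ((x, t), V (x, t)))"])
        show "((\<lambda>x. V (x, t)) has_derivative W (x, t)) (at x within ball x0 r)"
          using W(4)[OF z(2), of t] z(3) by (auto intro: has_derivative_at_withinI)
        show "((\<lambda>t. V (x, t)) has_derivative blinfun_scaleR_left (G ((x, t), V (x, t)))) (at t within {-c<..<c})"
          if "x \<in> ball x0 r" "t \<in> {-c<..<c}" for x t
        proof -
          have xT: "(x, s) \<in> T" if "s \<in> {-c<..<c}" for s using that \<open>x \<in> ball x0 r\<close> by (simp add: T_def)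
          have "continuous_on {-c<..<c} (\<lambda>s. G ((x, s), V (x, s)))"
            by (rule continuous_on_compose2[OF C_k_continuous_on[OF GV]]) (use xT in \<open>auto intro!: continuous_intros\<close>)
          then have "((\<lambda>t. V (x, t)) has_vector_derivative G ((x, t), V (x, t))) (at t)"
          proof (rule volterra_time_derivative)
            show "V (x, t) = volterra G V (x, t)" if "\<bar>t\<bar> < c" for t
            proof -
              have "(x, t) \<in> T" using that by (intro xT) auto
              then show ?thesis using T(4) by (intro Suc.prems(7)) blast
            qed
          qed (use that in auto)
          then show ?thesis
            by (simp add: has_vector_derivative_def has_derivative_at_withinI blinfun_scaleR_left.rep_eq)
        qed
        have "continuous_on T (\<lambda>z. blinfun_scaleR_left (G (z, V z)))"
          by (rule bounded_linear.continuous_on[OF bounded_linear_blinfun_scaleR_left C_k_continuous_on[OF GV]])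
        then show "continuous (at (x, t) within ball x0 r \<times> {-c<..<c}) (\<lambda>(x, t). blinfun_scaleR_left (G ((x, t), V (x, t))))"
          using zT z(1) by (simp add: case_prod_beta' T_def continuous_on_eq_continuous_within)
      qed (use z in auto)
      then show ?thesis
        using at_within_open[OF zT T(1)] z(1) by (simp add: T_def case_prod_beta')
    qed
    have "C_k k T (\<lambda>z. W z (fst v) + snd v *\<^sub>R G (z, V z))" for v
      by (intro C_k_add[OF T(1) WC] C_k_scaleR[OF T(1)] C_k_const[OF T(1)] GV)
    then have "C_k (Suc k) T V" using C_k_SucI'[OF T(1) deriv] by blast
    then show "\<exists>T. open T \<and> z0 \<in> T \<and> C_k (Suc k) T V" using T by blast
  qed
qed

lemma smooth_on_lipschitz_cball:
  fixes f :: "'a::euclidean_space \<Rightarrow> 'b::euclidean_space"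
  assumes "smooth_on S f" "cball p r \<subseteq> S"
  obtains K where "0 \<le> K" "\<And>x y. x \<in> cball p r \<Longrightarrow> y \<in> cball p r \<Longrightarrow> norm (f x - f y) \<le> K * norm (x - y)"
proof -
  have "C_k (Suc 0) S f" using assms(1) by (simp add: smooth_on_def del: C_k.simps)
  then obtain f' :: "'a \<Rightarrow> 'a \<Rightarrow>\<^sub>L 'b" where f':
    "\<And>x. x \<in> S \<Longrightarrow> (f has_derivative blinfun_apply (f' x)) (at x)" "continuous_on S f'"
    using C_k_blinfun_derivative by metis
  have "compact (f' ` cball p r)"
    by (rule compact_continuous_image[OF continuous_on_subset[OF f'(2) assms(2)] compact_cball])
  then obtain K where K: "K > 0" "\<And>x. x \<in> cball p r \<Longrightarrow> norm (f' x) \<le> K"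
    using compact_imp_bounded[of "f' ` cball p r"] unfolding bounded_pos by auto
  have "norm (f x - f y) \<le> K * norm (x - y)" if "x \<in> cball p r" "y \<in> cball p r" for x y
  proof (rule differentiable_bound[OF convex_cball _ _ that])
    show "(f has_derivative blinfun_apply (f' x)) (at x within cball p r)" if "x \<in> cball p r" for x
      using f'(1) that assms(2) has_derivative_at_withinI by blast
    show "onorm (blinfun_apply (f' x)) \<le> K" if "x \<in> cball p r" for x
      using K(2)[OF that] by (simp add: norm_blinfun.rep_eq)
  qed
  then show ?thesis using that K(1) by (meson less_imp_le)
qed

text \<open>The flow is \<open>\<Phi> (x, t) = x + V (x, t)\<close>, where \<open>V\<close> is the fixed point for \<open>G ((x, t), v) = f (x + v)\<close>.\<close>

theorem smooth_local_flow:
  fixes f :: "'e::euclidean_space \<Rightarrow> 'e"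
  assumes "open S" "p \<in> S" "smooth_on S f"
  obtains r d \<Phi> where "0 < r" "0 < d" "smooth_on (ball p r \<times> {-d<..<d}) \<Phi>"
    "\<And>z. z \<in> ball p r \<times> {-d<..<d} \<Longrightarrow> \<Phi> z \<in> S" "\<And>x. x \<in> ball p r \<Longrightarrow> \<Phi> (x, 0) = x"
    "\<And>x t. x \<in> ball p r \<Longrightarrow> \<bar>t\<bar> < d \<Longrightarrow> ((\<lambda>t. \<Phi> (x, t)) has_vector_derivative f (\<Phi> (x, t))) (at t)"
proof -
  obtain R where R: "R > 0" "cball p R \<subseteq> S" using assms(1,2) open_contains_cball by blast
  \<comment> \<open>leaves room for start \<open>x\<close> within \<open>r\<close> of \<open>p\<close> and displacement up to \<open>2 r\<close>; the solution stays in a closed ball, smoothness wants an open one\<close>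
  define r where "r = R / 3"
  have r: "r > 0" using R by (simp add: r_def)
  obtain K where K: "0 \<le> K" "\<And>x y. x \<in> cball p R \<Longrightarrow> y \<in> cball p R \<Longrightarrow> norm (f x - f y) \<le> K * norm (x - y)"
    using smooth_on_lipschitz_cball[OF assms(3) R(2)] by blast
  have "compact (f ` cball p R)"
    by (rule compact_continuous_image[OF continuous_on_subset[OF smooth_on_continuous_on[OF assms(3)] R(2)] compact_cball])
  then obtain M where M: "M > 0" "\<And>x. x \<in> cball p R \<Longrightarrow> norm (f x) \<le> M"
    using compact_imp_bounded[of "f ` cball p R"] unfolding bounded_pos by auto
  \<comment> \<open>the first bound confines the displacement to \<open>r\<close>, the second makes the operator a contraction\<close>
  define d where "d = min (r / M) (1 / (2 * (K + 1)))"
  have d: "d > 0" "d * M \<le> r" "d * K \<le> 1 / 2"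
  proof -
    show "d > 0" using r M K by (simp add: d_def)
    have "d \<le> r / M" "d \<le> 1 / (2 * (K + 1))" by (simp_all add: d_def)
    then have "d * M \<le> r" "d * (2 * (K + 1)) \<le> 1" using M K by (simp_all add: pos_le_divide_eq)
    then show "d * M \<le> r" "d * K \<le> 1 / 2" using \<open>d > 0\<close> by (simp_all add: algebra_simps)
  qed
  define G where "G = (\<lambda>q :: ('e \<times> real) \<times> 'e. f (fst (fst q) + snd q))"
  have mem: "x + v \<in> cball p R" if "x \<in> ball p r" "norm v \<le> 2 * r" for x v
    using that norm_triangle_ineq[of "x - p" v] by (simp add: dist_norm norm_minus_commute r_def algebra_simps)
  let ?Z = "ball p r \<times> {-d<..<d}"
  have Zop: "open ?Z" "open (?Z \<times> ball 0 (2 * r) :: (('e \<times> real) \<times> 'e) set)" by (simp_all add: open_Times)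
  have "bounded_linear (\<lambda>q :: ('e \<times> real) \<times> 'e. fst (fst q) + snd q)"
    by (intro bounded_linear_add bounded_linear_snd bounded_linear_compose[OF bounded_linear_fst bounded_linear_fst])
  then have "smooth_on (?Z \<times> ball 0 (2 * r)) (\<lambda>q. f (fst (fst q) + snd q))"
    by (rule smooth_on_compose[OF Zop(2) assms(1,3) smooth_on_bounded_linear[OF Zop(2)]])
      (use mem R(2) in \<open>auto simp: less_imp_le subset_iff\<close>)
  then have Gsm: "smooth_on (?Z \<times> ball 0 (2 * r)) G" by (simp add: G_def split_beta)
  have GC: "continuous_on (?Z \<times> cball 0 r) G"
    by (rule continuous_on_subset[OF smooth_on_continuous_on[OF Gsm]]) (use r in auto)
  have star: "(x, u * t) \<in> ?Z" if "(x, t) \<in> ?Z" "0 \<le> u" "u \<le> 1" for x t u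
  proof -
    have "\<bar>u * t\<bar> \<le> 1 * \<bar>t\<bar>" unfolding abs_mult by (intro mult_right_mono) (use that in auto)
    then show ?thesis using that by auto
  qed
  have lip: "norm (G (z, v) - G (z, w)) \<le> K * norm (v - w)"
    if "z \<in> ?Z" "v \<in> ball 0 (2 * r)" "w \<in> ball 0 (2 * r)" for z v w
    using K(2)[OF mem mem, of "fst z" v "fst z" w] that by (auto simp: G_def)
  obtain V where V: "continuous_on ?Z V" "V ` ?Z \<subseteq> cball 0 r" "\<And>z. z \<in> ?Z \<Longrightarrow> V z = volterra G V z"
  proof (rule volterra_fixed_point[OF GC _ _ star, of d K M])
    show "norm (G (z, v) - G (z, w)) \<le> K * norm (v - w)" if "z \<in> ?Z" "v \<in> cball 0 r" "w \<in> cball 0 r" for z v w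
      using lip that r by auto
    show "norm (G (z, 0)) \<le> M" if "z \<in> ?Z" for z
      using M(2)[OF mem[of "fst z" 0]] that r by (auto simp: G_def)
    show "volterra G V ` ?Z \<subseteq> cball 0 r" if V: "continuous_on ?Z V" "V ` ?Z \<subseteq> cball 0 r" for V
    proof clarify
      fix x t assume xt: "x \<in> ball p r" "t \<in> {-d<..<d}"
      have "norm (volterra G V (x, t)) \<le> d * M"
      proof (rule norm_volterra_le)
        show "continuous_on {0..1} (\<lambda>u. G ((x, u * t), V (x, u * t)))"
          using continuous_on_volterra_slice[OF GC V star, of "(x, t)"] xt by simp
        fix u :: real assume "0 \<le> u" "u \<le> 1"
        then have "(x, u * t) \<in> ?Z" using star xt by blast
        then have "norm (V (x, u * t)) \<le> r" using V(2) by (auto simp: image_subset_iff)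
        then show "norm (G ((x, u * t), V (x, u * t))) \<le> M"
          using M(2)[OF mem[OF xt(1), of "V (x, u * t)"]] r by (simp add: G_def)
      qed (use xt in auto)
      then show "volterra G V (x, t) \<in> cball 0 r" using d(2) by simp
    qed
  qed (use d K r in auto)
  have V2: "V ` ?Z \<subseteq> ball 0 (2 * r)" using V(2) r by fastforce
  have "C_k k ?Z V" for k
    by (rule C_k_volterra[OF K(1) open_ball open_ball d(3) _ V(1) V2 V(3) lip])
      (use Gsm in \<open>auto simp: smooth_on_def\<close>)
  then have Vsm: "smooth_on ?Z V" by (simp add: smooth_on_def)
  define \<Phi> where "\<Phi> z = fst z + V z" for z
  show ?thesis
  proof (rule that[OF r d(1)])
    show "smooth_on ?Z \<Phi>"
      unfolding \<Phi>_def by (intro smooth_on_add Zop Vsm smooth_on_bounded_linear bounded_linear_fst)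
    show "\<Phi> z \<in> S" if "z \<in> ?Z" for z
      using mem[of "fst z" "V z"] V(2) that R(2) r by (force simp: \<Phi>_def)
    show "\<Phi> (x, 0) = x" if "x \<in> ball p r" for x
      using V(3)[of "(x, 0)"] that d(1) by (simp add: \<Phi>_def volterra_def)
    show "((\<lambda>t. \<Phi> (x, t)) has_vector_derivative f (\<Phi> (x, t))) (at t)" if x: "x \<in> ball p r" "\<bar>t\<bar> < d" for x t
    proof -
      have xZ: "(x, s) \<in> ?Z" if "\<bar>s\<bar> < d" for s using that x(1) by auto
      have "continuous_on {-d<..<d} (\<lambda>s. ((x, s), V (x, s)))"
        by (intro continuous_intros continuous_on_compose2[OF V(1)]) (use x in auto)
      then have "continuous_on {-d<..<d} (\<lambda>s. G ((x, s), V (x, s)))"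
        by (rule continuous_on_compose2[OF GC]) (use x V(2) in \<open>auto simp: image_subset_iff\<close>)
      then have "((\<lambda>t. V (x, t)) has_vector_derivative G ((x, t), V (x, t))) (at t)"
        by (rule volterra_time_derivative[OF _ x(2)]) (use V(3) xZ in blast)
      then have "((\<lambda>t. x + V (x, t)) has_vector_derivative 0 + G ((x, t), V (x, t))) (at t)"
        by (intro has_vector_derivative_add has_vector_derivative_const)
      then show ?thesis by (simp add: \<Phi>_def G_def)
    qed
  qed
qed

section \<open>Smooth functions on a manifold\<close>

locale manifold =
  fixes A :: "('a::{t2_space, second_countable_topology}, 'e::euclidean_space) atlas"
  assumes smooth_manifold: "smooth_manifold A"
begin

lemma chart:
  assumes "(D, c) \<in> A"
  shows "open D" "open (c ` D)" "homeomorphism D (c ` D) c (inv_into D c)" "D \<subseteq> carrier A"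
    "\<And>q. q \<in> D \<Longrightarrow> inv_into D c (c q) = q"
    "\<And>x. x \<in> c ` D \<Longrightarrow> inv_into D c x \<in> D \<and> c (inv_into D c x) = x"
proof -
  show h: "open D" "open (c ` D)" "homeomorphism D (c ` D) c (inv_into D c)"
    using smooth_manifold assms unfolding smooth_manifold_def by auto
  show "D \<subseteq> carrier A" using assms by (force simp: carrier_def)
  show "inv_into D c (c q) = q" if "q \<in> D" for q using h(3) that by (auto simp: homeomorphism_def)
  show "inv_into D c x \<in> D \<and> c (inv_into D c x) = x" if "x \<in> c ` D" for x
    using h(3) that by (metis f_inv_into_f inv_into_into)
qed

lemma chart_transition:
  "(D, c) \<in> A \<Longrightarrow> (D', c') \<in> A \<Longrightarrow> smooth_on (c ` (D \<inter> D')) (\<lambda>x. c' (inv_into D c x))"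
  using smooth_manifold unfolding smooth_manifold_def by (fastforce simp: comp_def)

lemma open_chart_image: "(D, c) \<in> A \<Longrightarrow> open W \<Longrightarrow> W \<subseteq> D \<Longrightarrow> open (c ` W)"
  using homeomorphism_imp_open_map[OF chart(3)] chart(2) openin_open_eq
  by (metis inf.absorb2 openin_open openin_open_trans)

lemma open_chart_preimage:
  assumes "(D, c) \<in> A" "open T"
  shows "open {q \<in> D. c q \<in> T}"
proof -
  have "continuous_on D c" using chart(3)[OF assms(1)] by (simp add: homeomorphism_def)
  then have "open (D \<inter> c -` T)" using continuous_open_preimage chart(1)[OF assms(1)] assms(2) by blast
  then show ?thesis by (simp add: vimage_def Int_def)
qed

lemma carrierE:
  assumes "p \<in> carrier A"
  obtains D c where "(D, c) \<in> A" "p \<in> D"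
  using assms by (force simp: carrier_def)

lemma open_carrier: "open (carrier A)"
  unfolding carrier_def using chart(1) by (force intro!: open_Union)

lemma smooth_funD:
  assumes "smooth_fun A U f"
  shows "open U" "U \<subseteq> carrier A" "(D, c) \<in> A \<Longrightarrow> smooth_on (c ` (D \<inter> U)) (\<lambda>x. f (inv_into D c x))"
  using assms unfolding smooth_fun_def comp_def by auto

lemma smooth_funI:
  assumes "open U" "U \<subseteq> carrier A"
    and "\<And>D c. (D, c) \<in> A \<Longrightarrow> smooth_on (c ` (D \<inter> U)) (\<lambda>x. f (inv_into D c x))"
  shows "smooth_fun A U f"
  using assms unfolding smooth_fun_def comp_def by auto

lemma smooth_fun_chartI:
  assumes "(D, c) \<in> A" "open N" "N \<subseteq> D" "smooth_on (c ` N) (\<lambda>x. f (inv_into D c x))"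
  shows "smooth_fun A N f"
proof (rule smooth_funI)
  show "open N" by fact
  show "N \<subseteq> carrier A" using assms(3) chart(4)[OF assms(1)] by blast
  fix D' c' assume c': "(D', c') \<in> A"
  let ?O = "c' ` (D' \<inter> N)"
  have O: "open ?O" by (rule open_chart_image[OF c']) (use chart(1)[OF c'] assms(2) in auto)
  have 1: "smooth_on ?O (\<lambda>x. c (inv_into D' c' x))"
    by (rule smooth_on_subset[OF chart_transition[OF c' assms(1)]]) (use assms(3) in auto)
  have "smooth_on ?O (\<lambda>x. f (inv_into D c (c (inv_into D' c' x))))"
    by (rule smooth_on_compose[OF O open_chart_image[OF assms(1-3)] assms(4) 1])
      (use chart(5)[OF c'] in auto)
  then show "smooth_on ?O (\<lambda>x. f (inv_into D' c' x))"
    by (rule smooth_on_cong[OF O, rotated]) (use chart(5)[OF c'] chart(5)[OF assms(1)] assms(3) in auto)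
qed

lemma smooth_fun_local:
  assumes "\<And>p. p \<in> U \<Longrightarrow> \<exists>N. p \<in> N \<and> N \<subseteq> U \<and> smooth_fun A N f"
  shows "smooth_fun A U f"
proof (rule smooth_funI)
  have ex: "\<exists>N. open N \<and> p \<in> N \<and> N \<subseteq> U \<and> smooth_fun A N f" if "p \<in> U" for p
    using assms[OF that] smooth_funD(1) by blast
  show "open U" by (subst open_subopen) (use ex in blast)
  show "U \<subseteq> carrier A" using assms smooth_funD(2) by blast
  fix D c assume c: "(D, c) \<in> A"
  show "smooth_on (c ` (D \<inter> U)) (\<lambda>x. f (inv_into D c x))"
  proof (rule smooth_on_local)
    fix x assume "x \<in> c ` (D \<inter> U)"
    then obtain p where p: "x = c p" "p \<in> D" "p \<in> U" by blast
    obtain N where N: "p \<in> N" "smooth_fun A N f" using assms[OF p(3)] by blast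
    show "\<exists>T. open T \<and> x \<in> T \<and> smooth_on T (\<lambda>x. f (inv_into D c x))"
      using smooth_funD(1,3)[OF N(2)] c p N(1) open_chart_image[OF c, of "D \<inter> N"] chart(1)[OF c] by blast
  qed
qed

lemma smooth_fun_subset:
  assumes "smooth_fun A U f" "open V" "V \<subseteq> U"
  shows "smooth_fun A V f"
  using assms by (intro smooth_funI smooth_on_subset[OF smooth_funD(3)[OF assms(1)]]) (auto dest: smooth_funD(2))

lemma smooth_fun_cong:
  assumes "smooth_fun A U f" "\<And>q. q \<in> U \<Longrightarrow> f q = g q"
  shows "smooth_fun A U g"
proof (rule smooth_funI)
  fix D c assume c: "(D, c) \<in> A"
  have "open (c ` (D \<inter> U))"
    by (rule open_chart_image[OF c]) (use chart(1)[OF c] smooth_funD(1)[OF assms(1)] in auto)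
  then show "smooth_on (c ` (D \<inter> U)) (\<lambda>x. g (inv_into D c x))"
    by (rule smooth_on_cong[OF _ _ smooth_funD(3)[OF assms(1) c]]) (use chart(5)[OF c] assms(2) in auto)
qed (use smooth_funD[OF assms(1)] in auto)

lemma smooth_fun_const: "open U \<Longrightarrow> U \<subseteq> carrier A \<Longrightarrow> smooth_fun A U (\<lambda>q. r)"
  by (intro smooth_funI smooth_on_const open_chart_image) (auto dest: chart(1))

lemma smooth_fun_add:
  assumes "smooth_fun A U f" "smooth_fun A U g"
  shows "smooth_fun A U (\<lambda>q. f q + g q)" "smooth_fun A U (\<lambda>q. f q * g q)"
  using smooth_funD[OF assms(1)] smooth_funD[OF assms(2)]
  by (auto intro!: smooth_funI smooth_on_add smooth_on_mult open_chart_image dest: chart(1))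

lemma smooth_fun_cmul: "smooth_fun A U f \<Longrightarrow> smooth_fun A U (\<lambda>q. r * f q)"
  using smooth_fun_add(2)[OF smooth_fun_const, of U f r] smooth_funD by blast

lemma smooth_fun_diff:
  assumes "smooth_fun A U f" "smooth_fun A U g"
  shows "smooth_fun A U (\<lambda>q. f q - g q)"
  using smooth_fun_add(1)[OF assms(1) smooth_fun_cmul[OF assms(2), of "-1"]] by simp

lemma smooth_nearI: "smooth_fun A U f \<Longrightarrow> p \<in> U \<Longrightarrow> smooth_near A p f"
  unfolding smooth_near_def by blast

lemma smooth_near_carrier: "smooth_near A p f \<Longrightarrow> p \<in> carrier A"
  unfolding smooth_near_def using smooth_funD(2) by blast

lemma smooth_nearE:
  assumes "smooth_near A p f" "open W" "p \<in> W"
  obtains U where "p \<in> U" "U \<subseteq> W" "smooth_fun A U f"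
proof -
  obtain U where U: "p \<in> U" "smooth_fun A U f" using assms(1) unfolding smooth_near_def by blast
  have "smooth_fun A (U \<inter> W) f"
    by (rule smooth_fun_subset[OF U(2)]) (use smooth_funD(1)[OF U(2)] assms in auto)
  then show ?thesis using that U assms by blast
qed

lemma smooth_near2E:
  assumes "smooth_near A p f" "smooth_near A p g"
  obtains U where "p \<in> U" "smooth_fun A U f" "smooth_fun A U g"
proof -
  obtain U where U: "p \<in> U" "smooth_fun A U f" using assms(1) unfolding smooth_near_def by blast
  obtain W where "p \<in> W" "W \<subseteq> U" "smooth_fun A W g"
    using smooth_nearE[OF assms(2) smooth_funD(1)[OF U(2)] U(1)] by blast
  then show ?thesis using that U smooth_fun_subset smooth_funD(1) by blast
qed

lemma smooth_near_add:
  assumes "smooth_near A p f" "smooth_near A p g"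
  shows "smooth_near A p (\<lambda>q. f q + g q)" "smooth_near A p (\<lambda>q. f q * g q)" "smooth_near A p (\<lambda>q. f q - g q)"
  using smooth_near2E[OF assms] smooth_fun_add smooth_fun_diff smooth_nearI by (metis (no_types, lifting))+

lemma smooth_near_const: "p \<in> carrier A \<Longrightarrow> smooth_near A p (\<lambda>q. r)"
  using smooth_fun_const[OF open_carrier] smooth_nearI by blast

lemma smooth_near_cmul: "smooth_near A p f \<Longrightarrow> smooth_near A p (\<lambda>q. r * f q)"
  using smooth_near_add(2)[OF smooth_near_const] smooth_near_carrier by blast

lemma smooth_near_sum:
  assumes "p \<in> carrier A" "\<And>i. i \<in> I \<Longrightarrow> smooth_near A p (f i)"
  shows "smooth_near A p (\<lambda>q. \<Sum>i\<in>I. f i q)"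
  using assms(2) by (induction I rule: infinite_finite_induct) (auto simp: smooth_near_const assms(1) smooth_near_add)

lemma smooth_near_cong:
  assumes "open W" "p \<in> W" "\<And>q. q \<in> W \<Longrightarrow> f q = g q"
  shows "smooth_near A p f \<longleftrightarrow> smooth_near A p g"
proof -
  have "smooth_near A p g" if "smooth_near A p f" "\<And>q. q \<in> W \<Longrightarrow> f q = g q" for f g
    using smooth_nearE[OF that(1) assms(1,2)] smooth_fun_cong smooth_nearI that(2) by (metis subset_iff)
  then show ?thesis using assms(3) by metis
qed

lemma smooth_fun_coord:
  assumes "(D, c) \<in> A"
  shows "smooth_fun A D (\<lambda>q. c q \<bullet> b)"
proof (rule smooth_fun_chartI[OF assms chart(1)[OF assms] subset_refl])
  have "smooth_on (c ` D) (\<lambda>x. x \<bullet> b)"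
    by (rule smooth_on_inner_left[OF chart(2)[OF assms] smooth_on_ident[OF chart(2)[OF assms]]])
  then show "smooth_on (c ` D) (\<lambda>x. c (inv_into D c x) \<bullet> b)"
    by (rule smooth_on_cong[OF chart(2)[OF assms], rotated]) (use chart(6)[OF assms] in auto)
qed

lemma smooth_fun_of_coords:
  assumes "(D, c) \<in> A" "open T" "smooth_on T g" "T \<subseteq> c ` D"
  shows "smooth_fun A {q \<in> D. c q \<in> T} (\<lambda>q. g (c q))"
proof (rule smooth_fun_chartI[OF assms(1) open_chart_preimage[OF assms(1,2)]])
  have "c ` {q \<in> D. c q \<in> T} = T" using assms(4) by auto
  then show "smooth_on (c ` {q \<in> D. c q \<in> T}) (\<lambda>x. g (c (inv_into D c x)))"
    using smooth_on_cong[OF assms(2) _ assms(3)] chart(6)[OF assms(1)] assms(4) by (metis subset_iff)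
qed auto

section \<open>Tangent vectors\<close>

lemma tangentD:
  assumes "v \<in> tangent_space A p"
  shows "smooth_near A p f \<Longrightarrow> smooth_near A p g \<Longrightarrow> v (\<lambda>q. f q + g q) = v f + v g"
    "smooth_near A p f \<Longrightarrow> smooth_near A p g \<Longrightarrow> v (\<lambda>q. f q * g q) = v f * g p + f p * v g"
    "smooth_near A p f \<Longrightarrow> v (\<lambda>q. r * f q) = r * v f"
    "\<not> smooth_near A p f \<Longrightarrow> v f = 0"
  using assms unfolding tangent_space_def by auto

lemma tangentI:
  assumes "\<And>f g. smooth_near A p f \<Longrightarrow> smooth_near A p g \<Longrightarrow> v (\<lambda>q. f q + g q) = v f + v g"
    "\<And>f g. smooth_near A p f \<Longrightarrow> smooth_near A p g \<Longrightarrow> v (\<lambda>q. f q * g q) = v f * g p + f p * v g"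
    "\<And>f r. smooth_near A p f \<Longrightarrow> v (\<lambda>q. r * f q) = r * v f"
    "\<And>f. \<not> smooth_near A p f \<Longrightarrow> v f = 0"
  shows "v \<in> tangent_space A p"
  using assms unfolding tangent_space_def by auto

lemma tangent_closed:
  assumes "v \<in> tangent_space A p"
  shows "r *\<^sub>T v \<in> tangent_space A p" "- v \<in> tangent_space A p"
    "w \<in> tangent_space A p \<Longrightarrow> v + w \<in> tangent_space A p"
    "w \<in> tangent_space A p \<Longrightarrow> v - w \<in> tangent_space A p"
  by (rule tangentI; use assms in \<open>simp add: tangentD scale_def algebra_simps\<close>)+

lemma tangent_zero: "0 \<in> tangent_space A p"
  by (rule tangentI) simp_all

lemma tangent_sum: "p \<in> carrier A \<Longrightarrow> (\<And>i. i \<in> I \<Longrightarrow> v i \<in> tangent_space A p) \<Longrightarrow> (\<Sum>i\<in>I. v i) \<in> tangent_space A p"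
  by (induction I rule: infinite_finite_induct) (simp_all add: tangent_closed tangent_zero)

lemma tangent_diff:
  assumes "v \<in> tangent_space A p" "smooth_near A p f" "smooth_near A p g"
  shows "v (\<lambda>q. f q - g q) = v f - v g"
  using tangentD(1)[OF assms(1,2) smooth_near_cmul[OF assms(3), of "-1"]] tangentD(3)[OF assms(1,3), of "-1"] by simp

lemma tangent_const:
  assumes "v \<in> tangent_space A p" 
  shows "v (\<lambda>q. r) = 0"
proof (cases "p \<in> carrier A")
  case True
  have "v (\<lambda>q. 1 * 1) = 0"
    using tangentD(2)[OF assms smooth_near_const[OF True] smooth_near_const[OF True], of 1 1] by simp
  then show ?thesis using tangentD(3)[OF assms smooth_near_const[OF True], of r 1] by simp
qed (use tangentD(4)[OF assms] smooth_near_carrier in blast)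

lemma tangent_local:
  assumes v: "v \<in> tangent_space A p" and W: "open W" "p \<in> W" "\<And>q. q \<in> W \<Longrightarrow> f q = g q"
  shows "v f = v g"
proof (cases "smooth_near A p f")
  case True
  then have g: "smooth_near A p g" using smooth_near_cong[of W p f g] W by blast
  define h where "h q = (if q \<in> W then 0 else 1 :: real)" for q
  have h: "smooth_near A p h"
    using smooth_near_cong[OF W(1,2), of h "\<lambda>q. 0"] smooth_near_const smooth_near_carrier[OF g] by (simp add: h_def)
  have "v (\<lambda>q. g q + h q * (f q - g q)) = v g + (v h * (f p - g p) + h p * v (\<lambda>q. f q - g q))"
    using tangentD(1,2)[OF v] smooth_near_add g h True by simp
  moreover have "(\<lambda>q. g q + h q * (f q - g q)) = f" using W(3) by (auto simp: h_def)
  ultimately show ?thesis using W by (simp add: h_def)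
qed (use smooth_near_cong[of W p f g] W tangentD(4)[OF v] in auto)

lemma tangent_fun_sum:
  assumes "v \<in> tangent_space A p" "p \<in> carrier A" "\<And>i. i \<in> I \<Longrightarrow> smooth_near A p (f i)"
  shows "v (\<lambda>q. \<Sum>i\<in>I. f i q) = (\<Sum>i\<in>I. v (f i))"
  using assms(3)
  by (induction I rule: infinite_finite_induct)
    (auto simp: tangent_const[OF assms(1)] tangentD(1)[OF assms(1)] smooth_near_sum[OF assms(2)])

definition coords :: "('a \<Rightarrow> 'e) \<Rightarrow> 'a tvec \<Rightarrow> 'e" where
  "coords c v = (\<Sum>b\<in>Basis. v (\<lambda>q. c q \<bullet> b) *\<^sub>R b)"

definition tvec_of :: "'a set \<Rightarrow> ('a \<Rightarrow> 'e) \<Rightarrow> 'a \<Rightarrow> 'e \<Rightarrow> 'a tvec" where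
  "tvec_of D c p a = (\<lambda>f. if smooth_near A p f
     then frechet_derivative (\<lambda>x. f (inv_into D c x)) (at (c p)) a else 0)"

lemma smooth_near_chart_ball:
  assumes "(D, c) \<in> A" "p \<in> D" "smooth_near A p f"
  obtains r where "r > 0" "ball (c p) r \<subseteq> c ` D" "smooth_on (ball (c p) r) (\<lambda>x. f (inv_into D c x))"
proof -
  obtain U where U: "p \<in> U" "U \<subseteq> D" "smooth_fun A U f"
    using smooth_nearE[OF assms(3) chart(1)[OF assms(1)] assms(2)] by blast
  have "open (c ` U)" using open_chart_image[OF assms(1) smooth_funD(1)[OF U(3)] U(2)] .
  then obtain r where "r > 0" "ball (c p) r \<subseteq> c ` U" using U(1) openE by blast
  moreover have "smooth_on (c ` U) (\<lambda>x. f (inv_into D c x))"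
    using smooth_funD(3)[OF U(3) assms(1)] U(2) by (simp add: inf.absorb2)
  ultimately show ?thesis using that U(2) smooth_on_subset by blast
qed

text \<open>A derivation kills products of two functions vanishing at \<open>p\<close>; by the Hadamard lemma it is therefore
  determined by its values on the coordinate functions.\<close>

lemma tangent_coords:
  assumes c: "(D, c) \<in> A" "p \<in> D" and v: "v \<in> tangent_space A p"
  shows "v = tvec_of D c p (coords c v)"
proof
  fix f
  show "v f = tvec_of D c p (coords c v) f"
  proof (cases "smooth_near A p f")
    case True
    define F where "F x = f (inv_into D c x)" for x
    obtain r where r: "r > 0" "ball (c p) r \<subseteq> c ` D" "smooth_on (ball (c p) r) F"
      using smooth_near_chart_ball[OF c True] unfolding F_def by blast
    obtain g where g: "\<And>b. smooth_on (ball (c p) r) (g b)" "\<And>b. g b (c p) = frechet_derivative F (at (c p)) b"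
      "\<And>x. x \<in> ball (c p) r \<Longrightarrow> F x = F (c p) + (\<Sum>b\<in>Basis. ((x - c p) \<bullet> b) * g b x)"
      using hadamard[OF open_ball convex_ball _ r(3)] r(1) by (metis centre_in_ball)
    define N where "N = {q \<in> D. c q \<in> ball (c p) r}"
    have N: "open N" "p \<in> N" using open_chart_preimage[OF c(1) open_ball] c r(1) by (auto simp: N_def)
    have pA: "p \<in> carrier A" using smooth_near_carrier[OF True] .
    have sg: "smooth_near A p (\<lambda>q. g b (c q))" for b
      using smooth_fun_of_coords[OF c(1) open_ball g(1) r(2)] N(2) unfolding N_def by (rule smooth_nearI)
    have sc: "smooth_near A p (\<lambda>q. c q \<bullet> b)" for b
      using smooth_fun_coord[OF c(1)] c(2) by (rule smooth_nearI)
    have sc': "smooth_near A p (\<lambda>q. (c q - c p) \<bullet> b)" "v (\<lambda>q. (c q - c p) \<bullet> b) = v (\<lambda>q. c q \<bullet> b)" for b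
      using smooth_near_add(3)[OF sc smooth_near_const[OF pA]] tangent_diff[OF v sc smooth_near_const[OF pA]]
        tangent_const[OF v] by (simp_all add: inner_diff_left)
    have "v f = v (\<lambda>q. f p + (\<Sum>b\<in>Basis. ((c q - c p) \<bullet> b) * g b (c q)))"
    proof (rule tangent_local[OF v N])
      fix q assume "q \<in> N"
      then show "f q = f p + (\<Sum>b\<in>Basis. ((c q - c p) \<bullet> b) * g b (c q))"
        using g(3)[of "c q"] chart(5)[OF c(1)] c(2) by (simp add: N_def F_def)
    qed
    also have "\<dots> = v (\<lambda>q. f p) + v (\<lambda>q. \<Sum>b\<in>Basis. ((c q - c p) \<bullet> b) * g b (c q))"
      by (rule tangentD(1)[OF v smooth_near_const[OF pA] smooth_near_sum[OF pA smooth_near_add(2)[OF sc'(1) sg]]])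
    also have "\<dots> = (\<Sum>b\<in>Basis. v (\<lambda>q. c q \<bullet> b) * g b (c p))"
      by (simp add: tangent_const[OF v] tangent_fun_sum[OF v pA smooth_near_add(2)[OF sc'(1) sg]]
          tangentD(2)[OF v sc'(1) sg] sc'(2))
    also have "\<dots> = frechet_derivative F (at (c p)) (coords c v)"
      using smooth_on_linear_derivative[OF r(3), of "c p"] r(1)
      by (simp add: coords_def g(2) linear_sum linear_cmul)
    finally show ?thesis using True by (simp add: tvec_of_def F_def[abs_def])
  qed (simp add: tangentD(4)[OF v] tvec_of_def)
qed

lemma tvec_of_tangent:
  assumes c: "(D, c) \<in> A" "p \<in> D"
  shows "tvec_of D c p a \<in> tangent_space A p"
proof (rule tangentI)
  have d: "((\<lambda>x. f (inv_into D c x)) has_derivative frechet_derivative (\<lambda>x. f (inv_into D c x)) (at (c p))) (at (c p))"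
    if "smooth_near A p f" for f
  proof -
    obtain r where "r > 0" "smooth_on (ball (c p) r) (\<lambda>x. f (inv_into D c x))"
      using smooth_near_chart_ball[OF c \<open>smooth_near A p f\<close>] by blast
    then show ?thesis using smooth_on_has_derivative by (metis centre_in_ball)
  qed
  fix f g and r assume f: "smooth_near A p f"
  show "tvec_of D c p a (\<lambda>q. r * f q) = r * tvec_of D c p a f"
    using frechet_derivative_at[OF has_derivative_mult_right[OF d[OF f], of r], symmetric] smooth_near_cmul[OF f] f
    by (simp add: tvec_of_def)
  assume g: "smooth_near A p g"
  show "tvec_of D c p a (\<lambda>q. f q + g q) = tvec_of D c p a f + tvec_of D c p a g"
    using frechet_derivative_at[OF has_derivative_add[OF d[OF f] d[OF g]], symmetric] smooth_near_add[OF f g] f g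
    by (simp add: tvec_of_def)
  show "tvec_of D c p a (\<lambda>q. f q * g q) = tvec_of D c p a f * g p + f p * tvec_of D c p a g"
    using frechet_derivative_at[OF has_derivative_mult[OF d[OF f] d[OF g]], symmetric] smooth_near_add[OF f g] f g
      chart(5)[OF c] by (simp add: tvec_of_def)
qed (simp add: tvec_of_def)

lemma coords_tvec_of:
  assumes c: "(D, c) \<in> A" "p \<in> D"
  shows "coords c (tvec_of D c p a) = a"
proof -
  have "tvec_of D c p a (\<lambda>q. c q \<bullet> b) = a \<bullet> b" for b
  proof -
    have "((\<lambda>x. c (inv_into D c x) \<bullet> b) has_derivative (\<lambda>v. v \<bullet> b)) (at (c p))"
      by (rule has_derivative_transform_within_open[OF bounded_linear_imp_has_derivative[OF bounded_linear_inner_left] chart(2)[OF c(1)]])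
        (use c chart(6)[OF c(1)] in auto)
    then have "frechet_derivative (\<lambda>x. c (inv_into D c x) \<bullet> b) (at (c p)) = (\<lambda>v. v \<bullet> b)"
      by (simp add: frechet_derivative_at[symmetric])
    then show ?thesis
      using smooth_nearI[OF smooth_fun_coord[OF c(1)] c(2)] by (simp add: tvec_of_def)
  qed
  then show ?thesis by (simp add: coords_def euclidean_representation)
qed

lemma coords_eqI:
  "(D, c) \<in> A \<Longrightarrow> p \<in> D \<Longrightarrow> v \<in> tangent_space A p \<Longrightarrow> w \<in> tangent_space A p \<Longrightarrow> coords c v = coords c w \<Longrightarrow> v = w"
  using tangent_coords by metis

lemma coords_linear:
  "coords c (v + w) = coords c v + coords c w" "coords c (r *\<^sub>T v) = r *\<^sub>R coords c v" "coords c 0 = 0"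
  by (simp_all add: coords_def scale_def algebra_simps sum.distrib scaleR_sum_right)

lemma coords_inner: "b \<in> Basis \<Longrightarrow> coords c v \<bullet> b = v (\<lambda>q. c q \<bullet> b)"
  by (simp add: coords_def inner_sum_left inner_Basis if_distrib cong: if_cong)

section \<open>Vector fields, brackets and tensor fields\<close>

lemma vector_fieldD:
  assumes "vector_field A U X"
  shows "open U" "U \<subseteq> carrier A" "p \<in> U \<Longrightarrow> X p \<in> tangent_space A p"
    "V \<subseteq> U \<Longrightarrow> smooth_fun A V f \<Longrightarrow> smooth_fun A V (\<lambda>p. X p f)"
  using assms unfolding vector_field_def by blast+

lemma vector_fieldI:
  assumes "open U" "U \<subseteq> carrier A" "\<And>p. p \<in> U \<Longrightarrow> X p \<in> tangent_space A p"
    "\<And>V f. V \<subseteq> U \<Longrightarrow> smooth_fun A V f \<Longrightarrow> smooth_fun A V (\<lambda>p. X p f)"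
  shows "vector_field A U X"
  using assms unfolding vector_field_def by blast

lemma vector_field_subset: "vector_field A U X \<Longrightarrow> open V \<Longrightarrow> V \<subseteq> U \<Longrightarrow> vector_field A V X"
  unfolding vector_field_def by blast

lemma vector_field_Int: "vector_field A U X \<Longrightarrow> vector_field A V Y \<Longrightarrow> vector_field A (U \<inter> V) X \<and> vector_field A (U \<inter> V) Y"
  using vector_field_subset vector_fieldD(1) by (metis inf_le1 inf_le2 open_Int)

lemma vector_field_near: "vector_field A U X \<Longrightarrow> p \<in> U \<Longrightarrow> smooth_near A p f \<Longrightarrow> smooth_near A p (\<lambda>q. X q f)"
  by (metis smooth_nearE smooth_nearI vector_fieldD(1,4))

lemma vector_field_cong:
  assumes "vector_field A U X" "\<And>q. q \<in> U \<Longrightarrow> X q = Y q"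
  shows "vector_field A U Y"
proof (rule vector_fieldI)
  show "smooth_fun A V (\<lambda>p. Y p f)" if "V \<subseteq> U" "smooth_fun A V f" for V f
    by (rule smooth_fun_cong[OF vector_fieldD(4)[OF assms(1) that]]) (use assms(2) that in auto)
qed (use vector_fieldD[OF assms(1)] assms(2) in auto)

lemma vector_field_add:
  assumes "vector_field A U X" "vector_field A U Y"
  shows "vector_field A U (X + Y)" "vector_field A U (X - Y)"
  by (rule vector_fieldI; use vector_fieldD[OF assms(1)] vector_fieldD[OF assms(2)] in
      \<open>auto simp: tangent_closed intro!: smooth_fun_add smooth_fun_diff\<close>)+

lemma vector_field_scale:
  assumes "vector_field A U X" "smooth_fun A U f"
  shows "vector_field A U (\<lambda>q. f q *\<^sub>T X q)"
proof (rule vector_fieldI)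
  fix V g assume V: "V \<subseteq> U" "smooth_fun A V g"
  show "smooth_fun A V (\<lambda>p. (f p *\<^sub>T X p) g)"
    using smooth_fun_add(2)[OF smooth_fun_subset[OF assms(2) smooth_funD(1)[OF V(2)] V(1)] vector_fieldD(4)[OF assms(1) V]]
    by (simp add: scale_def)
qed (use vector_fieldD[OF assms(1)] in \<open>simp_all add: tangent_closed(1)\<close>)

lemma vector_field_cmul: "vector_field A U X \<Longrightarrow> vector_field A U (\<lambda>q. r *\<^sub>T X q)"
  by (rule vector_field_scale[OF _ smooth_fun_const]) (auto dest: vector_fieldD(1,2))

lemma vector_field_of_coords:
  assumes c: "(D, c) \<in> A" and T: "open T" "T \<subseteq> c ` D" "smooth_on T a"
  shows "vector_field A {q \<in> D. c q \<in> T} (\<lambda>q. tvec_of D c q (a (c q)))" (is "vector_field A ?N ?X")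
proof (rule vector_fieldI)
  show N: "open ?N" by (rule open_chart_preimage[OF c T(1)])
  show "?N \<subseteq> carrier A" using chart(4)[OF c] by blast
  show "?X p \<in> tangent_space A p" if "p \<in> ?N" for p using tvec_of_tangent[OF c] that by blast
  fix V f assume V: "V \<subseteq> ?N" "smooth_fun A V f"
  have VD: "V \<subseteq> D" using V(1) by blast
  have oV: "open (c ` V)" by (rule open_chart_image[OF c smooth_funD(1)[OF V(2)] VD])
  have F: "smooth_on (c ` V) (\<lambda>x. f (inv_into D c x))" using smooth_funD(3)[OF V(2) c] VD by (simp add: inf.absorb2)
  have aV: "smooth_on (c ` V) a" by (rule smooth_on_subset[OF T(3)]) (use V(1) in auto)
  have "smooth_on (c ` V) (\<lambda>x. frechet_derivative (\<lambda>x. f (inv_into D c x)) (at x) (a x))"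
    by (rule smooth_on_linear_apply[OF oV smooth_on_linear_derivative[OF F] smooth_on_derivative[OF F] aV])
  then have "smooth_on (c ` V) (\<lambda>x. tvec_of D c (inv_into D c x) (a (c (inv_into D c x))) f)"
    by (rule smooth_on_cong[OF oV, rotated])
      (use VD chart(5)[OF c] smooth_nearI[OF V(2)] in \<open>auto simp: tvec_of_def subset_iff\<close>)
  then show "smooth_fun A V (\<lambda>p. ?X p f)"
    by (rule smooth_fun_chartI[OF c smooth_funD(1)[OF V(2)] VD])
qed

lemma vector_field_coordinate:
  assumes "(D, c) \<in> A"
  shows "vector_field A D (\<lambda>q. tvec_of D c q a)"
proof -
  have "{q \<in> D. c q \<in> c ` D} = D" by blast
  then show ?thesis
    using vector_field_of_coords[OF assms chart(2)[OF assms] subset_refl smooth_on_const[OF chart(2)[OF assms], of a]]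
    by simp
qed

lemma vector_field_extension:
  assumes "p \<in> carrier A" "v \<in> tangent_space A p"
  obtains U X where "p \<in> U" "vector_field A U X" "X p = v"
proof -
  obtain D c where c: "(D, c) \<in> A" "p \<in> D" using carrierE[OF assms(1)] .
  show ?thesis
    by (rule that[OF c(2) vector_field_coordinate[OF c(1)] tangent_coords[OF c assms(2), symmetric]])
qed

text \<open>The coordinate frame of a chart at \<open>p\<close>. The field is expanded where it vanishes, because this is how
  \<open>C\<^sup>\<infinity>\<close>-linearity is turned into dependence on the value at a point.\<close>

lemma vector_field_frame:
  assumes "vector_field A U X" "p \<in> U" "X p = 0"
  obtains N f Y where "p \<in> N" "N \<subseteq> U"
    "\<And>b. b \<in> (Basis :: 'e set) \<Longrightarrow> smooth_fun A N (f b) \<and> f b p = 0 \<and> vector_field A N (Y b)"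
    "\<And>q. q \<in> N \<Longrightarrow> X q = (\<Sum>b\<in>Basis. f b q *\<^sub>T Y b q)"
proof -
  have "p \<in> carrier A" using vector_fieldD(2)[OF assms(1)] assms(2) by blast
  then obtain D c where c: "(D, c) \<in> A" "p \<in> D" using carrierE by blast
  define N where "N = D \<inter> U"
  have N: "open N" "p \<in> N" "N \<subseteq> U" "N \<subseteq> D" using chart(1)[OF c(1)] c(2) assms vector_fieldD(1)[OF assms(1)] by (auto simp: N_def)
  \<comment> \<open>the components of \<open>X\<close> in the chart\<close>
  define f where "f b q = X q (\<lambda>q. c q \<bullet> b)" for b q
  define Y where "Y b q = tvec_of D c q b" for b q
  have "vector_field A D (Y b)" for b
    using vector_field_coordinate[OF c(1), of b] by (simp add: Y_def[abs_def])
  then have Y: "vector_field A N (Y b)" for b using vector_field_subset N by blast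
  have "smooth_fun A N (f b)" for b
    unfolding f_def by (rule vector_fieldD(4)[OF assms(1) N(3) smooth_fun_subset[OF smooth_fun_coord[OF c(1)] N(1,4)]])
  moreover have "X q = (\<Sum>b\<in>Basis. f b q *\<^sub>T Y b q)" if q: "q \<in> N" for q
  proof -
    have qD: "q \<in> D" "q \<in> carrier A" "X q \<in> tangent_space A q"
      using q N chart(4)[OF c(1)] vector_fieldD(3)[OF assms(1)] by auto
    have "coords c (\<Sum>b\<in>I. f b q *\<^sub>T Y b q) = (\<Sum>b\<in>I. f b q *\<^sub>R b)" for I
      by (induction I rule: infinite_finite_induct) (simp_all only: sum.infinite sum.empty sum.insert coords_linear Y_def coords_tvec_of[OF c(1) qD(1)] not_False_eq_True)
    then show ?thesis
      by (intro coords_eqI[OF c(1) qD(1,3)] tangent_sum[OF qD(2)] tangent_closed)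
        (auto simp: Y_def tvec_of_tangent[OF c(1) qD(1)] f_def coords_def intro: tvec_of_tangent[OF c(1) qD(1)])
  qed
  ultimately show ?thesis using that[of N f Y] N Y assms(3) by (simp add: f_def)
qed

lemma bracket_tangent:
  assumes X: "vector_field A U X" and Y: "vector_field A U Y" and p: "p \<in> U"
  shows "lie_bracket A X Y p \<in> tangent_space A p"
proof (rule tangentI)
  fix f g r assume f: "smooth_near A p f"
  note Xp = vector_fieldD(3)[OF X p] and Yp = vector_fieldD(3)[OF Y p]
  note Xf = vector_field_near[OF X p] and Yf = vector_field_near[OF Y p]
  have loc: "v (\<lambda>q. Z q h) = v h'" if v: "v \<in> tangent_space A p" and Z: "vector_field A U Z"
    and eq: "\<And>W q. smooth_fun A W f \<Longrightarrow> smooth_fun A W g \<Longrightarrow> q \<in> W \<Longrightarrow> q \<in> U \<Longrightarrow> Z q h = h' q"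
    and g: "smooth_near A p g" for v Z h h' g
  proof -
    obtain W where W: "p \<in> W" "smooth_fun A W f" "smooth_fun A W g"
      using smooth_near2E[OF f g] by blast
    have "open (W \<inter> U)" "p \<in> W \<inter> U" using smooth_funD(1)[OF W(2)] vector_fieldD(1)[OF X] W(1) p by auto
    then show ?thesis by (rule tangent_local[OF v]) (use eq[OF W(2,3)] in auto)
  qed
  have cm: "v (\<lambda>q. Z q (\<lambda>q. r * f q)) = r * v (\<lambda>q. Z q f)" if "v \<in> tangent_space A p" "vector_field A U Z" for v Z
  proof -
    have "v (\<lambda>q. Z q (\<lambda>q. r * f q)) = v (\<lambda>q. r * Z q f)"
      by (rule loc[OF that _ f]) (rule tangentD(3)[OF vector_fieldD(3)[OF that(2)] smooth_nearI])
    then show ?thesis using tangentD(3)[OF that(1) vector_field_near[OF that(2) p f]] by simp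
  qed
  show "lie_bracket A X Y p (\<lambda>q. r * f q) = r * lie_bracket A X Y p f"
    using cm[OF Xp Y] cm[OF Yp X] f smooth_near_cmul[OF f] by (simp add: lie_bracket_def algebra_simps)
  assume g: "smooth_near A p g"
  have ad: "v (\<lambda>q. Z q (\<lambda>q. f q + g q)) = v (\<lambda>q. Z q f) + v (\<lambda>q. Z q g)" if "v \<in> tangent_space A p" "vector_field A U Z" for v Z
  proof -
    have "v (\<lambda>q. Z q (\<lambda>q. f q + g q)) = v (\<lambda>q. Z q f + Z q g)"
      by (rule loc[OF that _ g]) (rule tangentD(1)[OF vector_fieldD(3)[OF that(2)] smooth_nearI smooth_nearI])
    then show ?thesis using tangentD(1)[OF that(1) vector_field_near[OF that(2) p f] vector_field_near[OF that(2) p g]] by simp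
  qed
  show "lie_bracket A X Y p (\<lambda>q. f q + g q) = lie_bracket A X Y p f + lie_bracket A X Y p g"
    using ad[OF Xp Y] ad[OF Yp X] f g smooth_near_add[OF f g] by (simp add: lie_bracket_def algebra_simps)
  have mu: "v (\<lambda>q. Z q (\<lambda>q. f q * g q)) = v (\<lambda>q. Z q f) * g p + Z p f * v g + (v f * Z p g + f p * v (\<lambda>q. Z q g))"
    if "v \<in> tangent_space A p" "vector_field A U Z" for v Z
  proof -
    note Zf = vector_field_near[OF that(2) p f] and Zg = vector_field_near[OF that(2) p g]
    have "v (\<lambda>q. Z q (\<lambda>q. f q * g q)) = v (\<lambda>q. Z q f * g q + f q * Z q g)"
      by (rule loc[OF that _ g]) (rule tangentD(2)[OF vector_fieldD(3)[OF that(2)] smooth_nearI smooth_nearI])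
    then show ?thesis
      using tangentD(1)[OF that(1) smooth_near_add(2)[OF Zf g] smooth_near_add(2)[OF f Zg]]
        tangentD(2)[OF that(1) Zf g] tangentD(2)[OF that(1) f Zg] by simp
  qed
  show "lie_bracket A X Y p (\<lambda>q. f q * g q) = lie_bracket A X Y p f * g p + f p * lie_bracket A X Y p g"
    using mu[OF Xp Y] mu[OF Yp X] f g smooth_near_add[OF f g] by (simp add: lie_bracket_def algebra_simps)
qed (simp add: lie_bracket_def)

lemma vector_field_bracket:
  assumes X: "vector_field A U X" and Y: "vector_field A U Y"
  shows "vector_field A U (lie_bracket A X Y)"
proof (rule vector_fieldI)
  fix V f assume V: "V \<subseteq> U" "smooth_fun A V f"
  have "smooth_fun A V (\<lambda>p. X p (\<lambda>q. Y q f) - Y p (\<lambda>q. X q f))"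
    by (rule smooth_fun_diff[OF vector_fieldD(4)[OF X V(1) vector_fieldD(4)[OF Y V]]
          vector_fieldD(4)[OF Y V(1) vector_fieldD(4)[OF X V]]])
  then show "smooth_fun A V (\<lambda>p. lie_bracket A X Y p f)"
    by (rule smooth_fun_cong) (use smooth_nearI[OF V(2)] in \<open>simp add: lie_bracket_def\<close>)
qed (use vector_fieldD[OF X] bracket_tangent[OF X Y] in auto)

lemma bracket_local:
  assumes "X p \<in> tangent_space A p" "Y p \<in> tangent_space A p"
    and "open W" "p \<in> W" "\<And>q. q \<in> W \<Longrightarrow> X q = X' q" "\<And>q. q \<in> W \<Longrightarrow> Y q = Y' q"
  shows "lie_bracket A X Y p = lie_bracket A X' Y' p"
proof
  fix f
  have "X p (\<lambda>q. Y q f) = X' p (\<lambda>q. Y' q f)" "Y p (\<lambda>q. X q f) = Y' p (\<lambda>q. X' q f)"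
    using tangent_local[OF assms(1,3,4), of "\<lambda>q. Y q f" "\<lambda>q. Y' q f"]
      tangent_local[OF assms(2-4), of "\<lambda>q. X q f" "\<lambda>q. X' q f"] assms(4-6) by auto
  then show "lie_bracket A X Y p f = lie_bracket A X' Y' p f" by (simp add: lie_bracket_def)
qed

lemma bracket_antisym: "lie_bracket A X Y p = - lie_bracket A Y X p"
  by (auto simp: lie_bracket_def)

lemma bracket_zero:
  assumes "X p \<in> tangent_space A p" "open W" "p \<in> W" "\<And>q. q \<in> W \<Longrightarrow> Y q = 0"
  shows "lie_bracket A X Y p = 0" "lie_bracket A Y X p = 0"
proof -
  have "X p (\<lambda>q. Y q f) = 0" for f
    using tangent_local[OF assms(1-3), of "\<lambda>q. Y q f" "\<lambda>q. 0"] assms(4) tangent_const[OF assms(1)] by simp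
  then show "lie_bracket A X Y p = 0" "lie_bracket A Y X p = 0" using assms(3,4) by (auto simp: lie_bracket_def)
qed

lemma bracket_add:
  assumes X: "vector_field A U X" and Y: "vector_field A U Y" and Z: "vector_field A U Z" and p: "p \<in> U"
  shows "lie_bracket A X (Y + Z) p = lie_bracket A X Y p + lie_bracket A X Z p"
proof
  fix f
  show "lie_bracket A X (Y + Z) p f = (lie_bracket A X Y p + lie_bracket A X Z p) f"
    using tangentD(1)[OF vector_fieldD(3)[OF X p] vector_field_near[OF Y p] vector_field_near[OF Z p]]
    by (auto simp: lie_bracket_def)
qed

lemma bracket_scale:
  assumes X: "vector_field A U X" and Y: "vector_field A U Y" and p: "p \<in> U" and f: "smooth_near A p f"
  shows "lie_bracket A X (\<lambda>q. f q *\<^sub>T Y q) p = X p f *\<^sub>T Y p + f p *\<^sub>T lie_bracket A X Y p"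
proof
  fix g
  show "lie_bracket A X (\<lambda>q. f q *\<^sub>T Y q) p g = (X p f *\<^sub>T Y p + f p *\<^sub>T lie_bracket A X Y p) g"
  proof (cases "smooth_near A p g")
    case True
    then show ?thesis
      using tangentD(2)[OF vector_fieldD(3)[OF X p] f vector_field_near[OF Y p True]]
      by (simp add: lie_bracket_def scale_def algebra_simps)
  next
    case False
    then show ?thesis using tangentD(4)[OF vector_fieldD(3)[OF Y p]] by (simp add: lie_bracket_def scale_def)
  qed
qed

lemma bracket_cmul:
  assumes "vector_field A U X" "vector_field A U Y" "p \<in> U"
  shows "lie_bracket A X (\<lambda>q. r *\<^sub>T Y q) p = r *\<^sub>T lie_bracket A X Y p"
  using bracket_scale[OF assms smooth_near_const, of r] assms(3) vector_fieldD(2)[OF assms(1)]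
    tangent_const[OF vector_fieldD(3)[OF assms(1,3)]] by (auto simp: scale_def fun_eq_iff)

lemma jacobi:
  assumes X: "vector_field A U X" and Y: "vector_field A U Y" and Z: "vector_field A U Z" and p: "p \<in> U"
  shows "lie_bracket A X (lie_bracket A Y Z) p = lie_bracket A (lie_bracket A X Y) Z p + lie_bracket A Y (lie_bracket A X Z) p"
proof
  fix f
  show "lie_bracket A X (lie_bracket A Y Z) p f = (lie_bracket A (lie_bracket A X Y) Z p + lie_bracket A Y (lie_bracket A X Z) p) f"
  proof (cases "smooth_near A p f")
    case True
    then obtain N where N: "p \<in> N" "N \<subseteq> U" "smooth_fun A N f" using smooth_nearE vector_fieldD(1)[OF X] p by blast
    have sub: "v (\<lambda>q. lie_bracket A Y' Z' q f) = v (\<lambda>q. Y' q (\<lambda>q. Z' q f)) - v (\<lambda>q. Z' q (\<lambda>q. Y' q f))"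
      if "v \<in> tangent_space A p" "vector_field A U Y'" "vector_field A U Z'" for v Y' Z'
    proof -
      have "v (\<lambda>q. lie_bracket A Y' Z' q f) = v (\<lambda>q. Y' q (\<lambda>q. Z' q f) - Z' q (\<lambda>q. Y' q f))"
        by (rule tangent_local[OF that(1) smooth_funD(1)[OF N(3)] N(1)]) (use smooth_nearI[OF N(3)] in \<open>simp add: lie_bracket_def\<close>)
      then show ?thesis
        using tangent_diff[OF that(1)] vector_field_near[OF _ p] that True by metis
    qed
    have near: "smooth_near A p (\<lambda>q. V q f)" if "vector_field A U V" for V using vector_field_near[OF that p True] .
    show ?thesis
      using sub[OF vector_fieldD(3)[OF X p] Y Z] sub[OF vector_fieldD(3)[OF Z p] X Y] sub[OF vector_fieldD(3)[OF Y p] X Z]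
        near[OF X] near[OF Y] near[OF Z] True
      by (simp add: lie_bracket_def)
  qed (simp add: lie_bracket_def)
qed

lemma tensorD:
  assumes "tensor_field A \<phi>" "p \<in> carrier A" "v \<in> tangent_space A p"
  shows "\<phi> p v \<in> tangent_space A p" "\<phi> p (r *\<^sub>T v) = r *\<^sub>T \<phi> p v" "\<phi> p (- v) = - \<phi> p v"
    "w \<in> tangent_space A p \<Longrightarrow> \<phi> p (v + w) = \<phi> p v + \<phi> p w"
    "w \<in> tangent_space A p \<Longrightarrow> \<phi> p (v - w) = \<phi> p v - \<phi> p w"
proof -
  show a: "\<phi> p v \<in> tangent_space A p" "\<phi> p (r *\<^sub>T v) = r *\<^sub>T \<phi> p v"
    "w \<in> tangent_space A p \<Longrightarrow> \<phi> p (v + w) = \<phi> p v + \<phi> p w" for w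
    using assms unfolding tensor_field_def by blast+
  have s: "(-1) *\<^sub>T u = - u" for u :: "'a tvec" by (auto simp: scale_def)
  have n: "\<phi> p (- u) = - \<phi> p u" if "u \<in> tangent_space A p" for u
    using assms(1,2) that s unfolding tensor_field_def by metis
  show "\<phi> p (- v) = - \<phi> p v" using n assms by blast
  show "\<phi> p (v - w) = \<phi> p v - \<phi> p w" if "w \<in> tangent_space A p"
    using a(3)[OF tangent_closed(2)[OF that]] n[OF that] by simp
qed

lemma tensor_zero: "tensor_field A \<phi> \<Longrightarrow> p \<in> carrier A \<Longrightarrow> \<phi> p 0 = 0"
  using tensorD(5)[OF _ _ tangent_zero tangent_zero] by (metis diff_self)

lemma tensor_act: "tensor_field A \<phi> \<Longrightarrow> vector_field A U X \<Longrightarrow> vector_field A U (act \<phi> X)"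
  unfolding tensor_field_def by blast

lemma tensor_comp:
  assumes "tensor_field A \<phi>" "tensor_field A \<psi>"
  shows "tensor_field A (\<lambda>p v. \<phi> p (\<psi> p v))"
  unfolding tensor_field_def
proof (intro conjI allI impI ballI)
  show "vector_field A U (act (\<lambda>p v. \<phi> p (\<psi> p v)) X)" if "vector_field A U X" for U X
    using tensor_act[OF assms(1) tensor_act[OF assms(2) that]] by (simp add: act_def)
qed (use tensorD[OF assms(1)] tensorD[OF assms(2)] in simp_all)

lemma tensor_lincomb:
  assumes "tensor_field A \<phi>" "tensor_field A \<psi>"
  shows "tensor_field A (\<lambda>p v. a *\<^sub>T \<phi> p v + b *\<^sub>T \<psi> p v)"
  unfolding tensor_field_def
proof (intro conjI allI impI ballI)
  show "vector_field A U (act (\<lambda>p v. a *\<^sub>T \<phi> p v + b *\<^sub>T \<psi> p v) X)" if "vector_field A U X" for U X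
    using vector_field_add(1)[OF vector_field_cmul[OF tensor_act[OF assms(1) that]] vector_field_cmul[OF tensor_act[OF assms(2) that]]]
    by (simp add: act_def plus_fun_def)
qed (simp_all add: tensorD[OF assms(1)] tensorD[OF assms(2)] tangent_closed, auto simp: scale_def algebra_simps)

end

section \<open>The bracket formula for the Obata connection\<close>

text \<open>If \<open>\<phi>\<^sup>3 = \<phi>\<close>, this and \<open>minus_part\<close> project to the eigenbundles for \<open>1\<close> and \<open>-1\<close>. Both kill the kernel of \<open>\<phi>\<close>,
  which contains the Reeb field in the case of interest; \<open>(id \<plusminus> \<phi>)/2\<close> would not.\<close>

definition plus_part :: "'a tensor11 \<Rightarrow> 'a tensor11" where
  "plus_part \<phi> = (\<lambda>p v. (1/2) *\<^sub>T \<phi> p (\<phi> p v) + (1/2) *\<^sub>T \<phi> p v)"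

definition minus_part :: "'a tensor11 \<Rightarrow> 'a tensor11" where
  "minus_part \<phi> = (\<lambda>p v. (1/2) *\<^sub>T \<phi> p (\<phi> p v) + (-1/2) *\<^sub>T \<phi> p v)"

definition mixed_op ::
  "('a::topological_space, 'e::euclidean_space) atlas \<Rightarrow> 'a tensor11 \<Rightarrow> 'a tensor11 \<Rightarrow>
   'a vfield \<Rightarrow> 'a vfield \<Rightarrow> 'a vfield" where
  "mixed_op A P M X Y p =
     M p (lie_bracket A (act P X) (act M Y) p) + P p (lie_bracket A (act M X) (act P Y) p)"

text \<open>On an anti-hypercomplex manifold, with \<open>P\<close> and \<open>M\<close> the projections to the eigenbundles of \<open>J1\<close> and \<open>F = J2\<close>, this is
  the covariant derivative of \<open>Y\<close> along \<open>X\<close> for the Obata connection. The operator of mixed brackets preserves \<open>P\<close> and \<open>M\<close>, and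
  it differentiates the \<open>P\<close>-part of \<open>Y\<close> along the \<open>M\<close>-part of \<open>X\<close> and conversely; conjugation by \<open>F\<close>, which
  exchanges the two parts, supplies the other two combinations and makes \<open>F\<close> parallel.\<close>

definition obata_op ::
  "('a::topological_space, 'e::euclidean_space) atlas \<Rightarrow> 'a tensor11 \<Rightarrow> 'a tensor11 \<Rightarrow> 'a tensor11 \<Rightarrow>
   'a vfield \<Rightarrow> 'a vfield \<Rightarrow> 'a vfield" where
  "obata_op A P M F X Y p = mixed_op A P M X Y p + F p (mixed_op A P M X (act F Y) p)"

context manifold
begin

lemma scale_simps:
  "r *\<^sub>T (v + w) = r *\<^sub>T v + r *\<^sub>T w" "(r + s) *\<^sub>T v = r *\<^sub>T v + s *\<^sub>T v" "r *\<^sub>T s *\<^sub>T v = (r * s) *\<^sub>T v"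
  "1 *\<^sub>T v = v" "0 *\<^sub>T v = 0" "r *\<^sub>T 0 = 0" "r *\<^sub>T (- v) = - (r *\<^sub>T v)" "r *\<^sub>T (v - w) = r *\<^sub>T v - r *\<^sub>T w"
  by (auto simp: scale_def algebra_simps)

lemma field_nearI: "vector_field A U X \<Longrightarrow> p \<in> U \<Longrightarrow> field_near A p X"
  unfolding field_near_def by blast

lemma act_bracket_scale:
  assumes "tensor_field A Q" "vector_field A U X" "vector_field A U Y" "p \<in> U" "smooth_near A p f"
  shows "Q p (lie_bracket A X (\<lambda>q. f q *\<^sub>T Y q) p) = X p f *\<^sub>T Q p (Y p) + f p *\<^sub>T Q p (lie_bracket A X Y p)"
proof -
  have "p \<in> carrier A" using vector_fieldD(2)[OF assms(2)] assms(4) by blast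
  then show ?thesis
    using bracket_tangent[OF assms(2,3,4)] vector_fieldD(3)[OF assms(3,4)]
    by (simp add: bracket_scale[OF assms(2-5)] tensorD[OF assms(1)] tangent_closed)
qed

text \<open>The derivative of \<open>f\<close> comes multiplied by \<open>Q X\<close>, which is zero.\<close>

lemma act_bracket_scale_left:
  assumes "tensor_field A Q" "vector_field A U X" "vector_field A U Y" "p \<in> U" "smooth_near A p f" "Q p (X p) = 0"
  shows "Q p (lie_bracket A (\<lambda>q. f q *\<^sub>T X q) Y p) = f p *\<^sub>T Q p (lie_bracket A X Y p)"
proof -
  have p: "p \<in> carrier A" using vector_fieldD(2)[OF assms(2)] assms(4) by blast
  obtain N where N: "p \<in> N" "N \<subseteq> U" "smooth_fun A N f" using smooth_nearE[OF assms(5)] vector_fieldD(1)[OF assms(2)] assms(4) by blast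
  have T: "lie_bracket A X Y p \<in> tangent_space A p" "lie_bracket A Y X p \<in> tangent_space A p"
    "lie_bracket A Y (\<lambda>q. f q *\<^sub>T X q) p \<in> tangent_space A p"
    using bracket_tangent[OF assms(2,3,4)] bracket_tangent[OF assms(3,2,4)] N
      bracket_tangent[OF vector_field_subset[OF assms(3)] vector_field_scale[OF vector_field_subset[OF assms(2)]], of N f p]
      smooth_funD(1) by auto
  show ?thesis
    using act_bracket_scale[OF assms(1,3,2,4,5)] assms(6) T p
    by (simp add: bracket_antisym[of _ Y p] tensorD[OF assms(1)] scale_simps)
qed

lemma act_scale_field: "tensor_field A R \<Longrightarrow> q \<in> carrier A \<Longrightarrow> X q \<in> tangent_space A q \<Longrightarrow> act R (\<lambda>q. f q *\<^sub>T X q) q = f q *\<^sub>T act R X q"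
  by (simp add: act_def tensorD)

lemma act_add_field:
  "tensor_field A R \<Longrightarrow> q \<in> carrier A \<Longrightarrow> X q \<in> tangent_space A q \<Longrightarrow> Y q \<in> tangent_space A q \<Longrightarrow>
   act R (X + Y) q = act R X q + act R Y q"
  using tensorD(4)[of R q "X q" "Y q"] by (simp add: act_def)

end

text \<open>The algebra shared by an anti-hypercomplex manifold, where \<open>P + M\<close> is the identity, and by an almost bi-paracontact
  manifold, where \<open>P + M\<close> is the projection to the kernel of the contact form along the Reeb field.\<close>

locale split_structure = manifold A for A :: "('a::{t2_space, second_countable_topology}, 'e::euclidean_space) atlas" +
  fixes P M F :: "'a tensor11"
  assumes tensor: "tensor_field A P" "tensor_field A M" "tensor_field A F"
    and rel: "\<And>p v. p \<in> carrier A \<Longrightarrow> v \<in> tangent_space A p \<Longrightarrow>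
      P p (P p v) = P p v \<and> M p (M p v) = M p v \<and> P p (M p v) = 0 \<and> M p (P p v) = 0 \<and>
      M p (F p v) = F p (P p v) \<and> P p (F p v) = F p (M p v) \<and> F p (F p (P p v)) = P p v \<and> F p (F p (M p v)) = M p v"
begin

lemma rels:
  assumes "p \<in> carrier A" "v \<in> tangent_space A p"
  shows "P p (P p v) = P p v" "M p (M p v) = M p v" "P p (M p v) = 0" "M p (P p v) = 0"
    "M p (F p v) = F p (P p v)" "P p (F p v) = F p (M p v)" "F p (F p (P p v)) = P p v" "F p (F p (M p v)) = M p v"
  using rel[OF assms] by auto

lemmas T = tensorD[OF tensor(1)] tensorD[OF tensor(2)] tensorD[OF tensor(3)] tangent_closed
  tensor_zero[OF tensor(1)] tensor_zero[OF tensor(2)] tensor_zero[OF tensor(3)] tangent_zero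

lemmas acts = tensor_act[OF tensor(1)] tensor_act[OF tensor(2)] tensor_act[OF tensor(3)]

abbreviation "K \<equiv> mixed_op A P M"
abbreviation "E \<equiv> obata_op A P M F"

lemma vector_field_K: "vector_field A U X \<Longrightarrow> vector_field A U Y \<Longrightarrow> vector_field A U (K X Y)"
  using vector_field_add(1)[OF acts(2)[OF vector_field_bracket[OF acts(1) acts(2)]] acts(1)[OF vector_field_bracket[OF acts(2) acts(1)]]]
  by (rule vector_field_cong) (simp_all add: mixed_op_def act_def)

lemma vector_field_E: "vector_field A U X \<Longrightarrow> vector_field A U Y \<Longrightarrow> vector_field A U (E X Y)"
  by (rule vector_field_cong[OF vector_field_add(1)[OF vector_field_K acts(3)[OF vector_field_K[OF _ acts(3)]]]])
    (simp_all add: obata_op_def act_def)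

context
  fixes U X Y p
  assumes X: "vector_field A U X" and Y: "vector_field A U Y" and p: "p \<in> U"
begin

lemma pA: "p \<in> carrier A" using vector_fieldD(2)[OF X] vector_fieldD(2)[OF Y] p by blast

lemma br: "lie_bracket A (act P X) (act M Y) p \<in> tangent_space A p" "lie_bracket A (act M X) (act P Y) p \<in> tangent_space A p"
  using bracket_tangent[OF acts(1)[OF X] acts(2)[OF Y] p] bracket_tangent[OF acts(2)[OF X] acts(1)[OF Y] p] by auto

lemma K_tangent: "K X Y p \<in> tangent_space A p"
  using vector_fieldD(3)[OF vector_field_K[OF X Y] p] .

lemma KF_tangent: "K X (act F Y) p \<in> tangent_space A p"
  using vector_fieldD(3)[OF vector_field_K[OF X acts(3)[OF Y]] p] .

lemma E_tangent: "E X Y p \<in> tangent_space A p"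
  using vector_fieldD(3)[OF vector_field_E[OF X Y] p] .

lemma proj_K: "P p (K X Y p) = P p (lie_bracket A (act M X) (act P Y) p)"
  "M p (K X Y p) = M p (lie_bracket A (act P X) (act M Y) p)" "K X Y p = M p (K X Y p) + P p (K X Y p)"
  using br by (simp_all add: mixed_op_def T rels pA)

lemma K_cong:
  assumes W: "open W" "p \<in> W" "\<And>q. q \<in> W \<Longrightarrow> act P X q = act P X' q \<and> act M X q = act M X' q"
    "\<And>q. q \<in> W \<Longrightarrow> act P Y q = act P Y' q \<and> act M Y q = act M Y' q"
  shows "K X Y p = K X' Y' p"
  unfolding mixed_op_def
  using bracket_local[of "act P X" p "act M Y" W "act P X'" "act M Y'"] bracket_local[of "act M X" p "act P Y" W "act M X'" "act P Y'"]
    vector_fieldD(3)[OF acts(1)[OF X] p] vector_fieldD(3)[OF acts(1)[OF Y] p] vector_fieldD(3)[OF acts(2)[OF X] p] vector_fieldD(3)[OF acts(2)[OF Y] p] W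
  by simp

end

lemma tan: "vector_field A U X \<Longrightarrow> p \<in> U \<Longrightarrow> X p \<in> tangent_space A p \<and> p \<in> carrier A"
  using vector_fieldD by blast

lemma K_parallel:
  assumes X: "vector_field A U X" and Y: "vector_field A U Y" and p: "p \<in> U"
  shows "K X (act P Y) p = P p (K X Y p)" "K X (act M Y) p = M p (K X Y p)" "K X (act F (act F Y)) p = K X Y p"
proof -
  note U = vector_fieldD(1)[OF X]
  note MX = acts(2)[OF X] and PX = acts(1)[OF X] and MY = acts(2)[OF Y] and PY = acts(1)[OF Y]
  have z: "lie_bracket A (act P X) (act M (act P Y)) p = 0" "lie_bracket A (act M X) (act P (act M Y)) p = 0"
    by (rule bracket_zero[OF _ U p]; use tan[OF PX p] tan[OF MX p] tan[OF Y] in \<open>simp add: act_def rels\<close>)+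
  have "lie_bracket A (act M X) (act P (act P Y)) p = lie_bracket A (act M X) (act P Y) p"
    "lie_bracket A (act P X) (act M (act M Y)) p = lie_bracket A (act P X) (act M Y) p"
    by (rule bracket_local[OF _ _ U p]; use tan[OF MX p] tan[OF PX p] tan[OF acts(1)[OF PY] p] tan[OF acts(2)[OF MY] p] tan[OF Y]
          in \<open>simp add: act_def rels\<close>)+
  then show "K X (act P Y) p = P p (K X Y p)" "K X (act M Y) p = M p (K X Y p)"
    using z pA[OF X Y p] br[OF X Y p] by (simp_all add: mixed_op_def T rels)
  show "K X (act F (act F Y)) p = K X Y p"
    by (rule K_cong[OF X acts(3)[OF acts(3)[OF Y]] p U p]) (use tan[OF Y] in \<open>simp_all add: act_def rels T\<close>)
qed

lemma E_parallel:
  assumes X: "vector_field A U X" and Y: "vector_field A U Y" and p: "p \<in> U"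
  shows "E X (act P Y) p = P p (E X Y p)" "E X (act M Y) p = M p (E X Y p)" "E X (act F Y) p = F p (E X Y p)"
proof -
  note U = vector_fieldD(1)[OF X] and FY = acts(3)[OF Y]
  note t = K_tangent[OF X Y p] KF_tangent[OF X Y p] pA[OF X Y p]
  have "K X (act F (act P Y)) p = K X (act M (act F Y)) p" "K X (act F (act M Y)) p = K X (act P (act F Y)) p"
    by (rule K_cong[OF X _ p U p]; use acts Y tan[OF Y] in \<open>simp add: act_def rels T\<close>)+
  then show "E X (act P Y) p = P p (E X Y p)" "E X (act M Y) p = M p (E X Y p)"
    using t by (simp_all add: obata_op_def K_parallel[OF X Y p] K_parallel[OF X FY p] T rels)
  have "F p (F p (K X (act F Y) p)) = K X (act F Y) p"
    using t by (subst (1 2) proj_K(3)[OF X FY p]) (simp add: T rels)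
  then show "E X (act F Y) p = F p (E X Y p)"
    using t by (simp add: obata_op_def K_parallel[OF X Y p] T add.commute)
qed

lemma K_add:
  assumes X: "vector_field A U X" and Y: "vector_field A U Y" and Z: "vector_field A U Z" and p: "p \<in> U"
  shows "K X (Y + Z) p = K X Y p + K X Z p" "K (X + Z) Y p = K X Y p + K Z Y p"
proof -
  note U = vector_fieldD(1)[OF X]
  have a: "lie_bracket A V (act R (Y + Z)) p = lie_bracket A V (act R Y) p + lie_bracket A V (act R Z) p"
    if "tensor_field A R" "vector_field A U V" "vector_field A U Y" "vector_field A U Z" for R V Y Z
  proof -
    have "lie_bracket A V (act R (Y + Z)) p = lie_bracket A V (act R Y + act R Z) p"
      by (rule bracket_local[OF _ _ U p])
        (use tan[OF that(2) p] tan[OF tensor_act[OF that(1) vector_field_add(1)[OF that(3,4)]] p] tan[OF that(3)] tan[OF that(4)]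
          in \<open>simp_all add: act_add_field[OF that(1)]\<close>)
    then show ?thesis using bracket_add[OF that(2) tensor_act[OF that(1,3)] tensor_act[OF that(1,4)] p] by simp
  qed
  note t = bracket_tangent[OF _ _ p] acts
  show "K X (Y + Z) p = K X Y p + K X Z p"
    using pA[OF X Y p] t X Y Z by (simp add: mixed_op_def a tensor T)
  show "K (X + Z) Y p = K X Y p + K Z Y p"
    using pA[OF X Y p] t X Y Z
    by (simp add: mixed_op_def a tensor T bracket_antisym[of _ "act M Y" p] bracket_antisym[of _ "act P Y" p])
qed

lemma E_add:
  assumes X: "vector_field A U X" and Y: "vector_field A U Y" and Z: "vector_field A U Z" and p: "p \<in> U"
  shows "E X (Y + Z) p = E X Y p + E X Z p" "E (X + Z) Y p = E X Y p + E Z Y p"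
proof -
  have "K X (act F (Y + Z)) p = K X (act F Y + act F Z) p"
    by (rule K_cong[OF X acts(3)[OF vector_field_add(1)[OF Y Z]] p vector_fieldD(1)[OF X] p])
      (use tan[OF Y] tan[OF Z] in \<open>simp_all add: act_def T\<close>)
  then show "E X (Y + Z) p = E X Y p + E X Z p" "E (X + Z) Y p = E X Y p + E Z Y p"
    using K_add[OF X Y Z p] K_add[OF X acts(3)[OF Y] acts(3)[OF Z] p] KF_tangent[OF X Y p] KF_tangent[OF X Z p]
      KF_tangent[OF Z Y p] K_add(2)[OF X acts(3)[OF Y] Z p] pA[OF X Y p] by (simp_all add: obata_op_def T)
qed

text \<open>The derivatives of \<open>f\<close> in the first argument disappear because \<open>M P = P M = 0\<close>; so the mixed brackets are
  tensorial in \<open>X\<close> and satisfy half of a Leibniz rule in \<open>Y\<close>.\<close>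

lemma K_scale:
  assumes X: "vector_field A U X" and Y: "vector_field A U Y" and f: "smooth_fun A U f" and p: "p \<in> U"
  shows "K X (\<lambda>q. f q *\<^sub>T Y q) p = P p (X p) f *\<^sub>T M p (Y p) + M p (X p) f *\<^sub>T P p (Y p) + f p *\<^sub>T K X Y p"
    "K (\<lambda>q. f q *\<^sub>T X q) Y p = f p *\<^sub>T K X Y p"
proof -
  note U = vector_fieldD(1)[OF X] and fX = vector_field_scale[OF X f] and fY = vector_field_scale[OF Y f]
  note fn = smooth_nearI[OF f p]
  have l: "lie_bracket A V (act R (\<lambda>q. f q *\<^sub>T Y q)) p = lie_bracket A V (\<lambda>q. f q *\<^sub>T act R Y q) p"
    "lie_bracket A (act R (\<lambda>q. f q *\<^sub>T Y q)) V p = lie_bracket A (\<lambda>q. f q *\<^sub>T act R Y q) V p"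
    if "tensor_field A R" "vector_field A U V" "vector_field A U Y" for R V Y
    by (rule bracket_local[OF _ _ U p]; use tan[OF that(2) p] tan[OF tensor_act[OF that(1) vector_field_scale[OF that(3) f]] p] tan[OF that(3)]
          in \<open>simp add: act_scale_field[OF that(1)]\<close>)+
  note s = act_bracket_scale[OF tensor(2) acts(1)[OF X] acts(2)[OF Y] p fn]
    act_bracket_scale[OF tensor(1) acts(2)[OF X] acts(1)[OF Y] p fn]
    act_bracket_scale_left[OF tensor(2) acts(1)[OF X] acts(2)[OF Y] p fn]
    act_bracket_scale_left[OF tensor(1) acts(2)[OF X] acts(1)[OF Y] p fn]
  show "K X (\<lambda>q. f q *\<^sub>T Y q) p = P p (X p) f *\<^sub>T M p (Y p) + M p (X p) f *\<^sub>T P p (Y p) + f p *\<^sub>T K X Y p"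
    unfolding mixed_op_def l[OF tensor(1) acts(2)[OF X] Y] l[OF tensor(2) acts(1)[OF X] Y] s(1,2)
    using tan[OF X p] tan[OF Y p] by (simp add: act_def rels scale_simps)
  show "K (\<lambda>q. f q *\<^sub>T X q) Y p = f p *\<^sub>T K X Y p"
    unfolding mixed_op_def l[OF tensor(1) acts(2)[OF Y] X] l[OF tensor(2) acts(1)[OF Y] X]
    using s(3,4) tan[OF X p] by (simp add: act_def rels scale_simps)
qed

text \<open>The half of the Leibniz rule that is missing for the mixed brackets is contributed by the term with \<open>F\<close>.\<close>

lemma E_scale:
  assumes X: "vector_field A U X" and Y: "vector_field A U Y" and f: "smooth_fun A U f" and p: "p \<in> U"
  shows "E X (\<lambda>q. f q *\<^sub>T Y q) p = (P p (X p) f + M p (X p) f) *\<^sub>T (P p (Y p) + M p (Y p)) + f p *\<^sub>T E X Y p"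
    "E (\<lambda>q. f q *\<^sub>T X q) Y p = f p *\<^sub>T E X Y p"
proof -
  have "K X (act F (\<lambda>q. f q *\<^sub>T Y q)) p = K X (\<lambda>q. f q *\<^sub>T act F Y q) p"
    by (rule K_cong[OF X acts(3)[OF vector_field_scale[OF Y f]] p vector_fieldD(1)[OF X] p])
      (use tan[OF Y] in \<open>simp_all add: act_def T\<close>)
  then show "E X (\<lambda>q. f q *\<^sub>T Y q) p = (P p (X p) f + M p (X p) f) *\<^sub>T (P p (Y p) + M p (Y p)) + f p *\<^sub>T E X Y p"
    using K_scale[OF X Y f p] K_scale[OF X acts(3)[OF Y] f p] KF_tangent[OF X Y p] tan[OF Y p]
    by (simp add: obata_op_def T act_def rels scale_simps)
  show "E (\<lambda>q. f q *\<^sub>T X q) Y p = f p *\<^sub>T E X Y p"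
    using K_scale(2)[OF X Y f p] K_scale(2)[OF X acts(3)[OF Y] f p] KF_tangent[OF X Y p] tan[OF Y p]
    by (simp add: obata_op_def T scale_simps)
qed

lemma E_cong:
  assumes "vector_field A U X" "vector_field A U Y" "p \<in> U" "open W" "p \<in> W"
    "\<And>q. q \<in> W \<Longrightarrow> X q = X' q" "\<And>q. q \<in> W \<Longrightarrow> Y q = Y' q"
  shows "E X Y p = E X' Y' p"
  unfolding obata_op_def
  using K_cong[OF assms(1-5)] K_cong[OF assms(1) acts(3)[OF assms(2)] assms(3-5)] assms(6,7)
  by (simp add: act_def)

text \<open>A field vanishing at \<open>p\<close> is a combination of frame fields with coefficients vanishing at \<open>p\<close>.\<close>

lemma E_tensorial:
  assumes X: "vector_field A U X" "vector_field A U X'" and Y: "vector_field A U Y" and p: "p \<in> U" and eq: "X p = X' p"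
  shows "E X Y p = E X' Y p"
proof -
  have z: "E Z Y p = 0" if Z: "vector_field A U Z" "Z p = 0" for Z
  proof -
    obtain N f V where N: "p \<in> N" "N \<subseteq> U"
      and f: "\<And>b. b \<in> (Basis :: 'e set) \<Longrightarrow> smooth_fun A N (f b) \<and> f b p = 0 \<and> vector_field A N (V b)"
      and eq: "\<And>q. q \<in> N \<Longrightarrow> Z q = (\<Sum>b\<in>Basis. f b q *\<^sub>T V b q)"
      using vector_field_frame[OF Z(1) p Z(2)] by blast
    have oN: "open N" using f[OF SOME_Basis] vector_fieldD(1) by blast
    have YN: "vector_field A N Y" using vector_field_subset[OF Y oN N(2)] .
    have zero: "vector_field A N (\<lambda>q. 0)"
      using vector_field_cmul[OF YN, of 0] by (simp add: scale_simps)
    have "vector_field A N (\<lambda>q. \<Sum>b\<in>I. f b q *\<^sub>T V b q) \<and> E (\<lambda>q. \<Sum>b\<in>I. f b q *\<^sub>T V b q) Y p = 0"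
      if "I \<subseteq> Basis" for I
      using finite_subset[OF that finite_Basis] that
    proof (induction I rule: finite_induct)
      case empty
      have "E (\<lambda>q. 0) Y p = 0"
        using E_scale(2)[OF zero YN smooth_fun_const[OF oN vector_fieldD(2)[OF YN]] N(1), of 0] by (simp add: scale_simps)
      then show ?case using zero by (simp only: sum.empty)
    next
      case (insert b I)
      then have b: "smooth_fun A N (f b)" "f b p = 0" "vector_field A N (V b)" using f by auto
      have IH: "vector_field A N (\<lambda>q. \<Sum>b\<in>I. f b q *\<^sub>T V b q)" "E (\<lambda>q. \<Sum>b\<in>I. f b q *\<^sub>T V b q) Y p = 0"
        using insert by auto
      have eq: "(\<lambda>q. \<Sum>b\<in>insert b I. f b q *\<^sub>T V b q) = (\<lambda>q. f b q *\<^sub>T V b q) + (\<lambda>q. \<Sum>b\<in>I. f b q *\<^sub>T V b q)"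
        by (rule ext) (simp only: sum.insert[OF insert(1,2)] plus_fun_apply)
      show ?case
        unfolding eq
        using vector_field_add(1)[OF vector_field_scale[OF b(3,1)] IH(1)]
          E_add(2)[OF vector_field_scale[OF b(3,1)] YN IH(1) N(1)] E_scale(2)[OF b(3) YN b(1) N(1)] IH(2) b(2)
        by (simp add: scale_simps)
    qed
    from this[of Basis] show ?thesis
      using E_cong[OF Z(1) Y p oN N(1), of "\<lambda>q. \<Sum>b\<in>Basis. f b q *\<^sub>T V b q" Y] eq by auto
  qed
  have d: "vector_field A U (X - X')" using vector_field_add(2)[OF X] .
  have "E (X' + (X - X')) Y p = E X' Y p + E (X - X') Y p" by (rule E_add(2)[OF X(2) Y d p])
  then show ?thesis using z[OF d] eq by simp
qed

text \<open>On the \<open>M\<close>-part of \<open>Y\<close> the torsion trades the derivative along \<open>P X\<close> for a bracket, because the derivative of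
  \<open>P X\<close> stays in the image of \<open>P\<close>; on the \<open>P\<close>-part one first moves to the \<open>M\<close>-part with \<open>F\<close>.\<close>

lemma parallel_connection_eq_E:
  assumes D: "linear_connection A \<D>"
    and par: "\<And>p v Y T. p \<in> carrier A \<Longrightarrow> v \<in> tangent_space A p \<Longrightarrow> field_near A p Y \<Longrightarrow> T \<in> {P, M, F} \<Longrightarrow>
      \<D> p v (act T Y) = T p (\<D> p v Y)"
    and tor: "\<And>U X Y p. vector_field A U X \<Longrightarrow> vector_field A U Y \<Longrightarrow> p \<in> U \<Longrightarrow>
      P p (torsion A \<D> X Y p) = 0 \<and> M p (torsion A \<D> X Y p) = 0"
    and X: "vector_field A U X" and Y: "vector_field A U Y" and p: "p \<in> U"
  shows "P p (\<D> p (P p (X p) + M p (X p)) Y) + M p (\<D> p (P p (X p) + M p (X p)) Y) = E X Y p"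
proof -
  have dt: "\<D> p v Y \<in> tangent_space A p" if "v \<in> tangent_space A p" "vector_field A U Y" for v Y
    using D that p pA[OF X Y p] field_nearI unfolding linear_connection_def by blast
  have add: "\<D> p (v + w) Y = \<D> p v Y + \<D> p w Y" if "v \<in> tangent_space A p" "w \<in> tangent_space A p" for v w
    using D that p pA[OF X Y p] field_nearI[OF Y p] unfolding linear_connection_def by blast
  have par': "\<D> p v (act T Y) = T p (\<D> p v Y)" if "v \<in> tangent_space A p" "vector_field A U Y" "T \<in> {P, M, F}" for v Y T
    using par[OF pA[OF X Y p] that(1) field_nearI[OF that(2) p] that(3)] .
  have PX: "P p (X p) \<in> tangent_space A p" "M p (X p) \<in> tangent_space A p" using tan[OF X p] T by auto
  have key: "M p (\<D> p (P p (X p)) Y) = M p (K X Y p)" "P p (\<D> p (M p (X p)) Y) = P p (K X Y p)"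
    if Y: "vector_field A U Y" for Y
  proof -
    have "\<D> p (S p (X p)) (act R Y) = S p (\<D> p (R p (Y p)) X) + (lie_bracket A (act S X) (act R Y) p + torsion A \<D> (act S X) (act R Y) p)"
      if "S \<in> {P, M}" "R \<in> {P, M}" for S R
      using par'[of "R p (Y p)" X S] tan[OF Y p] X T that by (auto simp: torsion_def act_def)
    then have e: "R p (\<D> p (S p (X p)) Y) = S p (\<D> p (R p (Y p)) X) + (lie_bracket A (act S X) (act R Y) p + torsion A \<D> (act S X) (act R Y) p)"
      if "S \<in> {P, M}" "R \<in> {P, M}" for S R
      using par'[of "S p (X p)" Y R] that PX Y by force
    have tt: "torsion A \<D> (act S X) (act R Y) p \<in> tangent_space A p" if "S \<in> {P, M}" "R \<in> {P, M}" for S R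
    proof -
      have "vector_field A U (act S X)" "vector_field A U (act R Y)" using acts X Y that by auto
      then show ?thesis unfolding torsion_def
        using dt tan[OF _ p] bracket_tangent[OF _ _ p] T by metis
    qed
    have DY: "\<D> p (M p (Y p)) X \<in> tangent_space A p" "\<D> p (P p (Y p)) X \<in> tangent_space A p"
      using dt[OF _ X] tan[OF Y p] T by auto
    have "M p (M p (\<D> p (P p (X p)) Y)) = M p (lie_bracket A (act P X) (act M Y) p)"
      using e[of P M] tor[OF acts(1)[OF X] acts(2)[OF Y] p] tt[of P M] DY br[OF X Y p] pA[OF X Y p] by (simp add: T rels)
    then show "M p (\<D> p (P p (X p)) Y) = M p (K X Y p)"
      using proj_K[OF X Y p] dt[OF PX(1) Y] pA[OF X Y p] by (simp add: rels)
    have "P p (P p (\<D> p (M p (X p)) Y)) = P p (lie_bracket A (act M X) (act P Y) p)"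
      using e[of M P] tor[OF acts(2)[OF X] acts(1)[OF Y] p] tt[of M P] DY br[OF X Y p] pA[OF X Y p] by (simp add: T rels)
    then show "P p (\<D> p (M p (X p)) Y) = P p (K X Y p)"
      using proj_K[OF X Y p] dt[OF PX(2) Y] pA[OF X Y p] by (simp add: rels)
  qed
  note FY = acts(3)[OF Y] and t = dt[OF PX(1) Y] dt[OF PX(2) Y] pA[OF X Y p]
  have "P p (\<D> p (P p (X p)) Y) = F p (M p (F p (\<D> p (P p (X p)) Y)))" "M p (\<D> p (M p (X p)) Y) = F p (P p (F p (\<D> p (M p (X p)) Y)))"
    using t by (simp_all add: rels T)
  then have "P p (\<D> p (P p (X p)) Y) = F p (M p (K X (act F Y) p))" "M p (\<D> p (M p (X p)) Y) = F p (P p (K X (act F Y) p))"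
    using key[OF FY] par'[OF PX(1) Y, of F] par'[OF PX(2) Y, of F] by simp_all
  moreover have "F p (K X (act F Y) p) = F p (M p (K X (act F Y) p)) + F p (P p (K X (act F Y) p))"
    using KF_tangent[OF X Y p] pA[OF X Y p] by (subst proj_K(3)[OF X FY p]) (simp add: T)
  moreover have "P p (\<D> p (P p (X p) + M p (X p)) Y) + M p (\<D> p (P p (X p) + M p (X p)) Y) =
      (M p (\<D> p (P p (X p)) Y) + P p (\<D> p (M p (X p)) Y)) + (P p (\<D> p (P p (X p)) Y) + M p (\<D> p (M p (X p)) Y))"
    unfolding add[OF PX] using t by (simp add: T)
  ultimately show ?thesis
    unfolding obata_op_def key[OF Y] using proj_K(3)[OF X Y p] by simp
qed

text \<open>The terms with one argument in each eigenbundle recombine to the bracket by construction; for two arguments in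
  the same eigenbundle this is the vanishing of the Nijenhuis tensors.\<close>

lemma E_torsion_free:
  assumes full: "\<And>p v. p \<in> carrier A \<Longrightarrow> v \<in> tangent_space A p \<Longrightarrow> P p v + M p v = v"
    and intPM: "\<And>U X Y p. vector_field A U X \<Longrightarrow> vector_field A U Y \<Longrightarrow> p \<in> U \<Longrightarrow>
      P p (lie_bracket A (act M X) (act M Y) p) = 0 \<and> M p (lie_bracket A (act P X) (act P Y) p) = 0"
    and intF: "\<And>U X Y p. vector_field A U X \<Longrightarrow> vector_field A U Y \<Longrightarrow> p \<in> U \<Longrightarrow> nijenhuis A F X Y p = 0"
    and X: "vector_field A U X" and Y: "vector_field A U Y" and p: "p \<in> U"
  shows "E X Y p - E Y X p = lie_bracket A X Y p"
proof -
  note U = vector_fieldD(1)[OF X]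
  have FF: "F q (F q v) = v" if "q \<in> carrier A" "v \<in> tangent_space A q" for q v
  proof -
    have "F q (F q (P q v + M q v)) = P q v + M q v" using that by (simp add: T rels)
    then show ?thesis using full[OF that] by simp
  qed
  have pm: "v = M p v" if "v \<in> tangent_space A p" "P p v = 0" for v
    using full[OF pA[OF X Y p] that(1)] that(2) by simp
  have mp: "v = P p v" if "v \<in> tangent_space A p" "M p v = 0" for v
    using full[OF pA[OF X Y p] that(1)] that(2) by simp
  have same: "lie_bracket A (act S X) (act S Y) p =
      F p (R p (lie_bracket A (act S X) (act R (act F Y)) p)) - F p (R p (lie_bracket A (act S Y) (act R (act F X)) p))"
    if SR: "(S, R) = (M, P) \<or> (S, R) = (P, M)" for S R
  proof -
    have tS: "tensor_field A S" and tR: "tensor_field A R" using SR tensor by auto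
    have SF: "S q (F q v) = F q (R q v)" "R q (F q v) = F q (S q v)" if "q \<in> carrier A" "v \<in> tangent_space A q" for q v
      using SR rels[OF that] by auto
    note SX = tensor_act[OF tS X] and SY = tensor_act[OF tS Y]
    note t = bracket_tangent[OF SX SY p] bracket_tangent[OF acts(3)[OF SX] SY p] bracket_tangent[OF SX acts(3)[OF SY] p]
      bracket_tangent[OF acts(3)[OF SX] acts(3)[OF SY] p]
    have eqF: "act F (act S X) q = act R (act F X) q" "act F (act S Y) q = act R (act F Y) q" if "q \<in> U" for q
      using SF(2) tan[OF X that] tan[OF Y that] by (simp_all add: act_def)
    \<comment> \<open>\<open>F S X\<close> and \<open>F S Y\<close> are sections of the image of \<open>R\<close>, which is involutive\<close>
    have l1: "lie_bracket A (act F (act S X)) (act F (act S Y)) p = lie_bracket A (act R (act F X)) (act R (act F Y)) p"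
      by (rule bracket_local[OF _ _ U p]; use eqF tan[OF acts(3)[OF SX] p] tan[OF acts(3)[OF SY] p] in blast)
    have l2: "lie_bracket A (act F (act S X)) (act S Y) p = lie_bracket A (act R (act F X)) (act S Y) p"
      "lie_bracket A (act S X) (act F (act S Y)) p = lie_bracket A (act S X) (act R (act F Y)) p"
      by (rule bracket_local[OF _ _ U p]; use eqF tan[OF acts(3)[OF SX] p] tan[OF acts(3)[OF SY] p] tan[OF SX p] tan[OF SY p] in blast)+
    note pc = pA[OF X Y p]
    have z: "S p (lie_bracket A (act F (act S X)) (act F (act S Y)) p) = 0" "R p (lie_bracket A (act S X) (act S Y) p) = 0"
      unfolding l1 using SR intPM[OF acts(3)[OF X] acts(3)[OF Y] p] intPM[OF X Y p] by auto
    have "lie_bracket A (act S X) (act S Y) p + lie_bracket A (act F (act S X)) (act F (act S Y)) p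
        - F p (lie_bracket A (act F (act S X)) (act S Y) p) - F p (lie_bracket A (act S X) (act F (act S Y)) p) = 0"
      using intF[OF SX SY p] FF[OF pc t(1)] by (simp add: nijenhuis_def act_def)
    then have "S p (lie_bracket A (act S X) (act S Y) p + lie_bracket A (act F (act S X)) (act F (act S Y)) p
        - F p (lie_bracket A (act F (act S X)) (act S Y) p) - F p (lie_bracket A (act S X) (act F (act S Y)) p)) = 0"
      using tensor_zero[OF tS pc] by simp
    then have "S p (lie_bracket A (act S X) (act S Y) p) = F p (R p (lie_bracket A (act F (act S X)) (act S Y) p)) + F p (R p (lie_bracket A (act S X) (act F (act S Y)) p))"
      using t pc z by (simp add: T tensorD[OF tS] SF algebra_simps)
    moreover have "lie_bracket A (act S X) (act S Y) p = S p (lie_bracket A (act S X) (act S Y) p)"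
      using SR z(2) pm[OF t(1)] mp[OF t(1)] by auto
    ultimately show ?thesis
      using bracket_tangent[OF SY acts(3)[OF SX] p] pc tR
      unfolding l2 bracket_antisym[of "act R (act F X)" "act S Y" p]
      using bracket_tangent[OF SY tensor_act[OF tR acts(3)[OF X]] p]
      by (simp add: tensorD[OF tR] T)
  qed
  have split: "lie_bracket A V Y p = lie_bracket A V (act P Y) p + lie_bracket A V (act M Y) p"
    if "vector_field A U V" "vector_field A U Y" for V Y
  proof -
    have "lie_bracket A V Y p = lie_bracket A V (act P Y + act M Y) p"
      by (rule bracket_local[OF _ _ U p]) (use tan[OF that(1) p] tan[OF that(2)] p full in \<open>auto simp: act_def\<close>)
    then show ?thesis using bracket_add[OF that(1) acts(1)[OF that(2)] acts(2)[OF that(2)] p] by simp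
  qed
  note PX = acts(1)[OF X] and MX = acts(2)[OF X] and PY = acts(1)[OF Y] and MY = acts(2)[OF Y]
  have splitl: "lie_bracket A X V p = lie_bracket A (act P X) V p + lie_bracket A (act M X) V p" if "vector_field A U V" for V
    using split[OF that X] bracket_antisym[of X V p] bracket_antisym[of "act P X" V p] bracket_antisym[of "act M X" V p] by simp
  have B: "lie_bracket A X Y p = lie_bracket A (act P X) (act P Y) p + lie_bracket A (act M X) (act P Y) p
      + (lie_bracket A (act P X) (act M Y) p + lie_bracket A (act M X) (act M Y) p)"
    unfolding split[OF X Y] splitl[OF PY] splitl[OF MY] ..
  have ab: "lie_bracket A (act M X) (act P Y) p = P p (lie_bracket A (act M X) (act P Y) p) + M p (lie_bracket A (act M X) (act P Y) p)"
    "lie_bracket A (act P X) (act M Y) p = P p (lie_bracket A (act P X) (act M Y) p) + M p (lie_bracket A (act P X) (act M Y) p)"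
    using full[OF pA[OF X Y p]] br[OF X Y p] by simp_all
  have KY: "K Y X p = - M p (lie_bracket A (act M X) (act P Y) p) - P p (lie_bracket A (act P X) (act M Y) p)"
    unfolding mixed_op_def bracket_antisym[of "act P Y" "act M X" p] bracket_antisym[of "act M Y" "act P X" p]
    using br[OF X Y p] pA[OF X Y p] by (simp add: T)
  have FK: "F p (K V (act F W) p) = F p (M p (lie_bracket A (act P V) (act M (act F W)) p)) + F p (P p (lie_bracket A (act M V) (act P (act F W)) p))"
    if "vector_field A U V" "vector_field A U W" for V W
    using br[OF that(1) acts(3)[OF that(2)] p] pA[OF X Y p] by (simp add: mixed_op_def T)
  \<comment> \<open>the recombination as an identity in an abelian group\<close>
  have alg: "(M1 + P2 + (F1 + F2)) - (k + (F3 + F4)) = l"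
    if "l = d + b + (a + c)" "b = P2 + M2" "a = P1 + M1" "k = - M2 - P1" "c = F2 - F4" "d = F1 - F3"
    for l a b c d k M1 M2 P1 P2 F1 F2 F3 F4 :: "'a tvec"
    using that by simp
  show ?thesis
    unfolding obata_op_def FK[OF X Y] FK[OF Y X] unfolding mixed_op_def[of A P M X Y p]
    by (rule alg[OF B ab KY]) (use same[of M P] same[of P M] in auto)
qed

end

text \<open>A product-like tensor \<open>\<phi>1\<close> splits its image into eigenbundles, which an anti-commuting \<open>\<phi>2\<close> interchanges.\<close>

lemma (in manifold) split_structureI:
  assumes t: "tensor_field A \<phi>1" "tensor_field A \<phi>2"
    and r: "\<And>p v. p \<in> carrier A \<Longrightarrow> v \<in> tangent_space A p \<Longrightarrow> \<phi>1 p (\<phi>1 p (\<phi>1 p v)) = \<phi>1 p v \<and>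
      \<phi>1 p (\<phi>2 p v) = - \<phi>2 p (\<phi>1 p v) \<and> \<phi>2 p (\<phi>2 p (\<phi>1 p v)) = \<phi>1 p v"
  shows "split_structure A (plus_part \<phi>1) (minus_part \<phi>1) \<phi>2"
proof -
  have "tensor_field A (plus_part \<phi>1)" "tensor_field A (minus_part \<phi>1)"
    unfolding plus_part_def minus_part_def by (rule tensor_lincomb[OF tensor_comp[OF t(1,1)] t(1)])+
  then show ?thesis
    unfolding split_structure_def split_structure_axioms_def
  proof (intro conjI allI impI manifold_axioms t(2))
    fix p v assume pv: "p \<in> carrier A" "v \<in> tangent_space A p"
    note T = tensorD[OF t(1)] tensorD[OF t(2)] tangent_closed pv
    have r3: "\<phi>1 p (\<phi>1 p (\<phi>1 p w)) = \<phi>1 p w" "\<phi>1 p (\<phi>2 p w) = - \<phi>2 p (\<phi>1 p w)" "\<phi>2 p (\<phi>2 p (\<phi>1 p w)) = \<phi>1 p w"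
      if "w \<in> tangent_space A p" for w using r[OF pv(1) that] by auto
    show "plus_part \<phi>1 p (plus_part \<phi>1 p v) = plus_part \<phi>1 p v" "minus_part \<phi>1 p (minus_part \<phi>1 p v) = minus_part \<phi>1 p v"
      "plus_part \<phi>1 p (minus_part \<phi>1 p v) = 0" "minus_part \<phi>1 p (plus_part \<phi>1 p v) = 0"
      "minus_part \<phi>1 p (\<phi>2 p v) = \<phi>2 p (plus_part \<phi>1 p v)" "plus_part \<phi>1 p (\<phi>2 p v) = \<phi>2 p (minus_part \<phi>1 p v)"
      "\<phi>2 p (\<phi>2 p (plus_part \<phi>1 p v)) = plus_part \<phi>1 p v" "\<phi>2 p (\<phi>2 p (minus_part \<phi>1 p v)) = minus_part \<phi>1 p v"
      by (simp_all add: plus_part_def minus_part_def T r3 scale_simps, simp_all add: scale_def fun_eq_iff)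
  qed
qed

lemma plus_minus_part: "plus_part \<phi> p v + minus_part \<phi> p v = \<phi> p (\<phi> p v)"
  by (auto simp: plus_part_def minus_part_def scale_def fun_eq_iff)

section \<open>Parallel connections and the Obata connection\<close>

context manifold
begin

lemma connectionD:
  assumes "linear_connection A \<D>" "p \<in> carrier A" "v \<in> tangent_space A p" "field_near A p Y"
  shows "\<D> p v Y \<in> tangent_space A p"
    "w \<in> tangent_space A p \<Longrightarrow> \<D> p (v + w) Y = \<D> p v Y + \<D> p w Y" "\<D> p (r *\<^sub>T v) Y = r *\<^sub>T \<D> p v Y"
    "field_near A p Z \<Longrightarrow> \<D> p v (Y + Z) = \<D> p v Y + \<D> p v Z"
    "smooth_near A p f \<Longrightarrow> \<D> p v (\<lambda>q. f q *\<^sub>T Y q) = v f *\<^sub>T Y p + f p *\<^sub>T \<D> p v Y"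
    "\<D> p v (\<lambda>q. r *\<^sub>T Y q) = r *\<^sub>T \<D> p v Y"
proof -
  show 1: "\<D> p v Y \<in> tangent_space A p"
    "w \<in> tangent_space A p \<Longrightarrow> \<D> p (v + w) Y = \<D> p v Y + \<D> p w Y" "\<D> p (r *\<^sub>T v) Y = r *\<^sub>T \<D> p v Y"
    "field_near A p Z \<Longrightarrow> \<D> p v (Y + Z) = \<D> p v Y + \<D> p v Z"
    "smooth_near A p f \<Longrightarrow> \<D> p v (\<lambda>q. f q *\<^sub>T Y q) = v f *\<^sub>T Y p + f p *\<^sub>T \<D> p v Y" for f
    using assms unfolding linear_connection_def by blast+
  show "\<D> p v (\<lambda>q. r *\<^sub>T Y q) = r *\<^sub>T \<D> p v Y"
    using 1(5)[OF smooth_near_const[OF assms(2), of r]] tangent_const[OF assms(3)] by (simp add: scale_simps)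
qed

text \<open>The function \<open>h\<close> equal to \<open>0\<close> on \<open>U\<close> and to \<open>1\<close> elsewhere is smooth near \<open>p\<close>, and \<open>Y' = Y + h (Y' - Y)\<close> everywhere; so the
  Leibniz rule gives locality without bump functions.\<close>

lemma connection_local:
  assumes D: "linear_connection A \<D>" "v \<in> tangent_space A p" "vector_field A U Y" "vector_field A U Y'"
    and p: "p \<in> U" and eq: "\<And>q. q \<in> U \<Longrightarrow> Y q = Y' q"
  shows "\<D> p v Y = \<D> p v Y'"
proof -
  have pA: "p \<in> carrier A" and U: "open U" using vector_fieldD[OF D(3)] p by auto
  define h where "h q = (if q \<in> U then 0 else 1 :: real)" for q
  have h: "smooth_near A p h"
    using smooth_near_cong[OF U p, of h "\<lambda>q. 0"] smooth_near_const[OF pA] by (simp add: h_def)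
  note d = field_nearI[OF vector_field_add(2)[OF D(4,3)] p]
  have "field_near A p (\<lambda>q. h q *\<^sub>T (Y' - Y) q)"
    by (rule field_nearI[OF vector_field_cong[OF vector_field_cmul[OF D(3), of 0]] p]) (simp add: h_def scale_simps)
  then have "\<D> p v (Y + (\<lambda>q. h q *\<^sub>T (Y' - Y) q)) = \<D> p v Y + (v h *\<^sub>T (Y' - Y) p + h p *\<^sub>T \<D> p v (Y' - Y))"
    using connectionD(4)[OF D(1) pA D(2) field_nearI[OF D(3) p]] connectionD(5)[OF D(1) pA D(2) d h] by simp
  moreover have "(Y + (\<lambda>q. h q *\<^sub>T (Y' - Y) q)) q = Y' q" for q
    using eq[of q] by (auto simp: h_def scale_simps)
  then have "Y + (\<lambda>q. h q *\<^sub>T (Y' - Y) q) = Y'" by blast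
  ultimately show ?thesis using eq[OF p] p by (simp add: h_def scale_simps)
qed

lemma parallel_plus_minus:
  assumes D: "linear_connection A \<D>" and t: "tensor_field A \<phi>" and par: "parallel_tensor A \<D> \<phi>"
    and p: "p \<in> carrier A" "v \<in> tangent_space A p" "field_near A p Y"
  shows "\<D> p v (act \<phi> Y) = \<phi> p (\<D> p v Y)"
    "\<D> p v (act (plus_part \<phi>) Y) = plus_part \<phi> p (\<D> p v Y)" "\<D> p v (act (minus_part \<phi>) Y) = minus_part \<phi> p (\<D> p v Y)"
proof -
  have fn: "field_near A p (act \<phi> Y)" if "field_near A p Y" for Y
    using tensor_act[OF t] that unfolding field_near_def by blast
  have s: "field_near A p (\<lambda>q. r *\<^sub>T Y q)" if "field_near A p Y" for Y r
    using vector_field_cmul that unfolding field_near_def by blast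
  have par': "\<D> p v (act \<phi> Y) = \<phi> p (\<D> p v Y)" if "field_near A p Y" for Y
    using par p that unfolding parallel_tensor_def by (metis eq_iff_diff_eq_0)
  show "\<D> p v (act \<phi> Y) = \<phi> p (\<D> p v Y)" by (rule par'[OF p(3)])
  have "\<D> p v ((\<lambda>q. a *\<^sub>T act \<phi> (act \<phi> Y) q) + (\<lambda>q. b *\<^sub>T act \<phi> Y q)) = a *\<^sub>T \<phi> p (\<phi> p (\<D> p v Y)) + b *\<^sub>T \<phi> p (\<D> p v Y)" for a b
    using connectionD(4)[OF D p(1,2) s s] connectionD(6)[OF D p(1,2)] fn p(3) par' by simp
  then show "\<D> p v (act (plus_part \<phi>) Y) = plus_part \<phi> p (\<D> p v Y)" "\<D> p v (act (minus_part \<phi>) Y) = minus_part \<phi> p (\<D> p v Y)"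
    by (simp_all add: plus_part_def minus_part_def act_def plus_fun_def)
qed

end

text \<open>A connection differentiates along a single tangent vector, the bracket formula along a field; any extension of
  the vector to a field serves.\<close>

definition obata_conn ::
  "('a::topological_space, 'e::euclidean_space) atlas \<Rightarrow> 'a tensor11 \<Rightarrow> 'a tensor11 \<Rightarrow> 'a tensor11 \<Rightarrow> 'a conn" where
  "obata_conn A P M F p v Y = obata_op A P M F (SOME X. \<exists>U. p \<in> U \<and> vector_field A U X \<and> X p = v) Y p"

lemma (in split_structure) obata_conn_eq:
  assumes "vector_field A U X" "vector_field A V Y" "p \<in> U" "p \<in> V"
  shows "obata_conn A P M F p (X p) Y = E X Y p"
proof -
  define X' where "X' = (SOME X'. \<exists>U. p \<in> U \<and> vector_field A U X' \<and> X' p = X p)"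
  have "\<exists>U. p \<in> U \<and> vector_field A U X' \<and> X' p = X p"
    unfolding X'_def by (rule someI[of _ X]) (use assms in blast)
  then obtain U' where U': "p \<in> U'" "vector_field A U' X'" "X' p = X p" by blast
  have op: "open (U \<inter> V \<inter> U')" using assms U' vector_fieldD(1) by blast
  have "vector_field A (U \<inter> V \<inter> U') X" "vector_field A (U \<inter> V \<inter> U') X'" "vector_field A (U \<inter> V \<inter> U') Y"
    by (rule vector_field_subset[OF _ op], fact, blast)+
  from E_tensorial[OF this(2,1,3)] U' assms show ?thesis by (simp add: obata_conn_def X'_def)
qed

locale complex_product = manifold A for A :: "('a::{t2_space, second_countable_topology}, 'e::euclidean_space) atlas" +
  fixes J1 J2 J3 :: "'a tensor11"
  assumes ahc: "anti_hypercomplex A J1 J2 J3"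
begin

lemma tensors: "tensor_field A J1" "tensor_field A J2" "tensor_field A J3"
  and integrable: "integrable_tensor A J1" "integrable_tensor A J2"
  using ahc unfolding anti_hypercomplex_def product_structure_def complex_structure_def by auto

lemma relations:
  assumes "p \<in> carrier A" "v \<in> tangent_space A p"
  shows "J1 p (J1 p v) = v" "J2 p (J2 p v) = v" "J1 p (J2 p v) = - J2 p (J1 p v)" "J3 p v = J1 p (J2 p v)"
  using ahc assms unfolding anti_hypercomplex_def product_structure_def by metis+

sublocale split_structure A "plus_part J1" "minus_part J1" J2
proof (rule split_structureI[OF tensors(1,2)])
  fix p v assume pv: "p \<in> carrier A" "v \<in> tangent_space A p"
  have "J1 p v \<in> tangent_space A p" by (rule tensorD(1)[OF tensors(1) pv])
  then show "J1 p (J1 p (J1 p v)) = J1 p v \<and> J1 p (J2 p v) = - J2 p (J1 p v) \<and> J2 p (J2 p (J1 p v)) = J1 p v"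
    using relations[OF pv] relations[OF pv(1)] by auto
qed

abbreviation "\<D>J \<equiv> obata_conn A (plus_part J1) (minus_part J1) J2"

lemma full: "p \<in> carrier A \<Longrightarrow> v \<in> tangent_space A p \<Longrightarrow> plus_part J1 p v + minus_part J1 p v = v"
  by (simp add: plus_minus_part relations)

lemma J1_parts: "p \<in> carrier A \<Longrightarrow> v \<in> tangent_space A p \<Longrightarrow> J1 p v = plus_part J1 p v - minus_part J1 p v"
  "p \<in> carrier A \<Longrightarrow> v \<in> tangent_space A p \<Longrightarrow> J1 p (plus_part J1 p v) = plus_part J1 p v"
  "p \<in> carrier A \<Longrightarrow> v \<in> tangent_space A p \<Longrightarrow> J1 p (minus_part J1 p v) = - minus_part J1 p v"
proof -
  fix p v assume pv: "p \<in> carrier A" "v \<in> tangent_space A p"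
  show "J1 p v = plus_part J1 p v - minus_part J1 p v"
    by (auto simp: plus_part_def minus_part_def scale_def fun_eq_iff)
  show "J1 p (plus_part J1 p v) = plus_part J1 p v" "J1 p (minus_part J1 p v) = - minus_part J1 p v"
    using relations(1)[OF pv] tensorD[OF tensors(1) pv] tensorD[OF tensors(1) pv(1)] pv
    by (simp_all add: plus_part_def minus_part_def tangent_closed, auto simp: scale_def fun_eq_iff)
qed

text \<open>On two fields with the same eigenvalue \<open>s\<close> the Nijenhuis tensor of \<open>J1\<close> is \<open>2 ([V, W] - s J1 [V, W])\<close>.\<close>

lemma eigenbundles_involutive:
  assumes X: "vector_field A U X" and Y: "vector_field A U Y" and p: "p \<in> U"
  shows "plus_part J1 p (lie_bracket A (act (minus_part J1) X) (act (minus_part J1) Y) p) = 0 \<and>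
    minus_part J1 p (lie_bracket A (act (plus_part J1) X) (act (plus_part J1) Y) p) = 0"
proof -
  note U = vector_fieldD(1)[OF X] and pc = pA[OF X Y p]
  have "2 *\<^sub>T (lie_bracket A V W p + s *\<^sub>T (- J1 p (lie_bracket A V W p))) = 0"
    if V: "vector_field A U V" "\<And>q. q \<in> U \<Longrightarrow> J1 q (V q) = s *\<^sub>T V q"
      and W: "vector_field A U W" "\<And>q. q \<in> U \<Longrightarrow> J1 q (W q) = s *\<^sub>T W q" and s: "s * s = 1" for V W s
  proof -
    have b: "lie_bracket A (\<lambda>q. s *\<^sub>T V q) W' p = s *\<^sub>T lie_bracket A V W' p" if "vector_field A U W'" for W'
      using bracket_cmul[OF that V(1) p, of s] bracket_antisym[of V W' p] bracket_antisym[of "\<lambda>q. s *\<^sub>T V q" W' p]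
      by (simp add: scale_simps)
    have e: "lie_bracket A (act J1 V) (act J1 W) p = lie_bracket A (\<lambda>q. s *\<^sub>T V q) (\<lambda>q. s *\<^sub>T W q) p"
      "lie_bracket A (act J1 V) W p = lie_bracket A (\<lambda>q. s *\<^sub>T V q) W p"
      "lie_bracket A V (act J1 W) p = lie_bracket A V (\<lambda>q. s *\<^sub>T W q) p"
      by (rule bracket_local[OF _ _ U p]; use V W p tan[OF V(1) p] tan[OF W(1) p] in \<open>simp add: act_def T\<close>)+
    have "nijenhuis A J1 V W p = 0" using integrable(1) V(1) W(1) p unfolding integrable_tensor_def by blast
    moreover note bt = bracket_tangent[OF V(1) W(1) p]
    have "act J1 (act J1 (lie_bracket A V W)) p = lie_bracket A V W p" using relations(1)[OF pc bt] by (simp add: act_def)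
    ultimately have eq: "lie_bracket A V W p + s *\<^sub>T s *\<^sub>T lie_bracket A V W p - J1 p (s *\<^sub>T lie_bracket A V W p) - J1 p (s *\<^sub>T lie_bracket A V W p) = 0"
      using e b[OF W(1)] b[OF vector_field_cmul[OF W(1)]] bracket_cmul[OF V(1) W(1) p]
      by (simp add: nijenhuis_def act_def[of J1 "lie_bracket A (act J1 V) W"] act_def[of J1 "lie_bracket A V (act J1 W)"])
    have ss: "s * (s * c) = c" for c using s by (simp add: mult.assoc[symmetric])
    show ?thesis
    proof
      fix f
      show "(2 *\<^sub>T (lie_bracket A V W p + s *\<^sub>T (- J1 p (lie_bracket A V W p)))) f = 0 f"
        using fun_cong[OF eq[unfolded tensorD(2)[OF tensors(1) pc bt]], of f] by (simp add: scale_def ss)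
    qed
  qed note key = this
  have neg: "(-1) *\<^sub>T u = - u" for u :: "'a tvec" by (auto simp: scale_def)
  note bM = bracket_tangent[OF acts(2)[OF X] acts(2)[OF Y] p] and bP = bracket_tangent[OF acts(1)[OF X] acts(1)[OF Y] p]
  have "2 *\<^sub>T (lie_bracket A (act (minus_part J1) X) (act (minus_part J1) Y) p + (-1) *\<^sub>T (- J1 p (lie_bracket A (act (minus_part J1) X) (act (minus_part J1) Y) p))) = 0"
    by (rule key[OF acts(2)[OF X] _ acts(2)[OF Y]])
      (use tan[OF X] tan[OF Y] in \<open>simp_all add: act_def J1_parts(3) neg\<close>)
  moreover have "2 *\<^sub>T (lie_bracket A (act (plus_part J1) X) (act (plus_part J1) Y) p + 1 *\<^sub>T (- J1 p (lie_bracket A (act (plus_part J1) X) (act (plus_part J1) Y) p))) = 0"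
    by (rule key[OF acts(1)[OF X] _ acts(1)[OF Y]])
      (use tan[OF X] tan[OF Y] in \<open>simp_all add: act_def J1_parts(2) scale_simps\<close>)
  moreover have "plus_part J1 p u = 0" if "J1 p (J1 p u) = u" "2 *\<^sub>T (u + (-1) *\<^sub>T (- J1 p u)) = 0" for u
  proof
    show "plus_part J1 p u f = 0 f" for f
      using fun_cong[OF that(2), of f] that(1) by (simp add: plus_part_def scale_def)
  qed
  moreover have "minus_part J1 p u = 0" if "J1 p (J1 p u) = u" "2 *\<^sub>T (u + 1 *\<^sub>T (- J1 p u)) = 0" for u
  proof
    show "minus_part J1 p u f = 0 f" for f
      using fun_cong[OF that(2), of f] that(1) by (simp add: minus_part_def scale_def)
  qed
  ultimately show ?thesis using relations(1)[OF pc bM] relations(1)[OF pc bP] by blast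
qed

lemma obata_conn_torsion_free:
  assumes "vector_field A U X" "vector_field A U Y" "p \<in> U"
  shows "torsion A \<D>J X Y p = 0"
  unfolding torsion_def obata_conn_eq[OF assms(1,2,3,3)] obata_conn_eq[OF assms(2,1,3,3)]
  using E_torsion_free[OF full eigenbundles_involutive _ assms] integrable(2) unfolding integrable_tensor_def by simp

lemma linear_connection_obata: "linear_connection A \<D>J"
  unfolding linear_connection_def
proof (intro conjI ballI allI impI)
  fix p v Y assume p: "p \<in> carrier A" and v: "v \<in> tangent_space A p" and "field_near A p Y"
  then obtain V where V: "p \<in> V" "vector_field A V Y" unfolding field_near_def by blast
  obtain U X where X: "p \<in> U" "vector_field A U X" "X p = v" using vector_field_extension[OF p v] .
  note Dv = obata_conn_eq[OF X(2) _ X(1), unfolded X(3)]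
  note XV = vector_field_Int[OF X(2) V(2)] and pUV = IntI[OF X(1) V(1)]
  show "\<D>J p v Y \<in> tangent_space A p" unfolding Dv[OF V(2,1)] by (rule E_tangent[OF conjunct1[OF XV] conjunct2[OF XV] pUV])
  show "\<D>J p (r *\<^sub>T v) Y = r *\<^sub>T \<D>J p v Y" for r
    using obata_conn_eq[OF vector_field_cmul[OF X(2)] V(2) X(1) V(1), of r] X(3) Dv[OF V(2,1)]
      E_scale(2)[OF conjunct1[OF XV] conjunct2[OF XV] smooth_fun_const pUV, of r] vector_fieldD(1,2)[OF conjunct1[OF XV]]
    by simp
  show "\<D>J p (v + w) Y = \<D>J p v Y + \<D>J p w Y" if w: "w \<in> tangent_space A p" for w
  proof -
    obtain U' X' where X': "p \<in> U'" "vector_field A U' X'" "X' p = w" using vector_field_extension[OF p w] .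
    note i = vector_field_Int[OF conjunct1[OF XV] X'(2)]
    have Yi: "vector_field A (U \<inter> V \<inter> U') Y"
      by (rule vector_field_subset[OF V(2) vector_fieldD(1)[OF conjunct1[OF i]]]) blast
    have pi: "p \<in> U \<inter> V \<inter> U'" using pUV X' by blast
    show ?thesis
      using obata_conn_eq[OF vector_field_add(1)[OF conjunct1[OF i] conjunct2[OF i]] V(2) pi V(1)]
        Dv[OF V(2,1)] obata_conn_eq[OF X'(2) V(2) X'(1) V(1)] X(3) X'(3) E_add(2)[OF conjunct1[OF i] Yi conjunct2[OF i] pi]
      by simp
  qed
  show "\<D>J p v (Y + Z) = \<D>J p v Y + \<D>J p v Z" if Zn: "field_near A p Z" for Z
  proof -
    obtain V' where V': "p \<in> V'" "vector_field A V' Z" using Zn unfolding field_near_def by blast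
    note i = vector_field_Int[OF conjunct1[OF XV] V'(2)] vector_field_Int[OF conjunct2[OF XV] V'(2)]
    have pi: "p \<in> U \<inter> V \<inter> V'" using pUV V' by blast
    show ?thesis
      using Dv[OF vector_field_add(1)[OF conjunct1[OF i(2)] conjunct2[OF i(2)]] pi] Dv[OF V(2,1)] Dv[OF V'(2,1)]
        E_add(1)[OF conjunct1[OF i(1)] conjunct1[OF i(2)] conjunct2[OF i(2)] pi]
      by simp
  qed
  show "\<D>J p v (\<lambda>q. f q *\<^sub>T Y q) = v f *\<^sub>T Y p + f p *\<^sub>T \<D>J p v Y" if f: "smooth_near A p f" for f
  proof -
    obtain N where N: "p \<in> N" "N \<subseteq> U \<inter> V" "smooth_fun A N f"
      using smooth_nearE[OF f vector_fieldD(1)[OF conjunct1[OF XV]] pUV] by blast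
    note XN = vector_field_subset[OF conjunct1[OF XV] smooth_funD(1)[OF N(3)] N(2)]
      vector_field_subset[OF conjunct2[OF XV] smooth_funD(1)[OF N(3)] N(2)]
    have "(plus_part J1 p v) f + (minus_part J1 p v) f = v f" using fun_cong[OF full[OF p v], of f] by simp
    then show ?thesis
      using Dv[OF vector_field_scale[OF XN(2) N(3)] N(1)] Dv[OF V(2,1)] E_scale(1)[OF XN N(3,1)]
        full[OF p vector_fieldD(3)[OF V(2,1)]] X(3) by simp
  qed
next
  fix U X Y assume XY: "vector_field A U X" "vector_field A U Y"
  show "vector_field A U (\<lambda>p. \<D>J p (X p) Y)"
    by (rule vector_field_cong[OF vector_field_E[OF XY]]) (simp add: obata_conn_eq[OF XY])
qed

lemma parallel_obata: "parallel_tensor A \<D>J J1" "parallel_tensor A \<D>J J2" "parallel_tensor A \<D>J J3"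
proof -
  have "\<D>J p v (act J1 Y) = J1 p (\<D>J p v Y) \<and> \<D>J p v (act J2 Y) = J2 p (\<D>J p v Y) \<and> \<D>J p v (act J3 Y) = J3 p (\<D>J p v Y)"
    if pv: "p \<in> carrier A" "v \<in> tangent_space A p" and Yn: "field_near A p Y" for p v Y
  proof -
    obtain V where V: "p \<in> V" "vector_field A V Y" using Yn unfolding field_near_def by blast
    obtain U X where X: "p \<in> U" "vector_field A U X" "X p = v" using vector_field_extension[OF pv] .
    define W where "W = U \<inter> V"
    have W: "vector_field A W X" "vector_field A W Y" "p \<in> W" "open W"
      using vector_field_Int[OF X(2) V(2)] X V vector_fieldD(1) by (auto simp: W_def)
    have D: "\<D>J p v Y = E X Y p" if "vector_field A W Y" for Y using obata_conn_eq[OF W(1) that W(3,3)] X(3) by simp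
    have J1: "E X (act J1 Y) p = J1 p (E X Y p)" if Y: "vector_field A W Y" for Y
    proof -
      have "E X (act (plus_part J1) Y) p = E X (act (minus_part J1) Y + act J1 Y) p"
        by (rule E_cong[OF W(1) acts(1)[OF Y] W(3,4,3)]) (use tan[OF Y] in \<open>simp_all add: act_def J1_parts(1)\<close>)
      then have "plus_part J1 p (E X Y p) = minus_part J1 p (E X Y p) + E X (act J1 Y) p"
        using E_add(1)[OF W(1) acts(2)[OF Y] tensor_act[OF tensors(1) Y] W(3)] E_parallel[OF W(1) Y W(3)] by simp
      then show ?thesis using J1_parts(1)[OF pv(1) E_tangent[OF W(1) Y W(3)]] by simp
    qed
    note J2 = E_parallel(3)[OF W(1,2,3)]
    have "E X (act J3 Y) p = E X (act J1 (act J2 Y)) p"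
      by (rule E_cong[OF W(1) tensor_act[OF tensors(3) W(2)] W(3,4,3)]) (use tan[OF W(2)] in \<open>simp_all add: act_def relations(4)\<close>)
    then show ?thesis
      using D[OF W(2)] D[OF tensor_act[OF tensors(1) W(2)]] D[OF acts(3)[OF W(2)]] D[OF tensor_act[OF tensors(3) W(2)]]
        J1[OF W(2)] J1[OF acts(3)[OF W(2)]] J2 relations(4)[OF pv(1) E_tangent[OF W(1,2,3)]] by simp
  qed
  then show "parallel_tensor A \<D>J J1" "parallel_tensor A \<D>J J2" "parallel_tensor A \<D>J J3"
    unfolding parallel_tensor_def by simp_all
qed

text \<open>Existence is the list of properties shown above; uniqueness holds because every such connection is given by
  the bracket formula.\<close>

theorem obata_connection_obata_conn: "obata_connection A J1 J2 J3 \<D>J"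
  unfolding obata_connection_def
proof (intro conjI allI impI ballI)
  show "torsion_free_preserving A J1 J2 J3 \<D>J"
    unfolding torsion_free_preserving_def
    using linear_connection_obata obata_conn_torsion_free parallel_obata by blast
  fix \<D>' p v Y
  assume D': "torsion_free_preserving A J1 J2 J3 \<D>'" and pv: "p \<in> carrier A" "v \<in> tangent_space A p" and "field_near A p Y"
  then obtain V where V: "p \<in> V" "vector_field A V Y" unfolding field_near_def by blast
  obtain U X where X: "p \<in> U" "vector_field A U X" "X p = v" using vector_field_extension[OF pv] .
  note i = vector_field_Int[OF X(2) V(2)] and pi = IntI[OF X(1) V(1)]
  have lc: "linear_connection A \<D>'" "parallel_tensor A \<D>' J1" "parallel_tensor A \<D>' J2"
    and tf: "\<And>U X Y p. vector_field A U X \<Longrightarrow> vector_field A U Y \<Longrightarrow> p \<in> U \<Longrightarrow> torsion A \<D>' X Y p = 0"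
    using D' unfolding torsion_free_preserving_def by blast+
  have "plus_part J1 p (\<D>' p (plus_part J1 p (X p) + minus_part J1 p (X p)) Y)
      + minus_part J1 p (\<D>' p (plus_part J1 p (X p) + minus_part J1 p (X p)) Y) = E X Y p"
  proof (rule parallel_connection_eq_E[OF lc(1) _ _ conjunct1[OF i] conjunct2[OF i] pi])
    show "\<D>' q w (act S Z) = S q (\<D>' q w Z)"
      if "q \<in> carrier A" "w \<in> tangent_space A q" "field_near A q Z" "S \<in> {plus_part J1, minus_part J1, J2}" for q w Z S
      using parallel_plus_minus[OF lc(1) tensors(1) lc(2) that(1-3)] parallel_plus_minus(1)[OF lc(1) tensors(2) lc(3) that(1-3)] that(4)
      by auto
    show "plus_part J1 q (torsion A \<D>' X Y q) = 0 \<and> minus_part J1 q (torsion A \<D>' X Y q) = 0"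
      if "vector_field A U X" "vector_field A U Y" "q \<in> U" for U X Y q
      using tf[OF that] pA[OF that] by (simp add: T)
  qed
  then show "\<D>' p v Y = \<D>J p v Y"
    using full[OF pv] full[OF pv(1) connectionD(1)[OF lc(1) pv field_nearI[OF V(2,1)]]] X(3)
      obata_conn_eq[OF X(2) V(2) X(1) V(1)] by simp
qed

end

section \<open>Normal almost bi-paracontact manifolds\<close>

text \<open>By the Jacobi identity the bracket of two fields commuting with \<open>\<xi>\<close> commutes with \<open>\<xi>\<close>, and invariant tensors
  preserve such fields; the formula is built from these operations.\<close>

lemma (in split_structure) bracket_E_eq_0:
  assumes \<xi>: "vector_field A U \<xi>"
    and inv: "\<And>T X q. T \<in> {P, M, F} \<Longrightarrow> vector_field A U X \<Longrightarrow> q \<in> U \<Longrightarrow> lie_bracket A \<xi> (act T X) q = T q (lie_bracket A \<xi> X q)"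
    and X: "vector_field A U X" "\<And>q. q \<in> U \<Longrightarrow> lie_bracket A \<xi> X q = 0"
    and Y: "vector_field A U Y" "\<And>q. q \<in> U \<Longrightarrow> lie_bracket A \<xi> Y q = 0"
    and p: "p \<in> U"
  shows "lie_bracket A \<xi> (E X Y) p = 0"
proof -
  note U = vector_fieldD(1)[OF \<xi>]
  have act: "vector_field A U (act T X) \<and> (\<forall>q\<in>U. lie_bracket A \<xi> (act T X) q = 0)"
    if "T \<in> {P, M, F}" "vector_field A U X" "\<And>q. q \<in> U \<Longrightarrow> lie_bracket A \<xi> X q = 0" for T X
    using that inv[OF that(1,2)] acts[OF that(2)] tan[OF \<xi>] T by auto
  have add: "lie_bracket A \<xi> (V + W) q = 0"
    if "vector_field A U V" "vector_field A U W" "q \<in> U" "lie_bracket A \<xi> V q = 0" "lie_bracket A \<xi> W q = 0" for V W q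
    using bracket_add[OF \<xi> that(1-3)] that(4,5) by simp
  have br: "lie_bracket A \<xi> (lie_bracket A V W) q = 0"
    if V: "vector_field A U V \<and> (\<forall>q\<in>U. lie_bracket A \<xi> V q = 0)" and W: "vector_field A U W \<and> (\<forall>q\<in>U. lie_bracket A \<xi> W q = 0)" and q: "q \<in> U" for V W q
  proof -
    have "lie_bracket A (lie_bracket A \<xi> V) W q = 0" "lie_bracket A V (lie_bracket A \<xi> W) q = 0"
      by (rule bracket_zero[OF _ U q]; use tan[OF conjunct1[OF V] q] tan[OF conjunct1[OF W] q] V W in blast)+
    then show ?thesis using jacobi[OF \<xi> conjunct1[OF V] conjunct1[OF W] q] by simp
  qed
  have K: "vector_field A U (K V W) \<and> (\<forall>q\<in>U. lie_bracket A \<xi> (K V W) q = 0)"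
    if V: "vector_field A U V" "\<And>q. q \<in> U \<Longrightarrow> lie_bracket A \<xi> V q = 0"
      and W: "vector_field A U W" "\<And>q. q \<in> U \<Longrightarrow> lie_bracket A \<xi> W q = 0" for V W
  proof -
    have eq: "K V W = act M (lie_bracket A (act P V) (act M W)) + act P (lie_bracket A (act M V) (act P W))"
      by (rule ext) (simp add: mixed_op_def act_def)
    have a: "vector_field A U (act M (lie_bracket A (act P V) (act M W))) \<and> (\<forall>q\<in>U. lie_bracket A \<xi> (act M (lie_bracket A (act P V) (act M W))) q = 0)"
      "vector_field A U (act P (lie_bracket A (act M V) (act P W))) \<and> (\<forall>q\<in>U. lie_bracket A \<xi> (act P (lie_bracket A (act M V) (act P W))) q = 0)"
    proof -
      have PMVW: "vector_field A U (act T V) \<and> (\<forall>q\<in>U. lie_bracket A \<xi> (act T V) q = 0)"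
        "vector_field A U (act T W) \<and> (\<forall>q\<in>U. lie_bracket A \<xi> (act T W) q = 0)" if "T \<in> {P, M}" for T
        using act[of T, OF _ V] act[of T, OF _ W] that by auto
      have "vector_field A U (act R (lie_bracket A (act S V) (act T W))) \<and> (\<forall>q\<in>U. lie_bracket A \<xi> (act R (lie_bracket A (act S V) (act T W))) q = 0)"
        if "R \<in> {P, M}" "S \<in> {P, M}" "T \<in> {P, M}" for R S T
        using act[of R "lie_bracket A (act S V) (act T W)"] br[OF PMVW(1)[OF that(2)] PMVW(2)[OF that(3)]]
          vector_field_bracket[OF conjunct1[OF PMVW(1)[OF that(2)]] conjunct1[OF PMVW(2)[OF that(3)]]] that(1) by auto
      then show "vector_field A U (act M (lie_bracket A (act P V) (act M W))) \<and> (\<forall>q\<in>U. lie_bracket A \<xi> (act M (lie_bracket A (act P V) (act M W))) q = 0)"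
        "vector_field A U (act P (lie_bracket A (act M V) (act P W))) \<and> (\<forall>q\<in>U. lie_bracket A \<xi> (act P (lie_bracket A (act M V) (act P W))) q = 0)"
        by auto
    qed
    show ?thesis
      unfolding eq
      using vector_field_add(1)[OF conjunct1[OF a(1)] conjunct1[OF a(2)]] add[OF conjunct1[OF a(1)] conjunct1[OF a(2)]] a by simp
  qed
  have eq: "E X Y = K X Y + act F (K X (act F Y))"
    by (rule ext) (simp add: obata_op_def act_def)
  have FY: "vector_field A U (act F Y) \<and> (\<forall>q\<in>U. lie_bracket A \<xi> (act F Y) q = 0)"
    by (rule act[OF _ Y]) auto
  have "vector_field A U (act F (K X (act F Y))) \<and> (\<forall>q\<in>U. lie_bracket A \<xi> (act F (K X (act F Y))) q = 0)"
    using K[OF X conjunct1[OF FY]] FY by (intro act) auto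
  then show ?thesis unfolding eq using K[OF X Y] p by (intro add) auto
qed

locale bi_paracontact = manifold A for A :: "('a::{t2_space, second_countable_topology}, 'e::euclidean_space) atlas" +
  fixes \<eta> :: "'a oneform" and \<xi> :: "'a vfield" and \<phi>1 \<phi>2 \<phi>3 :: "'a tensor11"
  assumes one_form: "one_form A \<eta>" and reeb: "reeb_field A \<eta> \<xi>"
    and abp: "almost_bi_paracontact A \<eta> \<xi> \<phi>1 \<phi>2 \<phi>3" and normal: "normal_structure A \<eta> \<xi> \<phi>1 \<phi>2 \<phi>3"
begin

lemma eta:
  assumes "p \<in> carrier A" "v \<in> tangent_space A p"
  shows "\<eta> p (r *\<^sub>T v) = r * \<eta> p v" "w \<in> tangent_space A p \<Longrightarrow> \<eta> p (v + w) = \<eta> p v + \<eta> p w"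
    "w \<in> tangent_space A p \<Longrightarrow> \<eta> p (v - w) = \<eta> p v - \<eta> p w"
proof -
  show "\<eta> p (r *\<^sub>T v) = r * \<eta> p v" "w \<in> tangent_space A p \<Longrightarrow> \<eta> p (v + w) = \<eta> p v + \<eta> p w"
    using one_form assms unfolding one_form_def by blast+
  assume w: "w \<in> tangent_space A p"
  then have "\<eta> p (v + (-1) *\<^sub>T w) = \<eta> p v + (-1) * \<eta> p w"
    using one_form assms tangent_closed(1)[OF w] unfolding one_form_def by metis
  moreover have "v + (-1) *\<^sub>T w = v - w" by (auto simp: scale_def)
  ultimately show "\<eta> p (v - w) = \<eta> p v - \<eta> p w" by simp
qed

lemma eta_smooth: "vector_field A U X \<Longrightarrow> smooth_fun A U (\<lambda>p. \<eta> p (X p))"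
  using one_form unfolding one_form_def by blast

lemma xi: "vector_field A (carrier A) \<xi>" "p \<in> carrier A \<Longrightarrow> \<eta> p (\<xi> p) = 1" "p \<in> carrier A \<Longrightarrow> \<xi> p \<in> tangent_space A p"
  "p \<in> carrier A \<Longrightarrow> \<xi> p \<noteq> 0"
proof -
  show x: "vector_field A (carrier A) \<xi>"
    using reeb unfolding reeb_field_def by auto
  show x1: "\<eta> p (\<xi> p) = 1" if "p \<in> carrier A"
    using reeb that unfolding reeb_field_def by auto
  show "\<xi> p \<in> tangent_space A p" if "p \<in> carrier A" by (rule vector_fieldD(3)[OF x that])
  show "\<xi> p \<noteq> 0" if "p \<in> carrier A"
  proof
    assume "\<xi> p = 0"
    then show False using eta(1)[OF that tangent_zero, of 0] x1[OF that] by (simp add: scale_simps)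
  qed
qed

lemma xi_on: "vector_field A U X \<Longrightarrow> vector_field A U \<xi>"
  by (rule vector_field_subset[OF xi(1)]) (auto dest: vector_fieldD)

lemma deta_xi: "vector_field A U X \<Longrightarrow> p \<in> U \<Longrightarrow> ext_deriv A \<eta> \<xi> X p = 0"
  using reeb unfolding reeb_field_def by blast

lemma eta_bracket_xi:
  assumes X: "vector_field A U X" and p: "p \<in> U"
  shows "\<eta> p (lie_bracket A \<xi> X p) = \<xi> p (\<lambda>q. \<eta> q (X q))"
proof -
  have "X p (\<lambda>q. \<eta> q (\<xi> q)) = X p (\<lambda>q. 1)"
    by (rule tangent_local[OF vector_fieldD(3)[OF X p] open_carrier]) (use xi(2) vector_fieldD(2)[OF X] p in auto)
  then show ?thesis using deta_xi[OF X p] tangent_const[OF vector_fieldD(3)[OF X p]] by (simp add: ext_deriv_def)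
qed

lemma phi_tensor: "tensor_field A \<phi>1" "tensor_field A \<phi>2" "tensor_field A \<phi>3"
  using abp unfolding almost_bi_paracontact_def by auto

lemma phi_rel:
  assumes "p \<in> carrier A" "v \<in> tangent_space A p"
  shows "\<phi>1 p (\<phi>2 p v) = - \<phi>2 p (\<phi>1 p v)" "\<phi>1 p (\<phi>1 p v) = 1 *\<^sub>T (v - \<eta> p v *\<^sub>T \<xi> p)" "\<phi>2 p (\<phi>2 p v) = 1 *\<^sub>T (v - \<eta> p v *\<^sub>T \<xi> p)"
    "\<phi>3 p v = \<phi>1 p (\<phi>2 p v)" "\<phi>3 p (\<phi>3 p v) = (-1) *\<^sub>T (v - \<eta> p v *\<^sub>T \<xi> p)"
  using abp assms unfolding almost_bi_paracontact_def by (auto simp: scale_def fun_eq_iff)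

text \<open>The sign \<open>s\<close> treats the product and the complex case together. Since \<open>\<phi>\<^sup>2 \<xi> = 0\<close>, applying \<open>\<phi>\<^sup>2\<close> to \<open>\<phi> \<xi>\<close>
  shows that \<open>\<phi> \<xi> = l \<xi>\<close>, and then \<open>l\<^sup>2 = 0\<close>; the rest follows by comparing \<open>\<phi> \<phi>\<^sup>2\<close> with \<open>\<phi>\<^sup>2 \<phi>\<close>.\<close>

lemma phi_basic:
  assumes t: "tensor_field A \<phi>" and s: "s * s = 1"
    and sq: "\<And>p v. p \<in> carrier A \<Longrightarrow> v \<in> tangent_space A p \<Longrightarrow> \<phi> p (\<phi> p v) = s *\<^sub>T (v - \<eta> p v *\<^sub>T \<xi> p)"
    and p: "p \<in> carrier A"
  shows "\<phi> p (\<xi> p) = 0" "v \<in> tangent_space A p \<Longrightarrow> \<eta> p (\<phi> p v) = 0" "v \<in> tangent_space A p \<Longrightarrow> \<phi> p (\<phi> p (\<phi> p v)) = s *\<^sub>T \<phi> p v"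
proof -
  note T = tensorD[OF t p] tangent_closed xi(3)[OF p]
  define l where "l = \<eta> p (\<phi> p (\<xi> p))"
  have z: "\<phi> p (\<phi> p (\<xi> p)) = 0" using sq[OF p xi(3)[OF p]] xi(2)[OF p] by (simp add: scale_simps)
  then have "s *\<^sub>T (\<phi> p (\<xi> p) - l *\<^sub>T \<xi> p) = 0"
    using sq[OF p, of "\<phi> p (\<xi> p)"] T(1)[OF xi(3)[OF p]] tensor_zero[OF t p] by (simp add: l_def)
  then have "s *\<^sub>T s *\<^sub>T (\<phi> p (\<xi> p) - l *\<^sub>T \<xi> p) = 0" by (simp add: scale_simps)
  then have e: "\<phi> p (\<xi> p) = l *\<^sub>T \<xi> p" by (simp add: scale_simps(3) s scale_simps(4))
  have "\<phi> p (\<phi> p (\<xi> p)) = (l * l) *\<^sub>T \<xi> p" using e T(2)[OF xi(3)[OF p], of l] by (simp add: scale_simps)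
  then have "(l * l) *\<^sub>T \<xi> p = 0" using z by simp
  then have "l * l = 0" using eta(1)[OF p xi(3)[OF p], of "l * l"] eta(1)[OF p tangent_zero, of 0] xi(2)[OF p] by (simp add: scale_simps)
  then show x: "\<phi> p (\<xi> p) = 0" using e by (simp add: scale_simps)
  assume v: "v \<in> tangent_space A p"
  have "\<phi> p (s *\<^sub>T (v - \<eta> p v *\<^sub>T \<xi> p)) = s *\<^sub>T \<phi> p v" using T v x by (simp add: scale_simps)
  then show c: "\<phi> p (\<phi> p (\<phi> p v)) = s *\<^sub>T \<phi> p v" using sq[OF p v] by simp
  have "s *\<^sub>T (\<phi> p v - \<eta> p (\<phi> p v) *\<^sub>T \<xi> p) = s *\<^sub>T \<phi> p v" using c sq[OF p T(1)[OF v]] by simp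
  then have "(s * \<eta> p (\<phi> p v)) *\<^sub>T \<xi> p = 0" by (simp add: scale_simps)
  then have "s * \<eta> p (\<phi> p v) = 0" using eta(1)[OF p xi(3)[OF p], of "s * \<eta> p (\<phi> p v)"] eta(1)[OF p tangent_zero, of 0] xi(2)[OF p] by (simp add: scale_simps)
  then show "\<eta> p (\<phi> p v) = 0" using s by auto
qed

text \<open>With \<open>\<phi> \<xi> = 0\<close>, the equation \<open>[\<phi>, \<phi>] (\<xi>, X) = 0\<close> reads \<open>\<phi> (\<phi> [\<xi>, X] - [\<xi>, \<phi> X]) = 0\<close>. Here
  \<open>\<phi> [\<xi>, X]\<close> and \<open>[\<xi>, \<phi> X]\<close> are both horizontal, the latter since \<open>\<eta> [\<xi>, Z] = \<xi> (\<eta> Z)\<close>, and \<open>\<phi>\<close> is injective on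
  horizontal vectors.\<close>

lemma bracket_xi_phi:
  assumes t: "tensor_field A \<phi>" and s: "s * s = 1"
    and sq: "\<And>p v. p \<in> carrier A \<Longrightarrow> v \<in> tangent_space A p \<Longrightarrow> \<phi> p (\<phi> p v) = s *\<^sub>T (v - \<eta> p v *\<^sub>T \<xi> p)"
    and N: "nijenhuis A \<phi> \<xi> X p = 0"
    and X: "vector_field A U X" and p: "p \<in> U"
  shows "lie_bracket A \<xi> (act \<phi> X) p = \<phi> p (lie_bracket A \<xi> X p)"
proof -
  note b = phi_basic(1)[OF t s sq] phi_basic(2)[OF t s sq] phi_basic(3)[OF t s sq]
  have pc: "p \<in> carrier A" and U: "open U" using vector_fieldD(1,2)[OF X] p by auto
  note fX = tensor_act[OF t X]
  have z: "act \<phi> \<xi> q = 0" if "q \<in> U" for q using b(1) vector_fieldD(2)[OF X] that by (auto simp: act_def)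
  have "lie_bracket A (act \<phi> \<xi>) (act \<phi> X) p = 0" "lie_bracket A (act \<phi> \<xi>) X p = 0"
    by (rule bracket_zero(2)[OF _ U p z]; use vector_fieldD(3)[OF fX p] vector_fieldD(3)[OF X p] in simp)+
  moreover note B = bracket_tangent[OF xi_on[OF X] X p] bracket_tangent[OF xi_on[OF X] fX p]
  moreover have "act \<phi> (act \<phi> (lie_bracket A \<xi> X)) p = \<phi> p (\<phi> p (lie_bracket A \<xi> X p))"
    "act \<phi> (lie_bracket A \<xi> (act \<phi> X)) p = \<phi> p (lie_bracket A \<xi> (act \<phi> X) p)"
    "act \<phi> (lie_bracket A (act \<phi> \<xi>) X) p = \<phi> p (lie_bracket A (act \<phi> \<xi>) X p)" by (simp_all add: act_def)
  ultimately have "\<phi> p (\<phi> p (lie_bracket A \<xi> X p)) - \<phi> p (lie_bracket A \<xi> (act \<phi> X) p) = 0"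
    using N tensor_zero[OF t pc] by (simp add: nijenhuis_def)
  then have e: "\<phi> p (\<phi> p (\<phi> p (lie_bracket A \<xi> X p))) = \<phi> p (\<phi> p (lie_bracket A \<xi> (act \<phi> X) p))" by simp
  have "\<xi> p (\<lambda>q. \<eta> q (act \<phi> X q)) = \<xi> p (\<lambda>q. 0)"
    by (rule tangent_local[OF xi(3)[OF pc] U p]) (use b(2) vector_fieldD(2,3)[OF X] in \<open>auto simp: act_def\<close>)
  then have "\<eta> p (lie_bracket A \<xi> (act \<phi> X) p) = 0"
    using eta_bracket_xi[OF fX p] tangent_const[OF xi(3)[OF pc]] by simp
  then have "s *\<^sub>T \<phi> p (lie_bracket A \<xi> X p) = s *\<^sub>T lie_bracket A \<xi> (act \<phi> X) p"
    using e sq[OF pc B(2)] b(3)[OF _ _ pc B(1)] by (simp add: scale_simps)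
  then have "s *\<^sub>T s *\<^sub>T \<phi> p (lie_bracket A \<xi> X p) = s *\<^sub>T s *\<^sub>T lie_bracket A \<xi> (act \<phi> X) p" by simp
  then show ?thesis by (simp add: scale_simps(3) s scale_simps(4))
qed

text \<open>Vanishing Lie derivative along \<open>\<xi>\<close> together with \<open>\<phi> \<xi> = 0\<close>: what makes a tensor field descend to a leaf space.\<close>

definition invariant :: "'a tensor11 \<Rightarrow> bool" where
  "invariant \<phi> \<longleftrightarrow> tensor_field A \<phi> \<and> (\<forall>p\<in>carrier A. \<phi> p (\<xi> p) = 0) \<and>
    (\<forall>U X. vector_field A U X \<longrightarrow> (\<forall>p\<in>U. lie_bracket A \<xi> (act \<phi> X) p = \<phi> p (lie_bracket A \<xi> X p)))"

lemma nijenhuis_normal: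
  assumes "vector_field A U X" "vector_field A U Y" "p \<in> U"
  shows "nijenhuis A \<phi>1 X Y p = (2 * ext_deriv A \<eta> X Y p) *\<^sub>T \<xi> p" "nijenhuis A \<phi>2 X Y p = (2 * ext_deriv A \<eta> X Y p) *\<^sub>T \<xi> p"
    "nijenhuis A \<phi>3 X Y p = (- (2 * ext_deriv A \<eta> X Y p)) *\<^sub>T \<xi> p"
proof -
  have "(- r) *\<^sub>T v = - (r *\<^sub>T v)" for r and v :: "'a tvec" by (auto simp: scale_def)
  then show "nijenhuis A \<phi>1 X Y p = (2 * ext_deriv A \<eta> X Y p) *\<^sub>T \<xi> p" "nijenhuis A \<phi>2 X Y p = (2 * ext_deriv A \<eta> X Y p) *\<^sub>T \<xi> p"
    "nijenhuis A \<phi>3 X Y p = (- (2 * ext_deriv A \<eta> X Y p)) *\<^sub>T \<xi> p"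
    using normal assms unfolding normal_structure_def by (metis eq_iff_diff_eq_0, metis eq_iff_diff_eq_0, metis eq_neg_iff_add_eq_0)
qed

lemma phi_xi: "p \<in> carrier A \<Longrightarrow> \<phi>1 p (\<xi> p) = 0" "p \<in> carrier A \<Longrightarrow> \<phi>2 p (\<xi> p) = 0" "p \<in> carrier A \<Longrightarrow> \<phi>3 p (\<xi> p) = 0"
  by (rule phi_basic(1)[where s = 1, OF phi_tensor(1)], simp_all add: phi_rel,
      rule phi_basic(1)[where s = 1, OF phi_tensor(2)], simp_all add: phi_rel,
      rule phi_basic(1)[where s = "-1", OF phi_tensor(3)], simp_all add: phi_rel(5))

lemma eta_phi: "p \<in> carrier A \<Longrightarrow> v \<in> tangent_space A p \<Longrightarrow> \<eta> p (\<phi>1 p v) = 0"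
  by (rule phi_basic(2)[where s = 1, OF phi_tensor(1)]) (simp_all add: phi_rel)

lemma phi_invariant: "invariant \<phi>1" "invariant \<phi>2" "invariant \<phi>3"
proof -
  have n: "nijenhuis A \<phi>1 \<xi> X p = 0" "nijenhuis A \<phi>2 \<xi> X p = 0" "nijenhuis A \<phi>3 \<xi> X p = 0"
    if "vector_field A U X" "p \<in> U" for U X p
    using nijenhuis_normal[OF xi_on[OF that(1)] that] deta_xi[OF that] by (simp_all add: scale_simps)
  have b: "lie_bracket A \<xi> (act \<phi>1 X) p = \<phi>1 p (lie_bracket A \<xi> X p)" "lie_bracket A \<xi> (act \<phi>2 X) p = \<phi>2 p (lie_bracket A \<xi> X p)"
    "lie_bracket A \<xi> (act \<phi>3 X) p = \<phi>3 p (lie_bracket A \<xi> X p)" if X: "vector_field A U X" and p: "p \<in> U" for U X p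
    by (rule bracket_xi_phi[where s = 1, OF phi_tensor(1) _ _ n(1)[OF X p] X p], (simp add: phi_rel; fail)+,
        rule bracket_xi_phi[where s = 1, OF phi_tensor(2) _ _ n(2)[OF X p] X p], (simp add: phi_rel; fail)+,
        rule bracket_xi_phi[where s = "-1", OF phi_tensor(3) _ _ n(3)[OF X p] X p], (simp add: phi_rel(5); fail)+)
  show "invariant \<phi>1" "invariant \<phi>2" "invariant \<phi>3"
    unfolding invariant_def using b phi_tensor phi_xi by auto
qed

sublocale split_structure A "plus_part \<phi>1" "minus_part \<phi>1" \<phi>2
proof (rule split_structureI[OF phi_tensor(1,2)])
  fix p v assume pv: "p \<in> carrier A" "v \<in> tangent_space A p"
  note 1 = tensorD(1)[OF phi_tensor(1) pv]
  show "\<phi>1 p (\<phi>1 p (\<phi>1 p v)) = \<phi>1 p v \<and> \<phi>1 p (\<phi>2 p v) = - \<phi>2 p (\<phi>1 p v) \<and> \<phi>2 p (\<phi>2 p (\<phi>1 p v)) = \<phi>1 p v"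
    using phi_rel(1)[OF pv] phi_rel(2)[OF pv] phi_rel(2,3)[OF pv(1) 1] eta_phi[OF pv]
    by (simp add: scale_simps)
qed

lemma invariant_parts:
  assumes "invariant \<phi>"
  shows "invariant (plus_part \<phi>)" "invariant (minus_part \<phi>)"
proof -
  have t: "tensor_field A \<phi>" and z: "\<And>p. p \<in> carrier A \<Longrightarrow> \<phi> p (\<xi> p) = 0"
    and b: "\<And>U X p. vector_field A U X \<Longrightarrow> p \<in> U \<Longrightarrow> lie_bracket A \<xi> (act \<phi> X) p = \<phi> p (lie_bracket A \<xi> X p)"
    using assms unfolding invariant_def by auto
  have "invariant (\<lambda>p v. a *\<^sub>T \<phi> p (\<phi> p v) + c *\<^sub>T \<phi> p v)" for a c
    unfolding invariant_def
  proof (intro conjI allI impI ballI)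
    show "tensor_field A (\<lambda>p v. a *\<^sub>T \<phi> p (\<phi> p v) + c *\<^sub>T \<phi> p v)" by (rule tensor_lincomb[OF tensor_comp[OF t t] t])
    show "a *\<^sub>T \<phi> p (\<phi> p (\<xi> p)) + c *\<^sub>T \<phi> p (\<xi> p) = 0" if "p \<in> carrier A" for p
      using z[OF that] tensor_zero[OF t that] by (simp add: scale_simps)
    fix U X p assume X: "vector_field A U X" and p: "p \<in> U"
    note fX = tensor_act[OF t X] and \<xi> = xi_on[OF X]
    have eq: "act (\<lambda>p v. a *\<^sub>T \<phi> p (\<phi> p v) + c *\<^sub>T \<phi> p v) X = (\<lambda>q. a *\<^sub>T act \<phi> (act \<phi> X) q) + (\<lambda>q. c *\<^sub>T act \<phi> X q)"
      by (simp add: act_def plus_fun_def)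
    show "lie_bracket A \<xi> (act (\<lambda>p v. a *\<^sub>T \<phi> p (\<phi> p v) + c *\<^sub>T \<phi> p v) X) p
        = a *\<^sub>T \<phi> p (\<phi> p (lie_bracket A \<xi> X p)) + c *\<^sub>T \<phi> p (lie_bracket A \<xi> X p)"
      unfolding eq bracket_add[OF \<xi> vector_field_cmul[OF tensor_act[OF t fX]] vector_field_cmul[OF fX] p]
        bracket_cmul[OF \<xi> tensor_act[OF t fX] p] bracket_cmul[OF \<xi> fX p] b[OF fX p] b[OF X p] ..
  qed
  then show "invariant (plus_part \<phi>)" "invariant (minus_part \<phi>)" unfolding plus_part_def minus_part_def by auto
qed

text \<open>The bracket is vertical because the field is basic, and horizontal because \<open>\<eta> [\<xi>, X] = \<xi> (\<eta> X) = 0\<close>.\<close>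

lemma bracket_xi_basic:
  assumes "basic_field A \<eta> \<xi> W X" "p \<in> W"
  shows "lie_bracket A \<xi> X p = 0"
proof -
  have X: "vector_field A W X" and h: "\<And>q. q \<in> W \<Longrightarrow> \<eta> q (X q) = 0"
    using assms(1) unfolding basic_field_def by auto
  have pc: "p \<in> carrier A" using vector_fieldD(2)[OF X] assms(2) by blast
  have "tangent_to_leaves A \<xi> W \<xi>"
    unfolding tangent_to_leaves_def using xi_on[OF X] scale_simps(4) by metis
  then have "tangent_to_leaves A \<xi> W (lie_bracket A X \<xi>)" using assms(1) unfolding basic_field_def by blast
  then obtain r where "lie_bracket A X \<xi> p = r *\<^sub>T \<xi> p" using assms(2) unfolding tangent_to_leaves_def by blast
  then have r: "lie_bracket A \<xi> X p = (- r) *\<^sub>T \<xi> p" using bracket_antisym[of \<xi> X p] by (auto simp: scale_def)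
  have "\<xi> p (\<lambda>q. \<eta> q (X q)) = \<xi> p (\<lambda>q. 0)"
    by (rule tangent_local[OF xi(3)[OF pc] vector_fieldD(1)[OF X] assms(2)]) (use h in auto)
  then have "\<eta> p (lie_bracket A \<xi> X p) = 0" using eta_bracket_xi[OF X assms(2)] tangent_const[OF xi(3)[OF pc]] by simp
  then have "r = 0" using r eta(1)[OF pc xi(3)[OF pc], of "- r"] xi(2)[OF pc] by simp
  then show ?thesis using r by (simp add: scale_simps)
qed

text \<open>The canonical connection is the bracket formula, up to its \<open>\<xi>\<close>-component, which vanishes on horizontal fields.\<close>

lemma canonical_eq_E:
  assumes D: "canonical_connection A \<eta> \<xi> \<phi>1 \<phi>2 \<phi>3 \<D>"
    and X: "vector_field A W X" "\<And>q. q \<in> W \<Longrightarrow> \<eta> q (X q) = 0" and Y: "vector_field A W Y" "\<And>q. q \<in> W \<Longrightarrow> \<eta> q (Y q) = 0"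
    and p: "p \<in> W"
  shows "\<D> p (X p) Y = E X Y p" "\<eta> p (\<D> p (X p) Y) = 0"
proof -
  have lc: "linear_connection A \<D>" "parallel_tensor A \<D> \<phi>1" "parallel_tensor A \<D> \<phi>2"
    and tor: "\<And>U X Y p. vector_field A U X \<Longrightarrow> vector_field A U Y \<Longrightarrow> p \<in> U \<Longrightarrow> torsion A \<D> X Y p = (2 * ext_deriv A \<eta> X Y p) *\<^sub>T \<xi> p"
    using D unfolding canonical_connection_def by blast+
  note pv = pA[OF X(1) Y(1) p] vector_fieldD(3)[OF X(1) p] and Yn = field_nearI[OF Y(1) p]
  note Dt = connectionD(1)[OF lc(1) pv Yn]
  have hor: "\<phi>1 q (\<phi>1 q (Z q)) = Z q" if "vector_field A W Z" "\<And>q. q \<in> W \<Longrightarrow> \<eta> q (Z q) = 0" "q \<in> W" for Z q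
    using phi_rel(2)[of q "Z q"] that tan[OF that(1,3)] by (simp add: scale_simps)
  have "\<D> p (X p) Y = \<D> p (X p) (act \<phi>1 (act \<phi>1 Y))"
    by (rule connection_local[OF lc(1) pv(2) Y(1) tensor_act[OF phi_tensor(1) tensor_act[OF phi_tensor(1) Y(1)]] p])
      (simp add: act_def hor[OF Y])
  also have "\<dots> = \<phi>1 p (\<phi>1 p (\<D> p (X p) Y))"
    using parallel_plus_minus(1)[OF lc(1) phi_tensor(1) lc(2) pv] Yn field_nearI[OF tensor_act[OF phi_tensor(1) Y(1)] p] by simp
  finally have h: "\<phi>1 p (\<phi>1 p (\<D> p (X p) Y)) = \<D> p (X p) Y" ..
  show "\<eta> p (\<D> p (X p) Y) = 0"
    using eta_phi[OF pv(1) tensorD(1)[OF phi_tensor(1) pv(1) Dt]] h by simp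
  have "plus_part \<phi>1 p (\<D> p (plus_part \<phi>1 p (X p) + minus_part \<phi>1 p (X p)) Y)
      + minus_part \<phi>1 p (\<D> p (plus_part \<phi>1 p (X p) + minus_part \<phi>1 p (X p)) Y) = E X Y p"
  proof (rule parallel_connection_eq_E[OF lc(1) _ _ X(1) Y(1) p])
    show "\<D> q w (act S Z) = S q (\<D> q w Z)"
      if "q \<in> carrier A" "w \<in> tangent_space A q" "field_near A q Z" "S \<in> {plus_part \<phi>1, minus_part \<phi>1, \<phi>2}" for q w Z S
      using parallel_plus_minus[OF lc(1) phi_tensor(1) lc(2) that(1-3)] parallel_plus_minus(1)[OF lc(1) phi_tensor(2) lc(3) that(1-3)] that(4)
      by auto
    show "plus_part \<phi>1 q (torsion A \<D> X Y q) = 0 \<and> minus_part \<phi>1 q (torsion A \<D> X Y q) = 0"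
      if "vector_field A U X" "vector_field A U Y" "q \<in> U" for U X Y q
      using tor[OF that] pA[OF that] invariant_parts[OF phi_invariant(1)] xi(3) unfolding invariant_def
      by (simp add: T scale_simps)
  qed
  then show "\<D> p (X p) Y = E X Y p"
    by (simp add: plus_minus_part hor[OF X p] h)
qed

text \<open>The torsion gives \<open>\<nabla>\<^sub>\<xi> X = [\<xi>, X] = 0\<close> for basic \<open>X\<close>. The derivative \<open>\<nabla>\<^sub>X Y\<close> equals the bracket formula, which
  commutes with \<open>\<xi>\<close>; hence its brackets with multiples of \<open>\<xi>\<close> are multiples of \<open>\<xi>\<close>.\<close>

lemma canonical_projectable:
  assumes D: "canonical_connection A \<eta> \<xi> \<phi>1 \<phi>2 \<phi>3 \<D>"
  shows "projectable_connection A \<eta> \<xi> \<D>"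
  unfolding projectable_connection_def
proof (intro allI impI conjI ballI)
  fix W X Y V
  assume bX: "basic_field A \<eta> \<xi> W X" and bY: "basic_field A \<eta> \<xi> W Y" and "tangent_to_leaves A \<xi> W V"
  have lc: "linear_connection A \<D>" and Dxi: "\<And>p v. p \<in> carrier A \<Longrightarrow> v \<in> tangent_space A p \<Longrightarrow> \<D> p v \<xi> = 0"
    and tor: "\<And>U X Y p. vector_field A U X \<Longrightarrow> vector_field A U Y \<Longrightarrow> p \<in> U \<Longrightarrow> torsion A \<D> X Y p = (2 * ext_deriv A \<eta> X Y p) *\<^sub>T \<xi> p"
    using D unfolding canonical_connection_def by blast+
  have X: "vector_field A W X" "\<And>q. q \<in> W \<Longrightarrow> \<eta> q (X q) = 0" and Y: "vector_field A W Y" "\<And>q. q \<in> W \<Longrightarrow> \<eta> q (Y q) = 0"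
    using bX bY unfolding basic_field_def by auto
  note \<xi> = xi_on[OF X(1)]
  show "\<D> p (V p) X = 0" if V: "p \<in> W" for p
  proof -
    obtain r where r: "V p = r *\<^sub>T \<xi> p" using \<open>tangent_to_leaves A \<xi> W V\<close> V unfolding tangent_to_leaves_def by blast
    have "\<D> p (\<xi> p) X = 0"
      using tor[OF \<xi> X(1) V] deta_xi[OF X(1) V] bracket_xi_basic[OF bX V] Dxi tan[OF X(1) V]
      by (simp add: torsion_def scale_simps)
    then show ?thesis
      using connectionD(3)[OF lc _ _ field_nearI[OF X(1) V]] tan[OF \<xi> V] r by (simp add: scale_simps)
  qed
  let ?Z = "\<lambda>p. \<D> p (X p) Y"
  have Z: "vector_field A W ?Z" using lc X(1) Y(1) unfolding linear_connection_def by blast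
  show "basic_field A \<eta> \<xi> W ?Z"
    unfolding basic_field_def
  proof (intro conjI allI impI ballI)
    show "vector_field A W ?Z" by (rule Z)
    show "\<eta> p (?Z p) = 0" if "p \<in> W" for p using canonical_eq_E(2)[OF D X Y that] .
    fix V assume tV: "tangent_to_leaves A \<xi> W V"
    then have V: "vector_field A W V" "\<And>p. p \<in> W \<Longrightarrow> \<exists>r. V p = r *\<^sub>T \<xi> p" unfolding tangent_to_leaves_def by auto
    have V\<xi>: "V p = \<eta> p (V p) *\<^sub>T \<xi> p" if pW: "p \<in> W" for p
    proof -
      obtain r where "V p = r *\<^sub>T \<xi> p" using V(2)[OF pW] by blast
      then show ?thesis using eta(1)[of p "\<xi> p"] tan[OF \<xi> pW] xi(2) by simp
    qed
    show "tangent_to_leaves A \<xi> W (lie_bracket A ?Z V)"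
      unfolding tangent_to_leaves_def
    proof (intro conjI ballI vector_field_bracket[OF Z V(1)])
      fix p assume p: "p \<in> W"
      note W = vector_fieldD(1)[OF X(1)]
      have "lie_bracket A \<xi> (E X Y) p = 0"
        by (rule bracket_E_eq_0[OF \<xi> _ X(1) bracket_xi_basic[OF bX] Y(1) bracket_xi_basic[OF bY] p])
          (use phi_invariant invariant_parts[OF phi_invariant(1)] in \<open>auto simp: invariant_def\<close>)
      moreover have "lie_bracket A \<xi> ?Z p = lie_bracket A \<xi> (E X Y) p"
        by (rule bracket_local[OF _ _ W p]) (use tan[OF \<xi> p] tan[OF Z p] canonical_eq_E(1)[OF D X Y] in auto)
      ultimately have z: "lie_bracket A ?Z \<xi> p = 0" using bracket_antisym[of ?Z \<xi> p] by simp
      have "lie_bracket A ?Z V p = lie_bracket A ?Z (\<lambda>q. \<eta> q (V q) *\<^sub>T \<xi> q) p"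
        by (rule bracket_local[OF _ _ W p]) (use tan[OF Z p] tan[OF V(1) p] V\<xi> in auto)
      also have "\<dots> = ?Z p (\<lambda>q. \<eta> q (V q)) *\<^sub>T \<xi> p"
        using bracket_scale[OF Z \<xi> p smooth_nearI[OF eta_smooth[OF V(1)] p]] z by (simp add: scale_simps)
      finally show "\<exists>r. lie_bracket A ?Z V p = r *\<^sub>T \<xi> p" by blast
    qed
  qed
qed

end

section \<open>Smooth maps and related fields\<close>

lemma pushforward_linear:
  "pushforward B h p (v + w) = pushforward B h p v + pushforward B h p w"
  "pushforward B h p (v - w) = pushforward B h p v - pushforward B h p w"
  "pushforward B h p (r *\<^sub>T v) = r *\<^sub>T pushforward B h p v" "pushforward B h p (- v) = - pushforward B h p v"
  "pushforward B h p 0 = 0"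
  by (auto simp: pushforward_def scale_def)

locale manifold_pair = A: manifold A + B: manifold B
  for A :: "('a::{t2_space, second_countable_topology}, 'e::euclidean_space) atlas"
    and B :: "('b::{t2_space, second_countable_topology}, 'f::euclidean_space) atlas"
begin

context
  fixes U h
  assumes h: "smooth_map A B U h"
begin

lemma smooth_mapD: "open U" "U \<subseteq> carrier A" "h ` U \<subseteq> carrier B" "continuous_on U h"
  "(D, c) \<in> A \<Longrightarrow> (E, d) \<in> B \<Longrightarrow> smooth_on (c ` (D \<inter> U \<inter> h -` E)) (\<lambda>x. d (h (inv_into D c x)))"
  using h unfolding smooth_map_def comp_def by auto

lemma open_preimage: "open V \<Longrightarrow> open (U \<inter> h -` V)"
  using continuous_open_preimage[OF smooth_mapD(4,1)] .

lemma smooth_pullback: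
  assumes g: "smooth_fun B V g"
  shows "smooth_fun A (U \<inter> h -` V) (\<lambda>p. g (h p))"
proof (rule A.smooth_fun_local)
  fix p assume p: "p \<in> U \<inter> h -` V"
  then have "p \<in> carrier A" "h p \<in> carrier B" using smooth_mapD(2) B.smooth_funD(2)[OF g] by auto
  then obtain D c E d where c: "(D, c) \<in> A" "p \<in> D" and d: "(E, d) \<in> B" "h p \<in> E"
    using A.carrierE B.carrierE by metis
  define N where "N = D \<inter> (U \<inter> h -` (E \<inter> V))"
  have EV: "open (E \<inter> V)" using B.chart(1)[OF d(1)] B.smooth_funD(1)[OF g] by blast
  have N: "open N" "N \<subseteq> D" "p \<in> N" "N \<subseteq> U \<inter> h -` V"
    using A.chart(1)[OF c(1)] open_preimage[OF EV] p c d by (auto simp: N_def)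
  have cN: "open (c ` N)" by (rule A.open_chart_image[OF c(1) N(1,2)])
  have 1: "smooth_on (c ` N) (\<lambda>x. d (h (inv_into D c x)))"
    by (rule smooth_on_subset[OF smooth_mapD(5)[OF c(1) d(1)]]) (auto simp: N_def)
  have inv: "inv_into D c x \<in> N" if "x \<in> c ` N" for x using that N(2) A.chart(5)[OF c(1)] by auto
  have "smooth_on (c ` N) (\<lambda>x. g (inv_into E d (d (h (inv_into D c x)))))"
    by (rule smooth_on_compose[OF cN B.open_chart_image[OF d(1) EV] B.smooth_funD(3)[OF g d(1)] 1])
      (use inv in \<open>auto simp: N_def\<close>)
  then have "smooth_on (c ` N) (\<lambda>x. g (h (inv_into D c x)))"
    by (rule smooth_on_cong[OF cN, rotated]) (use inv B.chart(5)[OF d(1)] in \<open>auto simp: N_def\<close>)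
  then show "\<exists>N. p \<in> N \<and> N \<subseteq> U \<inter> h -` V \<and> smooth_fun A N (\<lambda>p. g (h p))"
    using A.smooth_fun_chartI[OF c(1) N(1,2), of "\<lambda>p. g (h p)"] N by blast
qed

lemma smooth_near_pullback:
  assumes "p \<in> U" "smooth_near B (h p) g"
  shows "smooth_near A p (\<lambda>p. g (h p))"
proof -
  obtain V where V: "h p \<in> V" "smooth_fun B V g" using assms(2) unfolding smooth_near_def by blast
  show ?thesis by (rule A.smooth_nearI[OF smooth_pullback[OF V(2)]]) (use assms(1) V(1) in simp)
qed

lemma pushforward_apply: "smooth_near B (h p) g \<Longrightarrow> pushforward B h p v g = v (\<lambda>q. g (h q))"
  by (simp add: pushforward_def comp_def)

lemma pushforward_tangent:
  assumes "p \<in> U" "v \<in> tangent_space A p"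
  shows "pushforward B h p v \<in> tangent_space B (h p)"
  using A.tangentD[OF assms(2)] smooth_near_pullback[OF assms(1)]
  by (intro B.tangentI) (auto simp: pushforward_apply B.smooth_near_add B.smooth_near_cmul, simp add: pushforward_def)

lemma related_bracket:
  assumes X: "vector_field A N X" "vector_field B W X'" "fields_related B h N X X'"
    and Y: "vector_field A N Y" "vector_field B W Y'" "fields_related B h N Y Y'"
    and N: "N \<subseteq> U" "h ` N \<subseteq> W"
  shows "fields_related B h N (lie_bracket A X Y) (lie_bracket B X' Y')"
  unfolding fields_related_def
proof
  fix p assume p: "p \<in> N"
  show "pushforward B h p (lie_bracket A X Y p) = lie_bracket B X' Y' (h p)"
  proof
    fix g
    show "pushforward B h p (lie_bracket A X Y p) g = lie_bracket B X' Y' (h p) g"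
    proof (cases "smooth_near B (h p) g")
      case True
      then obtain V where V: "h p \<in> V" "smooth_fun B V g" unfolding smooth_near_def by blast
      have O: "open (N \<inter> (U \<inter> h -` V))" using A.vector_fieldD(1)[OF X(1)] open_preimage[OF B.smooth_funD(1)[OF V(2)]] by blast
      have s: "Z p (\<lambda>q. Z2 q (\<lambda>q. g (h q))) = Z' (h p) (\<lambda>y. Z2' y g)"
        if Z: "vector_field A N Z" "vector_field B W Z'" "fields_related B h N Z Z'"
          and Z2: "vector_field A N Z2" "vector_field B W Z2'" "fields_related B h N Z2 Z2'" for Z Z' Z2 Z2'
      proof -
        have "Z p (\<lambda>q. Z2 q (\<lambda>q. g (h q))) = Z p (\<lambda>q. Z2' (h q) g)"
        proof (rule A.tangent_local[OF A.vector_fieldD(3)[OF Z(1) p] O])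
          show "p \<in> N \<inter> (U \<inter> h -` V)" using p N V by auto
          show "Z2 q (\<lambda>q. g (h q)) = Z2' (h q) g" if "q \<in> N \<inter> (U \<inter> h -` V)" for q
            using Z2(3) that pushforward_apply[of q g "Z2 q"] B.smooth_nearI[OF V(2), of "h q"]
            unfolding fields_related_def by auto
        qed
        also have "\<dots> = pushforward B h p (Z p) (\<lambda>y. Z2' y g)"
          using B.vector_field_near[OF Z2(2) _ True] p N by (subst pushforward_apply) auto
        finally show ?thesis using Z(3) p unfolding fields_related_def by simp
      qed
      show ?thesis
        using s[OF X Y] s[OF Y X] True smooth_near_pullback[of p g] p N
        by (auto simp: pushforward_apply lie_bracket_def)
    qed (simp add: pushforward_def lie_bracket_def)
  qed
qed

definition intertwines :: "'a tensor11 \<Rightarrow> 'b tensor11 \<Rightarrow> bool" where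
  "intertwines T T' \<longleftrightarrow> (\<forall>p\<in>U. \<forall>v\<in>tangent_space A p. pushforward B h p (T p v) = T' (h p) (pushforward B h p v))"

lemma related_act:
  assumes "intertwines T T'" "vector_field A N X" "N \<subseteq> U" "fields_related B h N X X'"
  shows "fields_related B h N (act T X) (act T' X')"
  using assms A.vector_fieldD(3)[OF assms(2)] unfolding intertwines_def fields_related_def act_def by auto

lemma intertwines_parts:
  assumes T: "tensor_field A T" and i: "intertwines T T'"
  shows "intertwines (plus_part T) (plus_part T')" "intertwines (minus_part T) (minus_part T')"
  using i A.tensorD(1)[OF T] smooth_mapD(2) unfolding intertwines_def plus_part_def minus_part_def
  by (auto simp: pushforward_linear subset_iff)

text \<open>The formula uses only brackets and the tensors, and related fields have related brackets.\<close>

lemma related_obata_op: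
  assumes tA: "tensor_field A P" "tensor_field A M" "tensor_field A F" and tB: "tensor_field B P'" "tensor_field B M'" "tensor_field B F'"
    and i: "intertwines P P'" "intertwines M M'" "intertwines F F'"
    and X: "vector_field A N X" "vector_field B W X'" "fields_related B h N X X'"
    and Y: "vector_field A N Y" "vector_field B W Y'" "fields_related B h N Y Y'"
    and N: "N \<subseteq> U" "h ` N \<subseteq> W"
  shows "fields_related B h N (obata_op A P M F X Y) (obata_op B P' M' F' X' Y')"
proof -
  have act: "vector_field A N (act T X)" "vector_field B W (act T' X')" "fields_related B h N (act T X) (act T' X')"
    if "tensor_field A T" "tensor_field B T'" "intertwines T T'" "vector_field A N X" "vector_field B W X'" "fields_related B h N X X'" for T T' X X'
    using A.tensor_act[OF that(1,4)] B.tensor_act[OF that(2,5)] related_act[OF that(3,4) N(1) that(6)] by auto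
  have add: "vector_field A N (X + Y)" "vector_field B W (X' + Y')" "fields_related B h N (X + Y) (X' + Y')"
    if "vector_field A N X" "vector_field B W X'" "fields_related B h N X X'" "vector_field A N Y" "vector_field B W Y'" "fields_related B h N Y Y'" for X X' Y Y'
    using A.vector_field_add(1)[OF that(1,4)] B.vector_field_add(1)[OF that(2,5)] that(3,6)
    by (auto simp: fields_related_def pushforward_linear)
  have br: "vector_field A N (lie_bracket A X Y)" "vector_field B W (lie_bracket B X' Y')" "fields_related B h N (lie_bracket A X Y) (lie_bracket B X' Y')"
    if "vector_field A N X" "vector_field B W X'" "fields_related B h N X X'" "vector_field A N Y" "vector_field B W Y'" "fields_related B h N Y Y'" for X X' Y Y'
    using A.vector_field_bracket[OF that(1,4)] B.vector_field_bracket[OF that(2,5)] related_bracket[OF that N] by auto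
  note P = act[OF tA(1) tB(1) i(1)] and M = act[OF tA(2) tB(2) i(2)] and F = act[OF tA(3) tB(3) i(3)]
  have Keq: "mixed_op A P M X Y = act M (lie_bracket A (act P X) (act M Y)) + act P (lie_bracket A (act M X) (act P Y))"
    "mixed_op B P' M' X' Y' = act M' (lie_bracket B (act P' X') (act M' Y')) + act P' (lie_bracket B (act M' X') (act P' Y'))" for X Y X' Y'
    by (auto simp: mixed_op_def act_def fun_eq_iff)
  have K: "vector_field A N (mixed_op A P M X Y)" "vector_field B W (mixed_op B P' M' X' Y')" "fields_related B h N (mixed_op A P M X Y) (mixed_op B P' M' X' Y')"
    if X: "vector_field A N X" "vector_field B W X'" "fields_related B h N X X'" and Y: "vector_field A N Y" "vector_field B W Y'" "fields_related B h N Y Y'" for X X' Y Y'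
    unfolding Keq by (rule add[OF M[OF br[OF P[OF X] M[OF Y]]] P[OF br[OF M[OF X] P[OF Y]]]])+
  have Eeq: "obata_op A P M F X Y = mixed_op A P M X Y + act F (mixed_op A P M X (act F Y))"
    "obata_op B P' M' F' X' Y' = mixed_op B P' M' X' Y' + act F' (mixed_op B P' M' X' (act F' Y'))"
    by (auto simp: obata_op_def act_def fun_eq_iff)
  show ?thesis unfolding Eeq by (rule add(3)[OF K[OF X Y] F[OF K[OF X F[OF Y]]]])
qed

lemma related_nijenhuis:
  assumes t: "tensor_field A T" "tensor_field B T'" "intertwines T T'"
    and X: "vector_field A N X" "vector_field B W X'" "fields_related B h N X X'"
    and Y: "vector_field A N Y" "vector_field B W Y'" "fields_related B h N Y Y'"
    and N: "N \<subseteq> U" "h ` N \<subseteq> W" and p: "p \<in> N"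
  shows "pushforward B h p (nijenhuis A T X Y p) = nijenhuis B T' X' Y' (h p)"
proof -
  have a: "vector_field A N (act T X)" "vector_field B W (act T' X')" "fields_related B h N (act T X) (act T' X')"
    if "vector_field A N X" "vector_field B W X'" "fields_related B h N X X'" for X X'
    using A.tensor_act[OF t(1) that(1)] B.tensor_act[OF t(2) that(2)] related_act[OF t(3) that(1) N(1) that(3)] by auto
  have br: "vector_field A N (lie_bracket A X Y)" "vector_field B W (lie_bracket B X' Y')" "fields_related B h N (lie_bracket A X Y) (lie_bracket B X' Y')"
    if "vector_field A N X" "vector_field B W X'" "fields_related B h N X X'" "vector_field A N Y" "vector_field B W Y'" "fields_related B h N Y Y'" for X X' Y Y'
    using A.vector_field_bracket[OF that(1,4)] B.vector_field_bracket[OF that(2,5)] related_bracket[OF that N] by auto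
  have "fields_related B h N (act T (act T (lie_bracket A X Y))) (act T' (act T' (lie_bracket B X' Y')))"
    "fields_related B h N (lie_bracket A (act T X) (act T Y)) (lie_bracket B (act T' X') (act T' Y'))"
    "fields_related B h N (act T (lie_bracket A (act T X) Y)) (act T' (lie_bracket B (act T' X') Y'))"
    "fields_related B h N (act T (lie_bracket A X (act T Y))) (act T' (lie_bracket B X' (act T' Y')))"
    using a(3)[OF a[OF br[OF X Y]]] br(3)[OF a[OF X] a[OF Y]] a(3)[OF br[OF a[OF X] Y]] a(3)[OF br[OF X a[OF Y]]] by auto
  then show ?thesis using p by (simp add: nijenhuis_def fields_related_def pushforward_linear)
qed

end

end

section \<open>Submersions onto a leaf space\<close>

locale leaf_space = bi_paracontact A \<eta> \<xi> \<phi>1 \<phi>2 \<phi>3 + B: manifold B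
  for A :: "('a::{t2_space, second_countable_topology}, 'e::euclidean_space) atlas" and \<eta> \<xi> \<phi>1 \<phi>2 \<phi>3
    and B :: "('b::{t2_space, second_countable_topology}, 'f::euclidean_space) atlas" +
  fixes U :: "'a set" and \<pi> :: "'a \<Rightarrow> 'b"
  assumes leaf_space: "local_leaf_space A \<xi> B U \<pi>" and dim: "DIM('e) = DIM('f) + 1"
begin

sublocale manifold_pair A B ..

lemma submersion: "smooth_map A B U \<pi>" "p \<in> U \<Longrightarrow> pushforward B \<pi> p ` tangent_space A p = tangent_space B (\<pi> p)"
  "\<pi> ` U = carrier B" "y \<in> carrier B \<Longrightarrow> leaf_piece A \<xi> {p\<in>U. \<pi> p = y}"
  using leaf_space unfolding local_leaf_space_def submersion_on_def by auto

lemmas map = smooth_mapD[OF submersion(1)]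

abbreviation "push \<equiv> pushforward B \<pi>"

lemma UA: "p \<in> U \<Longrightarrow> p \<in> carrier A" "p \<in> U \<Longrightarrow> \<pi> p \<in> carrier B"
  using map(2,3) by auto

text \<open>Functions pulled back from the leaf space are constant along the integral curve that sweeps out a fibre.\<close>

lemma push_xi:
  assumes p: "p \<in> U"
  shows "push p (\<xi> p) = 0"
proof
  fix g
  show "push p (\<xi> p) g = 0 g"
  proof (cases "smooth_near B (\<pi> p) g")
    case True
    obtain I \<gamma> where I: "open I" "integral_curve A \<xi> I \<gamma>" "{q\<in>U. \<pi> q = \<pi> p} = \<gamma> ` I"
      using submersion(4)[OF UA(2)[OF p]] unfolding leaf_piece_def by blast
    then obtain t where t: "t \<in> I" "p = \<gamma> t" using p by blast
    have "((\<lambda>q. g (\<pi> q)) \<circ> \<gamma> has_real_derivative \<xi> (\<gamma> t) (\<lambda>q. g (\<pi> q))) (at t)"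
      using I(2) t smooth_near_pullback[OF submersion(1) p True] unfolding integral_curve_def by blast
    moreover have "((\<lambda>q. g (\<pi> q)) \<circ> \<gamma> has_real_derivative 0) (at t)"
    proof (rule has_field_derivative_transform_within_open[OF DERIV_const I(1) t(1)])
      show "g (\<pi> p) = ((\<lambda>q. g (\<pi> q)) \<circ> \<gamma>) s" if "s \<in> I" for s
      proof -
        have "\<gamma> s \<in> {q\<in>U. \<pi> q = \<pi> p}" using I(3) that by blast
        then show ?thesis by simp
      qed
    qed
    ultimately show ?thesis
      using DERIV_unique t(2) True by (auto simp: pushforward_def comp_def)
  qed (simp add: pushforward_def)
qed

text \<open>Charts \<open>c\<close> at \<open>p\<close> and \<open>d\<close> at \<open>\<pi> p\<close> are fixed; \<open>loc\<close> is the expression of \<open>\<pi>\<close> in them.\<close>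

context
  fixes p D c E d
  assumes c: "(D, c) \<in> A" "p \<in> D" and d: "(E, d) \<in> B" "\<pi> p \<in> E" and pU: "p \<in> U"
begin

definition "dom0 = D \<inter> (U \<inter> \<pi> -` E)"
definition "loc x = d (\<pi> (inv_into D c x))"

lemma dom0: "open dom0" "p \<in> dom0" "dom0 \<subseteq> D" "dom0 \<subseteq> U" "open (c ` dom0)" "smooth_on (c ` dom0) loc"
proof -
  show 1: "open dom0" "p \<in> dom0" "dom0 \<subseteq> D" "dom0 \<subseteq> U"
    using chart(1)[OF c(1)] open_preimage[OF submersion(1) B.chart(1)[OF d(1)]] c d pU by (auto simp: dom0_def)
  show "open (c ` dom0)" by (rule open_chart_image[OF c(1) 1(1,3)])
  show "smooth_on (c ` dom0) loc"
    using map(5)[OF c(1) d(1)] unfolding loc_def dom0_def by (simp add: Int_assoc)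
qed

lemma loc_derivative:
  assumes q: "q \<in> dom0"
  shows "frechet_derivative loc (at (c q)) a = B.coords d (push q (tvec_of D c q a))"
proof (rule euclidean_eqI)
  fix b :: 'f assume b: "b \<in> Basis"
  have qE: "q \<in> D" "\<pi> q \<in> E" "q \<in> U" using q by (auto simp: dom0_def)
  have nb: "smooth_near B (\<pi> q) (\<lambda>y. d y \<bullet> b)" by (rule B.smooth_nearI[OF B.smooth_fun_coord[OF d(1)] qE(2)])
  have "((\<lambda>x. loc x \<bullet> b) has_derivative (\<lambda>v. frechet_derivative loc (at (c q)) v \<bullet> b)) (at (c q))"
    by (rule bounded_linear.has_derivative[OF bounded_linear_inner_left smooth_on_has_derivative[OF dom0(6)]]) (use q in blast)
  then have "frechet_derivative (\<lambda>x. loc x \<bullet> b) (at (c q)) a = frechet_derivative loc (at (c q)) a \<bullet> b"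
    by (simp add: frechet_derivative_at[symmetric])
  then show "frechet_derivative loc (at (c q)) a \<bullet> b = B.coords d (push q (tvec_of D c q a)) \<bullet> b"
    using nb smooth_near_pullback[OF submersion(1) qE(3) nb]
    by (simp add: B.coords_inner[OF b] pushforward_apply[OF submersion(1) nb] tvec_of_def loc_def[abs_def])
qed

lemma xi_coords: "coords c (\<xi> p) \<noteq> 0"
  using xi(4)[OF UA(1)[OF pU]] tangent_coords[OF c xi(3)[OF UA(1)[OF pU]]] coords_eqI[OF c xi(3)[OF UA(1)[OF pU]] tangent_zero]
  by (auto simp: coords_linear)

text \<open>The derivative of \<open>\<pi>\<close> is onto and loses one dimension, so its kernel is a line, and it contains \<open>\<xi>\<close>.\<close>

lemma loc_kernel:
  assumes "frechet_derivative loc (at (c p)) a = 0"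
  shows "\<exists>s. a = s *\<^sub>R coords c (\<xi> p)"
proof -
  let ?L = "frechet_derivative loc (at (c p))" and ?f = "coords c (\<xi> p)"
  note pA = UA[OF pU]
  have lin: "linear ?L" by (rule smooth_on_linear_derivative[OF dom0(6)]) (use dom0(2) in blast)
  have Lf: "?L ?f = 0"
    using push_xi[OF pU] tangent_coords[OF c xi(3)[OF pA(1)]] by (simp add: loc_derivative[OF dom0(2)] B.coords_linear)
  have "surj ?L"
  proof (intro surjI)
    fix y
    have "B.tvec_of E d (\<pi> p) y \<in> tangent_space B (\<pi> p)" by (rule B.tvec_of_tangent[OF d])
    then obtain v where v: "v \<in> tangent_space A p" "push p v = B.tvec_of E d (\<pi> p) y"
      using submersion(2)[OF pU] by (metis imageE)
    have "?L (coords c v) = y"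
      using v(2) tangent_coords[OF c v(1)] B.coords_tvec_of[OF d] by (simp add: loc_derivative[OF dom0(2)])
    then show "?L (SOME a. ?L a = y) = y" by (rule someI)
  qed
  then obtain g where g: "linear g" "\<And>y. ?L (g y) = y"
    using linear_surjective_right_inverse[OF lin] by (metis comp_apply id_apply)
  have dm: "DIM('e) = DIM('f \<times> real)" using dim by simp
  obtain j :: "'e \<Rightarrow> 'f \<times> real" and i where j: "linear j" "linear i" "\<And>x. i (j x) = x" "\<And>y. j (i y) = y"
    using isomorphisms_UNIV_UNIV[OF dm] by metis
  \<comment> \<open>a right inverse of the derivative and the kernel direction span the space, by dimension\<close>
  define \<Theta> where "\<Theta> z = g (fst z) + snd z *\<^sub>R ?f" for z
  have "linear \<Theta>"
    unfolding \<Theta>_def using linear_add[OF g(1)] linear_cmul[OF g(1)] by (intro linearI) (auto simp: algebra_simps)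
  then have lT: "linear (\<lambda>x. \<Theta> (j x))" using linear_compose[OF j(1)] by (simp add: comp_def)
  have L\<Theta>: "?L (\<Theta> z) = fst z" for z
    by (simp add: \<Theta>_def linear_add[OF lin] linear_cmul[OF lin] g(2) Lf)
  have "\<Theta> z = 0 \<Longrightarrow> z = 0" for z
    using L\<Theta>[of z] linear_0[OF lin] linear_0[OF g(1)] xi_coords by (auto simp: \<Theta>_def prod_eq_iff)
  then have "inj (\<lambda>x. \<Theta> (j x))"
    unfolding linear_injective_0[OF lT] using linear_0[OF j(2)] j(3) by metis
  then have "surj (\<lambda>x. \<Theta> (j x))" using linear_injective_imp_surjective[OF lT] by blast
  then obtain x where "a = \<Theta> (j x)" by (metis surjD)
  moreover have "fst (j x) = 0" using L\<Theta>[of "j x"] assms calculation by simp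
  ultimately show ?thesis using linear_0[OF g(1)] by (auto simp: \<Theta>_def)
qed

lemma vertical:
  assumes "v \<in> tangent_space A p" "push p v = 0"
  shows "\<exists>r. v = r *\<^sub>T \<xi> p"
proof -
  have "frechet_derivative loc (at (c p)) (coords c v) = 0"
    using tangent_coords[OF c assms(1)] assms(2) by (simp add: loc_derivative[OF dom0(2)] B.coords_linear)
  then obtain s where "coords c v = s *\<^sub>R coords c (\<xi> p)" using loc_kernel by blast
  then show ?thesis
    using coords_eqI[OF c assms(1) tangent_closed(1)[OF xi(3)[OF UA(1)[OF pU]]]] by (auto simp: coords_linear)
qed

text \<open>Completing the coordinates of \<open>\<pi>\<close> by a linear function that is not constant along \<open>\<xi>\<close> gives
  coordinates in which \<open>\<pi>\<close> is a linear projection.\<close>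

lemma adapted_coordinates:
  obtains S T G where "open S" "c p \<in> S" "S \<subseteq> c ` dom0" "open T"
    "homeomorphism S T (\<lambda>x. (loc x, x \<bullet> coords c (\<xi> p))) G" "smooth_on T G"
proof -
  let ?f = "coords c (\<xi> p)"
  let ?\<Psi> = "\<lambda>x. (loc x, x \<bullet> ?f)"
  have sm: "smooth_on (c ` dom0) ?\<Psi>"
    by (rule smooth_on_Pair[OF dom0(5,6) smooth_on_inner_left[OF dom0(5) smooth_on_ident[OF dom0(5)]]])
  have cp: "c p \<in> c ` dom0" using dom0(2) by blast
  have "(?\<Psi> has_derivative (\<lambda>a. (frechet_derivative loc (at (c p)) a, a \<bullet> ?f))) (at (c p))"
    by (intro has_derivative_Pair smooth_on_has_derivative[OF dom0(6) cp] bounded_linear_imp_has_derivative bounded_linear_inner_left)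
  then have D: "frechet_derivative ?\<Psi> (at (c p)) = (\<lambda>a. (frechet_derivative loc (at (c p)) a, a \<bullet> ?f))"
    by (simp add: frechet_derivative_at[symmetric])
  have "inj (frechet_derivative ?\<Psi> (at (c p)))"
    unfolding linear_injective_0[OF smooth_on_linear_derivative[OF sm cp]] unfolding D
  proof (intro allI impI)
    fix a assume "(frechet_derivative loc (at (c p)) a, a \<bullet> ?f) = 0"
    then have "frechet_derivative loc (at (c p)) a = 0" "a \<bullet> ?f = 0" by (auto simp: zero_prod_def)
    moreover obtain s where "a = s *\<^sub>R ?f" using loc_kernel calculation(1) by blast
    ultimately show "a = 0" using xi_coords by auto
  qed
  moreover have "DIM('e) = DIM('f \<times> real)" using dim by simp
  ultimately obtain S T G where "open S" "S \<subseteq> c ` dom0" "c p \<in> S" "open T" "homeomorphism S T ?\<Psi> G" "smooth_on T G"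
    using smooth_inverse_function[OF _ dom0(5) cp sm] by blast
  then show ?thesis using that by blast
qed

text \<open>In adapted coordinates \<open>\<pi>\<close> is the first projection: a field is lifted with zero last component, and a
  section through \<open>p\<close> keeps the last coordinate of \<open>p\<close>.\<close>

lemma lift_and_section_at:
  shows "\<And>W X'. vector_field B W X' \<Longrightarrow> \<pi> p \<in> W \<Longrightarrow>
      \<exists>N X. p \<in> N \<and> N \<subseteq> U \<and> \<pi> ` N \<subseteq> W \<and> vector_field A N X \<and> fields_related B \<pi> N X X'"
    and "\<exists>s. s (\<pi> p) = p \<and> (\<forall>f. smooth_near A p f \<longrightarrow> smooth_near B (\<pi> p) (\<lambda>y. f (s y))) \<and>
      (\<forall>O'. open O' \<longrightarrow> p \<in> O' \<longrightarrow> (\<exists>N'. open N' \<and> \<pi> p \<in> N' \<and> (\<forall>y\<in>N'. s y \<in> O' \<inter> U \<and> \<pi> (s y) = y)))"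
proof -
  let ?f = "coords c (\<xi> p)"
  let ?\<Psi> = "\<lambda>x. (loc x, x \<bullet> ?f)"
  obtain S T G where S: "open S" "c p \<in> S" "S \<subseteq> c ` dom0" and T: "open T" and hom: "homeomorphism S T ?\<Psi> G" and G: "smooth_on T G"
    using adapted_coordinates .
  have hm: "\<And>x. x \<in> S \<Longrightarrow> ?\<Psi> x \<in> T \<and> G (?\<Psi> x) = x" "\<And>z. z \<in> T \<Longrightarrow> G z \<in> S \<and> ?\<Psi> (G z) = z"
    using hom unfolding homeomorphism_def by blast+
  have locS: "smooth_on S loc" and \<Psi>S: "smooth_on S ?\<Psi>"
    using smooth_on_subset[OF dom0(6) S(3)] smooth_on_Pair[OF S(1) _ smooth_on_inner_left[OF S(1) smooth_on_ident[OF S(1)]]] by auto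
  have inv: "inv_into D c x \<in> dom0 \<and> c (inv_into D c x) = x" if xS: "x \<in> S" for x
  proof -
    obtain q where "q \<in> dom0" "x = c q" using xS S(3) by blast
    then show ?thesis using chart(5)[OF c(1)] dom0(3) by (simp add: subset_iff)
  qed
  show "\<exists>N X. p \<in> N \<and> N \<subseteq> U \<and> \<pi> ` N \<subseteq> W \<and> vector_field A N X \<and> fields_related B \<pi> N X X'"
    if X': "vector_field B W X'" and W: "\<pi> p \<in> W" for W X'
  proof -
    define S' where "S' = S \<inter> c ` (dom0 \<inter> (U \<inter> \<pi> -` (E \<inter> W)))"
    have EW: "open (E \<inter> W)" using B.chart(1)[OF d(1)] B.vector_fieldD(1)[OF X'] by blast
    note pre = open_preimage[OF submersion(1) EW]
    have S': "open S'" "c p \<in> S'" "S' \<subseteq> S" "S' \<subseteq> c ` D"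
      using S open_chart_image[OF c(1), of "dom0 \<inter> (U \<inter> \<pi> -` (E \<inter> W))"] pre dom0(1,2,3) pU d W by (auto simp: S'_def)
    define w where "w y = B.coords d (X' y)" for y
    define \<alpha> where "\<alpha> x = frechet_derivative G (at (?\<Psi> x)) (w (\<pi> (inv_into D c x)), 0)" for x
    have "smooth_on S' (\<lambda>x. w (\<pi> (inv_into D c x)) \<bullet> b)" if "b \<in> Basis" for b
    proof -
      have "smooth_fun B (E \<inter> W) (\<lambda>y. X' y (\<lambda>y. d y \<bullet> b))"
        by (rule B.vector_fieldD(4)[OF X' _ B.smooth_fun_subset[OF B.smooth_fun_coord[OF d(1)] EW]]) auto
      then have "smooth_fun A (U \<inter> \<pi> -` (E \<inter> W)) (\<lambda>q. X' (\<pi> q) (\<lambda>y. d y \<bullet> b))" by (rule smooth_pullback[OF submersion(1)])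
      then have "smooth_on (c ` (D \<inter> (U \<inter> \<pi> -` (E \<inter> W)))) (\<lambda>x. X' (\<pi> (inv_into D c x)) (\<lambda>y. d y \<bullet> b))"
        by (rule smooth_funD(3)[OF _ c(1)])
      then show ?thesis
        unfolding w_def B.coords_inner[OF that] by (rule smooth_on_subset) (use dom0(3) in \<open>auto simp: S'_def\<close>)
    qed
    then have "smooth_on S' (\<lambda>x. w (\<pi> (inv_into D c x)))"
      by (rule smooth_on_componentwise[OF S'(1)])
    then have s1: "smooth_on S' (\<lambda>x. (w (\<pi> (inv_into D c x)), 0 :: real))"
      by (intro smooth_on_Pair S' smooth_on_const)
    have \<Psi>T: "?\<Psi> x \<in> T" if "x \<in> S'" for x using hm(1) S'(3) that by blast
    have s2: "smooth_on S' (\<lambda>x. frechet_derivative G (at (?\<Psi> x)) b)" for b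
      by (rule smooth_on_compose[OF S'(1) T smooth_on_derivative[OF G] smooth_on_subset[OF \<Psi>S S'(3)] \<Psi>T])
    have "smooth_on S' \<alpha>"
      unfolding \<alpha>_def by (rule smooth_on_linear_apply[OF S'(1) smooth_on_linear_derivative[OF G \<Psi>T] s2 s1])
    then have vf: "vector_field A {q \<in> D. c q \<in> S'} (\<lambda>q. tvec_of D c q (\<alpha> (c q)))"
      by (rule vector_field_of_coords[OF c(1) S'(1,4)])
    have N: "q \<in> dom0 \<and> \<pi> q \<in> E \<inter> W" if qS: "q \<in> {q \<in> D. c q \<in> S'}" for q
    proof -
      obtain q' where q': "q' \<in> dom0" "q' \<in> U \<inter> \<pi> -` (E \<inter> W)" "c q = c q'" using qS unfolding S'_def by blast
      then have "q = q'" using chart(5)[OF c(1), of q] chart(5)[OF c(1), of q'] dom0(3) qS by auto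
      then show ?thesis using q' by simp
    qed
    have "fields_related B \<pi> {q \<in> D. c q \<in> S'} (\<lambda>q. tvec_of D c q (\<alpha> (c q))) X'"
      unfolding fields_related_def
    proof
      fix q assume q: "q \<in> {q \<in> D. c q \<in> S'}"
      note Nq = N[OF q]
      have x: "c q \<in> S" using q S'(3) by auto
      have "((\<lambda>z. fst (?\<Psi> (G z))) has_derivative fst) (at (?\<Psi> (c q)))"
        by (rule has_derivative_transform_within_open[OF bounded_linear_imp_has_derivative[OF bounded_linear_fst] T])
          (use hm x in auto)
      moreover have "((\<lambda>z. loc (G z)) has_derivative (\<lambda>v. frechet_derivative loc (at (c q)) (frechet_derivative G (at (?\<Psi> (c q))) v))) (at (?\<Psi> (c q)))"
        using has_derivative_compose[OF smooth_on_has_derivative[OF G], of "?\<Psi> (c q)" loc "frechet_derivative loc (at (c q))"]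
          smooth_on_has_derivative[OF locS x] hm(1)[OF x] by simp
      ultimately have "fst = (\<lambda>v. frechet_derivative loc (at (c q)) (frechet_derivative G (at (?\<Psi> (c q))) v))"
        using has_derivative_unique by (simp; blast)
      then have e: "frechet_derivative loc (at (c q)) (\<alpha> (c q)) = w (\<pi> q)"
        using chart(5)[OF c(1)] q unfolding \<alpha>_def by (metis fst_conv mem_Collect_eq)
      have qD: "q \<in> D" "q \<in> U" "\<pi> q \<in> E" "\<pi> q \<in> W" using Nq dom0(3,4) by auto
      show "push q (tvec_of D c q (\<alpha> (c q))) = X' (\<pi> q)"
      proof (rule B.coords_eqI[OF d(1) qD(3)])
        show "push q (tvec_of D c q (\<alpha> (c q))) \<in> tangent_space B (\<pi> q)"
          by (rule pushforward_tangent[OF submersion(1) qD(2) tvec_of_tangent[OF c(1) qD(1)]])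
        show "X' (\<pi> q) \<in> tangent_space B (\<pi> q)" by (rule B.vector_fieldD(3)[OF X' qD(4)])
        show "B.coords d (push q (tvec_of D c q (\<alpha> (c q)))) = B.coords d (X' (\<pi> q))"
          using e loc_derivative[of q] Nq by (simp add: w_def)
      qed
    qed
    then show ?thesis
      using vf N c(2) S'(2) dom0(4) by (intro exI[of _ "{q \<in> D. c q \<in> S'}"] exI[of _ "\<lambda>q. tvec_of D c q (\<alpha> (c q))"]) auto
  qed
  define s where "s y = inv_into D c (G (d y, c p \<bullet> ?f))" for y
  have locp: "loc (c p) = d (\<pi> p)" using chart(5)[OF c] by (simp add: loc_def)
  have sp: "s (\<pi> p) = p" using hm(1)[OF S(2)] locp chart(5)[OF c] by (simp add: s_def)
  define T' where "T' R = d ` E \<inter> (\<lambda>z. (z, c p \<bullet> ?f)) -` (T \<inter> G -` R)" for R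
  have GT: "open (T \<inter> G -` R)" if "open R" for R
    using continuous_open_preimage[OF smooth_on_continuous_on[OF G] T that] .
  have T': "open (T' R)" "d (\<pi> p) \<in> T' R" if "open R" "c p \<in> R" for R
  proof -
    have "open ((\<lambda>z :: 'f. (z, c p \<bullet> ?f)) -` (T \<inter> G -` R))"
      by (rule open_vimage[OF GT[OF that(1)]]) (intro continuous_intros)
    then show "open (T' R)" using B.chart(2)[OF d(1)] by (auto simp: T'_def)
    show "d (\<pi> p) \<in> T' R" using hm(1)[OF S(2)] locp that d(2) by (auto simp: T'_def)
  qed
  have smt: "smooth_near B (\<pi> p) (\<lambda>y. f (s y))" if f: "smooth_near A p f" for f
  proof -
    obtain r where r: "r > 0" "ball (c p) r \<subseteq> c ` D" "smooth_on (ball (c p) r) (\<lambda>x. f (inv_into D c x))"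
      using smooth_near_chart_ball[OF c f] .
    have o: "open (T' (ball (c p) r))" "d (\<pi> p) \<in> T' (ball (c p) r)" using T'[OF open_ball] r(1) by auto
    have s1: "smooth_on (T' (ball (c p) r)) (\<lambda>z. (z, c p \<bullet> ?f))"
      by (intro smooth_on_Pair smooth_on_ident smooth_on_const o)
    have s2: "smooth_on (T' (ball (c p) r)) (\<lambda>z. G (z, c p \<bullet> ?f))"
      by (rule smooth_on_compose[OF o(1) T G s1]) (auto simp: T'_def)
    have "smooth_on (T' (ball (c p) r)) (\<lambda>z. f (inv_into D c (G (z, c p \<bullet> ?f))))"
      by (rule smooth_on_compose[OF o(1) open_ball r(3) s2]) (auto simp: T'_def)
    then have "smooth_fun B {y \<in> E. d y \<in> T' (ball (c p) r)} (\<lambda>y. f (inv_into D c (G (d y, c p \<bullet> ?f))))"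
      by (intro B.smooth_fun_of_coords[OF d(1) o(1)]) (auto simp: T'_def)
    then show ?thesis unfolding s_def by (rule B.smooth_nearI) (use o d(2) in auto)
  qed
  have "\<exists>N'. open N' \<and> \<pi> p \<in> N' \<and> (\<forall>y\<in>N'. s y \<in> O' \<inter> U \<and> \<pi> (s y) = y)" if O': "open O'" "p \<in> O'" for O'
  proof -
    define R where "R = c ` (dom0 \<inter> O')"
    have R: "open R" "c p \<in> R" using open_chart_image[OF c(1), of "dom0 \<inter> O'"] dom0(1-3) O' by (auto simp: R_def)
    show ?thesis
    proof (intro exI conjI ballI)
      show "open {y \<in> E. d y \<in> T' R}" by (rule B.open_chart_preimage[OF d(1) T'(1)[OF R]])
      show "\<pi> p \<in> {y \<in> E. d y \<in> T' R}" using T'(2)[OF R] d(2) by simp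
      fix y assume y: "y \<in> {y \<in> E. d y \<in> T' R}"
      then have z: "(d y, c p \<bullet> ?f) \<in> T" "G (d y, c p \<bullet> ?f) \<in> R" by (auto simp: T'_def)
      have sy: "s y \<in> dom0 \<inter> O'" using z(2) dom0(3) chart(5)[OF c(1)] by (auto simp: s_def R_def)
      have "loc (G (d y, c p \<bullet> ?f)) = d y" using hm(2)[OF z(1)] by simp
      then have "d (\<pi> (s y)) = d y" by (simp add: loc_def s_def)
      moreover have "\<pi> (s y) \<in> E" using sy by (auto simp: dom0_def)
      ultimately show "\<pi> (s y) = y" using B.chart(5)[OF d(1)] y by (metis (no_types, lifting) mem_Collect_eq)
      show "s y \<in> O' \<inter> U" using sy dom0(4) by blast
    qed
  qed
  then show "\<exists>s. s (\<pi> p) = p \<and> (\<forall>f. smooth_near A p f \<longrightarrow> smooth_near B (\<pi> p) (\<lambda>y. f (s y))) \<and>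
      (\<forall>O'. open O' \<longrightarrow> p \<in> O' \<longrightarrow> (\<exists>N'. open N' \<and> \<pi> p \<in> N' \<and> (\<forall>y\<in>N'. s y \<in> O' \<inter> U \<and> \<pi> (s y) = y)))"
    using sp smt by blast
qed

end

end

section \<open>The induced structure on a leaf space\<close>

context leaf_space
begin

lemma chartsE:
  assumes "p \<in> U"
  obtains D c E d where "(D, c) \<in> A" "p \<in> D" "(E, d) \<in> B" "\<pi> p \<in> E"
  using carrierE[OF UA(1)[OF assms]] B.carrierE[OF UA(2)[OF assms]] by metis

lemma kernel:
  assumes "p \<in> U" "v \<in> tangent_space A p" "push p v = 0"
  obtains r where "v = r *\<^sub>T \<xi> p"
  using chartsE[OF assms(1)] vertical assms by metis

lemma lift:
  assumes "p \<in> U" "vector_field B W X'" "\<pi> p \<in> W"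
  obtains N X where "p \<in> N" "N \<subseteq> U" "\<pi> ` N \<subseteq> W" "vector_field A N X" "fields_related B \<pi> N X X'"
proof -
  obtain D c E d where "(D, c) \<in> A" "p \<in> D" "(E, d) \<in> B" "\<pi> p \<in> E" using chartsE[OF assms(1)] .
  from lift_and_section_at(1)[OF this assms] show ?thesis using that by blast
qed

lemma lift2:
  assumes p: "p \<in> U" and X': "vector_field B W X'" and Y': "vector_field B W Y'" and W: "\<pi> p \<in> W"
  obtains N X Y where "p \<in> N" "N \<subseteq> U" "\<pi> ` N \<subseteq> W" "vector_field A N X" "fields_related B \<pi> N X X'"
    "vector_field A N Y" "fields_related B \<pi> N Y Y'"
proof -
  obtain N X where X: "p \<in> N" "N \<subseteq> U" "\<pi> ` N \<subseteq> W" "vector_field A N X" "fields_related B \<pi> N X X'"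
    using lift[OF p X' W] .
  obtain N' Y where Y: "p \<in> N'" "N' \<subseteq> U" "\<pi> ` N' \<subseteq> W" "vector_field A N' Y" "fields_related B \<pi> N' Y Y'"
    using lift[OF p Y' W] .
  show ?thesis
    using that[of "N \<inter> N'" X Y] vector_field_Int[OF X(4) Y(4)] X Y unfolding fields_related_def by auto
qed

lemma section_at:
  assumes "p \<in> U"
  obtains s where "s (\<pi> p) = p" "\<And>f. smooth_near A p f \<Longrightarrow> smooth_near B (\<pi> p) (\<lambda>y. f (s y))"
    "\<And>O'. open O' \<Longrightarrow> p \<in> O' \<Longrightarrow> \<exists>N'. open N' \<and> \<pi> p \<in> N' \<and> (\<forall>y\<in>N'. s y \<in> O' \<inter> U \<and> \<pi> (s y) = y)"
proof -
  obtain D c E d where "(D, c) \<in> A" "p \<in> D" "(E, d) \<in> B" "\<pi> p \<in> E" using chartsE[OF assms(1)] .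
  from lift_and_section_at(2)[OF this assms] show ?thesis using that by blast
qed

lemma push_congr:
  assumes "invariant \<phi>" "p \<in> U" "v \<in> tangent_space A p" "w \<in> tangent_space A p" "push p v = push p w"
  shows "push p (\<phi> p v) = push p (\<phi> p w)"
proof -
  have t: "tensor_field A \<phi>" "\<phi> p (\<xi> p) = 0" using assms(1) UA(1)[OF assms(2)] unfolding invariant_def by auto
  obtain r where "v - w = r *\<^sub>T \<xi> p"
    using kernel[OF assms(2) tangent_closed(4)[OF assms(3,4)]] assms(5) by (auto simp: pushforward_linear)
  then have "\<phi> p v - \<phi> p w = 0"
    using tensorD(5)[OF t(1) UA(1)[OF assms(2)] assms(3,4)] tensorD(2)[OF t(1) UA(1)[OF assms(2)] xi(3)[OF UA(1)[OF assms(2)]], of r] t(2)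
    by (simp add: scale_simps)
  then show ?thesis by simp
qed

text \<open>Along a fibre, which is one connected piece of a leaf, the projection of \<open>\<phi> v\<close> for a lift \<open>v\<close> of a fixed vector
  has derivative zero: for a projectable field \<open>X\<close> the bracket \<open>[\<xi>, X]\<close> is vertical, hence killed by \<open>\<phi>\<close>, and
  \<open>[\<xi>, \<phi> X] = \<phi> [\<xi>, X]\<close>.\<close>

lemma push_along_fibre:
  assumes \<phi>: "invariant \<phi>" and p: "p \<in> U" "v \<in> tangent_space A p" and q: "q \<in> U" "w \<in> tangent_space A q"
    and eq: "\<pi> p = \<pi> q" "push p v = push q w"
  shows "push p (\<phi> p v) = push q (\<phi> q w)"
proof
  fix g
  have t: "tensor_field A \<phi>" and z: "\<And>p. p \<in> carrier A \<Longrightarrow> \<phi> p (\<xi> p) = 0"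
    and b: "\<And>U X p. vector_field A U X \<Longrightarrow> p \<in> U \<Longrightarrow> lie_bracket A \<xi> (act \<phi> X) p = \<phi> p (lie_bracket A \<xi> X p)"
    using \<phi> unfolding invariant_def by auto
  show "push p (\<phi> p v) g = push q (\<phi> q w) g"
  proof (cases "smooth_near B (\<pi> p) g")
    case True
    define y where "y = \<pi> p"
    define w0 where "w0 = push p v"
    have yB: "y \<in> carrier B" and w0: "w0 \<in> tangent_space B y"
      using UA(2)[OF p(1)] pushforward_tangent[OF submersion(1) p] by (auto simp: y_def w0_def)
    obtain W X' where X': "y \<in> W" "vector_field B W X'" "X' y = w0" using B.vector_field_extension[OF yB w0] .
    obtain V where V: "y \<in> V" "smooth_fun B V g" using True unfolding smooth_near_def y_def by blast
    obtain I \<gamma> where I: "open I" "is_interval I" "integral_curve A \<xi> I \<gamma>" "{q\<in>U. \<pi> q = y} = \<gamma> ` I"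
      using submersion(4)[OF yB] unfolding leaf_piece_def by blast
    have \<gamma>: "\<gamma> t \<in> U" "\<pi> (\<gamma> t) = y" if "t \<in> I" for t using I(4) that by blast+
    define L where "L t = (SOME u. u \<in> tangent_space A (\<gamma> t) \<and> push (\<gamma> t) u = w0)" for t
    have L: "L t \<in> tangent_space A (\<gamma> t) \<and> push (\<gamma> t) (L t) = w0" if "t \<in> I" for t
    proof -
      have "w0 \<in> push (\<gamma> t) ` tangent_space A (\<gamma> t)" using submersion(2)[OF \<gamma>(1)[OF that]] \<gamma>(2)[OF that] w0 by simp
      then have "\<exists>u. u \<in> tangent_space A (\<gamma> t) \<and> push (\<gamma> t) u = w0" by blast
      then show ?thesis unfolding L_def by (rule someI_ex)
    qed
    \<comment> \<open>no regularity of the choice \<open>L\<close> is known; near each time \<open>F\<close> is compared with a smooth lift\<close>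
    define F where "F t = push (\<gamma> t) (\<phi> (\<gamma> t) (L t)) g" for t
    have "(F has_real_derivative 0) (at t0)" if t0: "t0 \<in> I" for t0
    proof -
      obtain N X where X: "\<gamma> t0 \<in> N" "N \<subseteq> U" "\<pi> ` N \<subseteq> W" "vector_field A N X" "fields_related B \<pi> N X X'"
        using lift[OF \<gamma>(1)[OF t0] X'(2)] X'(1) \<gamma>(2)[OF t0] by metis
      define f where "f r = act \<phi> X r (\<lambda>r. g (\<pi> r))" for r
      define J where "J = I \<inter> \<gamma> -` N"
      have J: "open J" "t0 \<in> J"
        using I(1,3) vector_fieldD(1)[OF X(4)] continuous_open_preimage t0 X(1) unfolding J_def integral_curve_def by auto
      note \<phi>X = tensor_act[OF t X(4)] and \<xi>N = xi_on[OF X(4)]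
      have q0: "\<gamma> t0 \<in> U" "\<gamma> t0 \<in> carrier A" "smooth_near B (\<pi> (\<gamma> t0)) g"
        using \<gamma>[OF t0] UA(1) True by (auto simp: y_def)
      have gn: "smooth_near A (\<gamma> t0) (\<lambda>r. g (\<pi> r))" by (rule smooth_near_pullback[OF submersion(1) q0(1,3)])
      have fF: "F t = f (\<gamma> t)" if "t \<in> J" for t
      proof -
        have tI: "t \<in> I" "\<gamma> t \<in> N" using that by (auto simp: J_def)
        have "push (\<gamma> t) (X (\<gamma> t)) = w0" using X(5) tI X'(3) \<gamma>(2) unfolding fields_related_def by auto
        then have "push (\<gamma> t) (\<phi> (\<gamma> t) (L t)) = push (\<gamma> t) (\<phi> (\<gamma> t) (X (\<gamma> t)))"
          using L[OF tI(1)] vector_fieldD(3)[OF X(4) tI(2)] \<gamma>(1)[OF tI(1)] by (intro push_congr[OF \<phi>]) auto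
        then show ?thesis
          using True \<gamma>(2)[OF tI(1)] by (simp add: F_def f_def y_def act_def pushforward_apply[OF submersion(1)])
      qed
      have "smooth_near A (\<gamma> t0) f" unfolding f_def by (rule vector_field_near[OF \<phi>X X(1) gn])
      then have "((f \<circ> \<gamma>) has_real_derivative \<xi> (\<gamma> t0) f) (at t0)"
        using I(3) t0 unfolding integral_curve_def by blast
      moreover have "\<xi> (\<gamma> t0) f = 0"
      proof -
        have "fields_related B \<pi> N \<xi> (\<lambda>y. 0)" using X(2) push_xi unfolding fields_related_def by auto
        moreover have "vector_field B W (\<lambda>y. 0)" using B.vector_field_cmul[OF X'(2), of 0] by (simp add: scale_simps)
        ultimately have "push (\<gamma> t0) (lie_bracket A \<xi> X (\<gamma> t0)) = lie_bracket B (\<lambda>y. 0) X' (\<pi> (\<gamma> t0))"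
          using related_bracket[OF submersion(1) \<xi>N _ _ X(4) X'(2) X(5) X(2,3)] X(1) unfolding fields_related_def by auto
        also have "\<dots> = 0"
          unfolding \<gamma>(2)[OF t0]
          by (rule B.bracket_zero(2)[where W = W]) (use B.vector_fieldD(1,3)[OF X'(2)] X'(1) in auto)
        finally obtain r where "lie_bracket A \<xi> X (\<gamma> t0) = r *\<^sub>T \<xi> (\<gamma> t0)"
          using kernel[OF q0(1) bracket_tangent[OF \<xi>N X(4,1)]] by blast
        then have "lie_bracket A \<xi> (act \<phi> X) (\<gamma> t0) = 0"
          using b[OF X(4,1)] tensorD(2)[OF t q0(2) xi(3)[OF q0(2)], of r] z[OF q0(2)] by (simp add: scale_simps)
        moreover have "act \<phi> X (\<gamma> t0) (\<lambda>r. \<xi> r (\<lambda>r. g (\<pi> r))) = act \<phi> X (\<gamma> t0) (\<lambda>r. 0)"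
        proof (rule tangent_local[OF vector_fieldD(3)[OF \<phi>X X(1)] open_preimage[OF submersion(1) B.smooth_funD(1)[OF V(2)]]])
          show "\<gamma> t0 \<in> U \<inter> \<pi> -` V" using q0(1) \<gamma>(2)[OF t0] V(1) by simp
          show "\<xi> r (\<lambda>r. g (\<pi> r)) = 0" if "r \<in> U \<inter> \<pi> -` V" for r
            using pushforward_apply[OF submersion(1) B.smooth_nearI[OF V(2), of "\<pi> r"], where v = "\<xi> r"] push_xi[of r] that by simp
        qed
        ultimately show ?thesis
          using tangent_const[OF vector_fieldD(3)[OF \<phi>X X(1)], of 0] gn
          by (auto simp: lie_bracket_def f_def[abs_def] fun_eq_iff dest!: spec[of _ "\<lambda>r. g (\<pi> r)"])
      qed
      ultimately have "((f \<circ> \<gamma>) has_real_derivative 0) (at t0)" by simp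
      then show ?thesis
        by (rule has_field_derivative_transform_within_open[OF _ J]) (simp add: fF)
    qed
    then obtain k where k: "\<And>t. t \<in> I \<Longrightarrow> F t = k"
      using has_field_derivative_zero_constant[OF is_interval_convex[OF I(2)], of F] has_field_derivative_at_within by metis
    have "push r (\<phi> r u) g = k" if "r \<in> U" "\<pi> r = y" "u \<in> tangent_space A r" "push r u = w0" for r u
    proof -
      obtain t where t: "t \<in> I" "r = \<gamma> t" using I(4) \<open>r \<in> U\<close> \<open>\<pi> r = y\<close> by blast
      have "push r (\<phi> r u) = push r (\<phi> r (L t))" using L[OF t(1)] that t(2) by (intro push_congr[OF \<phi>]) auto
      then show ?thesis using k[OF t(1)] t(2) by (simp add: F_def)
    qed
    then show ?thesis using p q eq by (simp add: y_def w0_def)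
  qed (simp add: pushforward_def eq(1))
qed

text \<open>Any lift of \<open>w\<close> at any point over \<open>y\<close> gives the same value when \<open>\<phi>\<close> is invariant (\<open>push_along_fibre\<close>).\<close>

definition induced :: "'a tensor11 \<Rightarrow> 'b tensor11" where
  "induced \<phi> y w = (case SOME (p, v). p \<in> U \<and> \<pi> p = y \<and> v \<in> tangent_space A p \<and> push p v = w of (p, v) \<Rightarrow> push p (\<phi> p v))"

lemma induced_push:
  assumes "invariant \<phi>" "p \<in> U" "v \<in> tangent_space A p"
  shows "push p (\<phi> p v) = induced \<phi> (\<pi> p) (push p v)"
proof -
  define c where "c = (SOME (q, u). q \<in> U \<and> \<pi> q = \<pi> p \<and> u \<in> tangent_space A q \<and> push q u = push p v)"
  have "case c of (q, u) \<Rightarrow> q \<in> U \<and> \<pi> q = \<pi> p \<and> u \<in> tangent_space A q \<and> push q u = push p v"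
    unfolding c_def by (rule someI[of _ "(p, v)"]) (use assms in auto)
  then show ?thesis
    using push_along_fibre[OF assms(1) _ _ assms(2,3)] unfolding induced_def c_def[symmetric] by (cases c) auto
qed

lemma intertwines_induced: "invariant \<phi> \<Longrightarrow> intertwines U \<pi> \<phi> (induced \<phi>)"
  unfolding intertwines_def[OF submersion(1)] using induced_push by blast

lemma fibreE:
  assumes "y \<in> carrier B"
  obtains p where "p \<in> U" "\<pi> p = y"
proof -
  have "y \<in> \<pi> ` U" using assms submersion(3) by simp
  then show ?thesis using that by auto
qed

lemma preimageE:
  assumes "y \<in> carrier B" "w \<in> tangent_space B y"
  obtains p v where "p \<in> U" "\<pi> p = y" "v \<in> tangent_space A p" "push p v = w"
proof -
  obtain p where p: "p \<in> U" "\<pi> p = y" using fibreE[OF assms(1)] .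
  then have "w \<in> push p ` tangent_space A p" using submersion(2)[OF p(1)] assms(2) by simp
  then show ?thesis using that p by blast
qed

text \<open>Linearity is clear over a single point. For smoothness, near \<open>y\<close> the value on a field \<open>X'\<close> is that of \<open>\<phi>\<close> on a lift
  of \<open>X'\<close>, read along a local section of \<open>\<pi>\<close>.\<close>

lemma induced_tensor:
  assumes \<phi>: "invariant \<phi>"
  shows "tensor_field B (induced \<phi>)"
  unfolding tensor_field_def
proof (intro conjI ballI allI impI)
  have t: "tensor_field A \<phi>" using \<phi> unfolding invariant_def by blast
  fix y w w' r assume y: "y \<in> carrier B" "w \<in> tangent_space B y" and w': "w' \<in> tangent_space B y"
  obtain p v where p: "p \<in> U" "\<pi> p = y" "v \<in> tangent_space A p" "push p v = w" using preimageE[OF y] .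
  obtain v' where v': "v' \<in> tangent_space A p" "push p v' = w'" using submersion(2)[OF p(1)] w' p(2) by (metis (no_types, lifting) image_iff)
  note T = tensorD[OF t UA(1)[OF p(1)]] and ip = induced_push[OF \<phi> p(1)]
  show "induced \<phi> y w \<in> tangent_space B y"
    using pushforward_tangent[OF submersion(1) p(1) T(1)[OF p(3)]] ip[OF p(3)] p by simp
  show "induced \<phi> y (w + w') = induced \<phi> y w + induced \<phi> y w'"
    using ip[OF p(3)] ip[OF v'(1)] ip[OF tangent_closed(3)[OF p(3) v'(1)]] T(4)[OF p(3) v'(1)] p v' by (simp add: pushforward_linear)
  show "induced \<phi> y (r *\<^sub>T w) = r *\<^sub>T induced \<phi> y w"
    using ip[OF p(3)] ip[OF tangent_closed(1)[OF p(3)], of r] T(2)[OF p(3), of r] p by (simp add: pushforward_linear)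
next
  have t: "tensor_field A \<phi>" using \<phi> unfolding invariant_def by blast
  fix W X' assume X': "vector_field B W X'"
  show "vector_field B W (act (induced \<phi>) X')"
  proof (rule B.vector_fieldI[OF B.vector_fieldD(1,2)[OF X']])
    show "act (induced \<phi>) X' y \<in> tangent_space B y" if yW: "y \<in> W" for y
    proof -
      obtain p v where p: "p \<in> U" "\<pi> p = y" "v \<in> tangent_space A p" "push p v = X' y"
        using preimageE[OF subsetD[OF B.vector_fieldD(2)[OF X'] yW] B.vector_fieldD(3)[OF X' yW]] .
      show ?thesis
        using pushforward_tangent[OF submersion(1) p(1) tensorD(1)[OF t UA(1)[OF p(1)] p(3)]] induced_push[OF \<phi> p(1,3)] p
        by (simp add: act_def)
    qed
    fix V g assume V: "V \<subseteq> W" "smooth_fun B V g"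
    show "smooth_fun B V (\<lambda>y. act (induced \<phi>) X' y g)"
    proof (rule B.smooth_fun_local)
      fix y assume y: "y \<in> V"
      then obtain p where p: "p \<in> U" "\<pi> p = y" using fibreE B.smooth_funD(2)[OF V(2)] by (metis subsetD)
      obtain N X where X: "p \<in> N" "N \<subseteq> U" "\<pi> ` N \<subseteq> W" "vector_field A N X" "fields_related B \<pi> N X X'"
        using lift[OF p(1) X'] p(2) y V(1) by (metis subsetD)
      obtain s where s: "s (\<pi> p) = p" "\<And>f. smooth_near A p f \<Longrightarrow> smooth_near B (\<pi> p) (\<lambda>y. f (s y))"
        "\<And>O'. open O' \<Longrightarrow> p \<in> O' \<Longrightarrow> \<exists>N'. open N' \<and> \<pi> p \<in> N' \<and> (\<forall>y\<in>N'. s y \<in> O' \<inter> U \<and> \<pi> (s y) = y)"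
        by (rule section_at[OF p(1)]) (rule that)
      have "smooth_near A p (\<lambda>q. act \<phi> X q (\<lambda>r. g (\<pi> r)))"
        by (rule vector_field_near[OF tensor_act[OF t X(4)] X(1) smooth_near_pullback[OF submersion(1) p(1) B.smooth_nearI[OF V(2)]]])
          (use p y in simp)
      then have sm: "smooth_near B y (\<lambda>y. act \<phi> X (s y) (\<lambda>r. g (\<pi> r)))" using s(2) p(2) by blast
      obtain N' where N': "open N'" "y \<in> N'" "\<And>y. y \<in> N' \<Longrightarrow> s y \<in> N \<inter> U \<and> \<pi> (s y) = y"
        using s(3)[OF vector_fieldD(1)[OF X(4)] X(1)] p(2) by blast
      have NV: "open (N' \<inter> V)" "y \<in> N' \<inter> V" using N' y B.smooth_funD(1)[OF V(2)] by auto
      have eq: "act \<phi> X (s y) (\<lambda>r. g (\<pi> r)) = act (induced \<phi>) X' y g" if "y \<in> N' \<inter> V" for y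
      proof -
        have sy: "s y \<in> N" "s y \<in> U" "\<pi> (s y) = y" using N'(3) that by auto
        have "push (s y) (X (s y)) = X' y" using X(5) sy unfolding fields_related_def by auto
        then show ?thesis
          using induced_push[OF \<phi> sy(2) vector_fieldD(3)[OF X(4) sy(1)]] B.smooth_nearI[OF V(2), of y] that sy(3)
            pushforward_apply[OF submersion(1), of "s y" g "\<phi> (s y) (X (s y))"] by (simp add: act_def)
      qed
      obtain O' where O': "y \<in> O'" "O' \<subseteq> N' \<inter> V" "smooth_fun B O' (\<lambda>y. act \<phi> X (s y) (\<lambda>r. g (\<pi> r)))"
        using B.smooth_nearE[OF sm NV] .
      have "smooth_fun B O' (\<lambda>y. act (induced \<phi>) X' y g)"
        by (rule B.smooth_fun_cong[OF O'(3)]) (use eq O'(2) in blast)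
      then show "\<exists>N. y \<in> N \<and> N \<subseteq> V \<and> smooth_fun B N (\<lambda>y. act (induced \<phi>) X' y g)" using O'(1,2) by blast
    qed
  qed
qed

text \<open>The Nijenhuis tensors of related tensors are related, and multiples of \<open>\<xi>\<close> project to zero.\<close>

lemma induced_integrable:
  assumes \<phi>: "invariant \<phi>" and N: "\<And>U X Y p. vector_field A U X \<Longrightarrow> vector_field A U Y \<Longrightarrow> p \<in> U \<Longrightarrow> \<exists>r. nijenhuis A \<phi> X Y p = r *\<^sub>T \<xi> p"
  shows "integrable_tensor B (induced \<phi>)"
  unfolding integrable_tensor_def
proof (intro allI impI ballI)
  fix W X' Y' y assume X': "vector_field B W X'" and Y': "vector_field B W Y'" and y: "y \<in> W"
  then obtain p where p: "p \<in> U" "\<pi> p = y" using fibreE B.vector_fieldD(2)[OF X'] by (metis subsetD)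
  obtain N X Y where l: "p \<in> N" "N \<subseteq> U" "\<pi> ` N \<subseteq> W" "vector_field A N X" "fields_related B \<pi> N X X'"
    "vector_field A N Y" "fields_related B \<pi> N Y Y'" using lift2[OF p(1) X' Y'] p(2) y by metis
  have t: "tensor_field A \<phi>" using \<phi> unfolding invariant_def by blast
  obtain r where "nijenhuis A \<phi> X Y p = r *\<^sub>T \<xi> p" using N[OF l(4,6,1)] by blast
  then show "nijenhuis B (induced \<phi>) X' Y' y = 0"
    using related_nijenhuis[OF submersion(1) t induced_tensor[OF \<phi>] intertwines_induced[OF \<phi>] l(4) X' l(5,6) Y' l(7,2,3,1)]
      push_xi[OF p(1)] p(2) by (simp add: pushforward_linear scale_simps)
qed

lemma anti_hypercomplex_induced: "anti_hypercomplex B (induced \<phi>1) (induced \<phi>2) (induced \<phi>3)"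
proof -
  have rel: "induced \<phi>1 y (induced \<phi>1 y w) = w \<and> induced \<phi>2 y (induced \<phi>2 y w) = w \<and> induced \<phi>3 y (induced \<phi>3 y w) = - w \<and>
      induced \<phi>1 y (induced \<phi>2 y w) = - induced \<phi>2 y (induced \<phi>1 y w) \<and> induced \<phi>1 y (induced \<phi>2 y w) = induced \<phi>3 y w"
    if y: "y \<in> carrier B" "w \<in> tangent_space B y" for y w
  proof -
    obtain p v where p: "p \<in> U" "\<pi> p = y" "v \<in> tangent_space A p" "push p v = w" using preimageE[OF y] .
    note pA = UA(1)[OF p(1)]
    have c: "induced \<phi> y (induced \<psi> y w) = push p (\<phi> p (\<psi> p v))" "induced \<phi> y w = push p (\<phi> p v)"
      if "invariant \<phi>" "invariant \<psi>" for \<phi> \<psi>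
    proof -
      have "tensor_field A \<psi>" using that unfolding invariant_def by blast
      then show "induced \<phi> y (induced \<psi> y w) = push p (\<phi> p (\<psi> p v))" "induced \<phi> y w = push p (\<phi> p v)"
        using induced_push[OF that(1) p(1) tensorD(1)[OF _ pA p(3)]] induced_push[OF that(2) p(1,3)] induced_push[OF that(1) p(1,3)] p by auto
    qed
    have neg: "(-1) *\<^sub>T u = - u" for u :: "'b tvec" by (auto simp: scale_def)
    note i = phi_invariant
    have "induced \<phi>3 y (induced \<phi>3 y w) = - w"
      unfolding c(1)[OF i(3,3)] phi_rel(5)[OF pA p(3)] using p(4) push_xi[OF p(1)]
      by (simp add: pushforward_linear scale_simps(4-8) neg)
    then show ?thesis
      unfolding c(1)[OF i(1,1)] c(1)[OF i(2,2)] c(1)[OF i(1,2)] c(1)[OF i(2,1)] phi_rel(2,3)[OF pA p(3)]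
      using c(2)[OF i(3,3)] phi_rel(1,4)[OF pA p(3)] p(4) push_xi[OF p(1)]
      by (simp add: pushforward_linear scale_simps(4-8) neg)
  qed
  show ?thesis
    unfolding anti_hypercomplex_def product_structure_def complex_structure_def
    using rel induced_tensor[OF phi_invariant(1)] induced_tensor[OF phi_invariant(2)] induced_tensor[OF phi_invariant(3)]
      induced_integrable[OF phi_invariant(1)] induced_integrable[OF phi_invariant(2)] induced_integrable[OF phi_invariant(3)]
      nijenhuis_normal by blast
qed

text \<open>Both connections are given by the bracket formula, which is compatible with \<open>\<pi>\<close>.\<close>

lemma canonical_projects:
  assumes D: "canonical_connection A \<eta> \<xi> \<phi>1 \<phi>2 \<phi>3 \<D>"
  shows "\<exists>\<D>'. obata_connection B (induced \<phi>1) (induced \<phi>2) (induced \<phi>3) \<D>' \<and> connection_projects A \<eta> \<xi> B U \<pi> \<D> \<D>'"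
proof -
  interpret J: complex_product B "induced \<phi>1" "induced \<phi>2" "induced \<phi>3"
    by unfold_locales (rule anti_hypercomplex_induced)
  have "connection_projects A \<eta> \<xi> B U \<pi> \<D> J.\<D>J"
    unfolding connection_projects_def
  proof (intro allI impI)
    fix W W' X Y X' Y'
    assume W: "W \<subseteq> U" "\<pi> ` W \<subseteq> W'" and bX: "basic_field A \<eta> \<xi> W X" and bY: "basic_field A \<eta> \<xi> W Y"
      and X': "vector_field B W' X'" and Y': "vector_field B W' Y'"
      and r: "fields_related B \<pi> W X X'" "fields_related B \<pi> W Y Y'"
    have X: "vector_field A W X" "\<And>q. q \<in> W \<Longrightarrow> \<eta> q (X q) = 0" and Y: "vector_field A W Y" "\<And>q. q \<in> W \<Longrightarrow> \<eta> q (Y q) = 0"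
      using bX bY unfolding basic_field_def by auto
    note i = intertwines_induced[OF phi_invariant(1)] intertwines_induced[OF phi_invariant(2)]
    have "fields_related B \<pi> W (E X Y) (J.E X' Y')"
      by (rule related_obata_op[OF submersion(1) tensor J.tensor intertwines_parts[OF submersion(1) phi_tensor(1) i(1)] i(2)
            X(1) X' r(1) Y(1) Y' r(2) W])
    then show "fields_related B \<pi> W (\<lambda>p. \<D> p (X p) Y) (\<lambda>y. J.\<D>J y (X' y) Y')"
      using canonical_eq_E(1)[OF D X Y] J.obata_conn_eq[OF X' Y'] W(2) unfolding fields_related_def by auto
  qed
  then show ?thesis using J.obata_connection_obata_conn by blast
qed

lemma tensor_projects_induced: "invariant \<phi> \<Longrightarrow> tensor_projects A B U \<pi> \<phi> (induced \<phi>)"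
  unfolding tensor_projects_def using induced_push by blast

end

section \<open>Existence of local leaf spaces\<close>

text \<open>Move the hyperplane orthogonal to \<open>f x0\<close> along the flow. At the origin the derivative is the inclusion of the
  hyperplane plus the direction \<open>f x0\<close>, hence invertible.\<close>

lemma smooth_flow_box:
  fixes f :: "'e::euclidean_space \<Rightarrow> 'e"
  assumes S: "open S" "x0 \<in> S" "smooth_on S f" "f x0 \<noteq> 0" and dim: "DIM('e) = DIM('f::euclidean_space) + 1"
  obtains \<rho> H G where "0 < \<rho>" "open (H ` (ball (0 :: 'f) \<rho> \<times> {-\<rho><..<\<rho>}))" "H ` (ball 0 \<rho> \<times> {-\<rho><..<\<rho>}) \<subseteq> S" "H (0, 0) = x0"
    "\<And>z. z \<in> ball 0 \<rho> \<times> {-\<rho><..<\<rho>} \<Longrightarrow> G (H z) = z"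
    "smooth_on (ball 0 \<rho> \<times> {-\<rho><..<\<rho>}) H" "smooth_on (H ` (ball 0 \<rho> \<times> {-\<rho><..<\<rho>})) G"
    "\<And>y t. y \<in> ball 0 \<rho> \<Longrightarrow> \<bar>t\<bar> < \<rho> \<Longrightarrow> ((\<lambda>t. H (y, t)) has_vector_derivative f (H (y, t))) (at t)"
proof -
  obtain r \<delta> \<Phi> where \<Phi>: "0 < r" "0 < \<delta>" "smooth_on (ball x0 r \<times> {-\<delta><..<\<delta>}) \<Phi>"
    "\<And>z. z \<in> ball x0 r \<times> {-\<delta><..<\<delta>} \<Longrightarrow> \<Phi> z \<in> S" "\<And>x. x \<in> ball x0 r \<Longrightarrow> \<Phi> (x, 0) = x"
    "\<And>x t. x \<in> ball x0 r \<Longrightarrow> \<bar>t\<bar> < \<delta> \<Longrightarrow> ((\<lambda>t. \<Phi> (x, t)) has_vector_derivative f (\<Phi> (x, t))) (at t)"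
    by (rule smooth_local_flow[OF S(1-3)]) (rule that)
  have "dim (UNIV :: 'f set) = dim {x. f x0 \<bullet> x = 0}" using dim dim_hyperplane[OF S(4)] by simp
  then obtain L :: "'f \<Rightarrow> 'e" and K where L: "linear L" "L ` UNIV = {x. f x0 \<bullet> x = 0}" "\<And>y. K (L y) = y"
    using isometries_subspaces[OF subspace_UNIV subspace_hyperplane[of "f x0"]] by (metis UNIV_I)
  note lL = linear_conv_bounded_linear[THEN iffD1, OF L(1)]
  define H where "H z = \<Phi> (x0 + L (fst z), snd z)" for z
  define Q where "Q = {z :: 'f \<times> real. (x0 + L (fst z), snd z) \<in> ball x0 r \<times> {-\<delta><..<\<delta>}}"
  have shift: "continuous_on UNIV (\<lambda>z :: 'f \<times> real. (x0 + L (fst z), snd z))"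
    by (intro continuous_intros bounded_linear.continuous_on[OF lL])
  have Q: "open Q" "(0, 0) \<in> Q"
    using open_vimage[OF _ shift, of "ball x0 r \<times> {-\<delta><..<\<delta>}"] \<Phi>(1,2) linear_0[OF L(1)]
    by (auto simp: Q_def vimage_def open_Times)
  have "smooth_on Q (\<lambda>z. (x0 + L (fst z), snd z))"
    by (intro smooth_on_Pair smooth_on_add smooth_on_const Q(1) smooth_on_bounded_linear bounded_linear_snd
        bounded_linear_compose[OF lL bounded_linear_fst])
  from smooth_on_compose[OF Q(1) _ \<Phi>(3) this] have HQ: "smooth_on Q H"
    unfolding H_def by (auto simp: Q_def open_Times)
  let ?D = "frechet_derivative H (at (0, 0))"
  note HD = smooth_on_has_derivative[OF HQ Q(2)]
  have Dy: "?D (y, 0) = L y" for y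
  proof -
    have "((\<lambda>y :: 'f. (y, 0 :: real)) has_derivative (\<lambda>y. (y, 0))) (at 0)"
      by (intro bounded_linear_imp_has_derivative bounded_linear_Pair bounded_linear_ident bounded_linear_zero)
    then have "((\<lambda>y. H (y, 0)) has_derivative (\<lambda>y. ?D (y, 0))) (at 0)"
      by (rule has_derivative_compose[where g = H]) (simp add: HD)
    moreover have "((\<lambda>y. H (y, 0)) has_derivative L) (at 0)"
    proof (rule has_derivative_transform_within_open[where s = "{y. (y, 0) \<in> Q}"])
      have "((\<lambda>y. x0 + L y) has_derivative (\<lambda>y. 0 + L y)) (at 0)"
        by (intro has_derivative_add has_derivative_const bounded_linear_imp_has_derivative lL)
      then show "((\<lambda>y. x0 + L y) has_derivative L) (at 0)" by simp
      show "open {y. (y, 0) \<in> Q}"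
        using open_vimage[OF Q(1), of "\<lambda>y. (y, 0)"] by (simp add: vimage_def continuous_on_Pair)
    qed (use Q(2) in \<open>auto simp: H_def Q_def \<Phi>(5)\<close>)
    ultimately show ?thesis using has_derivative_unique by metis
  qed
  have Dt: "?D (0, t) = t *\<^sub>R f x0" for t
  proof -
    have "((\<lambda>t :: real. (0 :: 'f, t)) has_derivative (\<lambda>t. (0, t))) (at 0)"
      by (intro bounded_linear_imp_has_derivative bounded_linear_Pair bounded_linear_ident bounded_linear_zero)
    then have "((\<lambda>t. H (0, t)) has_derivative (\<lambda>t. ?D (0, t))) (at 0)"
      by (rule has_derivative_compose[where g = H]) (simp add: HD)
    moreover have "((\<lambda>t. H (0, t)) has_derivative (\<lambda>t. t *\<^sub>R f x0)) (at 0)"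
      using \<Phi>(6)[of x0 0] \<Phi>(1,2) \<Phi>(5)[of x0] linear_0[OF L(1)] by (simp add: H_def has_vector_derivative_def)
    ultimately show ?thesis using has_derivative_unique by metis
  qed
  have linD: "linear ?D" using has_derivative_linear[OF HD] .
  have "inj ?D"
    unfolding linear_injective_0[OF linD]
  proof (intro allI impI)
    fix z assume z: "?D z = 0"
    obtain y t where yt: "z = (y, t)" by (cases z)
    have "?D ((y, 0) + (0, t)) = ?D (y, 0) + ?D (0, t)" by (rule linear_add[OF linD])
    then have e: "L y + t *\<^sub>R f x0 = 0" using z yt by (simp add: Dy Dt)
    have "f x0 \<bullet> L y = 0" using L(2) by blast
    then have "f x0 \<bullet> (t *\<^sub>R f x0) = 0" using arg_cong[OF e, of "(\<bullet>) (f x0)"] by (simp add: inner_add_right)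
    then have "t = 0" using S(4) by simp
    then have "L y = 0" using e by simp
    then have "y = 0" using L(3)[of y] L(3)[of 0] linear_0[OF L(1)] by simp
    then show "z = 0" using yt \<open>t = 0\<close> by (simp add: zero_prod_def)
  qed
  moreover have "DIM('f \<times> real) = DIM('e)" using dim by simp
  ultimately obtain S' T G where G: "open S'" "S' \<subseteq> Q" "(0, 0) \<in> S'" "open T" "homeomorphism S' T H G" "smooth_on T G"
    using smooth_inverse_function[OF _ Q HQ] by blast
  obtain V1 V2 where V: "open V1" "open V2" "(0 :: 'f) \<in> V1" "(0 :: real) \<in> V2" "V1 \<times> V2 \<subseteq> S'"
    by (rule open_prod_elim[OF G(1,3)]) (auto intro: that)
  obtain \<rho>1 \<rho>2 where \<rho>: "0 < \<rho>1" "ball 0 \<rho>1 \<subseteq> V1" "0 < \<rho>2" "ball 0 \<rho>2 \<subseteq> V2" using V openE by metis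
  define \<rho> where "\<rho> = min \<rho>1 \<rho>2"
  let ?Z = "ball (0 :: 'f) \<rho> \<times> {-\<rho><..<\<rho>}"
  have "ball 0 \<rho> \<subseteq> ball (0 :: 'f) \<rho>1" "{-\<rho><..<\<rho>} \<subseteq> ball 0 \<rho>2" by (auto simp: \<rho>_def dist_norm)
  then have ZS: "?Z \<subseteq> S'" using \<rho>(2,4) V(5) by blast
  have Zop: "open ?Z" by (simp add: open_Times)
  have GH: "G (H z) = z \<and> H z \<in> T" if "z \<in> S'" for z using G(5) that by (auto simp: homeomorphism_def)
  have "H ` ?Z = T \<inter> G -` ?Z"
  proof (intro equalityI subsetI)
    fix x assume "x \<in> T \<inter> G -` ?Z"
    then have "x = H (G x)" "G x \<in> ?Z" using homeomorphism_apply2[OF G(5)] by auto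
    then show "x \<in> H ` ?Z" by (rule image_eqI)
  next
    fix x assume "x \<in> H ` ?Z"
    then obtain z where z: "z \<in> ?Z" "x = H z" by blast
    then have "G (H z) = z" "H z \<in> T" using GH[OF subsetD[OF ZS z(1)]] by auto
    then show "x \<in> T \<inter> G -` ?Z" using z by simp
  qed
  then have op: "open (H ` ?Z)"
    using continuous_open_preimage[OF smooth_on_continuous_on[OF G(6)] G(4) Zop] by simp
  show ?thesis
  proof (rule that[of \<rho> H G])
    show "0 < \<rho>" using \<rho> by (simp add: \<rho>_def)
    have "H z \<in> S" if "z \<in> Q" for z using \<Phi>(4) that unfolding H_def Q_def by blast
    then show "H ` ?Z \<subseteq> S" using ZS G(2) by blast
    show "H (0, 0) = x0" using \<Phi>(1,5) linear_0[OF L(1)] by (simp add: H_def)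
    show "smooth_on ?Z H" using smooth_on_subset[OF HQ] ZS G(2) by blast
    show "smooth_on (H ` ?Z) G" by (rule smooth_on_subset[OF G(6)]) (use GH ZS in auto)
    fix y t assume yt: "y \<in> ball (0 :: 'f) \<rho>" "\<bar>t\<bar> < \<rho>"
    then have "(y, t) \<in> ?Z" by auto
    then have "(y, t) \<in> Q" using ZS G(2) by blast
    then show "((\<lambda>t. H (y, t)) has_vector_derivative f (H (y, t))) (at t)"
      using \<Phi>(6)[of "x0 + L y" t] by (auto simp: H_def Q_def)
  qed (use op GH ZS in auto)
qed

lemma smooth_manifold_open_set:
  fixes N :: "'f::euclidean_space set"
  assumes "open N"
  shows "smooth_manifold {(N, \<lambda>x. x)}"
proof -
  have inv: "inv_into N (\<lambda>x. x) x = x" if "x \<in> N" for x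
    using inv_into_f_f[of "\<lambda>x. x" N x] that by (simp add: inj_on_def)
  have "continuous_on N (inv_into N (\<lambda>x. x))"
    using continuous_on_cong[of N N "inv_into N (\<lambda>x. x)" "\<lambda>x. x"] inv by simp
  moreover have "smooth_on N ((\<lambda>x. x) \<circ> inv_into N (\<lambda>x. x))"
    by (rule smooth_on_cong[OF assms _ smooth_on_ident[OF assms]]) (simp add: inv)
  ultimately show ?thesis
    using assms inv unfolding smooth_manifold_def by (auto intro!: homeomorphismI simp: comp_def)
qed

text \<open>The leaf space is a ball in the transversal of a flow box around \<open>p\<close>, and \<open>\<pi>\<close> forgets the time coordinate. The flow lines
  of the box are the fibres.\<close>

theorem (in manifold) local_leaf_space_exists:
  assumes \<xi>: "vector_field A (carrier A) \<xi>" "\<xi> p \<noteq> 0" and p: "p \<in> carrier A"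
    and dim: "DIM('e) = DIM('f::euclidean_space) + 1"
  shows "\<exists>(B :: ('f, 'f) atlas) U \<pi>. p \<in> U \<and> local_leaf_space A \<xi> B U \<pi>"
proof -
  obtain D c where c: "(D, c) \<in> A" "p \<in> D" using carrierE[OF p] .
  define f where "f x = coords c (\<xi> (inv_into D c x))" for x
  have "smooth_on (c ` D) (\<lambda>x. f x \<bullet> b)" if "b \<in> Basis" for b
    using smooth_funD(3)[OF vector_fieldD(4)[OF \<xi>(1) chart(4)[OF c(1)] smooth_fun_coord[OF c(1), of b]] c(1)]
    by (simp add: f_def coords_inner[OF that])
  then have fsm: "smooth_on (c ` D) f" by (rule smooth_on_componentwise[OF chart(2)[OF c(1)]])
  have \<xi>T: "\<xi> q \<in> tangent_space A q" if "q \<in> D" for q using vector_fieldD(3)[OF \<xi>(1)] chart(4)[OF c(1)] that by blast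
  have f0: "f (c p) \<noteq> 0"
    using coords_eqI[OF c \<xi>T[OF c(2)] tangent_zero] \<xi>(2) chart(5)[OF c] by (auto simp: f_def coords_linear)
  obtain \<rho> H G where \<rho>: "0 < \<rho>" and H: "open (H ` (ball (0 :: 'f) \<rho> \<times> {-\<rho><..<\<rho>}))"
    "H ` (ball 0 \<rho> \<times> {-\<rho><..<\<rho>}) \<subseteq> c ` D" "H (0, 0) = c p"
    "\<And>z. z \<in> ball 0 \<rho> \<times> {-\<rho><..<\<rho>} \<Longrightarrow> G (H z) = z"
    "smooth_on (ball 0 \<rho> \<times> {-\<rho><..<\<rho>}) H" "smooth_on (H ` (ball 0 \<rho> \<times> {-\<rho><..<\<rho>})) G"
    "\<And>y t. y \<in> ball 0 \<rho> \<Longrightarrow> \<bar>t\<bar> < \<rho> \<Longrightarrow> ((\<lambda>t. H (y, t)) has_vector_derivative f (H (y, t))) (at t)"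
    using smooth_flow_box[OF chart(2)[OF c(1)] imageI[OF c(2)] fsm f0 dim] by blast
  define N where "N = ball (0 :: 'f) \<rho>"
  define I where "I = {-\<rho><..<\<rho>}"
  note H = H[folded N_def I_def]
  have NI: "open N" "open I" "open (N \<times> I)" "0 \<in> N" "0 \<in> I" using \<rho> by (auto simp: N_def I_def open_Times)
  define B where "B = {(N, \<lambda>x :: 'f. x)}"
  have cB: "carrier B = N" by (simp add: carrier_def B_def)
  interpret B: manifold B by unfold_locales (simp add: B_def smooth_manifold_open_set NI(1))
  interpret manifold_pair A B ..
  have dB: "(N, \<lambda>x. x) \<in> B" by (simp add: B_def)
  let ?T = "H ` (N \<times> I)"
  define U where "U = {q \<in> D. c q \<in> ?T}"
  define \<pi> where "\<pi> q = fst (G (c q))" for q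
  have U: "open U" "U \<subseteq> D" "U \<subseteq> carrier A"
    using open_chart_preimage[OF c(1) H(1)] chart(4)[OF c(1)] by (auto simp: U_def)
  have Gsm: "smooth_on ?T (\<lambda>x. fst (G x) \<bullet> b)" for b
    by (rule smooth_on_inner_left[OF H(1) smooth_on_linear_comp[OF H(1) bounded_linear_fst H(6)]])
  have \<pi>sm: "smooth_fun A U (\<lambda>q. \<pi> q \<bullet> b)" for b
    unfolding U_def \<pi>_def by (rule smooth_fun_of_coords[OF c(1) H(1) Gsm H(2)])
  \<comment> \<open>the leaf through \<open>y\<close>, in terms of the flow box\<close>
  define \<gamma> where "\<gamma> y t = inv_into D c (H (y, t))" for y t
  have \<gamma>: "\<gamma> y t \<in> U \<and> c (\<gamma> y t) = H (y, t) \<and> \<pi> (\<gamma> y t) = y" if "y \<in> N" "t \<in> I" for y t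
  proof -
    have "H (y, t) \<in> ?T" using that by blast
    then have "inv_into D c (H (y, t)) \<in> D \<and> c (inv_into D c (H (y, t))) = H (y, t)" using H(2) chart(6)[OF c(1)] by blast
    then show ?thesis using \<open>H (y, t) \<in> ?T\<close> H(4)[of "(y, t)"] that by (simp add: U_def \<gamma>_def \<pi>_def)
  qed
  have U\<gamma>: "\<pi> q \<in> N \<and> (\<exists>t\<in>I. q = \<gamma> (\<pi> q) t)" if qU: "q \<in> U" for q
  proof -
    obtain y t where yt: "y \<in> N" "t \<in> I" "c q = H (y, t)" using qU unfolding U_def by auto
    then have "q = \<gamma> y t" using chart(5)[OF c(1), of q] qU unfolding U_def \<gamma>_def by auto
    then show ?thesis using \<gamma>[OF yt(1,2)] yt by auto
  qed
  have sm: "smooth_map A B U \<pi>"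
    unfolding smooth_map_def
  proof (intro conjI U)
    show "\<pi> ` U \<subseteq> carrier B" using U\<gamma> cB by auto
    have "continuous_on U c" by (rule continuous_on_subset[OF homeomorphism_cont1[OF chart(3)[OF c(1)]] U(2)])
    then have "continuous_on U (\<lambda>q. G (c q))"
      by (rule continuous_on_compose2[OF smooth_on_continuous_on[OF H(6)]]) (auto simp: U_def)
    then show "continuous_on U \<pi>" unfolding \<pi>_def by (rule continuous_on_fst)
    have "smooth_on (c' ` (D' \<inter> U)) (\<lambda>x. \<pi> (inv_into D' c' x))" if "(D', c') \<in> A" for D' c'
      by (rule smooth_on_componentwise[OF open_chart_image[OF that open_Int[OF chart(1)[OF that] U(1)]] smooth_funD(3)[OF \<pi>sm that]]) blast
    moreover have "D' \<inter> U \<inter> \<pi> -` N = D' \<inter> U" for D' using U\<gamma> by blast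
    ultimately show "\<forall>(D, c)\<in>A. \<forall>(E, d)\<in>B. smooth_on (c ` (D \<inter> U \<inter> \<pi> -` E)) (d \<circ> \<pi> \<circ> inv_into D c)"
      by (auto simp: B_def comp_def)
  qed
  have "pushforward B \<pi> q ` tangent_space A q = tangent_space B (\<pi> q)" if q: "q \<in> U" for q
  proof (intro equalityI subsetI)
    fix w assume w: "w \<in> tangent_space B (\<pi> q)"
    obtain t where t: "t \<in> I" "q = \<gamma> (\<pi> q) t" and y: "\<pi> q \<in> N" using U\<gamma>[OF q] by blast
    define z where "z = (\<pi> q, t)"
    have z: "z \<in> N \<times> I" "H z = c q" using y t \<gamma>[OF y t(1)] by (auto simp: z_def)
    let ?w = "B.coords (\<lambda>x. x) w"
    let ?v = "tvec_of D c q (frechet_derivative H (at z) (?w, 0))"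
    have qD: "q \<in> D" using q U(2) by blast
    have v: "?v \<in> tangent_space A q" by (rule tvec_of_tangent[OF c(1) qD])
    have "pushforward B \<pi> q ?v = w"
    proof (rule B.coords_eqI[OF dB y pushforward_tangent[OF sm q v] w], rule euclidean_eqI)
      fix b :: 'f assume b: "b \<in> Basis"
      have "((\<lambda>z. G (H z)) has_derivative (\<lambda>u. frechet_derivative G (at (H z)) (frechet_derivative H (at z) u))) (at z)"
        by (rule has_derivative_compose[OF smooth_on_has_derivative[OF H(5) z(1)] smooth_on_has_derivative[OF H(6)]]) (use z(1) in blast)
      moreover have "((\<lambda>z. G (H z)) has_derivative (\<lambda>u. u)) (at z)"
        by (rule has_derivative_transform_within_open[OF has_derivative_ident NI(3) z(1)]) (simp add: H(4))
      ultimately have GH: "frechet_derivative G (at (H z)) (frechet_derivative H (at z) u) = u" for u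
        using has_derivative_unique by metis
      have "((\<lambda>x. fst (G x) \<bullet> b) has_derivative (\<lambda>u. fst (frechet_derivative G (at (H z)) u) \<bullet> b)) (at (H z))"
        by (intro has_derivative_inner_left has_derivative_fst smooth_on_has_derivative[OF H(6)]) (use z(1) in blast)
      moreover have "fst (G x) \<bullet> b = \<pi> (inv_into D c x) \<bullet> b" if "x \<in> ?T" for x
        using chart(6)[OF c(1)] H(2) that unfolding \<pi>_def by auto
      ultimately have "((\<lambda>x. \<pi> (inv_into D c x) \<bullet> b) has_derivative (\<lambda>u. fst (frechet_derivative G (at (H z)) u) \<bullet> b)) (at (H z))"
        using z(1) by (elim has_derivative_transform_within_open[OF _ H(1)]) auto
      then have "frechet_derivative (\<lambda>x. \<pi> (inv_into D c x) \<bullet> b) (at (c q)) = (\<lambda>u. fst (frechet_derivative G (at (H z)) u) \<bullet> b)"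
        using z(2) by (simp add: frechet_derivative_at[symmetric])
      then show "B.coords (\<lambda>x. x) (pushforward B \<pi> q ?v) \<bullet> b = B.coords (\<lambda>x. x) w \<bullet> b"
        using smooth_nearI[OF \<pi>sm q] pushforward_apply[OF sm B.smooth_nearI[OF B.smooth_fun_coord[OF dB] y]]
        by (simp add: B.coords_inner[OF b] tvec_of_def GH)
    qed
    then show "w \<in> pushforward B \<pi> q ` tangent_space A q" using imageI[OF v, of "pushforward B \<pi> q"] by simp
  qed (use pushforward_tangent[OF sm q] in blast)
  then have "submersion_on A B U \<pi>" using sm unfolding submersion_on_def by blast
  moreover have "\<pi> ` U = carrier B"
    unfolding cB
  proof (intro equalityI subsetI)
    show "y \<in> \<pi> ` U" if "y \<in> N" for y
      using \<gamma>[OF that NI(5)] by (metis imageI)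
  qed (use U\<gamma> in blast)
  moreover have "leaf_piece A \<xi> {q\<in>U. \<pi> q = y}" if "y \<in> carrier B" for y
    unfolding leaf_piece_def
  proof (intro exI conjI)
    have y: "y \<in> N" using that cB by simp
    show "open I" "is_interval I" "I \<noteq> {}" using NI by (auto simp: I_def)
    show "{q\<in>U. \<pi> q = y} = \<gamma> y ` I" using \<gamma>[OF y] U\<gamma> by blast
    have mem: "(y, t) \<in> N \<times> I" if "t \<in> I" for t using that y by blast
    show "integral_curve A \<xi> I (\<gamma> y)"
      unfolding integral_curve_def
    proof (intro conjI ballI allI impI)
      have "continuous_on I (\<lambda>t. H (y, t))"
        by (rule continuous_on_compose2[OF smooth_on_continuous_on[OF H(5)]]) (use mem in \<open>auto intro!: continuous_intros\<close>)
      moreover have "continuous_on (c ` D) (inv_into D c)" using chart(3)[OF c(1)] by (simp add: homeomorphism_def)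
      ultimately show "continuous_on I (\<gamma> y)"
        unfolding \<gamma>_def using continuous_on_compose2[of "c ` D" "inv_into D c" I "\<lambda>t. H (y, t)"] H(2) mem by blast
      show "\<gamma> y ` I \<subseteq> carrier A" using \<gamma>[OF y] U(3) by blast
      fix t g assume t: "t \<in> I" and g: "smooth_near A (\<gamma> y t) g"
      have q: "\<gamma> y t \<in> D" "c (\<gamma> y t) = H (y, t)" using \<gamma>[OF y t] U(2) by auto
      let ?F = "\<lambda>x. g (inv_into D c x)"
      obtain r where "r > 0" "smooth_on (ball (H (y, t)) r) ?F" using smooth_near_chart_ball[OF c(1) q(1) g] q(2) by metis
      then have F: "(?F has_derivative frechet_derivative ?F (at (H (y, t)))) (at (H (y, t)))"
        by (intro smooth_on_has_derivative) auto
      have "((\<lambda>t. H (y, t)) has_derivative (\<lambda>s. s *\<^sub>R f (H (y, t)))) (at t)"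
        using H(7)[of y t] y t by (auto simp: N_def I_def has_vector_derivative_def)
      then have "((\<lambda>t. ?F (H (y, t))) has_derivative (\<lambda>s. frechet_derivative ?F (at (H (y, t))) (s *\<^sub>R f (H (y, t))))) (at t)"
        by (rule has_derivative_compose[where g = ?F]) (rule F)
      then have "((\<lambda>t. ?F (H (y, t))) has_real_derivative frechet_derivative ?F (at (H (y, t))) (f (H (y, t)))) (at t)"
        using linear_cmul[OF has_derivative_linear[OF F]] by (simp add: has_field_derivative_def mult.commute[of _ "frechet_derivative _ _ _"])
      moreover have "frechet_derivative ?F (at (H (y, t))) (f (H (y, t))) = \<xi> (\<gamma> y t) g"
        using fun_cong[OF tangent_coords[OF c(1) q(1) \<xi>T[OF q(1)]], of g] g q(2) by (simp add: tvec_of_def f_def \<gamma>_def)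
      ultimately show "((g \<circ> \<gamma> y) has_real_derivative \<xi> (\<gamma> y t) g) (at t)"
        by (simp add: comp_def \<gamma>_def)
    qed
  qed
  moreover have "p \<in> U" using c H(3) NI by (auto simp: U_def intro!: image_eqI[of _ _ "(0, 0)"])
  ultimately have "p \<in> U \<and> local_leaf_space A \<xi> B U \<pi>"
    unfolding local_leaf_space_def using B.smooth_manifold by blast
  then show ?thesis by blast
qed

theorem theorem4p7:
  fixes A :: "('a::{t2_space, second_countable_topology}, 'e::euclidean_space) atlas"
    and \<eta> :: "'a oneform" and \<xi> :: "'a vfield" and \<phi>1 \<phi>2 \<phi>3 :: "'a tensor11" and n :: nat
  assumes "contact_manifold n A \<eta>"
    and "reeb_field A \<eta> \<xi>"
    and "almost_bi_paracontact A \<eta> \<xi> \<phi>1 \<phi>2 \<phi>3"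
    and "normal_structure A \<eta> \<xi> \<phi>1 \<phi>2 \<phi>3"
    and leaf_space_dim: "DIM('f::euclidean_space) = 2 * n"
  shows "(\<forall>p\<in>carrier A. \<exists>(B :: ('f, 'f) atlas) U \<pi>. p \<in> U \<and> local_leaf_space A \<xi> B U \<pi>) \<and>
    (\<forall>(B :: ('b::{t2_space, second_countable_topology}, 'f) atlas) U \<pi>.
       local_leaf_space A \<xi> B U \<pi> \<longrightarrow>
       (\<exists>J1 J2 J3.
          tensor_projects A B U \<pi> \<phi>1 J1 \<and>
          tensor_projects A B U \<pi> \<phi>2 J2 \<and>
          tensor_projects A B U \<pi> \<phi>3 J3 \<and>
          anti_hypercomplex B J1 J2 J3 \<and>
          (\<forall>\<D>. canonical_connection A \<eta> \<xi> \<phi>1 \<phi>2 \<phi>3 \<D> \<longrightarrow>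
             (\<exists>\<D>'. obata_connection B J1 J2 J3 \<D>' \<and> connection_projects A \<eta> \<xi> B U \<pi> \<D> \<D>')))) \<and>
    (\<forall>\<D>. canonical_connection A \<eta> \<xi> \<phi>1 \<phi>2 \<phi>3 \<D> \<longrightarrow> projectable_connection A \<eta> \<xi> \<D>)"
proof -
  have A: "smooth_manifold A" "one_form A \<eta>" and dim: "DIM('e) = DIM('f) + 1"
    using assms(1,5) unfolding contact_manifold_def contact_form_def by auto
  interpret bi_paracontact A \<eta> \<xi> \<phi>1 \<phi>2 \<phi>3
    by unfold_locales (use A assms in auto)
  have leaf: "\<exists>(B :: ('f, 'f) atlas) U \<pi>. p \<in> U \<and> local_leaf_space A \<xi> B U \<pi>" if "p \<in> carrier A" for p
    by (rule local_leaf_space_exists[OF xi(1) xi(4)[OF that] that dim])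
  have induced_structure: "\<exists>J1 J2 J3. tensor_projects A B U \<pi> \<phi>1 J1 \<and> tensor_projects A B U \<pi> \<phi>2 J2 \<and> tensor_projects A B U \<pi> \<phi>3 J3 \<and>
      anti_hypercomplex B J1 J2 J3 \<and> (\<forall>\<D>. canonical_connection A \<eta> \<xi> \<phi>1 \<phi>2 \<phi>3 \<D> \<longrightarrow>
        (\<exists>\<D>'. obata_connection B J1 J2 J3 \<D>' \<and> connection_projects A \<eta> \<xi> B U \<pi> \<D> \<D>'))"
    if "local_leaf_space A \<xi> B U \<pi>" for B :: "('b, 'f) atlas" and U \<pi>
  proof -
    interpret leaf_space A \<eta> \<xi> \<phi>1 \<phi>2 \<phi>3 B U \<pi>
      by unfold_locales (use that dim in \<open>auto simp: local_leaf_space_def\<close>)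
    show ?thesis
      using tensor_projects_induced[OF phi_invariant(1)] tensor_projects_induced[OF phi_invariant(2)]
        tensor_projects_induced[OF phi_invariant(3)] anti_hypercomplex_induced canonical_projects by blast
  qed
  show ?thesis using leaf induced_structure canonical_projectable by blast
qed

end
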